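(* Let $n$ and $p$ be positive integers with $n\ge 2p$, and let $\lambda=(\lambda_1,\dots,\lambda_{\ell(\lambda)})\vdash n$ and $\nu\vdash n$. Denote by $\lambda'$ and $\nu'$ the conjugate partitions. (a) If $\lambda_1\ge 2p-1$, then the coefficient $g_{(n-p,p),\lambda,\nu}$ of $s_\nu$ in $s_{(n-p,p)}\ast s_\lambda$ equals $$\sum_{\alpha\vdash p,\ \alpha\subseteq \lambda\cap\nu} k^{\lambda}_{\alpha\nu}.$$ (b) If $\ell(\lambda)\ge 2p-1$, then the coefficient of $s_\nu$ in $s_{(n-p,p)}\ast s_\lambda$ equals $$\sum_{\alpha\vdash p,\ \alpha\subseteq \lambda'\cap\nu'} k^{\lambda'}_{\alpha\nu'}.$$
   Context: For partitions $\lambda,\mu\vdash n$ with irreducible $S_n$-characters $\chi^\lambda,\chi^\mu$, write $\chi^\lambda\chi^\mu=\sum_{\nu\vdash n} g_{\lambda,\mu,\nu}\chi^\nu$ (pointwise product), and define the Kronecker product of Schur functions by $s_\lambda\ast s_\mu=\sum_{\nu\vdash n} g_{\lambda,\mu,\nu}s_\nu$. For partitions $\mu\subseteq\lambda$ (i.e. $\mu_i\le\lambda_i$ for all $i$), $\lambda/\mu$ is the skew diagram; row $i$ of $\lambda/\mu$ consists of the boxes $(i,j)$ with $\mu_i<j\le\lambda_i$. The intersection $\lambda\cap\nu$ is the diagram of boxes lying in both $\lambda$ and $\nu$. A semistandard Young tableau (SSYT) of shape $\lambda/\alpha$ is a filling of the boxes with positive integers weakly increasing along rows and strictly increasing down columns.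 For partitions $\alpha\subseteq\nu$, a SSYT has type $\nu/\alpha$ if, for each $i$, the number of entries equal to $i$ is $\nu_i-\alpha_i$ (with $\alpha_i=0$ for $i>\ell(\alpha)$). The reverse reading word of a tableau is obtained by reading its entries right to left in each row, rows taken from top to bottom. Given a partition $\alpha$ (with $\alpha_i=0$ for $i>\ell(\alpha)$), a sequence $a_1\cdots a_m$ is an $\alpha$-lattice permutation if for every initial segment $a_1\cdots a_j$ and every positive integer $i$: (number of $i$'s) $+\alpha_i\ \ge$ (number of $(i+1)$'s) $+\alpha_{i+1}$. A Kronecker tableau of shape $\lambda/\alpha$ and type $\nu/\alpha$ is a SSYT of shape $\lambda/\alpha$ and type $\nu/\alpha$ whose reverse reading word is an $\alpha$-lattice permutation and such that either (I) $\alpha_1=\alpha_2$, or (II) $\alpha_1>\alpha_2$ and at least one of: (i) the number of $1$'s in the second row of $\lambda/\alpha$ is exactly $\alpha_1-\alpha_2$; (ii) the number of $2$'s in the first row of $\lambda/\alpha$ is exactly $\alpha_1-\alpha_2$ (here $\alpha_2=0$ if $\ell(\alpha)=1$). $k^\lambda_{\alpha\nu}$ denotes the number of Kronecker tableaux of shape $\lambda/\alpha$ and type $\nu/\alpha$. *)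

theory Defs
  imports
    Complex_Main
    "HOL-Library.Function_Algebras"
    "HOL-Combinatorics.Permutations"
begin

text \<open>Rows, columns and tableau entries are numbered from 1.\<close>

definition partitions :: "nat \<Rightarrow> nat list set" where
  "partitions n = {la. sorted_wrt (\<ge>) la \<and> 0 \<notin> set la \<and> sum_list la = n}"

definition part :: "nat list \<Rightarrow> nat \<Rightarrow> nat" where
  "part la i = (if 1 \<le> i \<and> i \<le> length la then la ! (i - 1) else 0)"

definition skew :: "nat list \<Rightarrow> nat list \<Rightarrow> (nat \<times> nat) set" where
  "skew la mu = {(i, j). 1 \<le> i \<and> part mu i < j \<and> j \<le> part la i}"

definition diagram :: "nat list \<Rightarrow> (nat \<times> nat) set" where
  "diagram la = skew la []"

definition conj_partition :: "nat list \<Rightarrow> nat list" where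
  "conj_partition la = map (\<lambda>j. card {i. (i, j) \<in> diagram la}) [1..<part la 1 + 1]"

subsection \<open>Irreducible characters of the symmetric group\<close>

text \<open>
  The irreducible character indexed by \<open>la\<close> is the character of the Specht module of \<open>la\<close> over the
  complex numbers. A tabloid is the sequence of its row sets. The permutation module on tabloids is
  realised inside the space of complex functions on sequences of sets, and the Specht module is the
  subspace spanned by the polytabloids.
\<close>

definition fun_scale :: "complex \<Rightarrow> ('a \<Rightarrow> complex) \<Rightarrow> 'a \<Rightarrow> complex" where
  "fun_scale c f = (\<lambda>x. c * f x)"

interpretation fun_space: vector_space "fun_scale :: complex \<Rightarrow> ('a \<Rightarrow> complex) \<Rightarrow> 'a \<Rightarrow> complex"
  by unfold_locales (auto simp: fun_scale_def algebra_simps)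

text \<open>
  The trace of \<open>L\<close> on a finite-dimensional subspace \<open>V\<close> mapped into itself by \<open>L\<close>; it does not
  depend on the chosen basis.
\<close>

definition subspace_trace ::
  "('a \<Rightarrow> complex) set \<Rightarrow> (('a \<Rightarrow> complex) \<Rightarrow> 'a \<Rightarrow> complex) \<Rightarrow> complex" where
  "subspace_trace V L =
     (let B = (SOME B. fun_space.independent B \<and> fun_space.span B = V)
      in \<Sum>b\<in>B. fun_space.representation B (L b) b)"

definition young_tableaux :: "nat list \<Rightarrow> (nat \<times> nat \<Rightarrow> nat) set" where
  "young_tableaux la = {t. bij_betw t (diagram la) {1..sum_list la}}"

definition tabloid :: "nat list \<Rightarrow> (nat \<times> nat \<Rightarrow> nat) \<Rightarrow> nat \<Rightarrow> nat set" where
  "tabloid la t = (\<lambda>i. {t (i, j) | j. (i, j) \<in> diagram la})"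

definition column_stabilizer :: "nat list \<Rightarrow> (nat \<times> nat \<Rightarrow> nat) \<Rightarrow> (nat \<Rightarrow> nat) set" where
  "column_stabilizer la t =
     {\<pi>. \<pi> permutes {1..sum_list la} \<and>
         (\<forall>j. \<pi> ` {t (i, j) | i. (i, j) \<in> diagram la} = {t (i, j) | i. (i, j) \<in> diagram la})}"

definition polytabloid :: "nat list \<Rightarrow> (nat \<times> nat \<Rightarrow> nat) \<Rightarrow> (nat \<Rightarrow> nat set) \<Rightarrow> complex" where
  "polytabloid la t =
     (\<lambda>X. \<Sum>\<pi>\<in>column_stabilizer la t. if X = tabloid la (\<pi> \<circ> t) then of_int (sign \<pi>) else 0)"

definition specht_module :: "nat list \<Rightarrow> ((nat \<Rightarrow> nat set) \<Rightarrow> complex) set" where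
  "specht_module la = fun_space.span (polytabloid la ` young_tableaux la)"

text \<open>The linear extension of the action of \<open>\<sigma>\<close> on the rows of tabloids.\<close>

definition perm_action ::
  "(nat \<Rightarrow> nat) \<Rightarrow> ((nat \<Rightarrow> nat set) \<Rightarrow> complex) \<Rightarrow> (nat \<Rightarrow> nat set) \<Rightarrow> complex" where
  "perm_action \<sigma> f = (\<lambda>X. f (\<lambda>i. inv \<sigma> ` X i))"

definition irr_char :: "nat list \<Rightarrow> (nat \<Rightarrow> nat) \<Rightarrow> complex" where
  "irr_char la \<sigma> = subspace_trace (specht_module la) (perm_action \<sigma>)"

definition kronecker_coeff :: "nat \<Rightarrow> nat list \<Rightarrow> nat list \<Rightarrow> nat list \<Rightarrow> complex" where
  "kronecker_coeff n la mu =
     (THE g. (\<forall>nu. nu \<notin> partitions n \<longrightarrow> g nu = 0) \<and>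
             (\<forall>\<sigma>. \<sigma> permutes {1..n} \<longrightarrow>
                irr_char la \<sigma> * irr_char mu \<sigma> = (\<Sum>nu\<in>partitions n. g nu * irr_char nu \<sigma>)))"

subsection \<open>Semistandard tableaux and Schur functions\<close>

text \<open>A filling takes the value 0 outside its shape, so that fillings of a shape can be counted.\<close>

definition ssyt :: "nat list \<Rightarrow> nat list \<Rightarrow> (nat \<times> nat \<Rightarrow> nat) set" where
  "ssyt la al =
     {T. (\<forall>b. b \<in> skew la al \<longrightarrow> 0 < T b) \<and> (\<forall>b. b \<notin> skew la al \<longrightarrow> T b = 0) \<and>
         (\<forall>i j j'. (i, j) \<in> skew la al \<and> (i, j') \<in> skew la al \<and> j < j' \<longrightarrow> T (i, j) \<le> T (i, j')) \<and>
         (\<forall>i i' j. (i, j) \<in> skew la al \<and> (i', j) \<in> skew la al \<and> i < i' \<longrightarrow> T (i, j) < T (i', j))}"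

definition ssyt_content :: "nat list \<Rightarrow> nat list \<Rightarrow> (nat \<times> nat \<Rightarrow> nat) \<Rightarrow> nat \<Rightarrow> nat" where
  "ssyt_content la al T i = card {b \<in> skew la al. T b = i}"

text \<open>
  A symmetric function in the variables \<open>x\<^sub>1, x\<^sub>2, \<dots>\<close> is given by its coefficients: \<open>schur la m\<close> is the
  coefficient of the monomial in which \<open>x\<^sub>i\<close> has exponent \<open>m i\<close>.
\<close>

definition schur :: "nat list \<Rightarrow> (nat \<Rightarrow> nat) \<Rightarrow> complex" where
  "schur la m = of_nat (card {T \<in> ssyt la []. ssyt_content la [] T = m})"

definition schur_kronecker :: "nat \<Rightarrow> nat list \<Rightarrow> nat list \<Rightarrow> (nat \<Rightarrow> nat) \<Rightarrow> complex" where
  "schur_kronecker n la mu = (\<lambda>m. \<Sum>nu\<in>partitions n. kronecker_coeff n la mu nu * schur nu m)"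

text \<open>The coefficients of a homogeneous symmetric function of degree \<open>n\<close> in the Schur basis.\<close>

definition schur_coeff :: "nat \<Rightarrow> ((nat \<Rightarrow> nat) \<Rightarrow> complex) \<Rightarrow> nat list \<Rightarrow> complex" where
  "schur_coeff n F =
     (THE c. (\<forall>nu. nu \<notin> partitions n \<longrightarrow> c nu = 0) \<and>
             F = (\<lambda>m. \<Sum>nu\<in>partitions n. c nu * schur nu m))"

subsection \<open>Kronecker tableaux\<close>

definition has_type :: "nat list \<Rightarrow> nat list \<Rightarrow> nat list \<Rightarrow> (nat \<times> nat \<Rightarrow> nat) \<Rightarrow> bool" where
  "has_type la al nu T \<longleftrightarrow> (\<forall>i\<ge>1. ssyt_content la al T i + part al i = part nu i)"

definition reverse_reading_word :: "nat list \<Rightarrow> nat list \<Rightarrow> (nat \<times> nat \<Rightarrow> nat) \<Rightarrow> nat list" where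
  "reverse_reading_word la al T =
     concat (map (\<lambda>i. map (\<lambda>j. T (i, j)) (rev [part al i + 1..<part la i + 1])) [1..<length la + 1])"

definition lattice_permutation :: "nat list \<Rightarrow> nat list \<Rightarrow> bool" where
  "lattice_permutation al w \<longleftrightarrow>
     (\<forall>j\<le>length w. \<forall>i\<ge>1.
        count_list (take j w) i + part al i \<ge> count_list (take j w) (i + 1) + part al (i + 1))"

definition row_count :: "nat list \<Rightarrow> nat list \<Rightarrow> (nat \<times> nat \<Rightarrow> nat) \<Rightarrow> nat \<Rightarrow> nat \<Rightarrow> nat" where
  "row_count la al T r v = card {j. (r, j) \<in> skew la al \<and> T (r, j) = v}"

definition kronecker_tableaux :: "nat list \<Rightarrow> nat list \<Rightarrow> nat list \<Rightarrow> (nat \<times> nat \<Rightarrow> nat) set" where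
  "kronecker_tableaux la al nu =
     {T \<in> ssyt la al. has_type la al nu T \<and>
        lattice_permutation al (reverse_reading_word la al T) \<and>
        (part al 1 = part al 2 \<or>
         part al 1 > part al 2 \<and>
           (row_count la al T 2 1 = part al 1 - part al 2 \<or>
            row_count la al T 1 2 = part al 1 - part al 2))}"

definition kronecker_tableau_count :: "nat list \<Rightarrow> nat list \<Rightarrow> nat list \<Rightarrow> nat" where
  "kronecker_tableau_count la al nu = card (kronecker_tableaux la al nu)"

end

theory Submission
  imports Defs "HOL-Library.Poly_Mapping"
begin

text \<open>
  Write \<open>\<xi>\<^sub>k\<close> for the permutation character of \<open>S\<^sub>n\<close> on \<open>k\<close>-subsets. By Young's rule the character of
  \<open>(n - p, p)\<close> is \<open>\<xi>\<^sub>p - \<xi>\<^sub>p\<^sub>-\<^sub>1\<close>, and \<open>\<xi>\<^sub>k \<chi>\<^sup>\<lambda> = \<Sum>\<^sub>\<alpha> \<Sum>\<^sub>T \<chi>\<^sup>\<alpha>\<^sup>+\<^sup>w\<^sup>t\<^sup>(\<^sup>T\<^sup>)\<close>, where \<open>\<alpha>\<close> runs over the partitions of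
  \<open>k\<close> and \<open>T\<close> over the semistandard tableaux of shape \<open>\<lambda>/\<alpha>\<close> with \<open>\<alpha>\<close>-lattice reading word; the latter is the
  Littlewood--Richardson rule \<open>s\<^sub>\<alpha> s\<^sub>\<lambda>\<^sub>/\<^sub>\<alpha> = \<Sum>\<^sub>T s\<^sub>\<alpha>\<^sub>+\<^sub>w\<^sub>t\<^sub>(\<^sub>T\<^sub>)\<close>, proved with Stembridge's sign-reversing involution.
  Turning the last box of the first row of \<open>\<alpha>\<close> into an entry 1 matches the tableaux for the partitions of
  \<open>p\<close> that are not Kronecker tableaux with all tableaux for the partitions of \<open>p - 1\<close>; the hypothesis
  \<open>\<lambda>\<^sub>1 \<ge> 2p - 1\<close> guarantees that the latter have a 1 in the first row. Part (b) follows by tensoring with the sign.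

  Young's rule for Specht modules is obtained without counting standard tableaux: the Young symmetrizer
  gives an explicit formula for the trace, which shows that the character has norm 1 and pairs
  unitriangularly with the permutation characters on tabloids. Inverting the Kostka matrix gives another
  family, orthonormal by the Cauchy identity, and equality in Bessel's inequality identifies the two.
\<close>

section \<open>Gelfand--Tsetlin patterns and Bender--Knuth involutions\<close>

text \<open>The conditions defining Kronecker tableaux list the obstructions to freeing the last box
  of the first row of \<open>\<alpha>\<close>: this row may be no longer than the second, a 1 in the
  second row may stand below the box (i), or the 2s of the first row may leave the lattice condition
  without slack (ii). The other direction consumes a 1 of the first row. If there were none, the
  lattice condition would bound the first row by twice the first part of a partition of
  \<open>p - 1\<close>, hence by \<open>2 * p - 2\<close>; this is the origin of
  \<open>2 * p - 1\<close>. Tableaux are handled as patterns because a Bender-Knuth move and the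
  trade of a box each alter a single level. Two obstacles shape the rest. The character is a trace
  on a span of polytabloids with no basis at hand; the Young symmetrizer, idempotent up to a factor,
  supplies a spanning family with coefficient functionals. And a product of two permutation
  characters lives on words in pairs of letters, which have to become words in \<open>2 * n\<close>
  letters before Young's rule applies; hence \<open>N = 2 * n\<close>.\<close>

definition flip_lo :: "nat \<Rightarrow> (nat \<Rightarrow> nat) \<Rightarrow> (nat \<Rightarrow> nat) \<Rightarrow> nat \<Rightarrow> nat" where
  "flip_lo J A C k = max (min (A k) J) (min (C (Suc k)) J)"

definition flip_hi :: "nat \<Rightarrow> (nat \<Rightarrow> nat) \<Rightarrow> (nat \<Rightarrow> nat) \<Rightarrow> nat \<Rightarrow> nat" where
  "flip_hi J A C k = (case k of 0 \<Rightarrow> min (C 0) J | Suc k' \<Rightarrow> min (min (C k) J) (min (A k') J))"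

text \<open>Interlacing with the levels \<open>A\<close> below and \<open>C\<close> above confines
  \<open>B k\<close> to the interval from \<open>max (A k) (C (Suc k))\<close> to
  \<open>min (C k) (A (k - 1))\<close> (just \<open>C 0\<close> for \<open>k = 0\<close>), and the
  Bender-Knuth involution reflects \<open>B k\<close> there. With every length capped at
  \<open>J\<close> the reflection acts on the first \<open>J\<close> columns only;
  \<open>B k - J\<close> restores what sticks out.\<close>

definition flip :: "nat \<Rightarrow> (nat \<Rightarrow> nat) \<Rightarrow> (nat \<Rightarrow> nat) \<Rightarrow> (nat \<Rightarrow> nat) \<Rightarrow> nat \<Rightarrow> nat" where
  "flip J A C B k = (B k - J) + (flip_lo J A C k + flip_hi J A C k - min (B k) J)"

definition interlaced :: "(nat \<Rightarrow> nat) \<Rightarrow> (nat \<Rightarrow> nat) \<Rightarrow> bool" where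
  "interlaced A B \<longleftrightarrow> (\<forall>k. A k \<le> B k \<and> B (Suc k) \<le> A k)"

context
  fixes A B C :: "nat \<Rightarrow> nat" and J :: nat
  assumes AB: "interlaced A B" and BC: "interlaced B C"
    \<comment> \<open>No box of \<open>B\<close> outside \<open>A\<close> lies in column
      \<open>Suc J\<close>, so the columns on the two sides of the cut can be changed
      independently.\<close>
    and no_crossing: "\<And>k. \<not> (A k \<le> J \<and> J < B k)"
begin

lemma flip_below:
  assumes "B k \<le> J"
  shows "flip J A C B k = flip_lo J A C k + flip_hi J A C k - B k"
    and "flip_lo J A C k \<le> B k" and "B k \<le> flip_hi J A C k"
  using assms AB BC unfolding flip_def flip_lo_def flip_hi_def interlaced_def
  by (auto split: nat.splits intro: min.coboundedI1)

lemma flip_above: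
  assumes "J < B k"
  shows "flip J A C B k = B k" "J < A k"
proof -
  show "J < A k" using no_crossing[of k] assms by auto
  then have "flip_lo J A C k = J" by (auto simp: flip_lo_def)
  moreover have "flip_hi J A C k = J"
    using AB BC assms unfolding flip_hi_def interlaced_def
    by (auto split: nat.splits simp: min_def) (meson le_trans not_le)+
  ultimately show "flip J A C B k = B k" using assms by (simp add: flip_def)
qed

lemma flip_le_iff: "flip J A C B k \<le> J \<longleftrightarrow> B k \<le> J"
proof (cases "B k \<le> J")
  case True
  have "flip_hi J A C k \<le> J" by (auto simp: flip_hi_def split: nat.splits)
  then show ?thesis using flip_below[OF True] True by linarith
next
  case False
  then show ?thesis using flip_above[of k] by auto
qed

lemma max_flip: "J \<le> j \<Longrightarrow> max (flip J A C B k) j = max (B k) j"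
  using flip_le_iff[of k] flip_above[of k] by (cases "B k \<le> J") auto

lemma min_flip: "min (flip J A C B k) J + min (B k) J = flip_lo J A C k + flip_hi J A C k"
proof (cases "B k \<le> J")
  case True
  then show ?thesis using flip_below[OF True] flip_le_iff[of k] by (auto simp: min_def)
next
  case False
  then have "J < B k" by simp
  then show ?thesis
    using flip_above[OF \<open>J < B k\<close>] AB BC unfolding flip_lo_def flip_hi_def interlaced_def
    by (auto split: nat.splits simp: min_def max_def) (meson le_trans not_le)+
qed

lemma interlaced_flip: "interlaced A (flip J A C B)" "interlaced (flip J A C B) C"
proof -
  have "A k \<le> flip J A C B k \<and> C (Suc k) \<le> flip J A C B k \<and> flip J A C B k \<le> C k" for k
  proof (cases "B k \<le> J")
    case True
    have "A k \<le> B k" "C (Suc k) \<le> B k" using AB BC by (auto simp: interlaced_def)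
    then have lo: "A k \<le> flip_lo J A C k" "C (Suc k) \<le> flip_lo J A C k"
      using True by (auto simp: flip_lo_def)
    have "flip_hi J A C k \<le> C k" by (auto simp: flip_hi_def split: nat.splits)
    then show ?thesis using flip_below[OF True] lo by linarith
  next
    case False
    then show ?thesis using flip_above[of k] AB BC by (auto simp: interlaced_def)
  qed
  moreover have "flip J A C B (Suc k) \<le> A k" for k
  proof (cases "B (Suc k) \<le> J")
    case True
    have "flip_hi J A C (Suc k) \<le> A k" by (auto simp: flip_hi_def split: nat.splits)
    then show ?thesis using flip_below[OF True] by linarith
  next
    case False
    then show ?thesis using flip_above[of "Suc k"] AB BC by (auto simp: interlaced_def)
  qed
  ultimately show "interlaced A (flip J A C B)" "interlaced (flip J A C B) C"
    by (auto simp: interlaced_def)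
qed

lemma flip_flip: "flip J A C (flip J A C B) = B"
proof
  fix k
  show "flip J A C (flip J A C B) k = B k"
  proof (cases "B k \<le> J")
    case True
    then have "flip J A C B k \<le> J" using flip_le_iff by simp
    then show ?thesis using flip_below[OF True] unfolding flip_def[of J A C "flip J A C B"] by simp
  next
    case False
    then show ?thesis using flip_above[of k] unfolding flip_def[of J A C "flip J A C B"]
      by (simp add: flip_def[of J A C B])
  qed
qed

lemma no_crossing_flip: "\<not> (A k \<le> J \<and> J < flip J A C B k)"
  using no_crossing[of k] flip_le_iff[of k] by auto

text \<open>\<open>flip_lo\<close> at \<open>k\<close> and \<open>flip_hi\<close> at
  \<open>Suc k\<close> are the maximum and the minimum of the same two numbers, so the sum of all
  bounds rearranges into the capped sizes of \<open>A\<close> and \<open>C\<close>. This is what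
  exchanges the multiplicities of the two letters.\<close>

lemma sum_min_flip:
  assumes "C N = 0"
  shows "(\<Sum>k<N. min (flip J A C B k) J) + (\<Sum>k<N. min (B k) J)
    = (\<Sum>k<N. min (A k) J) + (\<Sum>k<N. min (C k) J)"
proof -
  have *: "(\<Sum>k<m. flip_lo J A C k + flip_hi J A C k) + flip_hi J A C m
    = (\<Sum>k<m. min (A k) J) + (\<Sum>k<Suc m. min (C k) J)" for m
  proof (induction m)
    case 0
    show ?case by (simp add: flip_hi_def)
  next
    case (Suc m)
    have "flip_lo J A C m + flip_hi J A C (Suc m) = min (A m) J + min (C (Suc m)) J"
      by (auto simp: flip_lo_def flip_hi_def)
    with Suc show ?case by simp
  qed
  have "flip_hi J A C N = 0" using assms by (auto simp: flip_hi_def split: nat.splits)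
  then show ?thesis
    using *[of N] assms by (simp add: sum.distrib[symmetric] min_flip)
qed

end


section \<open>Patterns and the symmetry of their weights\<close>

context
  fixes N :: nat
begin

definition shape :: "(nat \<Rightarrow> nat) \<Rightarrow> bool" where
  "shape a \<longleftrightarrow> antimono a \<and> (\<forall>r\<ge>N. a r = 0)"

definition vsize :: "(nat \<Rightarrow> nat) \<Rightarrow> nat" where
  "vsize a = (\<Sum>r<N. a r)"

text \<open>A semistandard tableau of shape \<open>l/a\<close> with letters \<open>0, \<dots>, N - 1\<close> is encoded by the
  Gelfand--Tsetlin pattern \<open>g\<close> in which \<open>g i r\<close> is the length of row \<open>r\<close> of the shape formed by \<open>a\<close> and
  the boxes with letters less than \<open>i\<close>. Rows, letters and levels count from 0.\<close>

definition gt :: "(nat \<Rightarrow> nat) \<Rightarrow> (nat \<Rightarrow> nat) \<Rightarrow> (nat \<Rightarrow> nat \<Rightarrow> nat) set" where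
  "gt a l = {g. g 0 = a \<and> (\<forall>i\<ge>N. g i = l) \<and> (\<forall>i. interlaced (g i) (g (Suc i)))}"

definition wt :: "(nat \<Rightarrow> nat \<Rightarrow> nat) \<Rightarrow> nat \<Rightarrow> nat" where
  "wt g i = vsize (g (Suc i)) - vsize (g i)"

lemma interlaced_iff: "interlaced A B \<longleftrightarrow> A \<le> B \<and> (\<forall>k. B (Suc k) \<le> A k)"
  by (auto simp: interlaced_def le_fun_def)

lemma vsize_mono: "a \<le> b \<Longrightarrow> vsize a \<le> vsize b"
  by (auto simp: vsize_def le_fun_def intro: sum_mono)

lemma gt_mono: "g \<in> gt a l \<Longrightarrow> i \<le> j \<Longrightarrow> g i \<le> g j"
  using lift_Suc_mono_le[of g i j] by (auto simp: gt_def interlaced_iff)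

lemma gt_bounds:
  assumes "g \<in> gt a l"
  shows "a \<le> g i" "g i \<le> l"
proof -
  show "a \<le> g i" using gt_mono[OF assms, of 0 i] assms by (auto simp: gt_def)
  show "g i \<le> l" using gt_mono[OF assms, of i "max i N"] assms by (auto simp: gt_def)
qed

lemma gt_zero:
  assumes "g \<in> gt a l" "shape l" "N \<le> r"
  shows "g i r = 0"
  using gt_bounds(2)[OF assms(1), of i] assms(2,3) by (auto simp: le_fun_def shape_def)
    (metis le_zero_eq)

text \<open>Row \<open>Suc r\<close> of level \<open>i\<close> is at most row \<open>Suc r\<close>
  of level \<open>Suc i\<close>, which by interlacing is at most row \<open>r\<close> of level
  \<open>i\<close>.\<close>

lemma gt_shape:
  assumes "g \<in> gt a l" "shape l"
  shows "shape (g i)"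
proof -
  have "g i (Suc r) \<le> g i r" for r
    using assms(1) le_trans[of "g i (Suc r)" "g (Suc i) (Suc r)" "g i r"]
    unfolding gt_def interlaced_def by simp
  then have "antimono (g i)" by (simp add: antimono_iff_le_Suc)
  then show ?thesis using gt_zero[OF assms] by (auto simp: shape_def)
qed

lemma finite_shapes_below: "finite {a. shape a \<and> (\<forall>r. a r \<le> m)}"
proof -
  have "{a. shape a \<and> (\<forall>r. a r \<le> m)} \<subseteq> (\<lambda>f r. if r < N then f r else 0) ` ({..<N} \<rightarrow>\<^sub>E {..m})"
  proof
    fix a assume a: "a \<in> {a. shape a \<and> (\<forall>r. a r \<le> m)}"
    show "a \<in> (\<lambda>f r. if r < N then f r else 0) ` ({..<N} \<rightarrow>\<^sub>E {..m})"
      using a by (intro image_eqI[of _ _ "restrict a {..<N}"]) (auto simp: shape_def)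
  qed
  then show ?thesis by (rule finite_subset) (auto intro!: finite_PiE)
qed

lemma finite_gt:
  assumes "shape l"
  shows "finite (gt a l)"
proof -
  let ?S = "{b. shape b \<and> (\<forall>r. b r \<le> l 0)}"
  have "gt a l \<subseteq> (\<lambda>f i. if i < N then f i else l) ` ({..<N} \<rightarrow>\<^sub>E ?S)"
  proof
    fix g assume g: "g \<in> gt a l"
    have "g i r \<le> l 0" for i r
      using gt_bounds(2)[OF g, of i] assms by (auto simp: le_fun_def shape_def antimono_def)
        (meson le0 le_trans)
    then show "g \<in> (\<lambda>f i. if i < N then f i else l) ` ({..<N} \<rightarrow>\<^sub>E ?S)"
      using g gt_shape[OF g assms]
      by (intro image_eqI[of _ _ "restrict g {..<N}"]) (auto simp: gt_def)
  qed
  then show ?thesis by (rule finite_subset) (auto intro!: finite_PiE finite_shapes_below)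
qed

lemma wt_eq:
  assumes "g \<in> gt a l"
  shows "wt g i + vsize (g i) = vsize (g (Suc i))"
  using vsize_mono[OF gt_mono[OF assms, of i "Suc i"]] by (simp add: wt_def)

lemma sum_wt:
  assumes "g \<in> gt a l"
  shows "(\<Sum>j<i. wt g j) + vsize a = vsize (g i)"
proof (induction i)
  case 0
  then show ?case using assms by (simp add: gt_def)
next
  case (Suc i)
  then show ?case using wt_eq[OF assms, of i] by simp
qed

lemma wt_outside: "g \<in> gt a l \<Longrightarrow> N \<le> i \<Longrightarrow> wt g i = 0"
  by (simp add: gt_def wt_def)

text \<open>Flipping level \<open>Suc i\<close> in the columns up to \<open>J\<close> is the Bender--Knuth involution applied to
  the letters \<open>i\<close> and \<open>Suc i\<close> of the first \<open>J\<close> columns.\<close>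

definition bk :: "nat \<Rightarrow> nat \<Rightarrow> (nat \<Rightarrow> nat \<Rightarrow> nat) \<Rightarrow> nat \<Rightarrow> nat \<Rightarrow> nat" where
  "bk J i g = g(Suc i := flip J (g i) (g (Suc (Suc i))) (g (Suc i)))"

definition uncrossed :: "nat \<Rightarrow> nat \<Rightarrow> (nat \<Rightarrow> nat \<Rightarrow> nat) \<Rightarrow> bool" where
  "uncrossed J i g \<longleftrightarrow> (\<forall>k. \<not> (g i k \<le> J \<and> J < g (Suc i) k))"

text \<open>The fourth claim says that boxes right of column \<open>J\<close> are untouched at every
  level; the fifth controls the exchange of the two letters inside the first \<open>J\<close>
  columns.\<close>

lemma bk_props:
  assumes g: "g \<in> gt a l" and l: "shape l" and i: "Suc i < N" and u: "uncrossed J i g"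
  shows "bk J i g \<in> gt a l" "bk J i (bk J i g) = g" "uncrossed J i (bk J i g)"
    "J \<le> j \<Longrightarrow> max (bk J i g m k) j = max (g m k) j"
    "(\<Sum>k<N. min (bk J i g (Suc i) k) J) + (\<Sum>k<N. min (g (Suc i) k) J)
      = (\<Sum>k<N. min (g i k) J) + (\<Sum>k<N. min (g (Suc (Suc i)) k) J)"
proof -
  have il: "interlaced (g i) (g (Suc i))" "interlaced (g (Suc i)) (g (Suc (Suc i)))"
    using g by (auto simp: gt_def)
  have u': "\<And>k. \<not> (g i k \<le> J \<and> J < g (Suc i) k)" using u by (auto simp: uncrossed_def)
  note fl = interlaced_flip[OF il u'] flip_flip[OF il u'] no_crossing_flip[OF il u']
    max_flip[OF il u'] sum_min_flip[OF il u', where N = N]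
  have "interlaced (bk J i g m) (bk J i g (Suc m))" for m
    using g fl(1,2) by (auto simp: gt_def bk_def)
  then show "bk J i g \<in> gt a l" using g i by (auto simp: gt_def bk_def)
  show "bk J i (bk J i g) = g" using fl(3) by (auto simp: bk_def fun_eq_iff)
  show "uncrossed J i (bk J i g)" using fl(4) by (auto simp: bk_def uncrossed_def)
  show "J \<le> j \<Longrightarrow> max (bk J i g m k) j = max (g m k) j" using fl(5) by (auto simp: bk_def)
  show "(\<Sum>k<N. min (bk J i g (Suc i) k) J) + (\<Sum>k<N. min (g (Suc i) k) J)
      = (\<Sum>k<N. min (g i k) J) + (\<Sum>k<N. min (g (Suc (Suc i)) k) J)"
    using fl(6) gt_zero[OF g l, of N] by (simp add: bk_def)
qed

text \<open>A cut at or beyond the length of the first row lies right of every box: the truncated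
  flip is then the ordinary Bender-Knuth involution, and capped sizes are sizes.\<close>

lemma vsize_bk_full:
  assumes g: "g \<in> gt a l" and l: "shape l" and i: "Suc i < N" and J: "l 0 \<le> J"
  shows "vsize (bk J i g (Suc i)) + vsize (g (Suc i)) = vsize (g i) + vsize (g (Suc (Suc i)))"
    and "uncrossed J i g"
proof -
  have b: "h m r \<le> J" if "h \<in> gt a l" for h m r
  proof -
    have "h m r \<le> l r" using gt_bounds(2)[OF that] by (auto simp: le_fun_def)
    also have "\<dots> \<le> l 0" using l by (auto simp: shape_def antimono_def)
    finally show ?thesis using J by simp
  qed
  show u: "uncrossed J i g" using b[OF g] by (auto simp: uncrossed_def not_less)
  show "vsize (bk J i g (Suc i)) + vsize (g (Suc i)) = vsize (g i) + vsize (g (Suc (Suc i)))"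
    using bk_props(5)[OF g l i u] b[OF g] b[OF bk_props(1)[OF g l i u]]
    by (simp add: vsize_def min_def)
qed

lemma wt_bk_full:
  assumes g: "g \<in> gt a l" and l: "shape l" and i: "Suc i < N" and J: "l 0 \<le> J"
  shows "wt (bk J i g) = wt g \<circ> transpose i (Suc i)"
proof
  fix m
  note v = vsize_bk_full[OF assms] and h = bk_props(1)[OF g l i vsize_bk_full(2)[OF assms]]
  have m: "vsize (g i) \<le> vsize (g (Suc i))" "vsize (g (Suc i)) \<le> vsize (g (Suc (Suc i)))"
    using vsize_mono[OF gt_mono[OF g, of i "Suc i"]] vsize_mono[OF gt_mono[OF g, of "Suc i" "Suc (Suc i)"]] by auto
  consider "m = i" | "m = Suc i" | "m \<noteq> i" "m \<noteq> Suc i" by blast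
  then show "wt (bk J i g) m = (wt g \<circ> transpose i (Suc i)) m"
  proof cases
    case 3
    then show ?thesis by (simp add: wt_def bk_def)
  qed (use v(1) m in \<open>auto simp: wt_def bk_def\<close>)
qed

lemma sum_wt_swap:
  fixes F :: "(nat \<Rightarrow> nat) \<Rightarrow> 'b::comm_monoid_add"
  assumes l: "shape l" and i: "Suc i < N"
  shows "(\<Sum>g\<in>gt a l. F (wt g)) = (\<Sum>g\<in>gt a l. F (wt g \<circ> transpose i (Suc i)))"
  by (rule sum.reindex_bij_witness[of _ "bk (l 0) i" "bk (l 0) i"])
    (use bk_props[OF _ l i] vsize_bk_full(2)[OF _ l i, where J = "l 0"]
       wt_bk_full[OF _ l i, where J = "l 0"] in \<open>auto simp: o_assoc[symmetric]\<close>)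

text \<open>Conjugation by adjacent transpositions lowers \<open>j\<close> until the two indices are
  neighbours. \<open>F\<close> stays arbitrary in the induction because every step absorbs a
  transposition into it.\<close>

lemma sum_wt_transpose:
  fixes F :: "(nat \<Rightarrow> nat) \<Rightarrow> 'b::comm_monoid_add"
  assumes l: "shape l"
  shows "i < j \<Longrightarrow> j < N \<Longrightarrow> (\<Sum>g\<in>gt a l. F (wt g)) = (\<Sum>g\<in>gt a l. F (wt g \<circ> transpose i j))"
proof (induction j arbitrary: F)
  case 0
  then show ?case by simp
next
  case (Suc j)
  show ?case
  proof (cases "i = j")
    case True
    show ?thesis unfolding True by (rule sum_wt_swap[OF l]) (use Suc.prems in simp)
  next
    case False
    then have ij: "i < j" "j < N" using Suc.prems by auto
    have t: "transpose i (Suc j) = transpose j (Suc j) \<circ> transpose i j \<circ> transpose j (Suc j)"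
      using ij by (auto simp: fun_eq_iff transpose_def)
    have "(\<Sum>g\<in>gt a l. F (wt g)) = (\<Sum>g\<in>gt a l. F (wt g \<circ> transpose j (Suc j)))"
      by (rule sum_wt_swap[OF l]) (use Suc.prems in auto)
    also have "\<dots> = (\<Sum>g\<in>gt a l. F (wt g \<circ> transpose i j \<circ> transpose j (Suc j)))"
      by (rule Suc.IH[OF ij, of "\<lambda>w. F (w \<circ> transpose j (Suc j))"])
    also have "\<dots> = (\<Sum>g\<in>gt a l. F (wt g \<circ> transpose j (Suc j) \<circ> transpose i j \<circ> transpose j (Suc j)))"
      by (rule sum_wt_swap[OF l, of _ "\<lambda>w. F (w \<circ> transpose i j \<circ> transpose j (Suc j))"]) (use Suc.prems in auto)
    finally show ?thesis unfolding t by (simp only: o_assoc)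
  qed
qed

text \<open>Symmetry of skew Schur polynomials, with an arbitrary function of the weight in place of
  the monomial.\<close>

lemma sum_wt_permute:
  fixes F :: "(nat \<Rightarrow> nat) \<Rightarrow> 'b::comm_monoid_add"
  assumes l: "shape l" and p: "p permutes {..<N}"
  shows "(\<Sum>g\<in>gt a l. F (wt g)) = (\<Sum>g\<in>gt a l. F (wt g \<circ> p))"
  using finite_lessThan p
proof (induction p arbitrary: F rule: permutes_rev_induct)
  case id
  then show ?case by simp
next
  case (swap i j p)
  have "(\<Sum>g\<in>gt a l. F (wt g)) = (\<Sum>g\<in>gt a l. F (wt g \<circ> transpose i j))"
    using sum_wt_transpose[OF l, of i j F] sum_wt_transpose[OF l, of j i F] swap(1-3)
    by (cases i j rule: linorder_cases) (simp_all add: transpose_commute)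
  also have "\<dots> = (\<Sum>g\<in>gt a l. F (wt g \<circ> p \<circ> transpose i j))"
    by (rule swap.IH[of "\<lambda>w. F (w \<circ> transpose i j)"])
  finally show ?case by (simp only: o_assoc)
qed


section \<open>The lattice condition by columns and its sign-reversing involution\<close>

definition col_sum :: "(nat \<Rightarrow> nat \<Rightarrow> nat) \<Rightarrow> nat \<Rightarrow> nat \<Rightarrow> nat" where
  "col_sum g j i = (\<Sum>k<N. max (g i k) j)"

text \<open>The number of letters \<open>i\<close> in the columns to the right of column \<open>j\<close>.\<close>

definition col_wt :: "(nat \<Rightarrow> nat \<Rightarrow> nat) \<Rightarrow> nat \<Rightarrow> nat \<Rightarrow> nat" where
  "col_wt g j i = col_sum g j (Suc i) - col_sum g j i"

text \<open>The lattice condition for \<open>i\<close> and \<open>Suc i\<close> fails once the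
  columns right of \<open>j\<close> are read. Only whole columns are tested, which suits an
  involution that cuts between columns.\<close>

definition violation :: "(nat \<Rightarrow> nat) \<Rightarrow> (nat \<Rightarrow> nat \<Rightarrow> nat) \<Rightarrow> nat \<Rightarrow> nat \<Rightarrow> bool" where
  "violation b g j i \<longleftrightarrow> Suc i < N \<and> b i + col_wt g j i < b (Suc i) + col_wt g j (Suc i)"

definition lattice :: "(nat \<Rightarrow> nat) \<Rightarrow> (nat \<Rightarrow> nat \<Rightarrow> nat) \<Rightarrow> bool" where
  "lattice b g \<longleftrightarrow> (\<forall>j i. \<not> violation b g j i)"

lemma col_wt_eq:
  assumes "g \<in> gt a l"
  shows "col_wt g j i + col_sum g j i = col_sum g j (Suc i)"
proof -
  have "col_sum g j i \<le> col_sum g j (Suc i)"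
    using gt_mono[OF assms, of i "Suc i"] unfolding col_sum_def le_fun_def
    by (intro sum_mono max.mono) auto
  then show ?thesis by (simp add: col_wt_def)
qed

lemma col_wt_0: "col_wt g 0 i = wt g i"
  by (simp add: col_wt_def wt_def col_sum_def vsize_def)

text \<open>Using \<open>max\<close> avoids truncated subtraction: a row contributes
  \<open>j\<close> plus its boxes right of column \<open>j\<close>, so \<open>col_sum\<close>
  exceeds the number of these boxes by the constant \<open>N * j\<close>, which cancels in
  differences of levels.\<close>

lemma col_sum_Suc: "col_sum g (Suc j) i = col_sum g j i + card {k. k < N \<and> g i k \<le> j}"
proof -
  have "col_sum g (Suc j) i = (\<Sum>k<N. max (g i k) j + (if g i k \<le> j then 1 else 0))"
    unfolding col_sum_def by (rule sum.cong) auto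
  also have "\<dots> = col_sum g j i + (\<Sum>k\<in>{k\<in>{..<N}. g i k \<le> j}. 1)"
    by (subst sum.inter_filter) (simp_all add: sum.distrib col_sum_def)
  finally show ?thesis by simp
qed

lemma col_wt_Suc:
  assumes "g \<in> gt a l"
  shows "col_wt g j i = col_wt g (Suc j) i + card {k. k < N \<and> g i k \<le> j \<and> j < g (Suc i) k}"
proof -
  have "{k. k < N \<and> g i k \<le> j} = {k. k < N \<and> g (Suc i) k \<le> j} \<union> {k. k < N \<and> g i k \<le> j \<and> j < g (Suc i) k}"
    (is "?A = ?B \<union> ?C")
    using gt_mono[OF assms, of i "Suc i"] by (auto simp: le_fun_def intro: le_trans)
  moreover have "card (?B \<union> ?C) = card ?B + card ?C"
    by (rule card_Un_disjoint) auto
  ultimately have "card ?A = card ?B + card ?C" by (rule back_subst[of "\<lambda>x. card x = _", OF _ sym, rotated])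
  then show ?thesis
    using col_wt_eq[OF assms, of j i] col_wt_eq[OF assms, of "Suc j" i] col_sum_Suc[of g j i]
      col_sum_Suc[of g j "Suc i"] by linarith
qed

text \<open>Column strictness: two such rows \<open>x < y\<close> would give
  \<open>j < g (Suc i) y \<le> g (Suc i) (Suc x) \<le> g i x \<le> j\<close>.\<close>

lemma card_column_le_1:
  assumes "g \<in> gt a l"
  shows "card {k. k < N \<and> g i k \<le> j \<and> j < g (Suc i) k} \<le> 1"
proof -
  have "x = y" if "g i x \<le> j" "j < g (Suc i) x" "g i y \<le> j" "j < g (Suc i) y" for x y
  proof -
    have *: False if "x < y" "g i x \<le> j" "j < g (Suc i) y" for x y
    proof -
      have "antimono (g (Suc i))"
        using assms unfolding antimono_iff_le_Suc gt_def interlaced_def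
        by (metis (mono_tags, lifting) le_trans mem_Collect_eq)
      then have "g (Suc i) y \<le> g (Suc i) (Suc x)" using that by (auto simp: antimono_def)
      also have "\<dots> \<le> g i x" using assms by (auto simp: gt_def interlaced_def)
      finally show False using that by simp
    qed
    then show ?thesis using that by (metis linorder_neqE_nat)
  qed
  then show ?thesis by (intro card_le_Suc0_iff_eq[THEN iffD2, folded One_nat_def]) auto
qed

lemma not_violation_large:
  assumes g: "g \<in> gt a l" and l: "shape l" and b: "antimono b" and j: "l 0 \<le> j"
  shows "\<not> violation b g j i"
proof -
  have "g m k \<le> j" for m k
    using gt_bounds(2)[OF g, of m] l j unfolding le_fun_def shape_def antimono_def
    by (meson le0 le_trans)
  then have "col_sum g j m = N * j" for m by (simp add: col_sum_def max_def)
  then show ?thesis using b by (simp add: violation_def col_wt_def antimono_def not_less)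
qed

definition viol_col :: "(nat \<Rightarrow> nat) \<Rightarrow> (nat \<Rightarrow> nat \<Rightarrow> nat) \<Rightarrow> nat" where
  "viol_col b g = (GREATEST j. \<exists>i. violation b g j i)"

text \<open>The violations at the column \<open>viol_col\<close> depend only on boxes to its right.
  The involution leaves those boxes alone, so the image selects the same column and the same
  row.\<close>

definition viol_row :: "(nat \<Rightarrow> nat) \<Rightarrow> (nat \<Rightarrow> nat \<Rightarrow> nat) \<Rightarrow> nat" where
  "viol_row b g = (LEAST i. violation b g (viol_col b g) i)"

text \<open>Stembridge's sign-reversing involution: apply the Bender--Knuth involution to the columns left of
  the rightmost violation of the lattice condition.\<close>

definition cancel :: "(nat \<Rightarrow> nat) \<Rightarrow> (nat \<Rightarrow> nat \<Rightarrow> nat) \<Rightarrow> nat \<Rightarrow> nat \<Rightarrow> nat" where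
  "cancel b g = bk (viol_col b g) (viol_row b g) g"

text \<open>The exponent vector of the Vandermonde alternant, raised by one from the usual
  \<open>N - 1 - k\<close>; its entries for \<open>k < N\<close> are distinct and drop by
  one.\<close>

definition staircase :: "nat \<Rightarrow> nat" where
  "staircase k = N - k"

lemma max_min_sum: "(\<Sum>k<N. max (f k) (j::nat)) + (\<Sum>k<N. min (f k) j) = (\<Sum>k<N. f k) + N * j"
proof -
  have "(\<Sum>k<N. max (f k) j + min (f k) j) = (\<Sum>k<N. f k + j)"
    by (rule sum.cong) auto
  then show ?thesis by (simp add: sum.distrib)
qed

text \<open>One column further right the condition still holds at \<open>i\<close>, and a column
  holds each letter at most once. Hence column \<open>Suc J\<close> contains \<open>Suc i\<close>
  but not \<open>i\<close>: no run of \<open>i\<close> meets the cut, and the deficit is exactly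
  one. Adding \<open>staircase\<close> turns this deficit into an equality, so exchanging the two
  letters in the remaining columns exchanges the entries \<open>i\<close> and \<open>Suc i\<close>
  of \<open>b + staircase + wt\<close>.\<close>

lemma cancel_props:
  assumes g: "g \<in> gt a l" and l: "shape l" and b: "antimono b" and bad: "\<not> lattice b g"
  defines "J \<equiv> viol_col b g" and "i \<equiv> viol_row b g"
  shows "cancel b g \<in> gt a l" "\<not> lattice b (cancel b g)" "cancel b (cancel b g) = g"
    "Suc i < N"
    "(\<lambda>k. b k + staircase k + wt (cancel b g) k) = (\<lambda>k. b k + staircase k + wt g k) \<circ> transpose i (Suc i)"
proof -
  have ex: "\<exists>j. \<exists>i. violation b g j i" using bad by (auto simp: lattice_def)
  have bd: "\<forall>j. (\<exists>i. violation b g j i) \<longrightarrow> j \<le> l 0"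
    using not_violation_large[OF g l b] by (meson nat_le_linear)
  have exJ: "\<exists>i. violation b g J i"
    unfolding J_def viol_col_def using GreatestI_ex_nat[OF ex, of "l 0"] bd by blast
  have maxJ: "\<not> violation b g j m" if "J < j" for j m
    using Greatest_le_nat[of "\<lambda>j. \<exists>i. violation b g j i" j "l 0"] bd that
    unfolding J_def viol_col_def by (meson leD)
  have v: "violation b g J i" unfolding i_def viol_row_def J_def[symmetric] using exJ by (meson LeastI)
  then show i: "Suc i < N" by (simp add: violation_def)
  have ci: "col_wt g J i = col_wt g (Suc J) i + card {k. k < N \<and> g i k \<le> J \<and> J < g (Suc i) k}"
    and ci': "col_wt g J (Suc i) = col_wt g (Suc J) (Suc i)
      + card {k. k < N \<and> g (Suc i) k \<le> J \<and> J < g (Suc (Suc i)) k}"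
    using col_wt_Suc[OF g] by blast+
  have nv: "b (Suc i) + col_wt g (Suc J) (Suc i) \<le> b i + col_wt g (Suc J) i"
    using maxJ[of "Suc J" i] i by (simp add: violation_def)
  have "b i + col_wt g J i < b (Suc i) + col_wt g J (Suc i)" using v by (simp add: violation_def)
  then have c0: "card {k. k < N \<and> g i k \<le> J \<and> J < g (Suc i) k} = 0"
    and exact: "b (Suc i) + col_wt g J (Suc i) = b i + col_wt g J i + 1"
    using nv ci ci' card_column_le_1[OF g, of "Suc i" J] by linarith+
  from c0 have empty: "{k. k < N \<and> g i k \<le> J \<and> J < g (Suc i) k} = {}" by simp
  have u: "uncrossed J i g" unfolding uncrossed_def
  proof (intro allI notI)
    fix k assume k: "g i k \<le> J \<and> J < g (Suc i) k"
    then have "k < N" using gt_zero[OF g l, of k "Suc i"] by (cases "k < N") auto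
    then show False using k empty by blast
  qed
  let ?h = "cancel b g"
  have h: "?h = bk J i g" by (simp add: cancel_def J_def i_def)
  note bp = bk_props[OF g l i u]
  show hg: "?h \<in> gt a l" using bp(1) h by simp
  have cs: "col_sum ?h j m = col_sum g j m" if "J \<le> j" for j m
    using bp(4)[OF that] by (simp add: h col_sum_def)
  then have vi: "violation b ?h j m = violation b g j m" if "J \<le> j" for j m
    using that by (simp add: violation_def col_wt_def)
  show "\<not> lattice b ?h" using v vi by (auto simp: lattice_def)
  have "viol_col b ?h = J" unfolding viol_col_def
  proof (rule Greatest_equality)
    show "\<exists>i. violation b ?h J i" using v vi by auto
    show "j \<le> J" if "\<exists>i. violation b ?h j i" for j
      using that maxJ vi by (meson less_imp_le not_le)
  qed
  moreover from this have "viol_row b ?h = i"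
    using vi by (simp add: viol_row_def i_def J_def)
  ultimately show "cancel b ?h = g" using bp(2) by (simp add: cancel_def[of b "bk J i g"] h)
  have mm: "col_sum f J m + (\<Sum>k<N. min (f m k) J) = vsize (f m) + N * J" for f m
    using max_min_sum[of "f m" J] by (simp add: col_sum_def vsize_def)
  \<comment> \<open>A size is a capped size plus \<open>col_sum\<close>, up to the constant
    \<open>N * J\<close>; right of column \<open>J\<close> the pattern and its image agree.\<close>
  have key: "vsize (?h (Suc i)) + vsize (g (Suc i)) + col_sum g J i + col_sum g J (Suc (Suc i))
    = vsize (g i) + vsize (g (Suc (Suc i))) + 2 * col_sum g J (Suc i)"
    using mm[of ?h "Suc i"] mm[of g i] mm[of g "Suc i"] mm[of g "Suc (Suc i)"] bp(5)[folded h]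
      cs[of J "Suc i", OF order_refl] by linarith
  have out: "?h m = g m" if "m \<noteq> Suc i" for m using that by (simp add: h bk_def)
  note w = wt_eq[OF g, of i] wt_eq[OF g, of "Suc i"] wt_eq[OF hg, of i] wt_eq[OF hg, of "Suc i"]
    col_wt_eq[OF g, of J i] col_wt_eq[OF g, of J "Suc i"]
  have st: "staircase i = Suc (staircase (Suc i))" using i by (simp add: staircase_def)
  have hi: "vsize (?h i) = vsize (g i)" "vsize (?h (Suc (Suc i))) = vsize (g (Suc (Suc i)))"
    using out by simp_all
  have e1: "b i + staircase i + wt ?h i = b (Suc i) + staircase (Suc i) + wt g (Suc i)"
    using w hi exact key st by linarith
  have e2: "b (Suc i) + staircase (Suc i) + wt ?h (Suc i) = b i + staircase i + wt g i"
    using w hi exact key st by linarith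
  have e3: "wt ?h m = wt g m" if "m \<noteq> i" "m \<noteq> Suc i" for m
    using that out by (simp add: wt_def)
  show "(\<lambda>k. b k + staircase k + wt ?h k) = (\<lambda>k. b k + staircase k + wt g k) \<circ> transpose i (Suc i)"
  proof
    fix m
    consider "m = i" | "m = Suc i" | "m \<noteq> i" "m \<noteq> Suc i" by blast
    then show "b m + staircase m + wt ?h m
      = ((\<lambda>k. b k + staircase k + wt g k) \<circ> transpose i (Suc i)) m"
    proof cases
      case 3
      then show ?thesis using e3[of m] by simp
    qed (use e1 e2 in \<open>simp_all only: o_def transpose_apply_first transpose_apply_second\<close>)
  qed
qed

end

section \<open>The lattice condition by rows\<close>

definition row_sum :: "(nat \<Rightarrow> nat \<Rightarrow> nat) \<Rightarrow> nat \<Rightarrow> nat \<Rightarrow> nat" where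
  "row_sum g i r = (\<Sum>k<r. g i k)"

text \<open>Row \<open>r\<close> is where a cut by columns meets a reading by rows: the rows above
  reach column \<open>j\<close>, the rows below do not pass it. This converts counts by columns into
  counts by rows.\<close>

lemma sum_max_split:
  fixes f :: "nat \<Rightarrow> nat"
  assumes "r < N" "\<And>k. k < r \<Longrightarrow> j \<le> f k" "\<And>k. r < k \<Longrightarrow> f k \<le> j"
  shows "(\<Sum>k<N. max (f k) j) = (\<Sum>k<r. f k) + max (f r) j + (N - Suc r) * j"
proof -
  have "(\<Sum>k<N. max (f k) j) = (\<Sum>k<Suc r. max (f k) j) + (\<Sum>k\<in>{Suc r..<N}. max (f k) j)"
    using sum.atLeastLessThan_concat[of 0 "Suc r" N "\<lambda>k. max (f k) j"] assms(1)
    by (simp add: atLeast0LessThan)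
  moreover have "(\<Sum>k<r. max (f k) j) = (\<Sum>k<r. f k)"
    by (rule sum.cong) (use assms(2) in \<open>auto simp: max_def dest: antisym\<close>)
  moreover have "(\<Sum>k\<in>{Suc r..<N}. max (f k) j) = (\<Sum>k\<in>{Suc r..<N}. j)"
    by (rule sum.cong) (use assms(3) in \<open>auto simp: max_def\<close>)
  ultimately show ?thesis by simp
qed

lemma violation_iff:
  assumes "g \<in> gt N a l"
  shows "violation N b g j i \<longleftrightarrow> Suc i < N \<and>
    b i + 2 * col_sum N g j (Suc i) < b (Suc i) + col_sum N g j (Suc (Suc i)) + col_sum N g j i"
  using col_wt_eq[OF assms, of j i] col_wt_eq[OF assms, of j "Suc i"] unfolding violation_def by linarith

text \<open>The lattice condition in reading order: it suffices to look at the prefixes that end just after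
  the letters \<open>Suc i\<close> of row \<open>r\<close>.\<close>

lemma lattice_iff_rows:
  assumes g: "g \<in> gt N a l" and l: "shape N l" and b: "antimono b"
  shows "lattice N b g \<longleftrightarrow> (\<forall>i r. Suc i < N \<longrightarrow>
    b (Suc i) + row_sum g (Suc (Suc i)) (Suc r) + row_sum g i r
      \<le> b i + row_sum g (Suc i) r + row_sum g (Suc i) (Suc r))"
    (is "_ \<longleftrightarrow> (\<forall>i r. _ \<longrightarrow> ?D i r)")
proof
  have il: "g m k \<le> g (Suc m) k" "g (Suc m) (Suc k) \<le> g m k" for m k
    using g by (auto simp: gt_def interlaced_def)
  have anti: "g m k' \<le> g m k" if "k \<le> k'" for m k k'
    using gt_shape[OF g l, of m] that by (auto simp: shape_def antimono_def)
  {
    assume lat: "lattice N b g"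
    show "\<forall>i r. Suc i < N \<longrightarrow> ?D i r"
    proof (rule ccontr)
      assume "\<not> (\<forall>i r. Suc i < N \<longrightarrow> ?D i r)"
      then obtain i where i: "Suc i < N" and ex: "\<exists>r. \<not> ?D i r" by blast
      define r where "r = (LEAST r. \<not> ?D i r)"
      have r: "\<not> ?D i r" unfolding r_def using ex by (rule LeastI_ex)
      have less_r: "?D i r'" if "r' < r" for r' using not_less_Least that unfolding r_def by blast
      \<comment> \<open>Reading row \<open>r\<close> from the right, column \<open>Suc J\<close> is
        where the condition first fails: the length of row \<open>r\<close> beyond \<open>J\<close>
        on level \<open>Suc (Suc i)\<close> exceeds by one the surplus of \<open>i\<close> over
        \<open>Suc i\<close> left by the rows above.\<close>
      define J where "J = g (Suc (Suc i)) r + b (Suc i) + row_sum g (Suc (Suc i)) r + row_sum g i r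
        - Suc (b i + 2 * row_sum g (Suc i) r)"
      have J: "J + Suc (b i + 2 * row_sum g (Suc i) r)
        = g (Suc (Suc i)) r + b (Suc i) + row_sum g (Suc (Suc i)) r + row_sum g i r"
        using r by (simp add: J_def row_sum_def)
      then have BJ: "g (Suc i) r \<le> J" using r by (simp add: row_sum_def)
      have JC: "J < g (Suc (Suc i)) r \<and> (\<forall>r'. r = Suc r' \<longrightarrow> J \<le> g i r')"
      proof (cases r)
        case 0
        have "b (Suc i) \<le> b i" using b by (simp add: antimono_iff_le_Suc)
        then show ?thesis using J 0 by (simp add: row_sum_def)
      next
        case (Suc r')
        \<comment> \<open>Minimality of \<open>r\<close> places every letter \<open>i\<close> and
          \<open>Suc i\<close> of the rows above to the right of column \<open>J\<close>, so the
          reading by columns has met the same letters.\<close>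
        have "?D i r'" using less_r Suc by simp
        then show ?thesis using J Suc il(1)[of i r'] il(2)[of "Suc i" r'] by (auto simp: row_sum_def)
      qed
      then have rN: "r < N" using gt_zero[OF g l, of r "Suc (Suc i)"] by (cases "r < N") auto
      have big: "J \<le> g m k" if kr: "k < r" and im: "i \<le> m" for m k
      proof -
        obtain r' where r': "r = Suc r'" "k \<le> r'" using kr by (cases r) auto
        have "J \<le> g i r'" using JC r' by simp
        also have "\<dots> \<le> g i k" using anti r' by simp
        also have "\<dots> \<le> g m k" using gt_mono[OF g im] by (simp add: le_fun_def)
        finally show ?thesis .
      qed
      have small: "g m k \<le> J" if "r < k" "m \<le> Suc (Suc i)" for m k
      proof -
        have "g m k \<le> g (Suc (Suc i)) k" using gt_mono[OF g that(2)] by (simp add: le_fun_def)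
        also have "\<dots> \<le> g (Suc (Suc i)) (Suc r)" using that by (intro anti) simp
        also have "\<dots> \<le> g (Suc i) r" by (rule il)
        finally show ?thesis using BJ by simp
      qed
      have cs: "col_sum N g J m = row_sum g m r + max (g m r) J + (N - Suc r) * J"
        if "i \<le> m" "m \<le> Suc (Suc i)" for m
        unfolding col_sum_def row_sum_def by (rule sum_max_split) (use that rN big small in auto)
      have "max (g i r) J = J" "max (g (Suc i) r) J = J" "max (g (Suc (Suc i)) r) J = g (Suc (Suc i)) r"
        using BJ JC il(1)[of i r] by auto
      then have "violation N b g J i"
        unfolding violation_iff[OF g] using i cs[of i] cs[of "Suc i"] cs[of "Suc (Suc i)"] J by simp
      then show False using lat by (simp add: lattice_def)
    qed
  next
    assume D: "\<forall>i r. Suc i < N \<longrightarrow> ?D i r"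
    show "lattice N b g"
    proof (rule ccontr)
      assume "\<not> lattice N b g"
      then obtain i where ex: "\<exists>j. violation N b g j i" by (auto simp: lattice_def)
      have bd: "j \<le> l 0" if "violation N b g j i" for j
        using not_violation_large[OF g l b] that by (meson nat_le_linear)
      \<comment> \<open>The rightmost violation at this \<open>i\<close>. As in the involution,
        column \<open>Suc j\<close> then contains \<open>Suc i\<close> in some row \<open>r\<close>
        and no \<open>i\<close>, which pushes the letters \<open>i\<close> of all higher rows to the
        right of \<open>j\<close>.\<close>
      define j where "j = (GREATEST j. violation N b g j i)"
      have j: "violation N b g j i" unfolding j_def
        by (rule GreatestI_ex_nat[OF ex, of "l 0"]) (use bd in blast)
      have "\<not> violation N b g (Suc j) i"
        using Greatest_le_nat[of "\<lambda>j. violation N b g j i" "Suc j" "l 0"] bd unfolding j_def by auto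
      moreover have i: "Suc i < N" using j by (simp add: violation_def)
      ultimately have "card {k. k < N \<and> g i k \<le> j \<and> j < g (Suc i) k} = 0"
        "card {k. k < N \<and> g (Suc i) k \<le> j \<and> j < g (Suc (Suc i)) k} \<noteq> 0"
        using j col_wt_Suc[OF g, of j i] col_wt_Suc[OF g, of j "Suc i"]
          card_column_le_1[OF g, of "Suc i" j] unfolding violation_def by linarith+
      then have none: "\<And>k. k < N \<Longrightarrow> g i k \<le> j \<Longrightarrow> g (Suc i) k \<le> j"
        and "{k. k < N \<and> g (Suc i) k \<le> j \<and> j < g (Suc (Suc i)) k} \<noteq> {}"
        by (auto simp: not_less[symmetric])
      then obtain r where r: "r < N" "g (Suc i) r \<le> j" "j < g (Suc (Suc i)) r" by blast
      have big: "j \<le> g m k" if "k < r" "i \<le> m" for m k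
      proof -
        have "g (Suc (Suc i)) r \<le> g (Suc (Suc i)) (Suc k)" using that by (intro anti) simp
        also have "\<dots> \<le> g (Suc i) k" by (rule il)
        finally have "\<not> g i k \<le> j" using none[of k] r that by auto
        then show ?thesis using gt_mono[OF g that(2)] by (auto simp: le_fun_def not_le intro: le_trans less_imp_le)
      qed
      have small: "g m k \<le> j" if "r < k" "m \<le> Suc (Suc i)" for m k
      proof -
        have "g m k \<le> g (Suc (Suc i)) k" using gt_mono[OF g that(2)] by (simp add: le_fun_def)
        also have "\<dots> \<le> g (Suc (Suc i)) (Suc r)" using that by (intro anti) simp
        also have "\<dots> \<le> g (Suc i) r" by (rule il)
        finally show ?thesis using r by simp
      qed
      have cs: "col_sum N g j m = row_sum g m r + max (g m r) j + (N - Suc r) * j"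
        if "i \<le> m" "m \<le> Suc (Suc i)" for m
        unfolding col_sum_def row_sum_def by (rule sum_max_split) (use that r big small in auto)
      have "max (g i r) j = j" "max (g (Suc i) r) j = j" "max (g (Suc (Suc i)) r) j = g (Suc (Suc i)) r"
        using r il(1)[of i r] by auto
      then have "b i + 2 * row_sum g (Suc i) r + j
          < b (Suc i) + row_sum g (Suc (Suc i)) r + g (Suc (Suc i)) r + row_sum g i r"
        using j cs[of i] cs[of "Suc i"] cs[of "Suc (Suc i)"] unfolding violation_iff[OF g] by simp
      then show False using D[rule_format, OF i, of r] r by (simp add: row_sum_def)
    qed
  }
qed

lemma gt_zero_rows:
  assumes "g \<in> gt N (\<lambda>_. 0) l"
  shows "i \<le> r \<Longrightarrow> g i r = 0"
proof (induction i arbitrary: r)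
  case 0
  then show ?case using assms by (simp add: gt_def)
next
  case (Suc i)
  then obtain r' where "r = Suc r'" "i \<le> r'" by (cases r) auto
  moreover have "g (Suc i) (Suc r') \<le> g i r'" using assms by (auto simp: gt_def interlaced_def)
  ultimately show ?case using Suc.IH[of r'] by simp
qed

text \<open>The tableau whose row \<open>r\<close> consists of the letter \<open>r\<close>
  only.\<close>

definition superstandard :: "(nat \<Rightarrow> nat) \<Rightarrow> nat \<Rightarrow> nat \<Rightarrow> nat" where
  "superstandard l i r = (if r < i then l r else 0)"

lemma superstandard_gt: "shape N l \<Longrightarrow> superstandard l \<in> gt N (\<lambda>_. 0) l"
  by (auto simp: gt_def superstandard_def shape_def interlaced_def antimono_iff_le_Suc fun_eq_iff)

lemma vsize_superstandard: "i \<le> N \<Longrightarrow> vsize N (superstandard l i) = (\<Sum>r<i. l r)"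
  unfolding vsize_def superstandard_def
  by (subst sum.inter_filter[symmetric]) (auto intro!: sum.cong)

lemma wt_superstandard:
  assumes "shape N l"
  shows "wt N (superstandard l) = l"
proof
  fix i
  show "wt N (superstandard l) i = l i"
  proof (cases "i < N")
    case True
    then show ?thesis by (simp add: wt_def vsize_superstandard)
  next
    case False
    then show ?thesis using wt_outside[OF superstandard_gt[OF assms]] assms by (simp add: shape_def)
  qed
qed

lemma row_sum_superstandard: "row_sum (superstandard l) i r = (\<Sum>k<min i r. l k)"
  unfolding row_sum_def superstandard_def
  by (subst sum.inter_filter[symmetric]) (auto intro!: sum.cong)

text \<open>Column strictness keeps letters below \<open>r\<close> out of row \<open>r\<close>.
  Larger letters are excluded by induction on rows: with the rows above already determined, the
  lattice condition for \<open>i \<ge> r\<close> admits no letter \<open>Suc i\<close> in row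
  \<open>r\<close>.\<close>

lemma lattice_zero_iff:
  assumes g: "g \<in> gt N (\<lambda>_. 0) l" and l: "shape N l"
  shows "lattice N (\<lambda>_. 0) g \<longleftrightarrow> g = superstandard l"
proof
  have anti: "antimono (\<lambda>_::nat. 0::nat)" by (simp add: antimono_def)
  assume lat: "lattice N (\<lambda>_. 0) g"
  have D: "row_sum g (Suc (Suc i)) (Suc r) + row_sum g i r \<le> row_sum g (Suc i) r + row_sum g (Suc i) (Suc r)"
    if "Suc i < N" for i r
    using lat that unfolding lattice_iff_rows[OF g l anti] by simp
  have "r < i \<longrightarrow> g i r = l r" for i r
  proof (induction r arbitrary: i rule: less_induct)
    case (less r)
    have step: "g (Suc (Suc i)) r = g (Suc i) r" if "r \<le> i" for i
    proof (cases "Suc i < N")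
      case True
      have "row_sum g m r = (\<Sum>k<r. l k)" if "i \<le> m" for m
        unfolding row_sum_def using less \<open>r \<le> i\<close> that by (intro sum.cong) auto
      then have "g (Suc (Suc i)) r \<le> g (Suc i) r" using D[OF True, of r] by (simp add: row_sum_def)
      then show ?thesis using g by (auto simp: gt_def interlaced_def intro: antisym)
    next
      case False
      then show ?thesis using g by (simp add: gt_def)
    qed
    have "g (Suc r + m) r = g (Suc r) r" for m
      by (induction m) (use step in auto)
    moreover have "g (Suc r + N) r = l r" using g by (simp add: gt_def)
    ultimately show ?case by (metis less_iff_Suc_add add_Suc)
  qed
  then show "g = superstandard l"
    using gt_zero_rows[OF g] by (auto simp: fun_eq_iff superstandard_def)
next
  have anti: "antimono (\<lambda>_::nat. 0::nat)" by (simp add: antimono_def)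
  assume gs: "g = superstandard l"
  show "lattice N (\<lambda>_. 0) g"
    unfolding lattice_iff_rows[OF g l anti] unfolding gs row_sum_superstandard
  proof (intro allI impI)
    fix i r
    have "l (Suc i) \<le> l i" using l by (auto simp: shape_def antimono_iff_le_Suc)
    then show "0 + (\<Sum>k<min (Suc (Suc i)) (Suc r). l k) + (\<Sum>k<min i r. l k)
      \<le> 0 + (\<Sum>k<min (Suc i) r. l k) + (\<Sum>k<min (Suc i) (Suc r). l k)"
      by (cases "r \<le> i") (auto simp: min_def not_le le_Suc_eq)
  qed
qed

section \<open>The Littlewood--Richardson rule\<close>

type_synonym mpoly = "(nat \<Rightarrow>\<^sub>0 nat) \<Rightarrow>\<^sub>0 int"

text \<open>Entries from \<open>N\<close> on are cut off, so that every function gives an exponent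
  of finite support.\<close>

definition expo :: "nat \<Rightarrow> (nat \<Rightarrow> nat) \<Rightarrow> nat \<Rightarrow>\<^sub>0 nat" where
  "expo N v = Abs_poly_mapping (\<lambda>i. if i < N then v i else 0)"

definition xpow :: "nat \<Rightarrow> (nat \<Rightarrow> nat) \<Rightarrow> mpoly" where
  "xpow N v = Poly_Mapping.single (expo N v) 1"

lemma lookup_expo: "Poly_Mapping.lookup (expo N v) i = (if i < N then v i else 0)"
proof -
  have "finite {i. (if i < N then v i else 0) \<noteq> 0}" by (rule finite_subset[of _ "{..<N}"]) auto
  then show ?thesis by (simp add: expo_def Abs_poly_mapping_inverse)
qed

lemma expo_eq_iff: "expo N v = expo N w \<longleftrightarrow> (\<forall>i<N. v i = w i)"
  by (auto simp: poly_mapping_eq_iff fun_eq_iff lookup_expo split: if_splits)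

lemma expo_add: "expo N v + expo N w = expo N (\<lambda>i. v i + w i)"
  by (rule poly_mapping_eqI) (simp add: lookup_add lookup_expo)

lemma xpow_mult: "xpow N v * xpow N w = xpow N (\<lambda>i. v i + w i)"
  by (simp add: xpow_def mult_single expo_add)

lemma lookup_xpow: "Poly_Mapping.lookup (xpow N v) (expo N w) = (if \<forall>i<N. v i = w i then 1 else 0)"
  by (simp add: xpow_def lookup_single when_def expo_eq_iff)

lemma xpow_prod:
  assumes "finite I"
  shows "(\<Prod>j\<in>I. xpow N (v j)) = xpow N (\<lambda>i. \<Sum>j\<in>I. v j i)"
  using assms
proof (induction I rule: finite_induct)
  case empty
  have "expo N (\<lambda>i. 0) = 0" by (rule poly_mapping_eqI) (simp add: lookup_expo)
  then show ?case by (simp add: xpow_def)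
next
  case (insert x F)
  then show ?case by (simp add: xpow_mult)
qed

section \<open>Alternants and the bialternant formula\<close>

definition alternant :: "nat \<Rightarrow> (nat \<Rightarrow> nat) \<Rightarrow> mpoly" where
  "alternant N v = (\<Sum>w | w permutes {..<N}. of_int (sign w) * xpow N (v \<circ> w))"

definition schur_poly :: "nat \<Rightarrow> (nat \<Rightarrow> nat) \<Rightarrow> (nat \<Rightarrow> nat) \<Rightarrow> mpoly" where
  "schur_poly N a l = (\<Sum>g\<in>gt N a l. xpow N (wt N g))"

lemma sign_comp_permutes:
  "finite S \<Longrightarrow> p permutes S \<Longrightarrow> q permutes S \<Longrightarrow> sign (p \<circ> q) = sign p * sign q"
  using permutes_imp_permutation sign_compose by blast

lemma alternant_swap:
  assumes "i < N" "j < N" "i \<noteq> j"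
  shows "alternant N (v \<circ> transpose i j) = - alternant N v"
proof -
  have t: "transpose i j permutes {..<N}" using assms by (intro permutes_swap_id) auto
  have "alternant N (v \<circ> transpose i j)
    = (\<Sum>w | w permutes {..<N}. of_int (sign w) * xpow N (v \<circ> (transpose i j \<circ> w)))"
    by (simp add: alternant_def o_assoc)
  also have "\<dots> = (\<Sum>w | w permutes {..<N}. - (of_int (sign (transpose i j \<circ> w)) * xpow N (v \<circ> (transpose i j \<circ> w))))"
    by (rule sum.cong) (use assms in \<open>simp_all add: sign_comp_permutes[OF finite_lessThan t] sign_swap_id\<close>)
  also have "\<dots> = - alternant N v"
    unfolding alternant_def sum_negf by (subst setum_permutations_compose_left[OF t]) simp
  finally show ?thesis .
qed

text \<open>By symmetry the weight of the tableau may be permuted along with \<open>v\<close>, so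
  that each permutation acts on \<open>v + wt\<close> as a whole.\<close>

lemma alternant_mult_schur:
  assumes "shape N l"
  shows "alternant N v * schur_poly N a l = (\<Sum>g\<in>gt N a l. alternant N (\<lambda>k. v k + wt N g k))"
proof -
  have "alternant N v * schur_poly N a l
    = (\<Sum>w | w permutes {..<N}. of_int (sign w) * (\<Sum>g\<in>gt N a l. xpow N (\<lambda>k. (v \<circ> w) k + wt N g k)))"
    by (simp add: alternant_def schur_poly_def sum_distrib_right sum_distrib_left mult.assoc xpow_mult)
      (rule sum.swap)
  also have "\<dots> = (\<Sum>w | w permutes {..<N}. of_int (sign w)
      * (\<Sum>g\<in>gt N a l. xpow N ((\<lambda>k. v k + wt N g k) \<circ> w)))"
  proof (rule sum.cong[OF refl])
    fix w assume "w \<in> {w. w permutes {..<N}}"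
    then have "(\<Sum>g\<in>gt N a l. xpow N (\<lambda>k. (v \<circ> w) k + wt N g k)) = (\<Sum>g\<in>gt N a l. xpow N ((\<lambda>k. v k + wt N g k) \<circ> w))"
      using sum_wt_permute[OF assms, where F = "\<lambda>u. xpow N (\<lambda>k. (v \<circ> w) k + u k)" and p = w]
      by (simp add: o_def)
    then show "of_int (sign w) * (\<Sum>g\<in>gt N a l. xpow N (\<lambda>k. (v \<circ> w) k + wt N g k))
      = of_int (sign w) * (\<Sum>g\<in>gt N a l. xpow N ((\<lambda>k. v k + wt N g k) \<circ> w))" by simp
  qed
  also have "\<dots> = (\<Sum>g\<in>gt N a l. alternant N (\<lambda>k. v k + wt N g k))"
    unfolding alternant_def sum_distrib_left by (rule sum.swap)
  finally show ?thesis .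
qed

lemma eq_neg_zero: "(x :: mpoly) = - x \<Longrightarrow> x = 0"
proof (rule poly_mapping_eqI)
  fix k assume "x = - x"
  then have "Poly_Mapping.lookup x k = - Poly_Mapping.lookup x k" by (metis lookup_uminus)
  then show "Poly_Mapping.lookup x k = Poly_Mapping.lookup 0 k" by simp
qed

text \<open>On the patterns that violate the condition \<open>cancel\<close> permutes the exponent
  by an adjacent transposition and so reverses the sign; their sum equals its own negative.\<close>

lemma alternant_mult_schur_lattice:
  assumes l: "shape N l" and b: "shape N b"
  shows "alternant N (\<lambda>k. b k + staircase N k) * schur_poly N a l
    = (\<Sum>g | g \<in> gt N a l \<and> lattice N b g. alternant N (\<lambda>k. b k + staircase N k + wt N g k))"
proof -
  let ?A = "\<lambda>g. alternant N (\<lambda>k. b k + staircase N k + wt N g k)"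
  let ?B = "{g. g \<in> gt N a l \<and> \<not> lattice N b g}"
  have anti: "antimono b" using b by (simp add: shape_def)
  have "sum ?A ?B = (\<Sum>g\<in>?B. - ?A g)"
  proof (rule sum.reindex_bij_witness[of _ "cancel N b" "cancel N b"])
    fix g assume "g \<in> ?B"
    then have g: "g \<in> gt N a l" "\<not> lattice N b g" by auto
    note cp = cancel_props[OF g(1) l anti g(2)]
    show "cancel N b (cancel N b g) = g" "cancel N b g \<in> ?B" using cp by auto
    then show "cancel N b (cancel N b g) = g" "cancel N b g \<in> ?B" by auto
    show "- ?A (cancel N b g) = ?A g"
      unfolding cp(5) using cp(4) by (subst alternant_swap) auto
  qed
  then have "sum ?A ?B = 0" by (intro eq_neg_zero) (simp add: sum_negf)
  moreover have "gt N a l = {g. g \<in> gt N a l \<and> lattice N b g} \<union> ?B" by auto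
  then have "sum ?A (gt N a l) = sum ?A {g. g \<in> gt N a l \<and> lattice N b g} + sum ?A ?B"
    using finite_gt[OF l, of a] by (metis (no_types, lifting) Collect_disj_eq finite_Un sum.union_disjoint disjoint_iff mem_Collect_eq)
  ultimately show ?thesis by (simp add: alternant_mult_schur[OF l])
qed

text \<open>The bialternant formula: for \<open>b = 0\<close> and empty inner shape only the
  superstandard pattern survives the cancellation.\<close>

lemma alternant_staircase_mult_schur:
  assumes l: "shape N l"
  shows "alternant N (staircase N) * schur_poly N (\<lambda>_. 0) l = alternant N (\<lambda>k. l k + staircase N k)"
proof -
  have z: "shape N (\<lambda>_. 0)" by (simp add: shape_def antimono_def)
  have "{g. g \<in> gt N (\<lambda>_. 0) l \<and> lattice N (\<lambda>_. 0) g} = {superstandard l}"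
    using lattice_zero_iff[OF _ l] superstandard_gt[OF l] by auto
  then show ?thesis
    using alternant_mult_schur_lattice[OF l z, of "\<lambda>_. 0"] by (simp add: wt_superstandard[OF l] add.commute)
qed

text \<open>The entries of the staircase are distinct, so its own monomial is reached by the
  identity alone.\<close>

lemma alternant_staircase_nonzero: "alternant N (staircase N) \<noteq> 0"
proof -
  have id: "w = id" if w: "w permutes {..<N}" and eq: "\<forall>i<N. staircase N (w i) = staircase N i" for w
  proof
    fix i
    show "w i = id i"
    proof (cases "i < N")
      case True
      then have "w i < N" using permutes_in_image[OF w, of i] by simp
      then show ?thesis using eq True by (auto simp: staircase_def)
    next
      case False
      then show ?thesis using permutes_not_in[OF w] by simp
    qed
  qed
  have "Poly_Mapping.lookup (alternant N (staircase N)) (expo N (staircase N))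
    = (\<Sum>w | w permutes {..<N}. of_int (sign w) * (if \<forall>i<N. staircase N (w i) = staircase N i then 1 else 0))"
    unfolding alternant_def lookup_sum
  proof (rule sum.cong[OF refl])
    fix w :: "nat \<Rightarrow> nat"
    have "of_int (sign w) * xpow N v = (if sign w = 1 then xpow N v else - xpow N v)" for v
      by (cases w rule: sign_cases) auto
    then show "Poly_Mapping.lookup (of_int (sign w) * xpow N (staircase N \<circ> w)) (expo N (staircase N))
      = of_int (sign w) * (if \<forall>i<N. staircase N (w i) = staircase N i then 1 else 0)"
      by (cases w rule: sign_cases) (auto simp: lookup_xpow)
  qed
  also have "\<dots> = (\<Sum>w | w permutes {..<N}. if w = id then 1 else 0)"
    by (rule sum.cong) (use id in auto)
  also have "\<dots> = 1" by (simp add: finite_permutations permutes_id)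
  finally show ?thesis by auto
qed

text \<open>At \<open>j = 0\<close> every column has been read, and the lattice condition says that
  \<open>b + wt\<close> decreases.\<close>

lemma shape_add_wt:
  assumes g: "g \<in> gt N a l" and b: "shape N b" and lat: "lattice N b g"
  shows "shape N (\<lambda>k. b k + wt N g k)"
proof -
  have "b (Suc i) + wt N g (Suc i) \<le> b i + wt N g i" for i
  proof (cases "Suc i < N")
    case True
    then show ?thesis
      using lat[unfolded lattice_def violation_def, rule_format, of i 0] by (simp add: col_wt_0)
  next
    case False
    then show ?thesis using wt_outside[OF g, of "Suc i"] b by (simp add: shape_def)
  qed
  then show ?thesis using b wt_outside[OF g] by (auto simp: shape_def antimono_iff_le_Suc)
qed

text \<open>Both sides agree after multiplication by the alternant of the staircase, which can be
  cancelled because the polynomial ring is a domain.\<close>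

theorem littlewood_richardson:
  assumes l: "shape N l" and b: "shape N b"
  shows "schur_poly N (\<lambda>_. 0) b * schur_poly N a l
    = (\<Sum>g | g \<in> gt N a l \<and> lattice N b g. schur_poly N (\<lambda>_. 0) (\<lambda>k. b k + wt N g k))"
proof -
  have "alternant N (staircase N) * (schur_poly N (\<lambda>_. 0) b * schur_poly N a l)
    = alternant N (\<lambda>k. b k + staircase N k) * schur_poly N a l"
    by (simp add: mult.assoc[symmetric] alternant_staircase_mult_schur[OF b])
  also have "\<dots> = (\<Sum>g | g \<in> gt N a l \<and> lattice N b g. alternant N (staircase N) * schur_poly N (\<lambda>_. 0) (\<lambda>k. b k + wt N g k))"
    unfolding alternant_mult_schur_lattice[OF l b]
    by (rule sum.cong) (use shape_add_wt[OF _ b] alternant_staircase_mult_schur in \<open>auto simp: add_ac\<close>)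
  finally show ?thesis
    using alternant_staircase_nonzero by (simp add: sum_distrib_left[symmetric])
qed

definition kostka :: "nat \<Rightarrow> (nat \<Rightarrow> nat) \<Rightarrow> (nat \<Rightarrow> nat) \<Rightarrow> (nat \<Rightarrow> nat) \<Rightarrow> nat" where
  "kostka N a l c = card {g \<in> gt N a l. wt N g = c}"

lemma lookup_schur_poly:
  assumes "shape N l" "\<And>i. N \<le> i \<Longrightarrow> c i = 0"
  shows "Poly_Mapping.lookup (schur_poly N a l) (expo N c) = int (kostka N a l c)"
proof -
  have "Poly_Mapping.lookup (schur_poly N a l) (expo N c) = (\<Sum>g\<in>gt N a l. if wt N g = c then 1 else 0)"
    unfolding schur_poly_def lookup_sum lookup_xpow
  proof (intro sum.cong[OF refl])
    fix g assume "g \<in> gt N a l"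
    then have "wt N g i = c i" if "N \<le> i" for i using wt_outside[OF _ that] assms(2)[OF that] by auto
    then have "(\<forall>i<N. wt N g i = c i) \<longleftrightarrow> wt N g = c" unfolding fun_eq_iff by (meson not_le)
    then show "(if \<forall>i<N. wt N g i = c i then 1 else 0) = (if wt N g = c then 1 else (0::int))" by simp
  qed
  then show ?thesis using finite_gt[OF assms(1)] by (simp add: kostka_def sum.inter_filter[symmetric])
qed

text \<open>The Littlewood-Richardson rule read off at one monomial: a count of pairs of tableaux
  with given joint content, the form in which it meets products of permutation characters.\<close>

lemma kostka_product:
  assumes l: "shape N l" and b: "shape N b" and c: "\<And>i. N \<le> i \<Longrightarrow> c i = 0"
  shows "card {(g, h). g \<in> gt N (\<lambda>_. 0) b \<and> h \<in> gt N a l \<and> (\<lambda>i. wt N g i + wt N h i) = c}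
    = (\<Sum>g | g \<in> gt N a l \<and> lattice N b g. kostka N (\<lambda>_. 0) (\<lambda>k. b k + wt N g k) c)"
proof -
  let ?P = "gt N (\<lambda>_. 0) b \<times> gt N a l"
  have fin: "finite ?P" using finite_gt l b by blast
  have prod: "schur_poly N (\<lambda>_. 0) b * schur_poly N a l = (\<Sum>(g, h)\<in>?P. xpow N (\<lambda>i. wt N g i + wt N h i))"
    by (simp add: schur_poly_def sum_product xpow_mult sum.cartesian_product)
  have "Poly_Mapping.lookup (schur_poly N (\<lambda>_. 0) b * schur_poly N a l) (expo N c)
    = (\<Sum>(g, h)\<in>?P. if (\<lambda>i. wt N g i + wt N h i) = c then 1 else 0)"
    unfolding prod lookup_sum case_prod_unfold
  proof (simp only: lookup_xpow, intro sum.cong[OF refl])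
    fix x assume "x \<in> ?P"
    then have "wt N (fst x) i + wt N (snd x) i = c i" if "N \<le> i" for i
      using wt_outside[OF _ that] c[OF that] by auto
    then have "(\<forall>i<N. wt N (fst x) i + wt N (snd x) i = c i) \<longleftrightarrow> (\<lambda>i. wt N (fst x) i + wt N (snd x) i) = c"
      unfolding fun_eq_iff by (meson not_le)
    then show "(if \<forall>i<N. wt N (fst x) i + wt N (snd x) i = c i then 1 else 0)
      = (if (\<lambda>i. wt N (fst x) i + wt N (snd x) i) = c then 1 else 0)" by simp
  qed
  also have "\<dots> = int (card {x \<in> ?P. (\<lambda>i. wt N (fst x) i + wt N (snd x) i) = c})"
    using fin by (simp add: case_prod_unfold sum.inter_filter[symmetric])
  also have "{x \<in> ?P. (\<lambda>i. wt N (fst x) i + wt N (snd x) i) = c}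
    = {(g, h). g \<in> gt N (\<lambda>_. 0) b \<and> h \<in> gt N a l \<and> (\<lambda>i. wt N g i + wt N h i) = c}" by auto
  finally have "int (card {(g, h). g \<in> gt N (\<lambda>_. 0) b \<and> h \<in> gt N a l \<and> (\<lambda>i. wt N g i + wt N h i) = c})
    = (\<Sum>g | g \<in> gt N a l \<and> lattice N b g. Poly_Mapping.lookup (schur_poly N (\<lambda>_. 0) (\<lambda>k. b k + wt N g k)) (expo N c))"
    unfolding littlewood_richardson[OF l b] lookup_sum by simp
  also have "\<dots> = (\<Sum>g | g \<in> gt N a l \<and> lattice N b g. int (kostka N (\<lambda>_. 0) (\<lambda>k. b k + wt N g k) c))"
    by (rule sum.cong) (use lookup_schur_poly[OF shape_add_wt[OF _ b] c] in auto)
  finally show ?thesis by (simp flip: of_nat_sum)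
qed

section \<open>Kostka numbers and the Cauchy identity\<close>

definition par :: "nat \<Rightarrow> nat \<Rightarrow> (nat \<Rightarrow> nat) set" where
  "par N n = {a. shape N a \<and> vsize N a = n}"

lemma finite_par: "finite (par N n)"
proof -
  have "a r \<le> n" if "a \<in> par N n" for a r
  proof (cases "r < N")
    case True
    then have "a r \<le> vsize N a" unfolding vsize_def by (intro member_le_sum) auto
    then show ?thesis using that by (simp add: par_def)
  next
    case False
    then show ?thesis using that by (simp add: par_def shape_def)
  qed
  then have "par N n \<subseteq> {a. shape N a \<and> (\<forall>r. a r \<le> n)}" by (auto simp: par_def)
  then show ?thesis using finite_subset finite_shapes_below by blast
qed

lemma eq_if_vsize_eq:
  assumes "a \<le> b" "vsize N a = vsize N b" "\<And>r. N \<le> r \<Longrightarrow> b r = 0"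
  shows "a = b"
proof
  fix r
  show "a r = b r"
  proof (cases "r < N")
    case True
    show ?thesis
    proof (rule ccontr)
      assume "a r \<noteq> b r"
      then have "a r < b r" using assms(1) by (simp add: le_fun_def order_less_le)
      then have "vsize N a < vsize N b" unfolding vsize_def using assms(1) True
        by (intro sum_strict_mono_ex1) (auto simp: le_fun_def)
      then show False using assms(2) by simp
    qed
  next
    case False
    then have "b r = 0" using assms(3) by simp
    then show ?thesis using assms(1) by (metis le_fun_def le_zero_eq)
  qed
qed

lemma gt_stationary:
  assumes g: "g \<in> gt N a l" and l: "shape N l" and w: "\<And>i. m \<le> i \<Longrightarrow> wt N g i = 0" and i: "m \<le> i"
  shows "g i = l"
proof -
  have "vsize N (g (i + k)) = vsize N (g i)" for k
  proof (induction k)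
    case (Suc k)
    then show ?case using wt_eq[OF g, of "i + k"] w[of "i + k"] i by simp
  qed simp
  from this[of N] have "vsize N (g i) = vsize N l" using g by (simp add: gt_def)
  then show ?thesis using gt_bounds(2)[OF g, of i] l by (intro eq_if_vsize_eq) (auto simp: shape_def)
qed

lemma gt_le: "g \<in> gt N a l \<Longrightarrow> g i r \<le> l r"
  using gt_bounds(2)[of g N a l i] by (simp add: le_fun_def)

lemma vsize_zero [simp]: "vsize N (\<lambda>_. 0) = 0"
  by (simp add: vsize_def)

text \<open>A tableau is cut at the shape \<open>a\<close> of its letters below \<open>m\<close>,
  and the upper part is relabelled from 0. Both parts are padded to full length: the lower one rests
  at \<open>a\<close> from level \<open>m\<close> on, the upper one has reached \<open>l\<close>
  after \<open>N - m\<close> levels because \<open>c2\<close> vanishes from there.\<close>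

lemma kostka_split:
  assumes l: "shape N l" and m: "m \<le> N"
    and c1: "\<And>i. m \<le> i \<Longrightarrow> c1 i = 0" and c2: "\<And>i. N \<le> m + i \<Longrightarrow> c2 i = 0"
  shows "kostka N (\<lambda>_. 0) l (\<lambda>i. if i < m then c1 i else c2 (i - m))
    = (\<Sum>a\<in>par N (\<Sum>i<m. c1 i). kostka N (\<lambda>_. 0) a c1 * kostka N a l c2)"
proof -
  define c where "c = (\<lambda>i. if i < m then c1 i else c2 (i - m))"
  let ?L = "{g \<in> gt N (\<lambda>_. 0) l. wt N g = c}"
  let ?R = "SIGMA a:par N (\<Sum>i<m. c1 i). {g \<in> gt N (\<lambda>_. 0) a. wt N g = c1} \<times> {h \<in> gt N a l. wt N h = c2}"
  let ?f = "\<lambda>g::nat \<Rightarrow> nat \<Rightarrow> nat. (g m, (\<lambda>i. g (min i m)), (\<lambda>i. g (m + i)))"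
  let ?k = "\<lambda>(a::nat \<Rightarrow> nat, g1::nat \<Rightarrow> nat \<Rightarrow> nat, h). \<lambda>i. if i \<le> m then g1 i else h (i - m)"
  have "bij_betw ?f ?L ?R"
  proof (rule bij_betwI[of _ _ _ ?k])
    show "?f \<in> ?L \<rightarrow> ?R"
    proof
      fix g assume "g \<in> ?L"
      then have g: "g \<in> gt N (\<lambda>_. 0) l" and w: "wt N g = c" by auto
      have "vsize N (g m) = (\<Sum>i<m. c1 i)" using sum_wt[OF g, of m] by (simp add: w c_def)
      then have "g m \<in> par N (\<Sum>i<m. c1 i)" using gt_shape[OF g l] by (simp add: par_def)
      moreover have "(\<lambda>i. g (min i m)) \<in> gt N (\<lambda>_. 0) (g m)"
      proof -
        have "interlaced (g (min i m)) (g (min (Suc i) m))" for i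
        proof (cases "i < m")
          case True
          then show ?thesis using g by (simp add: gt_def)
        next
          case False
          then show ?thesis using gt_shape[OF g l, of m] by (simp add: interlaced_def shape_def antimono_iff_le_Suc)
        qed
        then show ?thesis using g m by (auto simp: gt_def)
      qed
      moreover have "wt N (\<lambda>i. g (min i m)) = c1"
      proof
        fix i
        show "wt N (\<lambda>i. g (min i m)) i = c1 i"
        proof (cases "i < m")
          case True
          then have "wt N (\<lambda>i. g (min i m)) i = wt N g i" by (simp add: wt_def)
          then show ?thesis using True by (simp add: w c_def)
        next
          case False
          then show ?thesis using c1 by (simp add: wt_def)
        qed
      qed
      moreover have "(\<lambda>i. g (m + i)) \<in> gt N (g m) l" using g by (auto simp: gt_def)
      moreover have "wt N (\<lambda>i. g (m + i)) = c2"
      proof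
        fix i
        have "wt N (\<lambda>i. g (m + i)) i = wt N g (m + i)" by (simp add: wt_def)
        then show "wt N (\<lambda>i. g (m + i)) i = c2 i" by (simp add: w c_def)
      qed
      ultimately show "?f g \<in> ?R" by simp
    qed
    show "?k \<in> ?R \<rightarrow> ?L"
    proof
      fix x assume "x \<in> ?R"
      then obtain a g h where x: "x = (a, g, h)" and a: "a \<in> par N (\<Sum>i<m. c1 i)"
        and g: "g \<in> gt N (\<lambda>_. 0) a" "wt N g = c1" and h: "h \<in> gt N a l" "wt N h = c2" by auto
      have sa: "shape N a" using a by (simp add: par_def)
      have gm: "g i = a" if "m \<le> i" for i using gt_stationary[OF g(1) sa _ that] c1 g(2) by simp
      have hm: "h i = l" if "N - m \<le> i" for i using gt_stationary[OF h(1) l _ that] c2 h(2) by simp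
      have h0: "h 0 = a" using h by (simp add: gt_def)
      have "interlaced (?k x i) (?k x (Suc i))" for i
      proof -
        consider "i < m" | "i = m" | "m < i" by linarith
        then show ?thesis
        proof cases
          case 1
          then show ?thesis using g by (simp add: x gt_def)
        next
          case 2
          have "interlaced (h 0) (h (Suc 0))" using h(1) unfolding gt_def by blast
          then show ?thesis using 2 gm[of m] h0 by (simp add: x)
        next
          case 3
          have "interlaced (h (i - m)) (h (Suc (i - m)))" using h(1) unfolding gt_def by blast
          then show ?thesis using 3 by (simp add: x Suc_diff_le)
        qed
      qed
      moreover have "?k x i = l" if "N \<le> i" for i
        using hm[of "i - m"] gm[of i] h0 hm[of 0] that m by (auto simp: x)
      moreover have "?k x 0 = (\<lambda>_. 0)" using g by (simp add: x gt_def)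
      ultimately have gt: "?k x \<in> gt N (\<lambda>_. 0) l" by (auto simp: gt_def)
      have "wt N (?k x) = c"
      proof
        fix i
        consider "i < m" | "i = m" | "m < i" by linarith
        then show "wt N (?k x) i = c i"
        proof cases
          case 1
          then have "wt N (?k x) i = wt N g i" by (simp add: x wt_def)
          then show ?thesis using 1 g by (simp add: c_def)
        next
          case 2
          then have "wt N (?k x) i = wt N h 0" using gm[of m] h0 by (simp add: x wt_def)
          then show ?thesis using 2 h by (simp add: c_def)
        next
          case 3
          then have "wt N (?k x) i = wt N h (i - m)" by (simp add: x wt_def Suc_diff_le)
          then show ?thesis using 3 h by (simp add: c_def)
        qed
      qed
      with gt show "?k x \<in> ?L" by simp
    qed
    show "?k (?f g) = g" for g by (auto simp: fun_eq_iff min_def)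
    show "?f (?k x) = x" if "x \<in> ?R" for x
    proof -
      obtain a g h where x: "x = (a, g, h)" and a: "a \<in> par N (\<Sum>i<m. c1 i)"
        and g: "g \<in> gt N (\<lambda>_. 0) a" "wt N g = c1" and h: "h \<in> gt N a l" "wt N h = c2"
        using \<open>x \<in> ?R\<close> by auto
      have sa: "shape N a" using a by (simp add: par_def)
      have gm: "g i = a" if "m \<le> i" for i using gt_stationary[OF g(1) sa _ that] c1 g(2) by simp
      have h0: "h 0 = a" using h by (simp add: gt_def)
      have "(\<lambda>i. if m + i \<le> m then g (m + i) else h (m + i - m)) = h"
        using gm[of m] h0 by (auto simp: fun_eq_iff)
      moreover have "(\<lambda>i. if min i m \<le> m then g (min i m) else h (min i m - m)) = g"
        using gm by (auto simp: fun_eq_iff min_def)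
      ultimately show ?thesis using gm[of m] by (simp add: x)
    qed
  qed
  then have "card ?L = card ?R" by (rule bij_betw_same_card)
  also have "\<dots> = (\<Sum>a\<in>par N (\<Sum>i<m. c1 i). card ({g \<in> gt N (\<lambda>_. 0) a. wt N g = c1} \<times> {h \<in> gt N a l. wt N h = c2}))"
    using finite_gt[OF l] finite_gt finite_par by (intro card_SigmaI) (auto simp: par_def)
  finally show ?thesis by (simp add: kostka_def card_cartesian_product c_def)
qed

text \<open>With one letter the pattern passes from \<open>a\<close> to \<open>l\<close> in a single
  step, and interlacing says that \<open>l/a\<close> is a horizontal strip.\<close>

lemma kostka_single:
  assumes l: "shape N l" and N: "0 < N"
  shows "kostka N a l (\<lambda>i. if i = 0 then v else 0) = (if interlaced a l \<and> vsize N l = vsize N a + v then 1 else 0)"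
proof -
  let ?g = "\<lambda>i::nat. if i = 0 then a else l"
  have eq: "g = ?g" if "g \<in> gt N a l" "wt N g = (\<lambda>i. if i = 0 then v else 0)" for g
    using gt_stationary[OF that(1) l, of 1] that by (auto simp: fun_eq_iff gt_def)
  have il: "interlaced l l" using l by (simp add: interlaced_def shape_def antimono_iff_le_Suc)
  have iff: "?g \<in> gt N a l \<longleftrightarrow> interlaced a l"
    using N il by (auto simp: gt_def)
  have w: "wt N ?g = (\<lambda>i. if i = 0 then v else 0) \<longleftrightarrow> vsize N l = vsize N a + v" if "interlaced a l"
    using vsize_mono[of a l N] that by (auto simp: wt_def fun_eq_iff interlaced_iff)
  have "{g \<in> gt N a l. wt N g = (\<lambda>i. if i = 0 then v else 0)}
    = (if interlaced a l \<and> vsize N l = vsize N a + v then {?g} else {})"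
    using eq iff w by auto
  then show ?thesis by (simp add: kostka_def)
qed

text \<open>By column strictness the letters below \<open>i\<close> all lie in the first
  \<open>i\<close> rows.\<close>

lemma kostka_dominance:
  assumes "kostka N (\<lambda>_. 0) l c \<noteq> 0" and l: "shape N l"
  shows "(\<Sum>j<i. c j) \<le> (\<Sum>r<i. l r)"
proof -
  have "{g \<in> gt N (\<lambda>_. 0) l. wt N g = c} \<noteq> {}" using assms(1) unfolding kostka_def by (metis card.empty)
  then obtain g where g: "g \<in> gt N (\<lambda>_. 0) l" and w: "wt N g = c" by auto
  have "(\<Sum>j<i. c j) = vsize N (g i)" using sum_wt[OF g, of i] w by simp
  also have "\<dots> \<le> (\<Sum>r<i. g i r)"
  proof -
    have "g i r = 0" if "\<not> r < i" for r using gt_zero_rows[OF g] that by simp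
    then have "vsize N (g i) = (\<Sum>r\<in>{r\<in>{..<N}. r < i}. g i r)"
      unfolding vsize_def by (intro sum.mono_neutral_right) blast+
    also have "\<dots> \<le> (\<Sum>r<i. g i r)" by (rule sum_mono2) auto
    finally show ?thesis .
  qed
  also have "\<dots> \<le> (\<Sum>r<i. l r)" using gt_bounds(2)[OF g, of i] by (intro sum_mono) (simp add: le_fun_def)
  finally show ?thesis .
qed

lemma kostka_self:
  assumes l: "shape N l"
  shows "kostka N (\<lambda>_. 0) l l = 1"
proof -
  have "g = superstandard l" if g: "g \<in> gt N (\<lambda>_. 0) l" and w: "wt N g = l" for g
  proof
    fix i
    have "g i \<le> superstandard l i"
      using gt_bounds(2)[OF g, of i] gt_zero_rows[OF g, of i] by (auto simp: le_fun_def superstandard_def)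
    moreover have "vsize N (g i) = vsize N (superstandard l i)"
      using sum_wt[OF g, of i] sum_wt[OF superstandard_gt[OF l], of i] w wt_superstandard[OF l] by simp
    ultimately show "g i = superstandard l i"
      by (rule eq_if_vsize_eq) (use l in \<open>auto simp: superstandard_def shape_def\<close>)
  qed
  then have "{g \<in> gt N (\<lambda>_. 0) l. wt N g = l} = {superstandard l}"
    using superstandard_gt[OF l] wt_superstandard[OF l] by blast
  then show ?thesis by (simp add: kostka_def)
qed

text \<open>A number that strictly increases along the dominance order, so that inductions over
  dominance become inductions over \<open>nat\<close>.\<close>

definition rank :: "nat \<Rightarrow> (nat \<Rightarrow> nat) \<Rightarrow> nat" where
  "rank N a = (\<Sum>i\<le>N. \<Sum>r<i. a r)"

lemma rank_less:
  assumes dom: "\<And>i. (\<Sum>r<i. b r) \<le> (\<Sum>r<i. a r)" and "shape N a" "shape N b" "a \<noteq> b"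
  shows "rank N b < rank N a"
proof -
  have "\<exists>i\<le>N. (\<Sum>r<i. b r) < (\<Sum>r<i. a r)"
  proof (rule ccontr)
    assume "\<not> ?thesis"
    then have eq: "(\<Sum>r<i. b r) = (\<Sum>r<i. a r)" if "i \<le> N" for i
      using dom[of i] that by (meson le_neq_implies_less)
    have "a r = b r" for r
    proof (cases "r < N")
      case True
      then show ?thesis using eq[of r] eq[of "Suc r"] by simp
    next
      case False
      then show ?thesis using assms by (simp add: shape_def)
    qed
    then show False using \<open>a \<noteq> b\<close> by auto
  qed
  then show ?thesis unfolding rank_def using dom by (intro sum_strict_mono_ex1) auto
qed


section \<open>Complete homogeneous polynomials and Pieri's rule\<close>

definition vecs :: "nat \<Rightarrow> nat \<Rightarrow> (nat \<Rightarrow> nat) set" where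
  "vecs N m = {v. (\<forall>i\<ge>N. v i = 0) \<and> (\<Sum>i<N. v i) = m}"

definition hom :: "nat \<Rightarrow> nat \<Rightarrow> mpoly" where
  "hom N m = (\<Sum>v\<in>vecs N m. xpow N v)"

definition row_shape :: "nat \<Rightarrow> nat \<Rightarrow> nat" where
  "row_shape m r = (if r = 0 then m else 0)"

text \<open>The one-row tableau of content \<open>v\<close>.\<close>

definition row_pattern :: "(nat \<Rightarrow> nat) \<Rightarrow> nat \<Rightarrow> nat \<Rightarrow> nat" where
  "row_pattern v i = row_shape (\<Sum>k<i. v k)"

lemma finite_vecs: "finite (vecs N m)"
proof -
  have "vecs N m \<subseteq> (\<lambda>f i. if i < N then f i else 0) ` ({..<N} \<rightarrow>\<^sub>E {..m})"
  proof
    fix v assume v: "v \<in> vecs N m"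
    have "v i \<le> m" if "i < N" for i
      using member_le_sum[of i "{..<N}" v] that v by (simp add: vecs_def)
    then show "v \<in> (\<lambda>f i. if i < N then f i else 0) ` ({..<N} \<rightarrow>\<^sub>E {..m})"
      using v by (intro image_eqI[of _ _ "restrict v {..<N}"]) (auto simp: vecs_def)
  qed
  then show ?thesis by (rule finite_subset) (auto intro!: finite_PiE)
qed

lemma vsize_row_shape: "0 < N \<Longrightarrow> vsize N (row_shape m) = m"
  by (simp add: vsize_def row_shape_def)

lemma shape_row_shape: "0 < N \<Longrightarrow> shape N (row_shape m)"
  by (simp add: shape_def row_shape_def antimono_def)

lemma row_pattern_bij:
  assumes N: "0 < N"
  shows "v \<in> vecs N m \<Longrightarrow> row_pattern v \<in> gt N (\<lambda>_. 0) (row_shape m)"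
    and "v \<in> vecs N m \<Longrightarrow> wt N (row_pattern v) = v"
    and "g \<in> gt N (\<lambda>_. 0) (row_shape m) \<Longrightarrow> wt N g \<in> vecs N m"
    and "g \<in> gt N (\<lambda>_. 0) (row_shape m) \<Longrightarrow> row_pattern (wt N g) = g"
proof -
  assume v: "v \<in> vecs N m"
  have "(\<Sum>k<i. v k) = m" if "N \<le> i" for i
  proof -
    have "(\<Sum>k<i. v k) = (\<Sum>k<N. v k)"
      by (rule sum.mono_neutral_right) (use that v in \<open>auto simp: vecs_def\<close>)
    then show ?thesis using v by (simp add: vecs_def)
  qed
  then show "row_pattern v \<in> gt N (\<lambda>_. 0) (row_shape m)"
    by (auto simp: gt_def row_pattern_def interlaced_def row_shape_def)
  show "wt N (row_pattern v) = v"
    by (simp add: fun_eq_iff wt_def row_pattern_def vsize_row_shape[OF N])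
next
  assume g: "g \<in> gt N (\<lambda>_. 0) (row_shape m)"
  have "g N = row_shape m" using g by (simp add: gt_def)
  then show "wt N g \<in> vecs N m"
    using sum_wt[OF g, of N] wt_outside[OF g] vsize_row_shape[OF N] by (simp add: vecs_def)
  have z: "g i r = 0" if "0 < r" for i r using gt_le[OF g, of i r] that by (simp add: row_shape_def)
  have "vsize N (g i) = g i 0" for i
  proof -
    have "vsize N (g i) = (\<Sum>r\<in>{0}. g i r)"
      unfolding vsize_def by (rule sum.mono_neutral_right) (use z N in auto)
    then show ?thesis by simp
  qed
  then show "row_pattern (wt N g) = g"
    using sum_wt[OF g] z by (auto simp: fun_eq_iff row_pattern_def row_shape_def)
qed

lemma hom_eq_schur: "0 < N \<Longrightarrow> hom N m = schur_poly N (\<lambda>_. 0) (row_shape m)"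
  unfolding hom_def schur_poly_def
  by (rule sum.reindex_bij_witness[of _ "wt N" row_pattern]) (auto simp: row_pattern_bij)

text \<open>For one row the condition with \<open>r = 0\<close> reads
  \<open>b (Suc i) + v (Suc i) \<le> b i\<close>, and the conditions with larger \<open>r\<close>
  are weaker. This says that adding \<open>v\<close> to \<open>b\<close> adds a horizontal
  strip.\<close>

lemma lattice_row_iff:
  assumes N: "0 < N" and v: "v \<in> vecs N m" and b: "shape N b"
  shows "lattice N b (row_pattern v) \<longleftrightarrow> interlaced b (\<lambda>k. b k + v k)"
proof -
  have rs: "row_sum (row_pattern v) i r = (if r = 0 then 0 else \<Sum>k<i. v k)" for i r
    by (induction r) (auto simp: row_sum_def row_pattern_def row_shape_def)
  have anti: "antimono b" using b by (simp add: shape_def)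
  have "lattice N b (row_pattern v) \<longleftrightarrow> (\<forall>i. Suc i < N \<longrightarrow> b (Suc i) + v (Suc i) \<le> b i)"
    unfolding lattice_iff_rows[OF row_pattern_bij(1)[OF N v] shape_row_shape[OF N] anti] rs
  proof (intro iffI allI impI)
    fix i assume *: "\<forall>i r. Suc i < N \<longrightarrow>
           b (Suc i) + (if Suc r = 0 then 0 else sum v {..<Suc (Suc i)}) + (if r = 0 then 0 else sum v {..<i})
           \<le> b i + (if r = 0 then 0 else sum v {..<Suc i}) + (if Suc r = 0 then 0 else sum v {..<Suc i})"
      and i: "Suc i < N"
    show "b (Suc i) + v (Suc i) \<le> b i" using *[rule_format, OF i, of 0] by simp
  next
    fix i r assume *: "\<forall>i. Suc i < N \<longrightarrow> b (Suc i) + v (Suc i) \<le> b i" and i: "Suc i < N"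
    show "b (Suc i) + (if Suc r = 0 then 0 else sum v {..<Suc (Suc i)}) + (if r = 0 then 0 else sum v {..<i})
           \<le> b i + (if r = 0 then 0 else sum v {..<Suc i}) + (if Suc r = 0 then 0 else sum v {..<Suc i})"
      using *[rule_format, OF i] by simp
  qed
  also have "\<dots> \<longleftrightarrow> interlaced b (\<lambda>k. b k + v k)"
  proof -
    have "b (Suc i) + v (Suc i) \<le> b i" if "\<not> Suc i < N" for i
      using that v b by (simp add: vecs_def shape_def)
    then show ?thesis unfolding interlaced_def by auto
  qed
  finally show ?thesis .
qed

text \<open>The Littlewood-Richardson rule for a one-row shape, where a pattern is the vector of
  differences \<open>B - b\<close>.\<close>

lemma pieri:
  assumes N: "0 < N" and b: "shape N b"
  shows "schur_poly N (\<lambda>_. 0) b * hom N m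
    = (\<Sum>B | B \<in> par N (vsize N b + m) \<and> interlaced b B. schur_poly N (\<lambda>_. 0) B)"
  unfolding hom_eq_schur[OF N] littlewood_richardson[OF shape_row_shape[OF N] b]
proof (rule sum.reindex_bij_witness[of _ "\<lambda>B. row_pattern (\<lambda>k. B k - b k)" "\<lambda>g k. b k + wt N g k"])
  fix g assume "g \<in> {g \<in> gt N (\<lambda>_. 0) (row_shape m). lattice N b g}"
  then have g: "g \<in> gt N (\<lambda>_. 0) (row_shape m)" and lat: "lattice N b g" by auto
  note rb = row_pattern_bij[OF N]
  show "row_pattern (\<lambda>k. b k + wt N g k - b k) = g" using rb(4)[OF g] by simp
  have "interlaced b (\<lambda>k. b k + wt N g k)"
    using lattice_row_iff[OF N rb(3)[OF g] b] lat rb(4)[OF g] by simp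
  moreover have "vsize N (\<lambda>k. b k + wt N g k) = vsize N b + m"
    using rb(3)[OF g] by (simp add: vsize_def sum.distrib vecs_def)
  ultimately show "(\<lambda>k. b k + wt N g k) \<in> {B \<in> par N (vsize N b + m). interlaced b B}"
    using shape_add_wt[OF g b lat] by (simp add: par_def)
next
  fix B assume "B \<in> {B \<in> par N (vsize N b + m). interlaced b B}"
  then have B: "shape N B" "vsize N B = vsize N b + m" "interlaced b B" by (auto simp: par_def)
  have le: "b k \<le> B k" for k using B(3) by (simp add: interlaced_def)
  have "(\<Sum>k<N. B k - b k) = m"
    using B(2) le by (simp add: vsize_def sum_subtractf_nat)
  then have v: "(\<lambda>k. B k - b k) \<in> vecs N m" using B(1) by (simp add: vecs_def shape_def)
  note rb = row_pattern_bij[OF N]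
  show eq: "(\<lambda>k. b k + wt N (row_pattern (\<lambda>k. B k - b k)) k) = B" using rb(2)[OF v] le by simp
  show "row_pattern (\<lambda>k. B k - b k) \<in> {g \<in> gt N (\<lambda>_. 0) (row_shape m). lattice N b g}"
    using rb(1)[OF v] lattice_row_iff[OF N v b] B(3) le by simp
qed auto

lemma kostka_last:
  assumes l: "shape N l" and m: "m < N"
  shows "kostka N (\<lambda>_. 0) l (\<lambda>i. if i < Suc m then d i else 0)
    = (\<Sum>a | a \<in> par N (\<Sum>i<m. d i) \<and> interlaced a l \<and> vsize N l = vsize N a + d m.
        kostka N (\<lambda>_. 0) a (\<lambda>i. if i < m then d i else 0))"
proof -
  have eq: "(\<lambda>i. if i < Suc m then d i else 0)
    = (\<lambda>i. if i < m then (\<lambda>i. if i < m then d i else 0) i else (\<lambda>i. if i = 0 then d m else 0) (i - m))"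
    by (auto simp: fun_eq_iff)
  show ?thesis unfolding eq
    by (subst kostka_split[OF l]) (use m in \<open>auto simp: kostka_single[OF l] finite_par
      sum.inter_filter[symmetric] if_distrib cong: if_cong intro!: sum.cong\<close>)
qed

text \<open>Iterated Pieri: each further factor adds a horizontal strip filled with the next letter,
  which is the recursion of Kostka numbers in their last letter.\<close>

lemma hom_prod:
  assumes N: "0 < N"
  shows "m \<le> N \<Longrightarrow> (\<Prod>j<m. hom N (d j)) = (\<Sum>l\<in>par N (\<Sum>j<m. d j).
    of_nat (kostka N (\<lambda>_. 0) l (\<lambda>i. if i < m then d i else 0)) * schur_poly N (\<lambda>_. 0) l)"
proof (induction m)
  case 0
  have z: "shape N (\<lambda>_. 0)" by (simp add: shape_def antimono_def)
  have p: "par N 0 = {\<lambda>_. 0}"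
  proof -
    have "a = (\<lambda>_. 0)" if "a \<in> par N 0" for a
    proof
      fix r show "a r = 0" using that by (cases "r < N") (auto simp: par_def shape_def vsize_def)
    qed
    then show ?thesis using z by (auto simp: par_def)
  qed
  have "gt N (\<lambda>_. 0) (\<lambda>_. 0) = {\<lambda>_ _. 0}"
  proof -
    have "g = (\<lambda>_ _. 0)" if "g \<in> gt N (\<lambda>_. 0) (\<lambda>_. 0)" for g
      using gt_le[OF that] by (simp add: fun_eq_iff)
    then show ?thesis by (auto simp: gt_def interlaced_def)
  qed
  moreover have "wt N (\<lambda>_ _. 0) = (\<lambda>_. 0)" by (simp add: wt_def fun_eq_iff)
  moreover have "xpow N (\<lambda>_. 0) = 1" using xpow_prod[of "{}" N] by simp
  ultimately show ?case using kostka_self[OF z] by (simp add: p schur_poly_def)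
next
  case (Suc m)
  let ?K = "\<lambda>m l. kostka N (\<lambda>_. 0) l (\<lambda>i. if i < m then d i else 0)"
  let ?s = "\<Sum>j<m. d j"
  have "(\<Prod>j<Suc m. hom N (d j)) = (\<Sum>l\<in>par N ?s. of_nat (?K m l) * (schur_poly N (\<lambda>_. 0) l * hom N (d m)))"
    using Suc by (simp add: sum_distrib_right mult.assoc)
  also have "\<dots> = (\<Sum>l\<in>par N ?s. \<Sum>B | B \<in> par N (?s + d m) \<and> interlaced l B.
      of_nat (?K m l) * schur_poly N (\<lambda>_. 0) B)"
  proof (rule sum.cong[OF refl])
    fix l assume "l \<in> par N ?s"
    then have "shape N l" "vsize N l = ?s" by (auto simp: par_def)
    then show "of_nat (?K m l) * (schur_poly N (\<lambda>_. 0) l * hom N (d m))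
      = (\<Sum>B | B \<in> par N (?s + d m) \<and> interlaced l B. of_nat (?K m l) * schur_poly N (\<lambda>_. 0) B)"
      by (simp add: pieri[OF N] sum_distrib_left)
  qed
  also have "\<dots> = (\<Sum>B\<in>par N (?s + d m). \<Sum>l | l \<in> par N ?s \<and> interlaced l B.
      of_nat (?K m l) * schur_poly N (\<lambda>_. 0) B)"
    by (rule sum.swap_restrict) (auto simp: finite_par)
  also have "\<dots> = (\<Sum>B\<in>par N (?s + d m). of_nat (?K (Suc m) B) * schur_poly N (\<lambda>_. 0) B)"
  proof (rule sum.cong[OF refl])
    fix B assume B: "B \<in> par N (?s + d m)"
    then have "{l. l \<in> par N ?s \<and> interlaced l B} = {a. a \<in> par N ?s \<and> interlaced a B \<and> vsize N B = vsize N a + d m}"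
      by (auto simp: par_def)
    then have "?K (Suc m) B = (\<Sum>l | l \<in> par N ?s \<and> interlaced l B. ?K m l)"
      using kostka_last[of N B m d] B Suc.prems by (simp add: par_def)
    then show "(\<Sum>l | l \<in> par N ?s \<and> interlaced l B. of_nat (?K m l) * schur_poly N (\<lambda>_. 0) B)
      = of_nat (?K (Suc m) B) * schur_poly N (\<lambda>_. 0) B"
      by (simp only: sum_distrib_right of_nat_sum)
  qed
  finally show ?case by simp
qed

section \<open>Integer matrices with given margins and the Cauchy identity\<close>

definition mats :: "nat \<Rightarrow> (nat \<Rightarrow> nat) \<Rightarrow> (nat \<Rightarrow> nat) \<Rightarrow> (nat \<times> nat \<Rightarrow> nat) set" where
  "mats N c d = {m. (\<forall>i j. N \<le> i \<or> N \<le> j \<longrightarrow> m (i, j) = 0) \<and>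
    (\<forall>i<N. (\<Sum>j<N. m (i, j)) = c i) \<and> (\<forall>j<N. (\<Sum>i<N. m (i, j)) = d j)}"

text \<open>The monomial chosen from the factor \<open>hom N (d j)\<close> is column
  \<open>j\<close> of the matrix; the exponent of the product is the vector of row sums.\<close>

lemma lookup_hom_prod:
  "Poly_Mapping.lookup (\<Prod>j<N. hom N (d j)) (expo N c) = int (card (mats N c d))"
proof -
  let ?P = "PiE {..<N} (\<lambda>j. vecs N (d j))"
  have fin: "finite ?P" by (intro finite_PiE) (auto simp: finite_vecs)
  have "(\<Prod>j<N. hom N (d j)) = (\<Sum>f\<in>?P. xpow N (\<lambda>i. \<Sum>j<N. f j i))"
    unfolding hom_def by (subst prod_sum_PiE) (auto simp: finite_vecs xpow_prod)
  then have "Poly_Mapping.lookup (\<Prod>j<N. hom N (d j)) (expo N c)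
    = (\<Sum>f\<in>?P. if \<forall>i<N. (\<Sum>j<N. f j i) = c i then 1 else 0)"
    by (simp add: lookup_sum lookup_xpow)
  also have "\<dots> = int (card {f \<in> ?P. \<forall>i<N. (\<Sum>j<N. f j i) = c i})"
    using fin by (simp add: sum.inter_filter[symmetric])
  also have "card {f \<in> ?P. \<forall>i<N. (\<Sum>j<N. f j i) = c i} = card (mats N c d)"
  proof (rule bij_betw_same_card[of "\<lambda>f (i, j). if j < N then f j i else 0"],
      rule bij_betwI[of _ _ _ "\<lambda>m. restrict (\<lambda>j i. m (i, j)) {..<N}"])
    show "(\<lambda>f (i, j). if j < N then f j i else 0) \<in> {f \<in> ?P. \<forall>i<N. (\<Sum>j<N. f j i) = c i} \<rightarrow> mats N c d"
      by (auto simp: mats_def PiE_def Pi_def vecs_def)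
    show "(\<lambda>m. restrict (\<lambda>j i. m (i, j)) {..<N}) \<in> mats N c d \<rightarrow> {f \<in> ?P. \<forall>i<N. (\<Sum>j<N. f j i) = c i}"
      by (auto simp: mats_def vecs_def)
    show "restrict (\<lambda>j i. (case (i, j) of (i, j) \<Rightarrow> if j < N then f j i else 0)) {..<N} = f"
      if "f \<in> {f \<in> ?P. \<forall>i<N. (\<Sum>j<N. f j i) = c i}" for f
      using that by (auto simp: fun_eq_iff PiE_def extensional_def)
    show "(\<lambda>(i, j). if j < N then restrict (\<lambda>j i. m (i, j)) {..<N} j i else 0) = m" if "m \<in> mats N c d" for m
      using that by (auto simp: fun_eq_iff mats_def)
  qed
  finally show ?thesis .
qed

text \<open>Two computations of the coefficient of the monomial \<open>c\<close> in the product of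
  the \<open>hom N (d j)\<close>: from monomials and from the Schur expansion.\<close>

theorem cauchy:
  assumes N: "0 < N" and c: "\<And>i. N \<le> i \<Longrightarrow> c i = 0" and d: "\<And>i. N \<le> i \<Longrightarrow> d i = 0"
  shows "card (mats N c d) = (\<Sum>l\<in>par N (\<Sum>j<N. d j). kostka N (\<lambda>_. 0) l c * kostka N (\<lambda>_. 0) l d)"
proof -
  have dd: "(\<lambda>i. if i < N then d i else 0) = d" using d by (auto simp: fun_eq_iff)
  have lk: "Poly_Mapping.lookup (of_nat k * p) x = int k * Poly_Mapping.lookup p x" for k and p :: mpoly and x
    by (induction k) (simp_all add: lookup_add ring_distribs)
  have "int (card (mats N c d)) = (\<Sum>l\<in>par N (\<Sum>j<N. d j). int (kostka N (\<lambda>_. 0) l d) * int (kostka N (\<lambda>_. 0) l c))"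
    unfolding lookup_hom_prod[symmetric] hom_prod[OF N order_refl] dd lookup_sum lk
    by (rule sum.cong) (auto simp: par_def lookup_schur_poly c)
  then show ?thesis by (simp add: mult.commute flip: of_nat_mult of_nat_sum)
qed

section \<open>Permutation characters on words\<close>

text \<open>The type of letters is arbitrary because pairs of letters arise when two permutation
  characters are multiplied. Words are extensional so that they can be counted.\<close>

definition words :: "'a set \<Rightarrow> ('i \<Rightarrow> nat) \<Rightarrow> ('a \<Rightarrow> 'i) set" where
  "words S m = {f \<in> extensional S. \<forall>i. card {x \<in> S. f x = i} = m i}"

text \<open>The permutation character on the words with content \<open>m\<close>; for a partition \<open>m\<close> these words are
  the tabloids of shape \<open>m\<close>.\<close>

definition xi :: "'a set \<Rightarrow> ('i \<Rightarrow> nat) \<Rightarrow> ('a \<Rightarrow> 'a) \<Rightarrow> nat" where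
  "xi S m \<sigma> = card {f \<in> words S m. f \<circ> \<sigma> = f}"

lemma permutes_group:
  assumes "g permutes S"
  shows "inv g \<circ> g = id" "g \<circ> inv g = id" "inv (inv g) = g" "inv g permutes S"
    "inv g \<circ> (g \<circ> h) = h" "g \<circ> (inv g \<circ> h) = h"
  using permutes_inv_o[OF assms] permutes_inv_inv[OF assms] permutes_inv[OF assms]
  by (auto simp: o_assoc)

lemma inv_comp_permutes: "g permutes S \<Longrightarrow> h permutes S \<Longrightarrow> inv (g \<circ> h) = inv h \<circ> inv g"
  by (meson o_inv_distrib permutes_bij)

lemma words_content: "f \<in> words S m \<Longrightarrow> card {x \<in> S. f x = i} = m i"
  by (auto simp: words_def)

lemma words_range:
  assumes "finite S" "f \<in> words S m" "x \<in> S"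
  shows "m (f x) \<noteq> 0"
proof -
  have "x \<in> {y \<in> S. f y = f x}" "finite {y \<in> S. f y = f x}" using assms by simp_all
  then have "card {y \<in> S. f y = f x} \<noteq> 0" by (metis card_0_eq empty_iff)
  then show ?thesis using words_content[OF assms(2)] by simp
qed

lemma finite_words:
  assumes "finite S" "finite {i. m i \<noteq> 0}"
  shows "finite (words S m)"
proof -
  have "words S m \<subseteq> S \<rightarrow>\<^sub>E {i. m i \<noteq> 0}"
  proof
    fix f assume f: "f \<in> words S m"
    then show "f \<in> S \<rightarrow>\<^sub>E {i. m i \<noteq> 0}"
      using words_range[OF assms(1) f] by (simp add: words_def PiE_def Pi_def)
  qed
  then show ?thesis using assms by (meson finite_PiE finite_subset)
qed

lemma card_comp_permutes:
  assumes "\<sigma> permutes S"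
  shows "card {x \<in> S. P (\<sigma> x)} = card {x \<in> S. P x}"
proof (rule bij_betw_same_card[of \<sigma>], rule bij_betwI[of _ _ _ "inv \<sigma>"])
  show "\<sigma> \<in> {x \<in> S. P (\<sigma> x)} \<rightarrow> {x \<in> S. P x}" using permutes_in_image[OF assms] by auto
  show "inv \<sigma> \<in> {x \<in> S. P x} \<rightarrow> {x \<in> S. P (\<sigma> x)}"
    using permutes_in_image[OF permutes_inv[OF assms]] permutes_inverses[OF assms] by auto
qed (use permutes_inverses[OF assms] in auto)

lemma words_comp:
  assumes f: "f \<in> words S m" and g: "g permutes S"
  shows "f \<circ> g \<in> words S m"
proof -
  have "f \<circ> g \<in> extensional S"
    using f permutes_not_in[OF g] by (auto simp: words_def extensional_def)
  then show ?thesis using card_comp_permutes[OF g, of "\<lambda>x. f x = _"] f by (simp add: words_def)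
qed

lemma equal_fibres_permutes:
  assumes "finite S" "\<And>i. card {x \<in> S. f x = i} = card {x \<in> S. f' x = i}"
  obtains p where "p permutes S" "\<And>x. x \<in> S \<Longrightarrow> f x = f' (p x)"
proof -
  have "image_mset f (mset_set S) = image_mset f' (mset_set S)"
    by (rule multiset_eqI) (simp add: count_image_mset_eq_card_vimage[OF assms(1)] assms(2))
  then show ?thesis using image_mset_eq_implies_permutes[OF assms(1)] that by metis
qed

lemma words_transitive:
  assumes S: "finite S" and f: "f \<in> words S m" "f' \<in> words S m"
  obtains p where "p permutes S" "f = f' \<circ> p"
proof -
  obtain p where p: "p permutes S" "\<And>x. x \<in> S \<Longrightarrow> f x = f' (p x)"
    using equal_fibres_permutes[OF S, of f f'] words_content[OF f(1)] words_content[OF f(2)] by auto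
  have "f x = f' (p x)" if "x \<notin> S" for x
    using that permutes_not_in[OF p(1) that] f by (simp add: words_def extensional_def)
  then have "f = f' \<circ> p" using p(2) by (auto simp: fun_eq_iff)
  with p(1) show thesis by (rule that)
qed

lemma words_nonempty:
  assumes S: "finite S" and fin: "finite {i. m i \<noteq> 0}" and n: "(\<Sum>i | m i \<noteq> 0. m i) = card S"
  shows "words S m \<noteq> {}"
proof -
  let ?S = "SIGMA i:{i. m i \<noteq> 0}. {..<m i}"
  have "card ?S = card S" using fin n by (simp add: card_SigmaI)
  moreover have "finite ?S" using fin by auto
  ultimately obtain h where h: "bij_betw h S ?S"
    using finite_same_card_bij[OF S, of ?S] by auto
  let ?f = "restrict (fst \<circ> h) S"
  have "card {x \<in> S. ?f x = i} = m i" for i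
  proof -
    have "h ` {x \<in> S. fst (h x) = i} = {y \<in> h ` S. fst y = i}" by auto
    moreover have "inj_on h {x \<in> S. fst (h x) = i}"
      using h by (auto simp: bij_betw_def intro: inj_on_subset)
    ultimately have "bij_betw h {x \<in> S. fst (h x) = i} {y \<in> ?S. fst y = i}"
      using bij_betw_imp_surj_on[OF h] by (simp only: bij_betw_def simp_thms)
    then have "card {x \<in> S. fst (h x) = i} = card {y \<in> ?S. fst y = i}" by (rule bij_betw_same_card)
    also have "{y \<in> ?S. fst y = i} = {i} \<times> {..<m i}" by auto
    finally have "card {x \<in> S. fst (h x) = i} = m i" by (simp add: card_cartesian_product)
    moreover have "{x \<in> S. ?f x = i} = {x \<in> S. fst (h x) = i}" by auto
    ultimately show ?thesis by simp
  qed
  then have "?f \<in> words S m" by (simp add: words_def)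
  then show ?thesis by blast
qed

text \<open>Burnside's count for a transitive action: the stabilizer of \<open>f\<close> is a
  translate of the set of \<open>g\<close> with \<open>f0 \<circ> g = f\<close>, and these sets
  partition the group.\<close>

lemma sum_xi:
  assumes S: "finite S" and fin: "finite {i. m i \<noteq> 0}" and n: "(\<Sum>i | m i \<noteq> 0. m i) = card S"
  shows "(\<Sum>\<sigma> | \<sigma> permutes S. xi S m \<sigma>) = fact (card S)"
proof -
  let ?G = "{\<sigma>. \<sigma> permutes S}"
  note fw = finite_words[OF S fin]
  note fp = finite_permutations[OF S]
  obtain f0 where f0: "f0 \<in> words S m" using words_nonempty[OF assms] by blast
  have "(\<Sum>\<sigma>\<in>?G. xi S m \<sigma>) = (\<Sum>\<sigma>\<in>?G. \<Sum>f\<in>words S m. if f \<circ> \<sigma> = f then 1 else 0)"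
    using fw by (simp add: xi_def sum.inter_filter[symmetric])
  also have "\<dots> = (\<Sum>f\<in>words S m. \<Sum>\<sigma>\<in>?G. if f \<circ> \<sigma> = f then 1 else 0)" by (rule sum.swap)
  also have "\<dots> = (\<Sum>f\<in>words S m. card {\<sigma> \<in> ?G. f \<circ> \<sigma> = f})"
    using fp by (simp add: sum.inter_filter[symmetric])
  also have "\<dots> = (\<Sum>f\<in>words S m. card {g \<in> ?G. f0 \<circ> g = f})"
  proof (rule sum.cong[OF refl])
    fix f assume "f \<in> words S m"
    then obtain p where p: "p permutes S" "f = f0 \<circ> p" using words_transitive[OF S _ f0] by blast
    show "card {\<sigma> \<in> ?G. f \<circ> \<sigma> = f} = card {g \<in> ?G. f0 \<circ> g = f}"
      by (rule bij_betw_same_card[of "\<lambda>\<sigma>. p \<circ> \<sigma>"], rule bij_betwI[of _ _ _ "\<lambda>g. inv p \<circ> g"])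
        (auto simp: comp_assoc permutes_group[OF p(1)] p intro!: permutes_compose)
  qed
  also have "\<dots> = (\<Sum>f\<in>words S m. \<Sum>g\<in>{g \<in> ?G. f0 \<circ> g = f}. 1)" by simp
  also have "\<dots> = (\<Sum>g\<in>?G. 1)"
    by (rule sum.group) (use fp fw words_comp[OF f0] in auto)
  finally show ?thesis using card_permutations[OF refl S] by simp
qed

lemma xi_conj:
  assumes g: "g permutes S"
  shows "xi S m (g \<circ> \<sigma> \<circ> inv g) = xi S m \<sigma>"
  unfolding xi_def
proof (rule bij_betw_same_card[of "\<lambda>f. f \<circ> g"], rule bij_betwI[of _ _ _ "\<lambda>f. f \<circ> inv g"])
  note gr = permutes_group[OF g]
  show "(\<lambda>f. f \<circ> g) \<in> {f \<in> words S m. f \<circ> (g \<circ> \<sigma> \<circ> inv g) = f} \<rightarrow> {f \<in> words S m. f \<circ> \<sigma> = f}"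
  proof
    fix f assume f: "f \<in> {f \<in> words S m. f \<circ> (g \<circ> \<sigma> \<circ> inv g) = f}"
    then have "f \<circ> g = f \<circ> (g \<circ> \<sigma> \<circ> inv g) \<circ> g" by simp
    also have "\<dots> = f \<circ> g \<circ> \<sigma>" by (simp add: comp_assoc gr)
    finally show "f \<circ> g \<in> {f \<in> words S m. f \<circ> \<sigma> = f}" using f words_comp[OF _ g] by auto
  qed
  show "(\<lambda>f. f \<circ> inv g) \<in> {f \<in> words S m. f \<circ> \<sigma> = f} \<rightarrow> {f \<in> words S m. f \<circ> (g \<circ> \<sigma> \<circ> inv g) = f}"
  proof
    fix f assume f: "f \<in> {f \<in> words S m. f \<circ> \<sigma> = f}"
    have "f \<circ> inv g \<circ> (g \<circ> \<sigma> \<circ> inv g) = f \<circ> \<sigma> \<circ> inv g" by (simp add: comp_assoc gr)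
    then show "f \<circ> inv g \<in> {f \<in> words S m. f \<circ> (g \<circ> \<sigma> \<circ> inv g) = f}"
      using f words_comp[OF _ gr(4)] by auto
  qed
qed (auto simp: comp_assoc permutes_group[OF g])

lemma words_support_nat:
  fixes m :: "nat \<Rightarrow> nat"
  assumes "\<And>i. N \<le> i \<Longrightarrow> m i = 0"
  shows "finite {i. m i \<noteq> 0}"
proof (rule finite_subset)
  show "{i. m i \<noteq> 0} \<subseteq> {..<N}"
  proof
    fix i assume "i \<in> {i. m i \<noteq> 0}"
    then show "i \<in> {..<N}" using assms[of i] by (cases "i < N") auto
  qed
qed simp

text \<open>Renaming letters does not affect fixed points. This turns words in pairs of letters into
  words in numbers, to which Young's rule applies.\<close>

lemma xi_relabel:
  assumes h: "inj_on h A" and mA: "\<And>i. i \<notin> A \<Longrightarrow> m i = 0"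
    and m: "\<And>i. i \<in> A \<Longrightarrow> m' (h i) = m i" and m0: "\<And>j. j \<notin> h ` A \<Longrightarrow> m' j = 0"
    and S: "finite S" and s: "\<sigma> permutes S"
  shows "xi S m' \<sigma> = xi S m \<sigma>"
  unfolding xi_def
proof (rule bij_betw_same_card[symmetric, of "\<lambda>f. restrict (h \<circ> f) S"],
    rule bij_betwI[of _ _ _ "\<lambda>f. restrict (inv_into A h \<circ> f) S"])
  have si: "\<sigma> x \<in> S \<longleftrightarrow> x \<in> S" for x using permutes_in_image[OF s] .
  have ih: "inv_into A h (h i) = i" if "i \<in> A" for i using h that by simp
  have rngA: "f x \<in> A" if "f \<in> words S m" "x \<in> S" for f x
    by (rule ccontr) (use words_range[OF S that] mA[of "f x"] in simp)
  have rng: "f x \<in> h ` A" if "f \<in> words S m'" "x \<in> S" for f x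
    by (rule ccontr) (use words_range[OF S that] m0[of "f x"] in simp)
  show "(\<lambda>f. restrict (h \<circ> f) S) \<in> {f \<in> words S m. f \<circ> \<sigma> = f} \<rightarrow> {f \<in> words S m'. f \<circ> \<sigma> = f}"
  proof
    fix f assume "f \<in> {f \<in> words S m. f \<circ> \<sigma> = f}"
    then have f: "f \<in> words S m" "f \<circ> \<sigma> = f" by auto
    have fx: "f (\<sigma> x) = f x" for x using f(2) by (metis comp_apply)
    have "card {x \<in> S. restrict (h \<circ> f) S x = j} = m' j" for j
    proof (cases "j \<in> h ` A")
      case True
      then obtain i where i: "j = h i" "i \<in> A" by auto
      have "h (f x) = h i \<longleftrightarrow> f x = i" if "x \<in> S" for x
        using inj_on_eq_iff[OF h rngA[OF f(1) that] i(2)] .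
      then have "{x \<in> S. restrict (h \<circ> f) S x = j} = {x \<in> S. f x = i}" using i(1) by auto
      then show ?thesis using words_content[OF f(1), of i] m[OF i(2)] i(1) by simp
    next
      case False
      then have "{x \<in> S. restrict (h \<circ> f) S x = j} = {}" using rngA[OF f(1)] by auto
      then show ?thesis using m0[OF False] by (metis card.empty)
    qed
    moreover have "restrict (h \<circ> f) S \<circ> \<sigma> = restrict (h \<circ> f) S"
      using si fx by (auto simp: fun_eq_iff permutes_not_in[OF s])
    ultimately show "restrict (h \<circ> f) S \<in> {f \<in> words S m'. f \<circ> \<sigma> = f}" by (simp add: words_def)
  qed
  show "(\<lambda>f. restrict (inv_into A h \<circ> f) S) \<in> {f \<in> words S m'. f \<circ> \<sigma> = f} \<rightarrow> {f \<in> words S m. f \<circ> \<sigma> = f}"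
  proof
    fix f assume "f \<in> {f \<in> words S m'. f \<circ> \<sigma> = f}"
    then have f: "f \<in> words S m'" "f \<circ> \<sigma> = f" by auto
    have fx: "f (\<sigma> x) = f x" for x using f(2) by (metis comp_apply)
    have "card {x \<in> S. restrict (inv_into A h \<circ> f) S x = i} = m i" for i
    proof (cases "i \<in> A")
      case True
      have "inv_into A h (f x) = i \<longleftrightarrow> f x = h i" if "x \<in> S" for x
        using rng[OF f(1) that] ih True by (metis imageE)
      then have "{x \<in> S. restrict (inv_into A h \<circ> f) S x = i} = {x \<in> S. f x = h i}" by auto
      then show ?thesis using words_content[OF f(1), of "h i"] m[OF True] by simp
    next
      case False
      have "inv_into A h (f x) \<noteq> i" if "x \<in> S" for x
        using inv_into_into[OF rng[OF f(1) that]] False by auto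
      then have "{x \<in> S. restrict (inv_into A h \<circ> f) S x = i} = {}" by auto
      then show ?thesis using mA[OF False] by (metis card.empty)
    qed
    moreover have "restrict (inv_into A h \<circ> f) S \<circ> \<sigma> = restrict (inv_into A h \<circ> f) S"
      using si fx by (auto simp: fun_eq_iff permutes_not_in[OF s])
    ultimately show "restrict (inv_into A h \<circ> f) S \<in> {f \<in> words S m. f \<circ> \<sigma> = f}" by (simp add: words_def)
  qed
  show "restrict (inv_into A h \<circ> restrict (h \<circ> f) S) S = f" if f: "f \<in> {f \<in> words S m. f \<circ> \<sigma> = f}" for f
  proof
    fix x
    show "restrict (inv_into A h \<circ> restrict (h \<circ> f) S) S x = f x"
    proof (cases "x \<in> S")
      case True
      then show ?thesis using f ih[OF rngA, of f x] by simp
    next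
      case False
      then show ?thesis using f by (simp add: words_def extensional_def)
    qed
  qed
  show "restrict (h \<circ> restrict (inv_into A h \<circ> f) S) S = f" if f: "f \<in> {f \<in> words S m'. f \<circ> \<sigma> = f}" for f
  proof
    fix x
    show "restrict (h \<circ> restrict (inv_into A h \<circ> f) S) S x = f x"
    proof (cases "x \<in> S")
      case True
      then have "f x \<in> h ` A" using f by (intro rng) auto
      then show ?thesis using True by (simp add: f_inv_into_f)
    next
      case False
      then show ?thesis using f by (simp add: words_def extensional_def)
    qed
  qed
qed

section \<open>Young symmetrizers\<close>

text \<open>For a coordinate function of a numbering this is the row or column group; for a word it
  is the stabilizer under permutation of places.\<close>

definition stab :: "'a set \<Rightarrow> ('a \<Rightarrow> 'i) \<Rightarrow> ('a \<Rightarrow> 'a) set" where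
  "stab S f = {g. g permutes S \<and> f \<circ> g = f}"

lemma stab_permutes: "g \<in> stab S f \<Longrightarrow> g permutes S"
  by (simp add: stab_def)

lemma stab_id: "id \<in> stab S f"
  by (simp add: stab_def permutes_id)

lemma stab_comp: "g \<in> stab S f \<Longrightarrow> h \<in> stab S f \<Longrightarrow> g \<circ> h \<in> stab S f"
  by (simp add: stab_def permutes_compose o_assoc)

lemma stab_inv: "g \<in> stab S f \<Longrightarrow> inv g \<in> stab S f"
  unfolding stab_def by (metis (mono_tags, lifting) comp_assoc comp_id mem_Collect_eq permutes_inv permutes_inv_o(1))

lemma stab_comp_right_iff:
  assumes g: "g \<in> stab S f"
  shows "h \<circ> g \<in> stab S f \<longleftrightarrow> h \<in> stab S f"
proof
  assume "h \<circ> g \<in> stab S f"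
  then have "h \<circ> g \<circ> inv g \<in> stab S f" using stab_inv[OF g] by (rule stab_comp)
  then show "h \<in> stab S f" by (simp add: comp_assoc permutes_group(2)[OF stab_permutes[OF g]])
qed (use g stab_comp in blast)

lemma finite_stab: "finite S \<Longrightarrow> finite (stab S f)"
  by (rule finite_subset[of _ "{g. g permutes S}"]) (auto simp: stab_def finite_permutations)

lemma sum_stab_left:
  assumes h: "h \<in> stab S f"
  shows "(\<Sum>g\<in>stab S f. F (h \<circ> g)) = (\<Sum>g\<in>stab S f. F g)"
  by (rule sum.reindex_bij_witness[of _ "\<lambda>g. inv h \<circ> g" "\<lambda>g. h \<circ> g"])
    (auto simp: permutes_group[OF stab_permutes[OF h]] intro: stab_comp stab_inv h)

lemma stab_inv_inv: "g \<in> stab S f \<Longrightarrow> inv (inv g) = g"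
  using permutes_group(3)[OF stab_permutes] by blast

lemma sum_stab_inv: "(\<Sum>g\<in>stab S f. F (inv g)) = (\<Sum>g\<in>stab S f. F g)"
  by (rule sum.reindex_bij_witness[of _ inv inv]) (auto simp: stab_inv stab_inv_inv)

lemma sum_perm_left:
  assumes "h permutes S"
  shows "(\<Sum>g | g permutes S. F (h \<circ> g)) = (\<Sum>g | g permutes S. F g)"
  by (rule sum.reindex_bij_witness[of _ "\<lambda>g. inv h \<circ> g" "\<lambda>g. h \<circ> g"])
    (auto simp: permutes_group[OF assms] intro: permutes_compose assms)

lemma sum_perm_right:
  assumes "h permutes S"
  shows "(\<Sum>g | g permutes S. F (g \<circ> h)) = (\<Sum>g | g permutes S. F g)"
  by (rule sum.reindex_bij_witness[of _ "\<lambda>g. g \<circ> inv h" "\<lambda>g. g \<circ> h"])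
    (auto simp: permutes_group[OF assms] comp_assoc intro: permutes_compose assms)

lemma sum_perm_conj:
  assumes "h permutes S"
  shows "(\<Sum>g | g permutes S. F (inv h \<circ> g \<circ> h)) = (\<Sum>g | g permutes S. F g)"
  using sum_perm_left[OF permutes_inv[OF assms], of "\<lambda>g. F (g \<circ> h)"] sum_perm_right[OF assms, of F] by simp

text \<open>The Young symmetrizer of a numbering with row function \<open>rw\<close> and column function \<open>cl\<close>, as a
  function on the symmetric group.\<close>

definition ysym :: "'a set \<Rightarrow> ('a \<Rightarrow> nat) \<Rightarrow> ('a \<Rightarrow> nat) \<Rightarrow> ('a \<Rightarrow> 'a) \<Rightarrow> real" where
  "ysym S rw cl g = (\<Sum>q\<in>stab S cl. if inv q \<circ> g \<in> stab S rw then of_int (sign q) else 0)"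

text \<open>A bijective filling of the diagram of \<open>l\<close>, given by the coordinates of each
  entry rather than by the entry of each box. Passing to the conjugate shape then amounts to
  swapping \<open>rw\<close> and \<open>cl\<close>.\<close>

locale numbering =
  fixes S :: "'a set" and rw cl :: "'a \<Rightarrow> nat" and l :: "nat \<Rightarrow> nat"
  assumes finite_S: "finite S" and anti: "antimono l"
    and bij: "bij_betw (\<lambda>x. (rw x, cl x)) S {(r, c). c < l r}"
begin

abbreviation "G \<equiv> {g. g permutes S}"
abbreviation "R \<equiv> stab S rw"
abbreviation "C \<equiv> stab S cl"
abbreviation "a \<equiv> ysym S rw cl"
abbreviation sgn_of :: "('a \<Rightarrow> 'a) \<Rightarrow> real" where "sgn_of q \<equiv> of_int (sign q)"

lemma finite_G: "finite G" using finite_S by (rule finite_permutations)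
lemma finite_R: "finite R" and finite_C: "finite C" using finite_S by (auto intro: finite_stab)

lemma sgn_comp: "p permutes S \<Longrightarrow> q permutes S \<Longrightarrow> sgn_of (p \<circ> q) = sgn_of p * sgn_of q"
  by (simp add: sign_comp_permutes[OF finite_S])

lemma sgn_inv: "p permutes S \<Longrightarrow> sgn_of (inv p) = sgn_of p"
  using sign_inverse[OF permutes_imp_permutation[OF finite_S]] by simp

lemma a_left:
  assumes q: "q \<in> C" and g: "g permutes S"
  shows "a (q \<circ> g) = sgn_of q * a g"
proof -
  note qp = stab_permutes[OF q]
  have "a (q \<circ> g) = (\<Sum>p\<in>C. if inv (q \<circ> p) \<circ> (q \<circ> g) \<in> R then sgn_of (q \<circ> p) else 0)"
    unfolding ysym_def by (rule sum_stab_left[OF q, symmetric])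
  also have "\<dots> = (\<Sum>p\<in>C. sgn_of q * (if inv p \<circ> g \<in> R then sgn_of p else 0))"
    by (rule sum.cong[OF refl])
      (auto simp: inv_comp_permutes[OF qp] stab_permutes sgn_comp[OF qp] comp_assoc permutes_group[OF qp])
  finally show ?thesis by (simp add: ysym_def sum_distrib_left)
qed

lemma a_right:
  assumes r: "r \<in> R"
  shows "a (g \<circ> r) = a g"
  unfolding ysym_def
  by (rule sum.cong[OF refl])
    (simp add: o_assoc stab_comp_right_iff[OF r])

lemma sum_a:
  "(\<Sum>x\<in>G. a x * F x) = (\<Sum>q\<in>C. \<Sum>r\<in>R. sgn_of q * F (q \<circ> r))"
proof -
  have "(\<Sum>x\<in>G. a x * F x) = (\<Sum>q\<in>C. \<Sum>x\<in>G. if inv q \<circ> x \<in> R then sgn_of q * F x else 0)"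
    unfolding ysym_def sum_distrib_right by (subst sum.swap) (auto intro!: sum.cong)
  also have "\<dots> = (\<Sum>q\<in>C. \<Sum>r\<in>R. sgn_of q * F (q \<circ> r))"
  proof (rule sum.cong[OF refl])
    fix q assume q: "q \<in> C"
    note qp = stab_permutes[OF q]
    have "(\<Sum>x\<in>G. if inv q \<circ> x \<in> R then sgn_of q * F x else 0) = (\<Sum>x\<in>{x\<in>G. inv q \<circ> x \<in> R}. sgn_of q * F x)"
      by (rule sum.inter_filter[symmetric, OF finite_G])
    also have "\<dots> = (\<Sum>r\<in>R. sgn_of q * F (q \<circ> r))"
      by (rule sum.reindex_bij_witness[of _ "\<lambda>r. q \<circ> r" "\<lambda>x. inv q \<circ> x"])
        (auto simp: permutes_group[OF qp] permutes_compose qp stab_permutes)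
    finally show "(\<Sum>x\<in>G. if inv q \<circ> x \<in> R then sgn_of q * F x else 0) = (\<Sum>r\<in>R. sgn_of q * F (q \<circ> r))" .
  qed
  finally show ?thesis .
qed

lemma C_Int_R:
  assumes "q \<in> C" "q \<in> R"
  shows "q = id"
proof
  fix x
  show "q x = id x"
  proof (cases "x \<in> S")
    case True
    have "cl (q x) = cl x" "rw (q x) = rw x" using assms by (auto simp: stab_def dest: fun_cong[of _ _ x])
    moreover have "q x \<in> S" using True permutes_in_image[OF stab_permutes[OF assms(1)]] by simp
    ultimately show ?thesis using bij True by (auto simp: bij_betw_def inj_on_def)
  next
    case False
    then show ?thesis using permutes_not_in[OF stab_permutes[OF assms(1)]] by simp
  qed
qed

lemma a_id: "a id = 1"
proof -
  have "a id = (\<Sum>q\<in>C. if q = id then 1 else 0)" unfolding ysym_def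
  proof (rule sum.cong[OF refl])
    fix q assume q: "q \<in> C"
    have "inv q \<in> R \<longleftrightarrow> q = id"
      using C_Int_R[of "inv q"] stab_inv[OF q] permutes_group(3)[OF stab_permutes[OF q]] stab_id
      by (metis inv_id)
    then show "(if inv q \<circ> id \<in> R then sgn_of q else 0) = (if q = id then 1 else 0)" by auto
  qed
  then show ?thesis using finite_C stab_id[of S cl] by simp
qed

text \<open>A column occupies the rows from 0 on without gaps. So the boxes of the column in rows
  below \<open>i\<close> are either the whole column or exactly \<open>i\<close> in number, and a
  function injective on the column takes at most \<open>i\<close> values below
  \<open>i\<close>.\<close>

lemma column_counts_le:
  assumes inj: "\<And>x y. x \<in> S \<Longrightarrow> y \<in> S \<Longrightarrow> cl x = cl y \<Longrightarrow> f x = f y \<Longrightarrow> x = y"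
  shows "card {x \<in> S. cl x = j \<and> f x < i} \<le> card {x \<in> S. cl x = j \<and> rw x < i}"
proof (cases "i = 0 \<or> l (i - 1) \<le> j")
  case True
  have "rw x < i" if "x \<in> S" "cl x = j" "i \<noteq> 0" for x
  proof (rule ccontr)
    assume "\<not> rw x < i"
    then have "l (rw x) \<le> l (i - 1)" using anti by (auto simp: antimono_def)
    moreover have "j < l (rw x)" using bij that by (auto simp: bij_betw_def)
    ultimately show False using True that by auto
  qed
  then have "{x \<in> S. cl x = j \<and> f x < i} \<subseteq> {x \<in> S. cl x = j \<and> rw x < i}" by (cases "i = 0") auto
  then show ?thesis using finite_S by (intro card_mono) auto
next
  case False
  have "card {x \<in> S. cl x = j \<and> f x < i} \<le> card {..<i}"
    by (rule card_inj_on_le[of f]) (use inj in \<open>auto simp: inj_on_def\<close>)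
  also have "\<dots> \<le> card {x \<in> S. cl x = j \<and> rw x < i}"
  proof (rule surj_card_le[of _ _ rw])
    show "finite {x \<in> S. cl x = j \<and> rw x < i}" using finite_S by auto
    show "{..<i} \<subseteq> rw ` {x \<in> S. cl x = j \<and> rw x < i}"
    proof
      fix r assume "r \<in> {..<i}"
      then have "l (i - 1) \<le> l r" "r < i" using anti by (auto simp: antimono_def)
      then have "(r, j) \<in> (\<lambda>x. (rw x, cl x)) ` S" using bij False by (auto simp: bij_betw_def)
      then show "r \<in> rw ` {x \<in> S. cl x = j \<and> rw x < i}" using \<open>r < i\<close> by auto
    qed
  qed
  finally show ?thesis .
qed

lemma card_by_columns: "card {x \<in> S. P x} = (\<Sum>j\<in>cl ` S. card {x \<in> S. cl x = j \<and> P x})"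
proof -
  have "card {x \<in> S. P x} = (\<Sum>x\<in>{x \<in> S. P x}. 1)" by simp
  also have "\<dots> = (\<Sum>j\<in>cl ` S. \<Sum>x\<in>{x \<in> {x \<in> S. P x}. cl x = j}. 1)"
    by (rule sum.group[symmetric]) (use finite_S in auto)
  also have "\<dots> = (\<Sum>j\<in>cl ` S. card {x \<in> S. cl x = j \<and> P x})"
  proof (rule sum.cong[OF refl])
    fix j
    have "{x \<in> {x \<in> S. P x}. cl x = j} = {x \<in> S. cl x = j \<and> P x}" by auto
    then show "(\<Sum>x\<in>{x \<in> {x \<in> S. P x}. cl x = j}. 1) = card {x \<in> S. cl x = j \<and> P x}" by simp
  qed
  finally show ?thesis .
qed

lemma counts_le:
  assumes "\<And>x y. x \<in> S \<Longrightarrow> y \<in> S \<Longrightarrow> cl x = cl y \<Longrightarrow> f x = f y \<Longrightarrow> x = y"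
  shows "card {x \<in> S. f x < i} \<le> card {x \<in> S. rw x < i}"
  unfolding card_by_columns[of "\<lambda>x. f x < i"] card_by_columns[of "\<lambda>x. rw x < i"]
  by (rule sum_mono) (rule column_counts_le[OF assms])

lemma card_less_fibres:
  "card {x \<in> S. P x \<and> f x < Suc i} = card {x \<in> S. P x \<and> f x < i} + card {x \<in> S. P x \<and> f x = (i::nat)}"
proof -
  have "{x \<in> S. P x \<and> f x < Suc i} = {x \<in> S. P x \<and> f x < i} \<union> {x \<in> S. P x \<and> f x = i}" by auto
  then show ?thesis using finite_S by (simp add: card_Un_disjoint disjoint_iff)
qed

text \<open>Equal totals force equality in each of the inequalities for single columns. Inside every
  column \<open>f\<close> then has the same values as \<open>rw\<close>, hence differs from it by a
  column permutation.\<close>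

lemma column_injective_imp:
  assumes inj: "\<And>x y. x \<in> S \<Longrightarrow> y \<in> S \<Longrightarrow> cl x = cl y \<Longrightarrow> f x = f y \<Longrightarrow> x = y"
    and eq: "\<And>i. card {x \<in> S. f x = i} = card {x \<in> S. rw x = i}"
  obtains q where "q \<in> C" "\<And>x. x \<in> S \<Longrightarrow> f x = rw (q x)"
proof -
  have less: "card {x \<in> S. f x < i} = card {x \<in> S. rw x < i}" for i
  proof (induction i)
    case (Suc i)
    then show ?case using card_less_fibres[of "\<lambda>_. True" f i] card_less_fibres[of "\<lambda>_. True" rw i] eq[of i] by simp
  qed simp
  have col: "card {x \<in> S. cl x = j \<and> f x < i} = card {x \<in> S. cl x = j \<and> rw x < i}" for i j
  proof (cases "j \<in> cl ` S")
    case True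
    have "(\<Sum>j\<in>cl ` S. card {x \<in> S. cl x = j \<and> f x < i}) = (\<Sum>j\<in>cl ` S. card {x \<in> S. cl x = j \<and> rw x < i})"
      using less[of i] unfolding card_by_columns[of "\<lambda>x. f x < i"] card_by_columns[of "\<lambda>x. rw x < i"] .
    then show ?thesis
      by (rule sum_mono_inv[OF _ column_counts_le[OF inj] True]) (use finite_S in auto)
  next
    case False
    then have "{x \<in> S. cl x = j \<and> f x < i} = {}" "{x \<in> S. cl x = j \<and> rw x < i} = {}" by auto
    then show ?thesis by (simp only:)
  qed
  have "card {x \<in> S. cl x = j \<and> f x = i} = card {x \<in> S. cl x = j \<and> rw x = i}" for i j
    using card_less_fibres[of "\<lambda>x. cl x = j" f i] card_less_fibres[of "\<lambda>x. cl x = j" rw i] col[of j i] col[of j "Suc i"]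
    by simp
  then have fib: "card {x \<in> S. (cl x, f x) = y} = card {x \<in> S. (cl x, rw x) = y}" for y
    by (cases y) simp
  obtain p where p: "p permutes S" "\<And>x. x \<in> S \<Longrightarrow> (cl x, f x) = (cl (p x), rw (p x))"
    using equal_fibres_permutes[OF finite_S, of "\<lambda>x. (cl x, f x)" "\<lambda>x. (cl x, rw x)", OF fib] by blast
  have "cl \<circ> p = cl"
  proof
    fix x show "(cl \<circ> p) x = cl x" using p(2)[of x] permutes_not_in[OF p(1), of x] by (cases "x \<in> S") auto
  qed
  then have "p \<in> C" using p(1) by (simp add: stab_def)
  then show thesis using p(2) that by blast
qed

text \<open>Von Neumann's dichotomy. If no column of the numbering meets a row of the numbering
  moved by \<open>g\<close> twice, then \<open>g\<close> is a column permutation times a row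
  permutation. Otherwise two entries that share both give a transposition in the column group whose
  conjugate by \<open>g\<close> lies in the row group.\<close>

lemma symmetrizer_cases:
  assumes g: "g permutes S"
  obtains q r where "q \<in> C" "r \<in> R" "g = q \<circ> r"
  | t where "t \<in> C" "sign t = -1" "inv g \<circ> t \<circ> g \<in> R"
proof (cases "\<forall>x\<in>S. \<forall>y\<in>S. cl x = cl y \<longrightarrow> rw (inv g x) = rw (inv g y) \<longrightarrow> x = y")
  case True
  have "card {x \<in> S. (rw \<circ> inv g) x = i} = card {x \<in> S. rw x = i}" for i
    using card_comp_permutes[OF permutes_inv[OF g], of "\<lambda>x. rw x = i"] by simp
  then obtain q where q: "q \<in> C" "\<And>x. x \<in> S \<Longrightarrow> (rw \<circ> inv g) x = rw (q x)"
    using column_injective_imp[of "rw \<circ> inv g"] True by auto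
  note qp = stab_permutes[OF q(1)]
  have "rw \<circ> inv g = rw \<circ> q"
  proof
    fix x show "(rw \<circ> inv g) x = (rw \<circ> q) x"
      using q(2)[of x] permutes_not_in[OF qp, of x] permutes_not_in[OF permutes_inv[OF g], of x]
      by (cases "x \<in> S") auto
  qed
  then have "rw \<circ> (q \<circ> g) = rw" using permutes_group(1)[OF g] by (metis comp_assoc comp_id)
  then have "q \<circ> g \<in> R" using qp g by (simp add: stab_def permutes_compose)
  moreover have "g = inv q \<circ> (q \<circ> g)" by (simp add: permutes_group[OF qp])
  ultimately show thesis using that(1) stab_inv[OF q(1)] by blast
next
  case False
  then obtain x y where xy: "x \<in> S" "y \<in> S" "cl x = cl y" "rw (inv g x) = rw (inv g y)" "x \<noteq> y" by blast
  let ?t = "transpose x y"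
  have tp: "?t permutes S" using xy by (intro permutes_swap_id)
  have "cl \<circ> ?t = cl" using xy by (auto simp: fun_eq_iff transpose_def)
  then have "?t \<in> C" using tp by (simp add: stab_def)
  moreover have "sign ?t = -1" using xy by (simp add: sign_swap_id)
  moreover have "rw \<circ> inv g \<circ> ?t = rw \<circ> inv g" using xy by (auto simp: fun_eq_iff transpose_def)
  then have "rw \<circ> (inv g \<circ> ?t \<circ> g) = rw" using permutes_group(1)[OF g] by (metis comp_assoc comp_id)
  then have "inv g \<circ> ?t \<circ> g \<in> R" using tp g permutes_inv[OF g] by (simp add: stab_def permutes_compose)
  ultimately show thesis using that(2) by blast
qed

text \<open>On products \<open>q \<circ> r\<close> the two laws determine \<open>b\<close> from
  \<open>b id\<close>; at every other \<open>g\<close> the transposition of the dichotomy makes the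
  value equal to its negative.\<close>

lemma symmetrizer_unique:
  assumes b1: "\<And>q g. q \<in> C \<Longrightarrow> g permutes S \<Longrightarrow> b (q \<circ> g) = sgn_of q * b g"
    and b2: "\<And>r g. r \<in> R \<Longrightarrow> g permutes S \<Longrightarrow> b (g \<circ> r) = b g"
    and g: "g permutes S"
  shows "b g = b id * a g"
proof -
  have id: "id permutes S" by (rule permutes_id)
  show ?thesis using g
  proof (cases rule: symmetrizer_cases)
    case (1 q r)
    have "b g = sgn_of q * b id" using b1[OF 1(1) stab_permutes[OF 1(2)]] b2[OF 1(2) id] 1(3) by simp
    moreover have "a g = sgn_of q * a id"
      using a_left[OF 1(1) stab_permutes[OF 1(2)]] a_right[OF 1(2), of id] 1(3) by simp
    ultimately show ?thesis by (simp add: a_id)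
  next
    case (2 t)
    have eq: "g \<circ> (inv g \<circ> t \<circ> g) = t \<circ> g" using permutes_group[OF g] by (simp add: comp_assoc)
    have "b g = - b g" using b1[OF 2(1) g] b2[OF 2(3) g] 2(2) unfolding eq by simp
    moreover have "a g = - a g" using a_left[OF 2(1) g] a_right[OF 2(3), of g] 2(2) unfolding eq by simp
    ultimately show ?thesis by simp
  qed
qed


section \<open>Quasi-idempotency of the symmetrizer and its class function\<close>

definition ynorm :: real where
  "ynorm = (\<Sum>x\<in>G. a x * a (inv x))"

text \<open>\<open>hsum\<close> is the class function spanned by the Young symmetrizer; it turns out to be \<open>ynorm\<close> times
  the irreducible character.\<close>

definition hsum :: "('a \<Rightarrow> 'a) \<Rightarrow> real" where
  "hsum \<sigma> = (\<Sum>g\<in>G. a (inv g \<circ> \<sigma> \<circ> g))"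

text \<open>The left side is the coefficient of \<open>z\<close> in the group ring product of the
  symmetrizer, \<open>u\<close> and the symmetrizer. As a function of \<open>z\<close> it obeys both
  laws of \<open>symmetrizer_unique\<close>.\<close>

lemma a_conv:
  assumes u: "u permutes S" and z: "z permutes S"
  shows "(\<Sum>x\<in>G. a x * a (inv u \<circ> inv x \<circ> z)) = (\<Sum>x\<in>G. a x * a (inv u \<circ> inv x)) * a z"
proof -
  let ?b = "\<lambda>z. \<Sum>x\<in>G. a x * a (inv u \<circ> inv x \<circ> z)"
  have "?b z = ?b id * a z"
  proof (rule symmetrizer_unique[OF _ _ z])
    fix q g assume q: "q \<in> C" and g: "g permutes S"
    note qp = stab_permutes[OF q]
    have "?b (q \<circ> g) = (\<Sum>x\<in>G. a (q \<circ> x) * a (inv u \<circ> inv (q \<circ> x) \<circ> (q \<circ> g)))"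
      by (rule sum_perm_left[OF qp, symmetric])
    also have "\<dots> = (\<Sum>x\<in>G. sgn_of q * (a x * a (inv u \<circ> inv x \<circ> g)))"
      by (rule sum.cong[OF refl]) (simp add: a_left[OF q] inv_comp_permutes[OF qp] comp_assoc permutes_group[OF qp])
    finally show "?b (q \<circ> g) = sgn_of q * ?b g" by (simp add: sum_distrib_left)
  next
    fix r g assume r: "r \<in> R" and g: "g permutes S"
    show "?b (g \<circ> r) = ?b g" by (simp only: o_assoc a_right[OF r])
  qed
  then show ?thesis by simp
qed

text \<open>The square of the symmetrizer is \<open>ynorm\<close> times the symmetrizer.\<close>

lemma a_conv': "z permutes S \<Longrightarrow> (\<Sum>x\<in>G. a x * a (inv x \<circ> z)) = ynorm * a z"
  using a_conv[OF permutes_id, of z] by (simp add: ynorm_def)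

text \<open>Averaging from the left over the row group, without division, gives a function
  \<open>b\<close> whose sum of squares is \<open>ynorm\<close> times the squared order of that
  group, while \<open>b id\<close> is the order itself.\<close>

lemma ynorm_pos: "0 < ynorm"
proof -
  define b where "b = (\<lambda>g. \<Sum>r\<in>R. a (r \<circ> g))"
  have b_left: "b (r \<circ> g) = b g" if "r \<in> R" for r g
  proof -
    have "b (r \<circ> g) = (\<Sum>s\<in>R. a (s \<circ> r \<circ> g))" by (simp add: b_def o_assoc)
    also have "\<dots> = (\<Sum>s\<in>R. a (inv s \<circ> r \<circ> g))" by (rule sum_stab_inv[symmetric])
    also have "\<dots> = (\<Sum>s\<in>R. a (inv (r \<circ> s) \<circ> r \<circ> g))" by (rule sum_stab_left[OF that, symmetric])
    also have "\<dots> = (\<Sum>s\<in>R. a (inv s \<circ> g))"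
      by (rule sum.cong[OF refl])
        (simp add: inv_comp_permutes[OF stab_permutes[OF that] stab_permutes] comp_assoc permutes_group[OF stab_permutes[OF that]])
    also have "\<dots> = b g" unfolding b_def by (rule sum_stab_inv)
    finally show ?thesis .
  qed
  have b_right: "b (g \<circ> r) = b g" if "r \<in> R" for r g
    unfolding b_def by (simp only: o_assoc a_right[OF that])
  have yb: "ynorm = (\<Sum>q\<in>C. sgn_of q * b q)"
  proof -
    have "ynorm = (\<Sum>q\<in>C. \<Sum>r\<in>R. sgn_of q * a (inv (q \<circ> r)))" unfolding ynorm_def by (rule sum_a)
    also have "\<dots> = (\<Sum>q\<in>C. \<Sum>r\<in>R. sgn_of (inv q) * a (inv r \<circ> inv q))"
      by (intro sum.cong[OF refl]) (simp add: inv_comp_permutes[OF stab_permutes stab_permutes] sgn_inv[OF stab_permutes])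
    also have "\<dots> = (\<Sum>q\<in>C. \<Sum>r\<in>R. sgn_of q * a (inv r \<circ> q))"
      by (rule sum_stab_inv[of "\<lambda>q. \<Sum>r\<in>R. sgn_of q * a (inv r \<circ> q)"])
    also have "\<dots> = (\<Sum>q\<in>C. \<Sum>r\<in>R. sgn_of q * a (r \<circ> q))"
      by (intro sum.cong[OF refl] sum_stab_inv)
    finally show ?thesis by (simp add: b_def sum_distrib_left)
  qed
  have "(\<Sum>g\<in>G. b g * b g) = (\<Sum>r\<in>R. \<Sum>g\<in>G. a (r \<circ> g) * b g)"
    unfolding b_def sum_distrib_right by (rule sum.swap)
  also have "\<dots> = (\<Sum>r\<in>R. \<Sum>g\<in>G. a (r \<circ> g) * b (r \<circ> g))"
    by (intro sum.cong[OF refl]) (simp add: b_left)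
  also have "\<dots> = (\<Sum>r\<in>R. \<Sum>g\<in>G. a g * b g)"
    by (intro sum.cong[OF refl] sum_perm_left stab_permutes)
  also have "\<dots> = real (card R) * (\<Sum>q\<in>C. \<Sum>r\<in>R. sgn_of q * b (q \<circ> r))"
    by (simp add: sum_a)
  also have "(\<Sum>q\<in>C. \<Sum>r\<in>R. sgn_of q * b (q \<circ> r)) = (\<Sum>q\<in>C. real (card R) * (sgn_of q * b q))"
    by (intro sum.cong[OF refl]) (simp add: b_right)
  also have "\<dots> = real (card R) * ynorm" by (simp add: yb sum_distrib_left)
  finally have sq: "(\<Sum>g\<in>G. b g * b g) = real (card R) * (real (card R) * ynorm)" .
  have "b id = (\<Sum>r\<in>R. a (id \<circ> r))" by (simp add: b_def)
  also have "\<dots> = (\<Sum>r\<in>R. a id)" by (intro sum.cong[OF refl] a_right)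
  finally have "b id = real (card R)" by (simp add: a_id)
  moreover have "card R > 0" using stab_id finite_R by (auto simp: card_gt_0_iff)
  ultimately have "0 < b id * b id" by simp
  also have "\<dots> \<le> (\<Sum>g\<in>G. b g * b g)"
    using finite_G by (intro member_le_sum[of id G "\<lambda>g. b g * b g"]) (auto simp: permutes_id)
  finally show ?thesis unfolding sq by (simp add: zero_less_mult_iff)
qed

lemma hsum_conj:
  assumes h: "h permutes S" and s: "\<sigma> permutes S"
  shows "hsum (inv h \<circ> \<sigma> \<circ> h) = hsum \<sigma>"
proof -
  have "hsum (inv h \<circ> \<sigma> \<circ> h) = (\<Sum>g\<in>G. a (inv (h \<circ> g) \<circ> \<sigma> \<circ> (h \<circ> g)))"
    unfolding hsum_def by (rule sum.cong[OF refl]) (simp add: inv_comp_permutes[OF h] comp_assoc)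
  also have "\<dots> = hsum \<sigma>" unfolding hsum_def by (rule sum_perm_left[OF h])
  finally show ?thesis .
qed

definition conj_count :: "('a \<Rightarrow> 'a) \<Rightarrow> ('a \<Rightarrow> 'a) \<Rightarrow> nat" where
  "conj_count \<sigma> w = card {g \<in> G. inv g \<circ> \<sigma> \<circ> g = w}"

text \<open>Expressed through the number of elements that conjugate \<open>\<sigma>\<close> into
  \<open>q \<circ> r\<close>, the class function shows its invariance under inversion and, up to
  sign, under exchange of rows and columns.\<close>

lemma hsum_count:
  assumes s: "\<sigma> permutes S"
  shows "hsum \<sigma> = (\<Sum>q\<in>C. \<Sum>r\<in>R. sgn_of q * real (conj_count \<sigma> (q \<circ> r)))"
proof -
  have "hsum \<sigma> = (\<Sum>g\<in>G. \<Sum>x\<in>G. a x * (if inv g \<circ> \<sigma> \<circ> g = x then 1 else 0))"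
    unfolding hsum_def
  proof (rule sum.cong[OF refl])
    fix g assume "g \<in> G"
    then have "inv g \<circ> \<sigma> \<circ> g \<in> G" using s by (auto intro: permutes_compose permutes_inv)
    then show "a (inv g \<circ> \<sigma> \<circ> g) = (\<Sum>x\<in>G. a x * (if inv g \<circ> \<sigma> \<circ> g = x then 1 else 0))"
      using finite_G by (simp add: if_distrib cong: if_cong)
  qed
  also have "\<dots> = (\<Sum>x\<in>G. \<Sum>g\<in>G. a x * (if inv g \<circ> \<sigma> \<circ> g = x then 1 else 0))" by (rule sum.swap)
  also have "\<dots> = (\<Sum>x\<in>G. a x * real (conj_count \<sigma> x))"
    using finite_G by (simp add: sum_distrib_left[symmetric] conj_count_def sum.inter_filter[symmetric])
  finally show ?thesis by (simp add: sum_a)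
qed

lemma conj_count_cong:
  assumes h: "h permutes S" and s: "\<sigma> permutes S"
  shows "conj_count \<sigma> (inv h \<circ> w \<circ> h) = conj_count \<sigma> w"
  unfolding conj_count_def
proof (rule bij_betw_same_card[symmetric, of "\<lambda>g. g \<circ> h"], rule bij_betwI[of _ _ _ "\<lambda>g. g \<circ> inv h"])
  note gh = permutes_group[OF h]
  show "(\<lambda>g. g \<circ> h) \<in> {g \<in> G. inv g \<circ> \<sigma> \<circ> g = w} \<rightarrow> {g \<in> G. inv g \<circ> \<sigma> \<circ> g = inv h \<circ> w \<circ> h}"
  proof
    fix g assume "g \<in> {g \<in> G. inv g \<circ> \<sigma> \<circ> g = w}"
    then have g: "g permutes S" "inv g \<circ> \<sigma> \<circ> g = w" by auto
    then have "inv (g \<circ> h) \<circ> \<sigma> \<circ> (g \<circ> h) = inv h \<circ> w \<circ> h"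
      by (simp add: inv_comp_permutes[OF g(1) h] comp_assoc flip: g(2))
    then show "g \<circ> h \<in> {g \<in> G. inv g \<circ> \<sigma> \<circ> g = inv h \<circ> w \<circ> h}" using g(1) h by (simp add: permutes_compose)
  qed
  show "(\<lambda>g. g \<circ> inv h) \<in> {g \<in> G. inv g \<circ> \<sigma> \<circ> g = inv h \<circ> w \<circ> h} \<rightarrow> {g \<in> G. inv g \<circ> \<sigma> \<circ> g = w}"
  proof
    fix g assume "g \<in> {g \<in> G. inv g \<circ> \<sigma> \<circ> g = inv h \<circ> w \<circ> h}"
    then have g: "g permutes S" "inv g \<circ> \<sigma> \<circ> g = inv h \<circ> w \<circ> h" by auto
    have "inv (g \<circ> inv h) \<circ> \<sigma> \<circ> (g \<circ> inv h) = h \<circ> (inv g \<circ> \<sigma> \<circ> g) \<circ> inv h"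
      by (simp add: inv_comp_permutes[OF g(1) permutes_inv[OF h]] comp_assoc gh)
    also have "\<dots> = w" unfolding g(2) by (simp add: comp_assoc gh)
    finally show "g \<circ> inv h \<in> {g \<in> G. inv g \<circ> \<sigma> \<circ> g = w}"
      using g(1) permutes_inv[OF h] by (simp add: permutes_compose)
  qed
qed (simp_all add: comp_assoc permutes_group[OF h])

lemma conj_count_commute:
  assumes "q permutes S" "r permutes S" "\<sigma> permutes S"
  shows "conj_count \<sigma> (q \<circ> r) = conj_count \<sigma> (r \<circ> q)"
  using conj_count_cong[OF assms(1,3), of "q \<circ> r"] by (simp add: comp_assoc permutes_group[OF assms(1)])

lemma conj_count_inv:
  assumes "\<sigma> permutes S" "w permutes S"
  shows "conj_count (inv \<sigma>) w = conj_count \<sigma> (inv w)"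
proof -
  have "inv g \<circ> inv \<sigma> \<circ> g = w \<longleftrightarrow> inv g \<circ> \<sigma> \<circ> g = inv w" if g: "g permutes S" for g
  proof -
    have "inv (inv g \<circ> \<sigma> \<circ> g) = inv g \<circ> inv (inv g \<circ> \<sigma>)"
      by (rule inv_comp_permutes[OF permutes_compose[OF assms(1) permutes_inv[OF g]] g])
    also have "inv (inv g \<circ> \<sigma>) = inv \<sigma> \<circ> g"
      by (simp add: inv_comp_permutes[OF permutes_inv[OF g] assms(1)] permutes_group[OF g])
    finally have "inv (inv g \<circ> \<sigma> \<circ> g) = inv g \<circ> inv \<sigma> \<circ> g" by (simp only: o_assoc)
    moreover have "inv (inv (inv g \<circ> \<sigma> \<circ> g)) = inv g \<circ> \<sigma> \<circ> g"
      using g assms by (meson permutes_compose permutes_group(3) permutes_inv)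
    ultimately show ?thesis using permutes_group(3)[OF assms(2)] by metis
  qed
  then show ?thesis unfolding conj_count_def by (metis (mono_tags, lifting) mem_Collect_eq)
qed

lemma hsum_inv:
  assumes s: "\<sigma> permutes S"
  shows "hsum (inv \<sigma>) = hsum \<sigma>"
proof -
  have "hsum (inv \<sigma>) = (\<Sum>q\<in>C. \<Sum>r\<in>R. sgn_of (inv q) * real (conj_count \<sigma> (inv q \<circ> inv r)))"
    unfolding hsum_count[OF permutes_inv[OF s]]
  proof (intro sum.cong[OF refl])
    fix q r assume "q \<in> C" "r \<in> R"
    note p = stab_permutes[OF this(1)] stab_permutes[OF this(2)]
    have "conj_count (inv \<sigma>) (q \<circ> r) = conj_count \<sigma> (inv r \<circ> inv q)"
      using p s by (simp add: conj_count_inv permutes_compose inv_comp_permutes[OF p])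
    also have "\<dots> = conj_count \<sigma> (inv q \<circ> inv r)"
      using p s by (intro conj_count_commute) (auto intro: permutes_inv)
    finally show "sgn_of q * real (conj_count (inv \<sigma>) (q \<circ> r)) = sgn_of (inv q) * real (conj_count \<sigma> (inv q \<circ> inv r))"
      using p by (simp add: sgn_inv)
  qed
  also have "\<dots> = (\<Sum>q\<in>C. \<Sum>r\<in>R. sgn_of q * real (conj_count \<sigma> (q \<circ> inv r)))"
    by (rule sum_stab_inv[of "\<lambda>q. \<Sum>r\<in>R. sgn_of q * real (conj_count \<sigma> (q \<circ> inv r))"])
  also have "\<dots> = (\<Sum>q\<in>C. \<Sum>r\<in>R. sgn_of q * real (conj_count \<sigma> (q \<circ> r)))"
    by (intro sum.cong[OF refl] sum_stab_inv)
  finally show ?thesis using hsum_count[OF s] by simp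
qed

text \<open>Invariance under conjugation replaces one factor by \<open>a\<close> and contributes the
  group order. Invariance under inversion brings the other factor into the form required by
  \<open>a_conv\<close>, and quasi-idempotency collapses what remains to \<open>ynorm\<close>
  squared.\<close>

lemma hsum_norm: "(\<Sum>\<sigma>\<in>G. hsum \<sigma> * hsum \<sigma>) = fact (card S) * ynorm\<^sup>2"
proof -
  have "(\<Sum>\<sigma>\<in>G. hsum \<sigma> * hsum \<sigma>) = (\<Sum>\<sigma>\<in>G. \<Sum>g\<in>G. a (inv g \<circ> \<sigma> \<circ> g) * hsum (inv g \<circ> \<sigma> \<circ> g))"
    by (rule sum.cong[OF refl]) (simp add: hsum_conj sum_distrib_right[symmetric] flip: hsum_def)
  also have "\<dots> = (\<Sum>g\<in>G. \<Sum>\<sigma>\<in>G. a (inv g \<circ> \<sigma> \<circ> g) * hsum (inv g \<circ> \<sigma> \<circ> g))" by (rule sum.swap)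
  also have "\<dots> = (\<Sum>g\<in>G. \<Sum>\<sigma>\<in>G. a \<sigma> * hsum \<sigma>)"
    by (intro sum.cong[OF refl] sum_perm_conj) simp
  also have "\<dots> = fact (card S) * (\<Sum>\<sigma>\<in>G. a \<sigma> * hsum \<sigma>)"
    by (simp add: card_permutations[OF refl finite_S])
  also have "(\<Sum>\<sigma>\<in>G. a \<sigma> * hsum \<sigma>) = (\<Sum>\<sigma>\<in>G. \<Sum>g\<in>G. a \<sigma> * a (inv g \<circ> inv \<sigma> \<circ> g))"
    by (rule sum.cong[OF refl]) (simp add: hsum_inv[symmetric], simp add: hsum_def sum_distrib_left)
  also have "\<dots> = (\<Sum>g\<in>G. \<Sum>\<sigma>\<in>G. a \<sigma> * a (inv g \<circ> inv \<sigma> \<circ> g))" by (rule sum.swap)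
  also have "\<dots> = (\<Sum>g\<in>G. \<Sum>\<sigma>\<in>G. a \<sigma> * (a g * a (inv g \<circ> inv \<sigma>)))"
    by (rule sum.cong[OF refl]) (simp add: a_conv sum_distrib_left mult_ac)
  also have "\<dots> = (\<Sum>\<sigma>\<in>G. a \<sigma> * (\<Sum>g\<in>G. a g * a (inv g \<circ> inv \<sigma>)))"
    unfolding sum_distrib_left by (rule sum.swap)
  also have "\<dots> = (\<Sum>\<sigma>\<in>G. a \<sigma> * (ynorm * a (inv \<sigma>)))"
    by (rule sum.cong[OF refl]) (simp add: a_conv' permutes_inv)
  also have "\<dots> = ynorm * ynorm" by (simp add: ynorm_def[of] sum_distrib_left mult_ac)
  finally show ?thesis by (simp add: power2_eq_square)
qed

end

section \<open>Characters of Specht modules\<close>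

lemma card_filter_bij:
  assumes "bij_betw h S T"
  shows "card {x \<in> S. P (h x)} = card {y \<in> T. P y}"
proof -
  have "h ` {x \<in> S. P (h x)} = {y \<in> T. P y}" using bij_betw_imp_surj_on[OF assms] by blast
  moreover have "inj_on h {x \<in> S. P (h x)}"
    using assms by (auto simp: bij_betw_def intro: inj_on_subset)
  ultimately show ?thesis by (metis card_image)
qed

context numbering
begin

text \<open>Frobenius reciprocity by counting: \<open>xi\<close> is a number of fixed words, so
  pairing with it sums \<open>a\<close> over the stabilizers of all words.\<close>

lemma hsum_xi:
  fixes m :: "nat \<Rightarrow> nat"
  assumes m: "finite {i. m i \<noteq> 0}"
  shows "(\<Sum>\<sigma>\<in>G. hsum \<sigma> * real (xi S m \<sigma>)) = fact (card S) * (\<Sum>f\<in>words S m. \<Sum>t\<in>stab S f. a t)"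
proof -
  note fw = finite_words[OF finite_S m]
  have "(\<Sum>\<sigma>\<in>G. hsum \<sigma> * real (xi S m \<sigma>))
    = (\<Sum>\<sigma>\<in>G. \<Sum>g\<in>G. a (inv g \<circ> \<sigma> \<circ> g) * real (xi S m (inv g \<circ> \<sigma> \<circ> g)))"
  proof (rule sum.cong[OF refl])
    fix \<sigma>
    have "xi S m (inv g \<circ> \<sigma> \<circ> g) = xi S m \<sigma>" if "g \<in> G" for g
      using xi_conj[of "inv g" S m \<sigma>] permutes_group[of g S] that by auto
    then show "hsum \<sigma> * real (xi S m \<sigma>) = (\<Sum>g\<in>G. a (inv g \<circ> \<sigma> \<circ> g) * real (xi S m (inv g \<circ> \<sigma> \<circ> g)))"
      by (simp add: hsum_def sum_distrib_right)
  qed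
  also have "\<dots> = (\<Sum>g\<in>G. \<Sum>\<sigma>\<in>G. a (inv g \<circ> \<sigma> \<circ> g) * real (xi S m (inv g \<circ> \<sigma> \<circ> g)))" by (rule sum.swap)
  also have "\<dots> = (\<Sum>g\<in>G. \<Sum>\<sigma>\<in>G. a \<sigma> * real (xi S m \<sigma>))"
    by (intro sum.cong[OF refl] sum_perm_conj) simp
  also have "\<dots> = fact (card S) * (\<Sum>\<sigma>\<in>G. a \<sigma> * real (xi S m \<sigma>))"
    by (simp add: card_permutations[OF refl finite_S])
  also have "(\<Sum>\<sigma>\<in>G. a \<sigma> * real (xi S m \<sigma>)) = (\<Sum>\<sigma>\<in>G. \<Sum>f\<in>words S m. if f \<circ> \<sigma> = f then a \<sigma> else 0)"
    using fw by (simp add: xi_def sum.inter_filter[symmetric] mult.commute)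
  also have "\<dots> = (\<Sum>f\<in>words S m. \<Sum>\<sigma>\<in>G. if f \<circ> \<sigma> = f then a \<sigma> else 0)" by (rule sum.swap)
  also have "\<dots> = (\<Sum>f\<in>words S m. \<Sum>t\<in>stab S f. a t)"
    using finite_G by (simp add: sum.inter_filter[symmetric] stab_def)
  finally show ?thesis .
qed

text \<open>The transposition of \<open>x\<close> and \<open>y\<close> lies both in the stabilizer
  and in the column group, so translation by it reverses the sign of the sum.\<close>

lemma sum_stab_vanish:
  assumes "x \<in> S" "y \<in> S" "x \<noteq> y" "cl x = cl y" "f x = f y"
  shows "(\<Sum>t\<in>stab S f. a t) = 0"
proof -
  let ?t = "transpose x y"
  have tp: "?t permutes S" using assms by (intro permutes_swap_id)
  have "cl \<circ> ?t = cl" "f \<circ> ?t = f" using assms by (auto simp: fun_eq_iff transpose_def)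
  then have C: "?t \<in> C" and f: "?t \<in> stab S f" using tp by (auto simp: stab_def)
  have "(\<Sum>t\<in>stab S f. a t) = (\<Sum>t\<in>stab S f. a (?t \<circ> t))" by (rule sum_stab_left[OF f, symmetric])
  also have "\<dots> = (\<Sum>t\<in>stab S f. - a t)"
    by (rule sum.cong[OF refl]) (use assms in \<open>simp add: a_left[OF C stab_permutes] sign_swap_id\<close>)
  finally show ?thesis by (simp add: sum_negf)
qed

lemma card_rw: "card {x \<in> S. rw x = k} = l k"
proof -
  have "card {x \<in> S. rw x = k} = card {y \<in> {(r, c). c < l r}. fst y = k}"
    using card_filter_bij[OF bij, of "\<lambda>y. fst y = k"] by simp
  also have "{y \<in> {(r, c). c < l r}. fst y = k} = {k} \<times> {..<l k}" by auto
  finally show ?thesis by (simp add: card_cartesian_product)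
qed

lemma card_less_sum:
  assumes "\<And>k. card {x \<in> S. f x = k} = m (k::nat)"
  shows "card {x \<in> S. f x < i} = (\<Sum>k<i. m k)"
proof (induction i)
  case (Suc i)
  then show ?case using card_less_fibres[of "\<lambda>_. True" f i] assms[of i] by simp
qed simp

text \<open>A term that does not vanish comes from a word without repetitions in any column, and
  such a word has at most as many letters below \<open>i\<close> as there are boxes in the first
  \<open>i\<close> rows.\<close>

lemma hsum_xi_dominance:
  assumes m: "finite {i. m i \<noteq> 0}" and nz: "(\<Sum>\<sigma>\<in>G. hsum \<sigma> * real (xi S m \<sigma>)) \<noteq> 0"
  shows "(\<Sum>k<i. m k) \<le> (\<Sum>k<i. l k)"
proof -
  from nz have "(\<Sum>f\<in>words S m. \<Sum>t\<in>stab S f. a t) \<noteq> 0" unfolding hsum_xi[OF m] by auto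
  then obtain f where f: "f \<in> words S m" "(\<Sum>t\<in>stab S f. a t) \<noteq> 0" by (meson sum.neutral)
  then have "x = y" if "x \<in> S" "y \<in> S" "cl x = cl y" "f x = f y" for x y
    using sum_stab_vanish that by blast
  then have "card {x \<in> S. f x < i} \<le> card {x \<in> S. rw x < i}" by (rule counts_le)
  then show ?thesis using card_less_sum[OF words_content[OF f(1)]] card_less_sum[OF card_rw] by simp
qed

lemma ynorm_eq: "(\<Sum>q\<in>C. \<Sum>r\<in>R. sgn_of q * a (r \<circ> inv q)) = ynorm"
proof -
  have "ynorm = (\<Sum>q\<in>C. \<Sum>r\<in>R. sgn_of q * a (inv (q \<circ> r)))" unfolding ynorm_def by (rule sum_a)
  also have "\<dots> = (\<Sum>q\<in>C. \<Sum>r\<in>R. sgn_of q * a (inv r \<circ> inv q))"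
    by (intro sum.cong[OF refl]) (simp add: inv_comp_permutes[OF stab_permutes stab_permutes])
  also have "\<dots> = (\<Sum>q\<in>C. \<Sum>r\<in>R. sgn_of q * a (r \<circ> inv q))"
    by (rule sum.cong[OF refl]) (rule sum_stab_inv)
  finally show ?thesis by simp
qed

text \<open>With content \<open>l\<close> the words without repetitions in a column are the row
  function moved by column permutations, one word for each. Their stabilizers are conjugates of the
  row group, and the contributions add up to \<open>ynorm\<close>.\<close>

lemma hsum_xi_self:
  assumes m: "finite {i. l i \<noteq> 0}"
  shows "(\<Sum>\<sigma>\<in>G. hsum \<sigma> * real (xi S l \<sigma>)) = fact (card S) * ynorm"
proof -
  define W where "W = (\<lambda>q. restrict (rw \<circ> inv q) S)"
  have Wx: "W q x = rw (inv q x)" if "x \<in> S" for q x using that by (simp add: W_def)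
  have W_words: "W q \<in> words S l" if "q \<in> C" for q
  proof -
    have "card {x \<in> S. W q x = i} = l i" for i
    proof -
      have "{x \<in> S. W q x = i} = {x \<in> S. rw (inv q x) = i}" by (auto simp: Wx)
      then show ?thesis
        using card_comp_permutes[OF permutes_inv[OF stab_permutes[OF that]], of "\<lambda>x. rw x = i"] card_rw[of i] by simp
    qed
    then show ?thesis by (simp add: words_def W_def)
  qed
  have fixed: "g \<in> stab S (W q) \<longleftrightarrow> inv q \<circ> g \<circ> q \<in> R" if q: "q permutes S" and g: "g permutes S" for q g
  proof -
    note gq = permutes_group[OF q]
    have "W q \<circ> g = W q \<longleftrightarrow> (\<forall>x\<in>S. rw (inv q (g x)) = rw (inv q x))"
      using permutes_in_image[OF g] permutes_not_in[OF g] by (auto simp: fun_eq_iff W_def)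
    also have "\<dots> \<longleftrightarrow> rw \<circ> inv q \<circ> g = rw \<circ> inv q"
      using permutes_not_in[OF g] by (auto simp: fun_eq_iff)
    also have "\<dots> \<longleftrightarrow> rw \<circ> (inv q \<circ> g \<circ> q) = rw"
    proof
      assume "rw \<circ> inv q \<circ> g = rw \<circ> inv q"
      then have "rw \<circ> inv q \<circ> g \<circ> q = rw \<circ> inv q \<circ> q" by simp
      then show "rw \<circ> (inv q \<circ> g \<circ> q) = rw" by (simp add: comp_assoc gq)
    next
      assume "rw \<circ> (inv q \<circ> g \<circ> q) = rw"
      then have "rw \<circ> (inv q \<circ> g \<circ> q) \<circ> inv q = rw \<circ> inv q" by simp
      then show "rw \<circ> inv q \<circ> g = rw \<circ> inv q" by (simp add: comp_assoc gq)
    qed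
    finally show ?thesis using q g by (simp add: stab_def permutes_compose permutes_inv)
  qed
  have inj: "inj_on W C"
  proof (rule inj_onI)
    fix q p assume q: "q \<in> C" and p: "p \<in> C" and eq: "W q = W p"
    note qp = stab_permutes[OF q] and pp = stab_permutes[OF p]
    have "rw (inv q x) = rw (inv p x)" for x
    proof (cases "x \<in> S")
      case True
      then show ?thesis using fun_cong[OF eq, of x] by (simp add: Wx)
    next
      case False
      then show ?thesis using permutes_not_in[OF permutes_inv[OF qp]] permutes_not_in[OF permutes_inv[OF pp]] by simp
    qed
    then have "rw \<circ> inv q = rw \<circ> inv p" by auto
    then have "rw \<circ> (inv q \<circ> p) = rw" using permutes_group(1)[OF pp] by (metis comp_assoc comp_id)
    then have "inv q \<circ> p \<in> R" using qp pp by (simp add: stab_def permutes_compose permutes_inv)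
    then have "inv q \<circ> p = id" using C_Int_R stab_comp[OF stab_inv[OF q] p] by blast
    then show "q = p" using permutes_group(6)[OF qp, of p] by simp
  qed
  have "(\<Sum>f\<in>words S l. \<Sum>t\<in>stab S f. a t) = (\<Sum>f\<in>W ` C. \<Sum>t\<in>stab S f. a t)"
  proof (rule sum.mono_neutral_right)
    show "finite (words S l)" using finite_words[OF finite_S m] .
    show "W ` C \<subseteq> words S l" using W_words by auto
    show "\<forall>f\<in>words S l - W ` C. (\<Sum>t\<in>stab S f. a t) = 0"
    proof
      fix f assume f: "f \<in> words S l - W ` C"
      show "(\<Sum>t\<in>stab S f. a t) = 0"
      proof (rule ccontr)
        assume nz: "(\<Sum>t\<in>stab S f. a t) \<noteq> 0"
        have "x = y" if "x \<in> S" "y \<in> S" "cl x = cl y" "f x = f y" for x y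
          using sum_stab_vanish[OF that(1,2) _ that(3,4)] nz by blast
        moreover have "card {x \<in> S. f x = i} = card {x \<in> S. rw x = i}" for i
          using f words_content[of f S l i] card_rw by simp
        ultimately obtain q where q: "q \<in> C" "\<And>x. x \<in> S \<Longrightarrow> f x = rw (q x)"
          using column_injective_imp[of f] by blast
        have "f = W (inv q)"
        proof
          fix x show "f x = W (inv q) x"
            using f q(2)[of x] stab_inv_inv[OF q(1)] by (cases "x \<in> S") (auto simp: W_def words_def extensional_def)
        qed
        then show False using f stab_inv[OF q(1)] by blast
      qed
    qed
  qed
  also have "\<dots> = (\<Sum>q\<in>C. \<Sum>t\<in>stab S (W q). a t)" using inj by (simp add: sum.reindex)
  also have "\<dots> = (\<Sum>q\<in>C. \<Sum>r\<in>R. sgn_of q * a (r \<circ> inv q))"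
  proof (rule sum.cong[OF refl])
    fix q assume q: "q \<in> C"
    note qp = stab_permutes[OF q] and gq = permutes_group[OF stab_permutes[OF q]]
    have "(\<Sum>t\<in>stab S (W q). a t) = (\<Sum>r\<in>R. a (q \<circ> r \<circ> inv q))"
    proof (rule sum.reindex_bij_witness[of _ "\<lambda>r. q \<circ> r \<circ> inv q" "\<lambda>t. inv q \<circ> t \<circ> q"])
      fix t assume t: "t \<in> stab S (W q)"
      show "q \<circ> (inv q \<circ> t \<circ> q) \<circ> inv q = t" "inv q \<circ> t \<circ> q \<in> R"
        using fixed[OF qp stab_permutes[OF t]] t by (simp_all add: comp_assoc gq)
      then show "a (q \<circ> (inv q \<circ> t \<circ> q) \<circ> inv q) = a t" by simp
    next
      fix r assume r: "r \<in> R"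
      have p: "q \<circ> r \<circ> inv q permutes S"
        using qp stab_permutes[OF r] by (simp add: permutes_compose permutes_inv)
      show "inv q \<circ> (q \<circ> r \<circ> inv q) \<circ> q = r" by (simp add: comp_assoc gq)
      then show "q \<circ> r \<circ> inv q \<in> stab S (W q)" using fixed[OF qp p] r by simp
    qed
    also have "\<dots> = (\<Sum>r\<in>R. sgn_of q * a (r \<circ> inv q))"
      by (rule sum.cong[OF refl])
        (simp add: comp_assoc a_left[OF q] permutes_compose[OF gq(4) stab_permutes])
    finally show "(\<Sum>t\<in>stab S (W q). a t) = (\<Sum>r\<in>R. sgn_of q * a (r \<circ> inv q))" .
  qed
  finally show ?thesis by (simp add: hsum_xi[OF m] ynorm_eq)
qed

end

section \<open>Conjugate numberings and the sign\<close>

lemma hsum_transpose: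
  assumes A: "numbering S rw cl l" and B: "numbering S cl rw l'" and s: "\<sigma> permutes S"
  shows "numbering.hsum S cl rw \<sigma> = of_int (sign \<sigma>) * numbering.hsum S rw cl \<sigma>"
proof -
  interpret A: numbering S rw cl l by (rule A)
  interpret B: numbering S cl rw l' by (rule B)
  have "B.hsum \<sigma> = (\<Sum>r\<in>stab S rw. \<Sum>q\<in>stab S cl. of_int (sign \<sigma>) * (of_int (sign q) * real (A.conj_count \<sigma> (q \<circ> r))))"
    unfolding B.hsum_count[OF s]
  proof (intro sum.cong[OF refl])
    fix r q assume rq: "r \<in> stab S rw" "q \<in> stab S cl"
    note rp = stab_permutes[OF rq(1)] and qp = stab_permutes[OF rq(2)]
    have eq: "A.conj_count \<sigma> (r \<circ> q) = A.conj_count \<sigma> (q \<circ> r)" by (rule A.conj_count_commute[OF rp qp s])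
    show "of_int (sign r) * real (A.conj_count \<sigma> (r \<circ> q))
      = of_int (sign \<sigma>) * (of_int (sign q) * real (A.conj_count \<sigma> (q \<circ> r)))"
    proof (cases "A.conj_count \<sigma> (q \<circ> r) = 0")
      case False
      then have "{g. g permutes S \<and> inv g \<circ> \<sigma> \<circ> g = q \<circ> r} \<noteq> {}"
        unfolding A.conj_count_def by (metis (mono_tags, lifting) Collect_empty_eq card.empty mem_Collect_eq)
      then obtain g where g: "g permutes S" "inv g \<circ> \<sigma> \<circ> g = q \<circ> r" by blast
      \<comment> \<open>Exchanging rows and columns replaces the weight \<open>sign q\<close> by
        \<open>sign r\<close>; wherever the count is nonzero, \<open>q \<circ> r\<close> is
        conjugate to \<open>\<sigma>\<close>, which relates the two weights by
        \<open>sign \<sigma>\<close>.\<close>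
      have "sign \<sigma> = sign (inv g \<circ> \<sigma> \<circ> g)"
        using g(1) s A.finite_S sign_inverse[OF permutes_imp_permutation[OF A.finite_S g(1)]]
        by (simp add: sign_comp_permutes[OF A.finite_S permutes_compose[OF s permutes_inv[OF g(1)]] g(1)]
            sign_comp_permutes[OF A.finite_S permutes_inv[OF g(1)] s])
      also have "\<dots> = sign q * sign r" unfolding g(2) by (rule sign_comp_permutes[OF A.finite_S qp rp])
      finally have "sign \<sigma> * sign q = sign r" by simp
      then have "of_int (sign r) = of_int (sign \<sigma>) * (of_int (sign q) :: real)" by (metis of_int_mult)
      then show ?thesis by (simp add: eq)
    qed (simp add: eq)
  qed
  also have "\<dots> = of_int (sign \<sigma>) * A.hsum \<sigma>"
    unfolding A.hsum_count[OF s] sum_distrib_left by (rule sum.swap)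
  finally show ?thesis .
qed

text \<open>The two class functions agree up to sign and so have equal norms; \<open>ynorm\<close>
  is recovered from the norm as a positive square root.\<close>

lemma ynorm_transpose:
  assumes A: "numbering S rw cl l" and B: "numbering S cl rw l'"
  shows "numbering.ynorm S cl rw = numbering.ynorm S rw cl"
proof -
  interpret A: numbering S rw cl l by (rule A)
  interpret B: numbering S cl rw l' by (rule B)
  have "(\<Sum>\<sigma> | \<sigma> permutes S. B.hsum \<sigma> * B.hsum \<sigma>) = (\<Sum>\<sigma> | \<sigma> permutes S. A.hsum \<sigma> * A.hsum \<sigma>)"
  proof (rule sum.cong[OF refl])
    fix \<sigma> assume "\<sigma> \<in> {\<sigma>. \<sigma> permutes S}"
    then have "B.hsum \<sigma> = of_int (sign \<sigma>) * A.hsum \<sigma>" using hsum_transpose[OF A B] by simp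
    then have "B.hsum \<sigma> * B.hsum \<sigma> = of_int (sign \<sigma> * sign \<sigma>) * (A.hsum \<sigma> * A.hsum \<sigma>)"
      by (simp only: of_int_mult mult_ac)
    then show "B.hsum \<sigma> * B.hsum \<sigma> = A.hsum \<sigma> * A.hsum \<sigma>" by simp
  qed
  then have "B.ynorm\<^sup>2 = A.ynorm\<^sup>2" unfolding A.hsum_norm B.hsum_norm by simp
  then show ?thesis using A.ynorm_pos B.ynorm_pos by (simp add: power2_eq_iff)
qed


section \<open>Traces computed from a spanning family\<close>

lemma fun_sum_apply: "(\<Sum>x\<in>A. f x) y = (\<Sum>x\<in>A. f x y)"
  for f :: "'a \<Rightarrow> 'b \<Rightarrow> complex"
  by (induction A rule: infinite_finite_induct) auto

text \<open>The family \<open>e\<close> with functionals \<open>ph\<close> that reproduce every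
  vector plays the part of a basis and its dual basis. Expanding \<open>L b\<close> in the family
  and exchanging the sums over \<open>B\<close> and \<open>I\<close> recombines the basis expansion
  of \<open>e g\<close> inside \<open>ph g \<circ> L\<close>.\<close>

lemma subspace_trace_eq:
  fixes e :: "'g \<Rightarrow> 'b \<Rightarrow> complex" and ph :: "'g \<Rightarrow> ('b \<Rightarrow> complex) \<Rightarrow> complex"
  assumes I: "finite I" and V: "V = fun_space.span (e ` I)"
    and expand: "\<And>v. v \<in> V \<Longrightarrow> v = (\<Sum>g\<in>I. fun_scale (ph g v) (e g))"
    and L: "\<And>v. v \<in> V \<Longrightarrow> L v \<in> V"
    and lin: "\<And>g u v. ph g (L (u + v)) = ph g (L u) + ph g (L v)"
      "\<And>g c v. ph g (L (fun_scale c v)) = c * ph g (L v)"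
  shows "subspace_trace V L = (\<Sum>g\<in>I. ph g (L (e g)))"
proof -
  define B where "B = (SOME B. fun_space.independent B \<and> fun_space.span B = V)"
  have "\<exists>B. fun_space.independent B \<and> fun_space.span B = V"
  proof -
    obtain B where "B \<subseteq> e ` I" "fun_space.independent B" "e ` I \<subseteq> fun_space.span B"
      using fun_space.maximal_independent_subset by blast
    then have "fun_space.span B = V" unfolding V
      by (metis fun_space.span_mono fun_space.span_span subset_antisym)
    then show ?thesis using \<open>fun_space.independent B\<close> by blast
  qed
  then have "fun_space.independent B \<and> fun_space.span B = V" unfolding B_def by (rule someI_ex)
  then have B: "fun_space.independent B" "fun_space.span B = V" by auto
  have "finite B"
    using fun_space.independent_span_bound[OF finite_imageI[OF I] B(1), of e] fun_space.span_superset[of B] B(2) V by auto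
  let ?r = "fun_space.representation B"
  have eV: "e g \<in> fun_space.span B" if "g \<in> I" for g
    using that unfolding B(2) V by (intro fun_space.span_base) auto
  have lin_sum: "ph g (L (\<Sum>b\<in>A. fun_scale (c b) b)) = (\<Sum>b\<in>A. c b * ph g (L b))" if "finite A" for g c A
    using that
  proof (induction A rule: finite_induct)
    case empty
    have "fun_scale 0 0 = (0 :: 'b \<Rightarrow> complex)" by (simp add: fun_scale_def fun_eq_iff)
    then show ?case using lin(2)[of g 0 0] by (simp add: zero_fun_def)
  next
    case (insert x F)
    have "ph g (L (\<Sum>b\<in>insert x F. fun_scale (c b) b)) = ph g (L (fun_scale (c x) x + (\<Sum>b\<in>F. fun_scale (c b) b)))"
      by (simp only: sum.insert[OF insert.hyps])
    also have "\<dots> = c x * ph g (L x) + (\<Sum>b\<in>F. c b * ph g (L b))" by (simp only: lin insert.IH)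
    finally show ?case by (simp only: sum.insert[OF insert.hyps])
  qed
  have "subspace_trace V L = (\<Sum>b\<in>B. ?r (L b) b)"
    by (simp add: subspace_trace_def B_def Let_def)
  also have "\<dots> = (\<Sum>b\<in>B. \<Sum>g\<in>I. ph g (L b) * ?r (e g) b)"
  proof (rule sum.cong[OF refl])
    fix b assume "b \<in> B"
    then have "L b \<in> V" using L B(2) fun_space.span_base by blast
    then have "L b = (\<Sum>g\<in>I. fun_scale (ph g (L b)) (e g))" by (rule expand)
    then have "?r (L b) b = ?r (\<Sum>g\<in>I. fun_scale (ph g (L b)) (e g)) b" by (rule arg_cong[where f = "\<lambda>v. ?r v b"])
    also have "\<dots> = (\<Sum>g\<in>I. ?r (fun_scale (ph g (L b)) (e g)) b)"
      by (rule fun_cong[OF fun_space.representation_sum[OF B(1)]]) (rule fun_space.span_scale, rule eV)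
    also have "\<dots> = (\<Sum>g\<in>I. ph g (L b) * ?r (e g) b)"
      by (rule sum.cong[OF refl]) (simp add: fun_space.representation_scale[OF B(1) eV])
    finally show "?r (L b) b = (\<Sum>g\<in>I. ph g (L b) * ?r (e g) b)" .
  qed
  also have "\<dots> = (\<Sum>g\<in>I. \<Sum>b\<in>B. ?r (e g) b * ph g (L b))"
    by (subst sum.swap) (simp add: mult.commute)
  also have "\<dots> = (\<Sum>g\<in>I. ph g (L (e g)))"
  proof (rule sum.cong[OF refl])
    fix g assume "g \<in> I"
    have "(\<Sum>b\<in>B. fun_scale (?r (e g) b) b) = e g"
      by (rule fun_space.sum_representation_eq[OF B(1) eV[OF \<open>g \<in> I\<close>] \<open>finite B\<close>]) simp
    then show "(\<Sum>b\<in>B. ?r (e g) b * ph g (L b)) = ph g (L (e g))"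
      using lin_sum[OF \<open>finite B\<close>, of g "?r (e g)"] by simp
  qed
  finally show ?thesis .
qed


section \<open>Specht modules in terms of Young symmetrizers\<close>

definition shp :: "nat list \<Rightarrow> nat \<Rightarrow> nat" where
  "shp la r = part la (Suc r)"

lemma mem_diagram: "(i, j) \<in> diagram la \<longleftrightarrow> 1 \<le> i \<and> 1 \<le> j \<and> j \<le> shp la (i - 1)"
  by (auto simp: diagram_def skew_def part_def shp_def)

lemma shp_antimono:
  assumes "la \<in> partitions n"
  shows "antimono (shp la)"
proof -
  have "sorted_wrt (\<ge>) la" using assms by (simp add: partitions_def)
  then show ?thesis unfolding antimono_iff_le_Suc
    by (auto simp: shp_def part_def sorted_wrt_iff_nth_less)
qed

locale specht =
  fixes la :: "nat list" and n :: nat and t0 :: "nat \<times> nat \<Rightarrow> nat"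
  assumes la: "la \<in> partitions n" and t0: "t0 \<in> young_tableaux la"
begin

abbreviation "SS \<equiv> {1..n}"

text \<open>Otherwise the simplifier turns \<open>{1..n}\<close> into \<open>{Suc 0..n}\<close>.\<close>

declare One_nat_def [simp del]

text \<open>The value 0 outside \<open>{1..n}\<close> is a harmless default: permutations of
  \<open>{1..n}\<close> fix these points, so \<open>rw \<circ> g = rw\<close> restricts
  \<open>g\<close> on the entries only.\<close>

definition rw :: "nat \<Rightarrow> nat" where
  "rw x = (if x \<in> SS then fst (inv_into (diagram la) t0 x) - 1 else 0)"

definition cl :: "nat \<Rightarrow> nat" where
  "cl x = (if x \<in> SS then snd (inv_into (diagram la) t0 x) - 1 else 0)"

lemma sum_la: "sum_list la = n" using la by (simp add: partitions_def)

lemma bij_t0: "bij_betw t0 (diagram la) SS"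
  using t0 by (simp add: young_tableaux_def sum_la)

lemma box_of:
  assumes "x \<in> SS"
  shows "(Suc (rw x), Suc (cl x)) \<in> diagram la" "t0 (Suc (rw x), Suc (cl x)) = x"
proof -
  let ?p = "inv_into (diagram la) t0 x"
  have x: "x \<in> t0 ` diagram la" using bij_t0 assms by (simp add: bij_betw_def)
  have p: "?p \<in> diagram la" using inv_into_into[OF x] .
  then have "?p = (Suc (rw x), Suc (cl x))"
    using mem_diagram[of "fst ?p" "snd ?p" la] assms by (cases ?p) (simp add: rw_def cl_def)
  then show "(Suc (rw x), Suc (cl x)) \<in> diagram la" "t0 (Suc (rw x), Suc (cl x)) = x"
    using p f_inv_into_f[OF x] by auto
qed

lemma of_box:
  assumes "(Suc i, Suc j) \<in> diagram la"
  shows "t0 (Suc i, Suc j) \<in> SS" "rw (t0 (Suc i, Suc j)) = i" "cl (t0 (Suc i, Suc j)) = j"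
proof -
  show S: "t0 (Suc i, Suc j) \<in> SS" using bij_t0 assms by (auto simp: bij_betw_def)
  have "inv_into (diagram la) t0 (t0 (Suc i, Suc j)) = (Suc i, Suc j)"
    using bij_t0 assms by (simp add: bij_betw_def)
  then show "rw (t0 (Suc i, Suc j)) = i" "cl (t0 (Suc i, Suc j)) = j" using S by (simp_all add: rw_def cl_def)
qed

lemma numbering_la: "numbering SS rw cl (shp la)"
proof
  show "antimono (shp la)" using shp_antimono[OF la] .
  show "bij_betw (\<lambda>x. (rw x, cl x)) SS {(r, c). c < shp la r}"
  proof (rule bij_betwI[of _ _ _ "\<lambda>(r, c). t0 (Suc r, Suc c)"])
    show "(\<lambda>x. (rw x, cl x)) \<in> SS \<rightarrow> {(r, c). c < shp la r}"
    proof
      fix x assume "x \<in> SS"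
      from box_of(1)[OF this] show "(rw x, cl x) \<in> {(r, c). c < shp la r}" by (simp add: mem_diagram)
    qed
    show "(\<lambda>(r, c). t0 (Suc r, Suc c)) \<in> {(r, c). c < shp la r} \<rightarrow> SS"
    proof
      fix y assume "y \<in> {(r, c). c < shp la r}"
      then obtain r c where y: "y = (r, c)" "c < shp la r" by auto
      then have "t0 (Suc r, Suc c) \<in> SS" by (intro of_box(1)) (simp add: mem_diagram)
      then show "(\<lambda>(r, c). t0 (Suc r, Suc c)) y \<in> SS" by (simp add: y)
    qed
    show "(\<lambda>(r, c). t0 (Suc r, Suc c)) (rw x, cl x) = x" if "x \<in> SS" for x
      using box_of(2)[OF that] by simp
    show "(rw ((\<lambda>(r, c). t0 (Suc r, Suc c)) y), cl ((\<lambda>(r, c). t0 (Suc r, Suc c)) y)) = y"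
      if yy: "y \<in> {(r, c). c < shp la r}" for y
    proof -
      obtain r c where y: "y = (r, c)" "c < shp la r" using yy by auto
      then show ?thesis using of_box(2,3)[of r c] by (simp add: mem_diagram)
    qed
  qed
qed simp

sublocale numbering SS rw cl "shp la" by (rule numbering_la)

abbreviation Z :: "(nat \<Rightarrow> nat) \<Rightarrow> nat \<Rightarrow> nat set" where "Z g \<equiv> tabloid la (g \<circ> t0)"
abbreviation E :: "(nat \<Rightarrow> nat) \<Rightarrow> (nat \<Rightarrow> nat set) \<Rightarrow> complex" where "E g \<equiv> polytabloid la (g \<circ> t0)"

lemma row_set: "{t (i, j) |j. (i, j) \<in> diagram la} = (\<lambda>x. t (Suc (rw x), Suc (cl x))) ` {x \<in> SS. Suc (rw x) = i}" (is "?A = ?B")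
proof
  show "?A \<subseteq> ?B"
  proof
    fix y assume "y \<in> ?A"
    then obtain j where j: "y = t (i, j)" "(i, j) \<in> diagram la" by auto
    then have "i \<noteq> 0" "j \<noteq> 0" by (auto simp: mem_diagram)
    then obtain i' j' where ij: "i = Suc i'" "j = Suc j'" by (metis not0_implies_Suc)
    then show "y \<in> ?B" using of_box[of i' j'] j by (intro image_eqI[of _ _ "t0 (i, j)"]) auto
  qed
  show "?B \<subseteq> ?A" using box_of(1) by blast
qed

lemma col_set: "{t (i, j) |i. (i, j) \<in> diagram la} = (\<lambda>x. t (Suc (rw x), Suc (cl x))) ` {x \<in> SS. Suc (cl x) = j}" (is "?A = ?B")
proof
  show "?A \<subseteq> ?B"
  proof
    fix y assume "y \<in> ?A"
    then obtain i where j: "y = t (i, j)" "(i, j) \<in> diagram la" by auto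
    then have "i \<noteq> 0" "j \<noteq> 0" by (auto simp: mem_diagram)
    then obtain i' j' where ij: "i = Suc i'" "j = Suc j'" by (metis not0_implies_Suc)
    then show "y \<in> ?B" using of_box[of i' j'] j by (intro image_eqI[of _ _ "t0 (i, j)"]) auto
  qed
  show "?B \<subseteq> ?A" using box_of(1) by blast
qed

lemma Z_eq: "Z g i = g ` {x \<in> SS. Suc (rw x) = i}"
  unfolding tabloid_def row_set by (rule image_cong) (use box_of(2) in auto)

lemma col_eq: "{(g \<circ> t0) (i, j) |i. (i, j) \<in> diagram la} = g ` {x \<in> SS. Suc (cl x) = j}"
  unfolding col_set by (rule image_cong) (use box_of(2) in auto)

text \<open>Tabloids and column stabilizers are defined by sets of entries, \<open>stab\<close> by
  coordinate functions; this translates between the two.\<close>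

lemma fibres_fixed_iff:
  assumes p: "p permutes SS"
  shows "(\<forall>k. p ` {x \<in> SS. Suc (f x) = k} = {x \<in> SS. Suc (f x) = k}) \<longleftrightarrow> f \<circ> p = f"
proof
  assume fx: "\<forall>k. p ` {x \<in> SS. Suc (f x) = k} = {x \<in> SS. Suc (f x) = k}"
  show "f \<circ> p = f"
  proof
    fix x
    show "(f \<circ> p) x = f x"
    proof (cases "x \<in> SS")
      case True
      then have "p x \<in> p ` {y \<in> SS. Suc (f y) = Suc (f x)}" by blast
      then have "p x \<in> {y \<in> SS. Suc (f y) = Suc (f x)}" using fx by blast
      then show ?thesis by simp
    next
      case False
      then show ?thesis using permutes_not_in[OF p] by simp
    qed
  qed
next
  assume "f \<circ> p = f"
  then have fx: "f (p x) = f x" for x by (metis comp_apply)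
  show "\<forall>k. p ` {x \<in> SS. Suc (f x) = k} = {x \<in> SS. Suc (f x) = k}"
  proof (intro allI equalityI subsetI)
    fix k y assume "y \<in> p ` {x \<in> SS. Suc (f x) = k}"
    then show "y \<in> {x \<in> SS. Suc (f x) = k}" using fx permutes_in_image[OF p] by auto
  next
    fix k y assume y: "y \<in> {x \<in> SS. Suc (f x) = k}"
    have "inv p y \<in> SS" using y permutes_in_image[OF permutes_inv[OF p]] by auto
    moreover have "f (inv p y) = f y" using fx[of "inv p y"] permutes_inverses[OF p] by simp
    ultimately show "y \<in> p ` {x \<in> SS. Suc (f x) = k}"
      using y permutes_inverses(1)[OF p, of y] by (intro image_eqI[of _ _ "inv p y"]) auto
  qed
qed

lemma image_eq_iff_perm:
  assumes u: "u permutes SS"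
  shows "u ` A = v ` B \<longleftrightarrow> (inv u \<circ> v) ` B = A"
proof -
  have "u ` A = v ` B \<longleftrightarrow> inv u ` (u ` A) = inv u ` (v ` B)"
    using permutes_inj[OF permutes_inv[OF u]] by (simp add: inj_image_eq_iff)
  also have "\<dots> \<longleftrightarrow> A = (inv u \<circ> v) ` B"
    by (simp add: image_comp permutes_group[OF u] del: image_comp) (simp add: image_comp permutes_group[OF u])
  finally show ?thesis by auto
qed

lemma Z_eq_iff:
  assumes u: "u permutes SS" and v: "v permutes SS"
  shows "Z u = Z v \<longleftrightarrow> inv u \<circ> v \<in> stab SS rw"
proof -
  have p: "inv u \<circ> v permutes SS" using u v by (simp add: permutes_compose permutes_inv)
  have "Z u = Z v \<longleftrightarrow> (\<forall>k. u ` {x \<in> SS. Suc (rw x) = k} = v ` {x \<in> SS. Suc (rw x) = k})"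
    by (simp only: fun_eq_iff Z_eq)
  also have "\<dots> \<longleftrightarrow> rw \<circ> (inv u \<circ> v) = rw"
    unfolding image_eq_iff_perm[OF u] by (rule fibres_fixed_iff[OF p])
  finally show ?thesis using p by (simp add: stab_def)
qed

lemma column_stabilizer_iff:
  assumes g: "g permutes SS" and p: "p permutes SS"
  shows "p \<in> column_stabilizer la (g \<circ> t0) \<longleftrightarrow> inv g \<circ> p \<circ> g \<in> stab SS cl"
proof -
  have q: "inv g \<circ> p \<circ> g permutes SS" using g p by (simp add: permutes_compose permutes_inv)
  have "p \<in> column_stabilizer la (g \<circ> t0)
    \<longleftrightarrow> (\<forall>k. p ` g ` {x \<in> SS. Suc (cl x) = k} = g ` {x \<in> SS. Suc (cl x) = k})"
    unfolding column_stabilizer_def col_eq using p by (simp add: sum_la)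
  also have "\<dots> \<longleftrightarrow> (\<forall>k. (inv g \<circ> p \<circ> g) ` {x \<in> SS. Suc (cl x) = k} = {x \<in> SS. Suc (cl x) = k})"
    using image_eq_iff_perm[OF g, of "{x \<in> SS. Suc (cl x) = _}" "p \<circ> g" "{x \<in> SS. Suc (cl x) = _}"]
    by (metis (no_types, lifting) comp_assoc image_comp)
  also have "\<dots> \<longleftrightarrow> cl \<circ> (inv g \<circ> p \<circ> g) = cl" by (rule fibres_fixed_iff[OF q])
  finally show ?thesis using q by (simp add: stab_def)
qed

lemma E_eq:
  assumes g: "g permutes SS"
  shows "E g X = (\<Sum>q\<in>stab SS cl. if X = Z (g \<circ> q) then of_int (sign q) else 0)"
proof -
  note gg = permutes_group[OF g]
  have per: "p permutes SS" if "p \<in> column_stabilizer la (g \<circ> t0)" for p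
    using that by (simp add: column_stabilizer_def sum_la)
  show ?thesis unfolding polytabloid_def
  proof (rule sum.reindex_bij_witness[of _ "\<lambda>q. g \<circ> q \<circ> inv g" "\<lambda>p. inv g \<circ> p \<circ> g"])
    fix p assume p: "p \<in> column_stabilizer la (g \<circ> t0)"
    show "g \<circ> (inv g \<circ> p \<circ> g) \<circ> inv g = p" by (simp add: comp_assoc gg)
    show "inv g \<circ> p \<circ> g \<in> stab SS cl" using column_stabilizer_iff[OF g per[OF p]] p by simp
    have "sign (inv g \<circ> p \<circ> g) = sign p"
      using sign_inverse[OF permutes_imp_permutation[OF finite_S g]]
      by (simp add: sign_comp_permutes[OF finite_S permutes_compose[OF per[OF p] gg(4)] g]
          sign_comp_permutes[OF finite_S gg(4) per[OF p]])
    moreover have "p \<circ> (g \<circ> t0) = g \<circ> (inv g \<circ> p \<circ> g) \<circ> t0" by (simp add: comp_assoc gg)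
    ultimately show "(if X = Z (g \<circ> (inv g \<circ> p \<circ> g)) then of_int (sign (inv g \<circ> p \<circ> g)) else 0)
      = (if X = tabloid la (p \<circ> (g \<circ> t0)) then of_int (sign p) else (0::complex))" by simp
  next
    fix q assume q: "q \<in> stab SS cl"
    have p: "g \<circ> q \<circ> inv g permutes SS" using g stab_permutes[OF q] by (simp add: permutes_compose permutes_inv)
    show eq: "inv g \<circ> (g \<circ> q \<circ> inv g) \<circ> g = q" by (simp add: comp_assoc gg)
    show "g \<circ> q \<circ> inv g \<in> column_stabilizer la (g \<circ> t0)"
      unfolding column_stabilizer_iff[OF g p] eq by (rule q)
  qed
qed

text \<open>The bridge to the group: the coefficients of polytabloids in tabloids are values of the
  Young symmetrizer.\<close>

lemma E_Z:
  assumes g: "g permutes SS" and u: "u permutes SS"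
  shows "E g (Z u) = of_real (ysym SS rw cl (inv g \<circ> u))"
  unfolding E_eq[OF g] ysym_def of_real_sum
proof (rule sum.cong[OF refl])
  fix q assume q: "q \<in> stab SS cl"
  note qp = stab_permutes[OF q]
  have "Z u = Z (g \<circ> q) \<longleftrightarrow> inv q \<circ> (inv g \<circ> u) \<in> stab SS rw"
    using Z_eq_iff[OF permutes_compose[OF qp g] u] by (auto simp: inv_comp_permutes[OF g qp] comp_assoc)
  then show "(if Z u = Z (g \<circ> q) then of_int (sign q) else 0)
    = complex_of_real (if inv q \<circ> (inv g \<circ> u) \<in> stab SS rw then of_int (sign q) else 0)" by simp
qed

lemma perm_action_E:
  assumes s: "\<sigma> permutes SS" and g: "g permutes SS"
  shows "perm_action \<sigma> (E g) = E (\<sigma> \<circ> g)"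
proof
  fix X
  have "(\<lambda>i. inv \<sigma> ` X i) = Z (g \<circ> q) \<longleftrightarrow> X = Z (\<sigma> \<circ> g \<circ> q)" for q
  proof -
    have "inv \<sigma> ` X i = Z (g \<circ> q) i \<longleftrightarrow> X i = Z (\<sigma> \<circ> g \<circ> q) i" for i
      using image_eq_iff_perm[OF permutes_inv[OF s], of "X i" "g \<circ> q" "{x \<in> SS. Suc (rw x) = i}"]
      unfolding Z_eq permutes_group(3)[OF s] o_assoc by (simp only: eq_commute)
    then show ?thesis by (simp only: fun_eq_iff)
  qed
  then show "perm_action \<sigma> (E g) X = E (\<sigma> \<circ> g) X"
    by (simp add: perm_action_def E_eq[OF g] E_eq[OF permutes_compose[OF g s]])
qed

text \<open>A tableau may take any values outside the diagram, and polytabloids see only the values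
  on it. Up to those values every tableau is \<open>t0\<close> followed by a permutation.\<close>

lemma tableau_perm:
  assumes t: "t \<in> young_tableaux la"
  obtains g where "g permutes SS" "\<And>b. b \<in> diagram la \<Longrightarrow> t b = (g \<circ> t0) b"
proof -
  have bt: "bij_betw t (diagram la) SS" using t by (simp add: young_tableaux_def sum_la)
  define g where "g x = (if x \<in> SS then t (inv_into (diagram la) t0 x) else x)" for x
  have "bij_betw (\<lambda>x. t (inv_into (diagram la) t0 x)) SS SS"
    using bij_betw_trans[OF bij_betw_inv_into[OF bij_t0] bt] by (simp add: o_def)
  then have "bij_betw g SS SS" by (rule bij_betw_cong[THEN iffD1, rotated]) (simp add: g_def)
  then have "g permutes SS" by (rule bij_imp_permutes) (auto simp: g_def)
  moreover have "t b = (g \<circ> t0) b" if "b \<in> diagram la" for b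
    using that bij_t0 by (auto simp: g_def bij_betw_def)
  ultimately show thesis by (rule that)
qed

lemma polytabloid_cong:
  assumes "\<And>b. b \<in> diagram la \<Longrightarrow> t b = t' b"
  shows "polytabloid la t = polytabloid la t'"
proof -
  have 1: "tabloid la (p \<circ> t) = tabloid la (p \<circ> t')" for p
  proof
    fix i
    show "tabloid la (p \<circ> t) i = tabloid la (p \<circ> t') i"
      unfolding tabloid_def using assms by (metis (no_types, lifting) comp_apply)
  qed
  have "{t (i, j) |i. (i, j) \<in> diagram la} = {t' (i, j) |i. (i, j) \<in> diagram la}" for j
    using assms by (metis (no_types, lifting))
  then have "column_stabilizer la t = column_stabilizer la t'" unfolding column_stabilizer_def by simp
  then show ?thesis unfolding polytabloid_def 1 by simp
qed

lemma specht_module_eq: "specht_module la = fun_space.span (E ` {g. g permutes SS})"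
proof -
  have "polytabloid la ` young_tableaux la = E ` {g. g permutes SS}"
  proof (intro equalityI subsetI)
    fix v assume "v \<in> polytabloid la ` young_tableaux la"
    then obtain t where t: "t \<in> young_tableaux la" "v = polytabloid la t" by blast
    obtain g where "g permutes SS" "\<And>b. b \<in> diagram la \<Longrightarrow> t b = (g \<circ> t0) b" using tableau_perm[OF t(1)] by blast
    then show "v \<in> E ` {g. g permutes SS}" using polytabloid_cong[of t "g \<circ> t0"] t(2) by blast
  next
    fix v assume "v \<in> E ` {g. g permutes SS}"
    then obtain g where g: "g permutes SS" "v = E g" by blast
    have "bij_betw (g \<circ> t0) (diagram la) SS"
      using bij_betw_trans[OF bij_t0 permutes_imp_bij[OF g(1)]] .
    then show "v \<in> polytabloid la ` young_tableaux la" using g(2) by (auto simp: young_tableaux_def sum_la)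
  qed
  then show ?thesis by (simp add: specht_module_def)
qed

text \<open>Quasi-idempotency says that evaluation at \<open>Z g\<close>, divided by
  \<open>ynorm\<close>, is a coefficient functional for \<open>E g\<close>: together they reproduce
  every vector of the module. The trace becomes a sum of values of \<open>a\<close> on the
  conjugates of the inverse of \<open>\<sigma>\<close>, that is,
  \<open>hsum (inv \<sigma>) / ynorm\<close>.\<close>

lemma irr_char_eq:
  assumes s: "\<sigma> permutes SS"
  shows "irr_char la \<sigma> = of_real (hsum \<sigma> / ynorm)"
proof -
  let ?c = "complex_of_real ynorm"
  have c: "?c \<noteq> 0" using ynorm_pos by simp
  let ?ph = "\<lambda>g v. v (Z g) / ?c"
  have exE: "E h X = (\<Sum>g\<in>G. E h (Z g) / ?c * E g X)" if h: "h permutes SS" for h X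
  proof (cases "X \<in> Z ` G")
    case True
    then obtain u where u: "u permutes SS" "X = Z u" by blast
    have "(\<Sum>g\<in>G. E h (Z g) / ?c * E g X)
      = (\<Sum>g\<in>G. of_real (ysym SS rw cl (inv h \<circ> g) * ysym SS rw cl (inv g \<circ> u))) / ?c"
      unfolding sum_divide_distrib by (rule sum.cong[OF refl]) (simp add: u E_Z h)
    also have "\<dots> = of_real (\<Sum>g\<in>G. ysym SS rw cl (inv h \<circ> g) * ysym SS rw cl (inv g \<circ> u)) / ?c" by simp
    also have "(\<Sum>g\<in>G. ysym SS rw cl (inv h \<circ> g) * ysym SS rw cl (inv g \<circ> u))
      = (\<Sum>g\<in>G. ysym SS rw cl (inv h \<circ> (h \<circ> g)) * ysym SS rw cl (inv (h \<circ> g) \<circ> u))"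
      by (rule sum_perm_left[OF h, symmetric])
    also have "\<dots> = (\<Sum>g\<in>G. ysym SS rw cl g * ysym SS rw cl (inv g \<circ> (inv h \<circ> u)))"
      by (rule sum.cong[OF refl]) (simp add: permutes_group[OF h] inv_comp_permutes[OF h] comp_assoc)
    also have "\<dots> = ynorm * ysym SS rw cl (inv h \<circ> u)"
      using h u by (intro a_conv') (simp add: permutes_compose permutes_inv)
    finally have sum: "(\<Sum>g\<in>G. E h (Z g) / ?c * E g X) = of_real (ynorm * ysym SS rw cl (inv h \<circ> u)) / ?c" .
    have "E h X = of_real (ysym SS rw cl (inv h \<circ> u))" unfolding u(2) by (rule E_Z[OF h u(1)])
    moreover have "of_real (ynorm * ysym SS rw cl (inv h \<circ> u)) / ?c = of_real (ysym SS rw cl (inv h \<circ> u))"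
      using c by simp
    ultimately show ?thesis by (simp only: sum)
  next
    case False
    have "E g X = 0" if "g permutes SS" for g
      unfolding E_eq[OF that] using False that stab_permutes[of _ SS cl]
      by (intro sum.neutral) (auto simp: permutes_compose)
    then show ?thesis using h by simp
  qed
  have lin: "(\<lambda>X. \<Sum>g\<in>G. v (Z g) / ?c * E g X) = v" if "v \<in> specht_module la" for v
    using that unfolding specht_module_eq
  proof (induction rule: fun_space.span_induct_alt)
    case base
    then show ?case by (simp add: fun_eq_iff)
  next
    case (step k x y)
    then obtain h where h: "h permutes SS" "x = E h" by blast
    show ?case
    proof
      fix X
      have "(\<Sum>g\<in>G. (fun_scale k x + y) (Z g) / ?c * E g X)
        = k * (\<Sum>g\<in>G. x (Z g) / ?c * E g X) + (\<Sum>g\<in>G. y (Z g) / ?c * E g X)"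
        unfolding sum_distrib_left sum.distrib[symmetric]
        by (rule sum.cong[OF refl]) (simp add: fun_scale_def add_divide_distrib ring_distribs)
      also have "(\<Sum>g\<in>G. x (Z g) / ?c * E g X) = x X" unfolding h(2) by (rule exE[OF h(1), symmetric])
      also have "(\<Sum>g\<in>G. y (Z g) / ?c * E g X) = y X" using step(2) by (rule fun_cong)
      also have "k * x X + y X = (fun_scale k x + y) X" by (simp add: fun_scale_def)
      finally show "(\<Sum>g\<in>G. (fun_scale k x + y) (Z g) / ?c * E g X) = (fun_scale k x + y) X" .
    qed
  qed
  have "irr_char la \<sigma> = (\<Sum>g\<in>G. ?ph g (perm_action \<sigma> (E g)))"
    unfolding irr_char_def
  proof (rule subspace_trace_eq[OF finite_G specht_module_eq])
    show "v = (\<Sum>g\<in>G. fun_scale (?ph g v) (E g))" if "v \<in> specht_module la" for v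
      using lin[OF that] by (simp add: fun_eq_iff fun_sum_apply fun_scale_def)
    show "perm_action \<sigma> v \<in> specht_module la" if "v \<in> specht_module la" for v
      using that unfolding specht_module_eq
    proof (induction rule: fun_space.span_induct_alt)
      case base
      have "perm_action \<sigma> 0 = 0" by (simp add: perm_action_def fun_eq_iff)
      then show ?case by (simp only: fun_space.span_zero)
    next
      case (step k x y)
      then obtain h where h: "h permutes SS" "x = E h" by blast
      have "perm_action \<sigma> (fun_scale k x + y) = fun_scale k (perm_action \<sigma> x) + perm_action \<sigma> y"
        by (simp add: perm_action_def fun_scale_def fun_eq_iff)
      moreover have "perm_action \<sigma> x \<in> E ` G" using h perm_action_E[OF s h(1)] permutes_compose[OF h(1) s] by auto
      then have "perm_action \<sigma> x \<in> fun_space.span (E ` G)" by (rule fun_space.span_base)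
      then have "fun_scale k (perm_action \<sigma> x) + perm_action \<sigma> y \<in> fun_space.span (E ` G)"
        using step(2) by (intro fun_space.span_add fun_space.span_scale)
      ultimately show ?case by (simp only:)
    qed
  qed (simp_all add: perm_action_def fun_scale_def add_divide_distrib)
  also have "\<dots> = (\<Sum>g\<in>G. of_real (ysym SS rw cl (inv g \<circ> inv \<sigma> \<circ> g)) / ?c)"
    by (rule sum.cong[OF refl]) (simp add: perm_action_E[OF s] E_Z permutes_compose s inv_comp_permutes[OF s])
  also have "\<dots> = of_real (hsum (inv \<sigma>) / ynorm)"
    by (simp add: hsum_def sum_divide_distrib)
  finally show ?thesis by (simp add: hsum_inv[OF s])
qed

end

section \<open>Partitions as lists and as functions\<close>

lemma shp_zero: "length la \<le> r \<Longrightarrow> shp la r = 0"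
  by (simp add: shp_def part_def)

lemma shp_nth: "r < length la \<Longrightarrow> shp la r = la ! r"
  by (simp add: shp_def part_def)

lemma sum_shp: "length la \<le> N \<Longrightarrow> (\<Sum>r<N. shp la r) = sum_list la"
proof -
  assume N: "length la \<le> N"
  have "(\<Sum>r<N. shp la r) = (\<Sum>r<length la. shp la r)"
    by (rule sum.mono_neutral_right) (use N shp_zero in auto)
  then show ?thesis by (simp add: sum_list_sum_nth atLeast0LessThan shp_nth)
qed

lemma length_partition:
  assumes "la \<in> partitions n"
  shows "length la \<le> n"
proof -
  have "length la = (\<Sum>r<length la. 1)" by simp
  also have "\<dots> \<le> (\<Sum>r<length la. la ! r)"
    using assms by (intro sum_mono) (metis (no_types, lifting) One_nat_def Suc_leI lessThan_iff
        mem_Collect_eq not_gr_zero nth_mem partitions_def)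
  also have "\<dots> = n" using assms by (simp add: partitions_def sum_list_sum_nth atLeast0LessThan)
  finally show ?thesis .
qed

lemma shp_par:
  assumes "la \<in> partitions n" "n \<le> N"
  shows "shp la \<in> par N n"
proof -
  have len: "length la \<le> N" using length_partition[OF assms(1)] assms(2) by simp
  then show ?thesis
    using shp_antimono[OF assms(1)] sum_shp[OF len] assms(1) shp_zero
    by (simp add: par_def shape_def vsize_def partitions_def)
qed

lemma shp_inj:
  assumes la: "la \<in> partitions n" and mu: "mu \<in> partitions m" and eq: "shp la = shp mu"
  shows "la = mu"
proof -
  have len: "r < length ka \<longleftrightarrow> shp ka r \<noteq> 0" if "ka \<in> partitions k" for ka k r
    using that shp_zero[of ka r] shp_nth[of r ka] unfolding partitions_def
    by (metis (mono_tags, lifting) linorder_not_less mem_Collect_eq nth_mem)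
  have "r < length la \<longleftrightarrow> r < length mu" for r using len[OF la] len[OF mu] eq by simp
  then have "length la = length mu" by (metis linorder_neqE_nat less_irrefl)
  moreover have "la ! r = mu ! r" if "r < length la" for r
    using shp_nth[OF that] shp_nth[of r mu] that calculation eq by simp
  ultimately show ?thesis by (rule nth_equalityI)
qed

lemma shp_surj:
  assumes a: "a \<in> par N n"
  obtains la where "la \<in> partitions n" "shp la = a"
proof -
  have sh: "shape N a" "vsize N a = n" using a by (auto simp: par_def)
  define k where "k = (LEAST r. a r = 0)"
  have ex: "a N = 0" using sh(1) by (simp add: shape_def)
  then have kN: "k \<le> N" unfolding k_def by (rule Least_le)
  have k0: "a k = 0" unfolding k_def using ex by (rule LeastI)
  have anti: "antimono a" using sh(1) by (simp add: shape_def)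
  have z: "a r = 0" if "k \<le> r" for r using antimonoD[OF anti that] k0 by simp
  have nz: "a r \<noteq> 0" if "r < k" for r using not_less_Least that unfolding k_def by blast
  let ?la = "map a [0..<k]"
  have shp: "shp ?la = a"
  proof
    fix r show "shp ?la r = a r" using z[of r] by (cases "r < k") (auto simp: shp_def part_def)
  qed
  moreover have "sum_list ?la = n" using sum_shp[of ?la N] kN sh(2) shp by (simp add: vsize_def)
  moreover have "sorted_wrt (\<ge>) ?la" using anti by (auto simp: sorted_wrt_iff_nth_less antimono_def)
  moreover have "0 \<notin> set ?la"
  proof
    assume "0 \<in> set ?la"
    then obtain r where "r < k" "a r = 0" by auto
    then show False using nz by blast
  qed
  ultimately show thesis using that[of ?la] by (simp add: partitions_def)
qed

lemma bij_shp: "n \<le> N \<Longrightarrow> bij_betw shp (partitions n) (par N n)"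
  unfolding bij_betw_def using shp_par shp_inj shp_surj by (auto simp: inj_on_def) (metis imageI)

lemma finite_partitions: "finite (partitions n)"
  using bij_betw_finite[OF bij_shp[OF order_refl]] finite_par by blast

lemma sum_par: "n \<le> N \<Longrightarrow> (\<Sum>l\<in>par N n. F l) = (\<Sum>la\<in>partitions n. F (shp la))"
  using sum.reindex_bij_betw[OF bij_shp, of n N F] by simp

lemma specht_exists:
  assumes la: "la \<in> partitions n"
  obtains t0 where "specht la n t0"
proof -
  let ?S = "SIGMA r:{..<n}. {..<shp la r}"
  have D: "diagram la = (\<lambda>(r, c). (Suc r, Suc c)) ` ?S"
  proof (intro equalityI subsetI)
    fix b assume "b \<in> diagram la"
    then obtain i j where b: "b = (i, j)" "(i, j) \<in> diagram la" by (cases b) auto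
    then have ij: "1 \<le> i" "1 \<le> j" "j \<le> shp la (i - 1)" by (auto simp: mem_diagram)
    have "i - 1 < n" using ij shp_zero[of la "i - 1"] length_partition[OF la] by (cases "i - 1 < n") auto
    then show "b \<in> (\<lambda>(r, c). (Suc r, Suc c)) ` ?S"
      using ij b(1) by (intro image_eqI[of _ _ "(i - 1, j - 1)"]) auto
  qed (auto simp: mem_diagram)
  have "inj_on (\<lambda>(r, c). (Suc r, Suc c)) ?S" by (auto simp: inj_on_def)
  then have "card (diagram la) = card ?S" unfolding D by (rule card_image)
  also have "\<dots> = (\<Sum>r<n. shp la r)" by (simp add: card_SigmaI)
  also have "\<dots> = n" using sum_shp[OF length_partition[OF la]] la by (simp add: partitions_def)
  finally have "card (diagram la) = card {1..n}" by simp
  moreover have "finite (diagram la)" unfolding D by simp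
  ultimately obtain t where "bij_betw t (diagram la) {1..n}"
    using finite_same_card_bij[of "diagram la" "{1..n}"] by auto
  then show thesis using that[of t] la by (simp add: specht_def young_tableaux_def partitions_def)
qed

text \<open>The characters are real on permutations of \<open>{1..n}\<close>, so inner products are
  written without complex conjugation.\<close>

definition chi :: "nat list \<Rightarrow> (nat \<Rightarrow> nat) \<Rightarrow> real" where
  "chi la \<sigma> = Re (irr_char la \<sigma>)"

abbreviation perms :: "nat \<Rightarrow> (nat \<Rightarrow> nat) set" where
  "perms n \<equiv> {\<sigma>. \<sigma> permutes {1..n}}"

lemma finite_support_shp: "finite {i. shp la i \<noteq> 0}"
  by (rule words_support_nat[of "length la"]) (rule shp_zero)

text \<open>The facts on Specht modules that enter Young's rule: norm 1 and a pairing with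
  permutation characters that is unitriangular for dominance. Inner products are not divided by the
  group order, whence \<open>fact n\<close>.\<close>

lemma chi_props:
  assumes la: "la \<in> partitions n"
  shows "\<sigma> \<in> perms n \<Longrightarrow> irr_char la \<sigma> = of_real (chi la \<sigma>)"
    and "(\<Sum>\<sigma>\<in>perms n. chi la \<sigma> * chi la \<sigma>) = fact n"
    and "(\<Sum>\<sigma>\<in>perms n. chi la \<sigma> * real (xi {1..n} (shp la) \<sigma>)) = fact n"
    and "finite {i. m i \<noteq> 0} \<Longrightarrow> (\<Sum>\<sigma>\<in>perms n. chi la \<sigma> * real (xi {1..n} m \<sigma>)) \<noteq> 0 \<Longrightarrow>
      (\<Sum>k<i. m k) \<le> (\<Sum>k<i. shp la k)"
proof -
  obtain t0 where "specht la n t0" using specht_exists[OF la] .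
  then interpret s: specht la n t0 .
  have eq: "irr_char la \<sigma> = of_real (s.hsum \<sigma> / s.ynorm)" if "\<sigma> \<in> perms n" for \<sigma>
    using s.irr_char_eq that by simp
  then have chi: "chi la \<sigma> = s.hsum \<sigma> / s.ynorm" if "\<sigma> \<in> perms n" for \<sigma>
    using that by (simp add: chi_def)
  show "\<sigma> \<in> perms n \<Longrightarrow> irr_char la \<sigma> = of_real (chi la \<sigma>)" using eq chi by simp
  have "(\<Sum>\<sigma>\<in>perms n. chi la \<sigma> * chi la \<sigma>) = (\<Sum>\<sigma>\<in>perms n. s.hsum \<sigma> * s.hsum \<sigma>) / s.ynorm\<^sup>2"
    unfolding sum_divide_distrib by (rule sum.cong[OF refl]) (simp add: chi power2_eq_square)
  then show "(\<Sum>\<sigma>\<in>perms n. chi la \<sigma> * chi la \<sigma>) = fact n"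
    using s.hsum_norm s.ynorm_pos by simp
  have x: "(\<Sum>\<sigma>\<in>perms n. chi la \<sigma> * real (xi {1..n} m \<sigma>)) = (\<Sum>\<sigma>\<in>perms n. s.hsum \<sigma> * real (xi {1..n} m \<sigma>)) / s.ynorm"
    for m :: "nat \<Rightarrow> nat"
    unfolding sum_divide_distrib by (rule sum.cong[OF refl]) (simp add: chi)
  show "(\<Sum>\<sigma>\<in>perms n. chi la \<sigma> * real (xi {1..n} (shp la) \<sigma>)) = fact n"
    unfolding x using s.hsum_xi_self[OF finite_support_shp] s.ynorm_pos by simp
  show "(\<Sum>k<i. m k) \<le> (\<Sum>k<i. shp la k)"
    if "finite {i. m i \<noteq> 0}" "(\<Sum>\<sigma>\<in>perms n. chi la \<sigma> * real (xi {1..n} m \<sigma>)) \<noteq> 0"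
    using s.hsum_xi_dominance[OF that(1)] that(2) unfolding x by auto
qed

section \<open>Products of permutation characters\<close>

lemma finite_mats: "finite (mats N c d)"
proof -
  let ?B = "\<Sum>i<N. c i"
  have "mats N c d \<subseteq> (\<lambda>f x. if fst x < N \<and> snd x < N then f x else 0) ` (({..<N} \<times> {..<N}) \<rightarrow>\<^sub>E {..?B})"
  proof
    fix m assume m: "m \<in> mats N c d"
    have "m (i, j) \<le> ?B" if "i < N" "j < N" for i j
    proof -
      have "m (i, j) \<le> (\<Sum>j<N. m (i, j))" using that by (intro member_le_sum) auto
      also have "\<dots> = c i" using m that by (simp add: mats_def)
      also have "\<dots> \<le> ?B" using that by (intro member_le_sum) auto
      finally show ?thesis .
    qed
    then have "restrict m ({..<N} \<times> {..<N}) \<in> ({..<N} \<times> {..<N}) \<rightarrow>\<^sub>E {..?B}" by auto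
    moreover have "m = (\<lambda>x. if fst x < N \<and> snd x < N then restrict m ({..<N} \<times> {..<N}) x else 0)"
    proof
      fix x show "m x = (if fst x < N \<and> snd x < N then restrict m ({..<N} \<times> {..<N}) x else 0)"
        using m by (cases x) (auto simp: mats_def not_less)
    qed
    ultimately show "m \<in> (\<lambda>f x. if fst x < N \<and> snd x < N then f x else 0) ` (({..<N} \<times> {..<N}) \<rightarrow>\<^sub>E {..?B})"
      by blast
  qed
  then show ?thesis by (rule finite_subset) (auto intro!: finite_PiE)
qed

text \<open>Two fixed words are one fixed word in pairs of letters, whose content is a matrix with
  margins \<open>c\<close> and \<open>d\<close>.\<close>

lemma xi_mult:
  assumes S: "finite S" and s: "\<sigma> permutes S"
    and c: "\<And>i. N \<le> i \<Longrightarrow> c i = 0" and d: "\<And>i. N \<le> i \<Longrightarrow> d i = 0"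
  shows "xi S c \<sigma> * xi S d \<sigma> = (\<Sum>m\<in>mats N c d. xi S m \<sigma>)"
proof -
  have si: "\<sigma> x \<in> S \<longleftrightarrow> x \<in> S" for x using permutes_in_image[OF s] .
  let ?P = "{f \<in> words S c. f \<circ> \<sigma> = f} \<times> {f \<in> words S d. f \<circ> \<sigma> = f}"
  let ?M = "\<lambda>(f, f') (i, j). card {x \<in> S. f x = i \<and> f' x = j}"
  have fin: "finite ?P"
    using finite_words[OF S words_support_nat[OF c]] finite_words[OF S words_support_nat[OF d]] by simp
  have lt: "f x < N" if "f \<in> words S e" "x \<in> S" "\<And>i. N \<le> i \<Longrightarrow> e i = 0" for f x e
    by (rule ccontr) (use words_range[OF S that(1,2)] that(3)[of "f x"] in simp)
  have split: "card {x \<in> S. P x} = (\<Sum>j<N. card {x \<in> S. P x \<and> f x = j})" if "f \<in> words S e" "\<And>i. N \<le> i \<Longrightarrow> e i = 0" for f e P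
  proof -
    have "card {x \<in> S. P x} = (\<Sum>x\<in>{x \<in> S. P x}. 1)" by simp
    also have "\<dots> = (\<Sum>j<N. \<Sum>x\<in>{x \<in> {x \<in> S. P x}. f x = j}. 1)"
    proof (rule sum.group[symmetric])
      show "f ` {x \<in> S. P x} \<subseteq> {..<N}" using lt[OF that(1) _ that(2)] by blast
    qed (use S in auto)
    also have "\<dots> = (\<Sum>j<N. card {x \<in> S. P x \<and> f x = j})" by (simp add: conj_assoc)
    finally show ?thesis .
  qed
  have "xi S c \<sigma> * xi S d \<sigma> = (\<Sum>p\<in>?P. 1)" by (simp add: xi_def card_cartesian_product)
  also have "\<dots> = (\<Sum>m\<in>mats N c d. \<Sum>p\<in>{p \<in> ?P. ?M p = m}. 1)"
  proof (rule sum.group[symmetric, OF fin finite_mats], rule image_subsetI)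
    fix p assume "p \<in> ?P"
    then obtain f f' where p: "p = (f, f')" "f \<in> words S c" "f' \<in> words S d" by auto
    have "(\<Sum>j<N. card {x \<in> S. f x = i \<and> f' x = j}) = c i" for i
      using split[OF p(3) d, of "\<lambda>x. f x = i"] words_content[OF p(2), of i] by simp
    moreover have "(\<Sum>i<N. card {x \<in> S. f x = i \<and> f' x = j}) = d j" for j
      using split[OF p(2) c, of "\<lambda>x. f' x = j"] words_content[OF p(3), of j] by (simp add: conj_commute)
    moreover have "card {x \<in> S. f x = i \<and> f' x = j} = 0" if "N \<le> i \<or> N \<le> j" for i j
    proof -
      have "{x \<in> S. f x = i \<and> f' x = j} = {}" using lt[OF p(2) _ c] lt[OF p(3) _ d] that by (auto simp: not_le[symmetric])
      then show ?thesis by (metis card.empty)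
    qed
    ultimately show "?M p \<in> mats N c d" by (simp add: p(1) mats_def)
  qed
  also have "\<dots> = (\<Sum>m\<in>mats N c d. xi S m \<sigma>)"
  proof (rule sum.cong[OF refl])
    fix m assume m: "m \<in> mats N c d"
    have "card {p \<in> ?P. ?M p = m} = xi S m \<sigma>" unfolding xi_def
    proof (rule bij_betw_same_card[of "\<lambda>(f, f'). restrict (\<lambda>x. (f x, f' x)) S"],
        rule bij_betwI[of _ _ _ "\<lambda>h. (restrict (fst \<circ> h) S, restrict (snd \<circ> h) S)"])
      show "(\<lambda>(f, f'). restrict (\<lambda>x. (f x, f' x)) S) \<in> {p \<in> ?P. ?M p = m} \<rightarrow> {h \<in> words S m. h \<circ> \<sigma> = h}"
      proof
        fix p assume "p \<in> {p \<in> ?P. ?M p = m}"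
        then obtain f f' where p: "p = (f, f')" "f \<circ> \<sigma> = f" "f' \<circ> \<sigma> = f'" "?M (f, f') = m" by auto
        have fx: "f (\<sigma> x) = f x" "f' (\<sigma> x) = f' x" for x using p(2,3) by (metis comp_apply)+
        have "card {x \<in> S. restrict (\<lambda>x. (f x, f' x)) S x = y} = m y" for y
        proof -
          have "{x \<in> S. restrict (\<lambda>x. (f x, f' x)) S x = y} = {x \<in> S. f x = fst y \<and> f' x = snd y}"
            by (auto simp: prod_eq_iff)
          then show ?thesis using fun_cong[OF p(4), of y] by (cases y) simp
        qed
        moreover have "restrict (\<lambda>x. (f x, f' x)) S \<circ> \<sigma> = restrict (\<lambda>x. (f x, f' x)) S"
          using si fx by (auto simp: fun_eq_iff permutes_not_in[OF s])
        ultimately show "(\<lambda>(f, f'). restrict (\<lambda>x. (f x, f' x)) S) p \<in> {h \<in> words S m. h \<circ> \<sigma> = h}"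
          by (simp add: p(1) words_def)
      qed
      show "(\<lambda>h. (restrict (fst \<circ> h) S, restrict (snd \<circ> h) S)) \<in> {h \<in> words S m. h \<circ> \<sigma> = h} \<rightarrow> {p \<in> ?P. ?M p = m}"
      proof
        fix h assume "h \<in> {h \<in> words S m. h \<circ> \<sigma> = h}"
        then have h: "h \<in> words S m" "h \<circ> \<sigma> = h" by auto
        have hx: "h (\<sigma> x) = h x" for x using h(2) by (metis comp_apply)
        have hN: "fst (h x) < N" "snd (h x) < N" if "x \<in> S" for x
        proof -
          have "m (h x) \<noteq> 0" using words_range[OF S h(1) that] .
          then have "\<not> (N \<le> fst (h x) \<or> N \<le> snd (h x))" using m unfolding mats_def by (cases "h x") auto
          then show "fst (h x) < N" "snd (h x) < N" by auto
        qed
        have hm: "card {x \<in> S. fst (h x) = i \<and> snd (h x) = j} = m (i, j)" for i j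
          using words_content[OF h(1), of "(i, j)"] by (simp add: prod_eq_iff)
        have grp: "card {x \<in> S. P x} = (\<Sum>j<N. card {x \<in> S. P x \<and> k x = j})" if "\<And>x. x \<in> S \<Longrightarrow> k x < N" for k P
        proof -
          have "card {x \<in> S. P x} = (\<Sum>x\<in>{x \<in> S. P x}. 1)" by simp
          also have "\<dots> = (\<Sum>j<N. \<Sum>x\<in>{x \<in> {x \<in> S. P x}. k x = j}. 1)"
            by (rule sum.group[symmetric]) (use S that in auto)
          also have "\<dots> = (\<Sum>j<N. card {x \<in> S. P x \<and> k x = j})" by (simp add: conj_assoc)
          finally show ?thesis .
        qed
        have "card {x \<in> S. fst (h x) = i} = c i" for i
        proof (cases "i < N")
          case True
          then show ?thesis using grp[of "\<lambda>x. snd (h x)" "\<lambda>x. fst (h x) = i"] hN(2) hm m by (simp add: mats_def)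
        next
          case False
          then have "{x \<in> S. fst (h x) = i} = {}" using hN(1) by auto
          then show ?thesis using c[of i] False by (metis card.empty linorder_not_less)
        qed
        then have w1: "restrict (fst \<circ> h) S \<in> words S c" by (simp add: words_def cong: conj_cong)
        have "card {x \<in> S. snd (h x) = j} = d j" for j
        proof (cases "j < N")
          case True
          then show ?thesis using grp[of "\<lambda>x. fst (h x)" "\<lambda>x. snd (h x) = j"] hN(1) hm m
            by (simp add: mats_def conj_commute)
        next
          case False
          then have "{x \<in> S. snd (h x) = j} = {}" using hN(2) by auto
          then show ?thesis using d[of j] False by (metis card.empty linorder_not_less)
        qed
        then have w2: "restrict (snd \<circ> h) S \<in> words S d" by (simp add: words_def cong: conj_cong)
        have "restrict (fst \<circ> h) S \<circ> \<sigma> = restrict (fst \<circ> h) S" "restrict (snd \<circ> h) S \<circ> \<sigma> = restrict (snd \<circ> h) S"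
          using si hx by (auto simp: fun_eq_iff permutes_not_in[OF s])
        moreover have "?M (restrict (fst \<circ> h) S, restrict (snd \<circ> h) S) = m"
          using hm by (auto simp: fun_eq_iff cong: conj_cong)
        ultimately show "(restrict (fst \<circ> h) S, restrict (snd \<circ> h) S) \<in> {p \<in> ?P. ?M p = m}"
          using w1 w2 by simp
      qed
      show "(\<lambda>h. (restrict (fst \<circ> h) S, restrict (snd \<circ> h) S)) ((\<lambda>(f, f'). restrict (\<lambda>x. (f x, f' x)) S) p) = p"
        if "p \<in> {p \<in> ?P. ?M p = m}" for p
        using that by (auto simp: fun_eq_iff words_def extensional_def restrict_def)
      show "(\<lambda>(f, f'). restrict (\<lambda>x. (f x, f' x)) S) (restrict (fst \<circ> h) S, restrict (snd \<circ> h) S) = h"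
        if "h \<in> {h \<in> words S m. h \<circ> \<sigma> = h}" for h
        using that by (auto simp: fun_eq_iff words_def extensional_def restrict_def)
    qed
    then show "(\<Sum>p\<in>{p \<in> ?P. ?M p = m}. 1) = xi S m \<sigma>" by simp
  qed
  finally show ?thesis .
qed

text \<open>Every matrix stands for one transitive action, whose permutation character sums to the
  group order.\<close>

lemma xi_inner:
  assumes c: "\<And>i. N \<le> i \<Longrightarrow> c i = 0" and d: "\<And>i. N \<le> i \<Longrightarrow> d i = 0" and n: "(\<Sum>i<N. c i) = n"
  shows "(\<Sum>\<sigma>\<in>perms n. real (xi {1..n} c \<sigma>) * real (xi {1..n} d \<sigma>)) = fact n * real (card (mats N c d))"
proof -
  have "(\<Sum>\<sigma>\<in>perms n. xi {1..n} c \<sigma> * xi {1..n} d \<sigma>) = (\<Sum>\<sigma>\<in>perms n. \<Sum>m\<in>mats N c d. xi {1..n} m \<sigma>)"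
    by (rule sum.cong[OF refl]) (simp add: xi_mult[OF _ _ c d])
  also have "\<dots> = (\<Sum>m\<in>mats N c d. \<Sum>\<sigma>\<in>perms n. xi {1..n} m \<sigma>)" by (rule sum.swap)
  also have "\<dots> = (\<Sum>m\<in>mats N c d. fact n)"
  proof (rule sum.cong[OF refl])
    fix m assume m: "m \<in> mats N c d"
    have sub: "{x. m x \<noteq> 0} \<subseteq> {..<N} \<times> {..<N}"
    proof
      fix x assume x: "x \<in> {x. m x \<noteq> 0}"
      obtain i j where ij: "x = (i, j)" by (cases x)
      have "N \<le> i \<or> N \<le> j \<longrightarrow> m (i, j) = 0" using m by (simp add: mats_def)
      then have "\<not> (N \<le> i \<or> N \<le> j)" using x by (simp add: ij)
      then show "x \<in> {..<N} \<times> {..<N}" by (simp add: ij)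
    qed
    have fin: "finite {x. m x \<noteq> 0}" using sub by (rule finite_subset) simp
    have "(\<Sum>x | m x \<noteq> 0. m x) = (\<Sum>x\<in>{..<N} \<times> {..<N}. m x)"
      by (rule sum.mono_neutral_left) (use sub in auto)
    also have "\<dots> = (\<Sum>i<N. \<Sum>j<N. m (i, j))" by (simp add: sum.cartesian_product)
    also have "\<dots> = n" using m n by (simp add: mats_def)
    finally have "(\<Sum>x | m x \<noteq> 0. m x) = card {1..n}" by simp
    from sum_xi[OF _ fin this] show "(\<Sum>\<sigma>\<in>perms n. xi {1..n} m \<sigma>) = fact n" by simp
  qed
  finally have "(\<Sum>\<sigma>\<in>perms n. xi {1..n} c \<sigma> * xi {1..n} d \<sigma>) = card (mats N c d) * fact n" by simp
  then have "real (\<Sum>\<sigma>\<in>perms n. xi {1..n} c \<sigma> * xi {1..n} d \<sigma>) = real (card (mats N c d) * fact n)" by (simp only:)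
  then show ?thesis by (simp add: mult.commute)
qed

section \<open>Young's rule\<close>

abbreviation kos :: "nat \<Rightarrow> nat list \<Rightarrow> (nat \<Rightarrow> nat) \<Rightarrow> nat" where
  "kos N la c \<equiv> kostka N (\<lambda>_. 0) (shp la) c"

context
  fixes n N :: nat
  assumes nN: "n \<le> N" and N: "0 < N"
begin

declare One_nat_def [simp del]

lemma kos_triangular:
  assumes "la \<in> partitions n" "mu \<in> partitions n" "kos N la (shp mu) \<noteq> 0" "la \<noteq> mu"
  shows "rank N (shp mu) < rank N (shp la)"
proof (rule rank_less)
  have sh: "shape N (shp la)" "shape N (shp mu)" using shp_par[OF _ nN] assms(1,2) by (auto simp: par_def)
  then show "shape N (shp la)" "shape N (shp mu)" by auto
  show "(\<Sum>r<i. shp mu r) \<le> (\<Sum>r<i. shp la r)" for i by (rule kostka_dominance[OF assms(3) sh(1)])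
  show "shp la \<noteq> shp mu" using shp_inj[OF assms(1,2)] assms(4) by blast
qed

lemma kos_self: "la \<in> partitions n \<Longrightarrow> kos N la (shp la) = 1"
  using shp_par[OF _ nN, of la] by (intro kostka_self) (auto simp: par_def)

lemma rank_bound: "\<exists>B. \<forall>la\<in>partitions n. rank N (shp la) \<le> B"
  using finite_nat_set_iff_bounded_le[of "(\<lambda>la. rank N (shp la)) ` partitions n"] finite_partitions[of n] by auto

lemma kos_split_diag:
  fixes x :: "nat list \<Rightarrow> 'b::comm_ring_1"
  assumes "mu \<in> partitions n"
  shows "(\<Sum>la\<in>partitions n. of_nat (kos N la (shp mu)) * x la)
    = x mu + (\<Sum>la\<in>partitions n - {mu}. of_nat (kos N la (shp mu)) * x la)"
  using assms by (simp add: sum.remove[OF finite_partitions assms] kos_self)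

text \<open>Back substitution from the highest rank downwards. The diagonal entries are 1, so the
  coefficients may lie in any commutative ring; real and complex ones occur.\<close>

lemma kos_injective:
  fixes x :: "nat list \<Rightarrow> 'b::comm_ring_1"
  assumes z: "\<And>mu. mu \<in> partitions n \<Longrightarrow> (\<Sum>la\<in>partitions n. of_nat (kos N la (shp mu)) * x la) = 0"
    and la: "la \<in> partitions n"
  shows "x la = 0"
proof -
  obtain B where B: "\<And>la. la \<in> partitions n \<Longrightarrow> rank N (shp la) \<le> B" using rank_bound by blast
  show ?thesis using la
  proof (induction "B - rank N (shp la)" arbitrary: la rule: less_induct)
    case less
    have "of_nat (kos N ka (shp la)) * x ka = 0" if ka: "ka \<in> partitions n - {la}" for ka
    proof (cases "kos N ka (shp la) = 0")
      case False
      then have "rank N (shp la) < rank N (shp ka)" using kos_triangular[of ka la] ka less.prems by auto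
      then have "B - rank N (shp ka) < B - rank N (shp la)" using B[of ka] ka by auto
      then show ?thesis using less.hyps[of ka] ka by simp
    qed simp
    then show ?case using z[OF less.prems] kos_split_diag[OF less.prems, of x] by simp
  qed
qed

text \<open>After \<open>k\<close> rounds the equations for the \<open>k\<close> highest ranks hold.
  The next round defines the values one rank lower, and triangularity leaves the earlier equations
  intact.\<close>

lemma kos_solvable:
  fixes y :: "nat list \<Rightarrow> real"
  obtains x where "\<And>mu. mu \<in> partitions n \<Longrightarrow> y mu = (\<Sum>la\<in>partitions n. real (kos N la (shp mu)) * x la)"
proof -
  obtain B where B: "\<And>la. la \<in> partitions n \<Longrightarrow> rank N (shp la) \<le> B" using rank_bound by blast
  let ?E = "\<lambda>x mu. y mu = (\<Sum>la\<in>partitions n. real (kos N la (shp mu)) * x la)"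
  have "\<exists>x. \<forall>mu\<in>partitions n. B < rank N (shp mu) + k \<longrightarrow> ?E x mu" for k
  proof (induction k)
    case 0
    then show ?case using B by (auto simp: not_less[symmetric])
  next
    case (Suc k)
    then obtain x where x: "\<And>mu. mu \<in> partitions n \<Longrightarrow> B < rank N (shp mu) + k \<Longrightarrow> ?E x mu" by blast
    define x' where "x' mu = (if B < rank N (shp mu) + k then x mu
      else y mu - (\<Sum>la\<in>partitions n - {mu}. real (kos N la (shp mu)) * x la))" for mu
    have same: "real (kos N la (shp mu)) * x' la = real (kos N la (shp mu)) * x la"
      if "mu \<in> partitions n" "la \<in> partitions n - {mu}" "B < rank N (shp mu) + Suc k" for la mu
    proof (cases "kos N la (shp mu) = 0")
      case False
      then have "rank N (shp mu) < rank N (shp la)" using kos_triangular[of la mu] that by auto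
      then show ?thesis using that(3) by (simp add: x'_def)
    qed simp
    have "?E x' mu" if mu: "mu \<in> partitions n" "B < rank N (shp mu) + Suc k" for mu
    proof -
      have s: "(\<Sum>la\<in>partitions n - {mu}. real (kos N la (shp mu)) * x' la)
        = (\<Sum>la\<in>partitions n - {mu}. real (kos N la (shp mu)) * x la)"
        by (rule sum.cong[OF refl]) (rule same[OF mu(1) _ mu(2)])
      show ?thesis
      proof (cases "B < rank N (shp mu) + k")
        case True
        then show ?thesis using x[OF mu(1) True] kos_split_diag[OF mu(1), of x] kos_split_diag[OF mu(1), of x'] s
          by (simp add: x'_def)
      next
        case False
        then show ?thesis using kos_split_diag[OF mu(1), of x'] s by (simp add: x'_def)
      qed
    qed
    then show ?case by blast
  qed
  from this[of "Suc B"] show thesis using that by auto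
qed

abbreviation ip :: "((nat \<Rightarrow> nat) \<Rightarrow> real) \<Rightarrow> ((nat \<Rightarrow> nat) \<Rightarrow> real) \<Rightarrow> real" where
  "ip f g \<equiv> (\<Sum>\<sigma>\<in>perms n. f \<sigma> * g \<sigma>)"

abbreviation XI :: "(nat \<Rightarrow> nat) \<Rightarrow> (nat \<Rightarrow> nat) \<Rightarrow> real" where
  "XI c \<equiv> (\<lambda>\<sigma>. real (xi {1..n} c \<sigma>))"

text \<open>Contents that need not decrease: writing the two rows of a matrix one after the other
  gives an unsorted content.\<close>

definition comp_of :: "(nat \<Rightarrow> nat) set" where
  "comp_of = {c. (\<forall>i\<ge>N. c i = 0) \<and> (\<Sum>i<N. c i) = n}"

lemma shp_comp: "la \<in> partitions n \<Longrightarrow> shp la \<in> comp_of"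
  using shp_par[OF _ nN, of la] by (auto simp: comp_of_def par_def shape_def vsize_def)

lemma ip_xi:
  assumes "c \<in> comp_of" "d \<in> comp_of"
  shows "ip (XI c) (XI d) = fact n * (\<Sum>la\<in>partitions n. real (kos N la c) * real (kos N la d))"
proof -
  have "card (mats N c d) = (\<Sum>la\<in>partitions n. kos N la c * kos N la d)"
    using cauchy[OF N, of c d] sum_par[OF nN, of "\<lambda>l. kostka N (\<lambda>_. 0) l c * kostka N (\<lambda>_. 0) l d"] assms
    by (simp add: comp_of_def)
  then show ?thesis using xi_inner[of N c d n] assms by (simp add: comp_of_def)
qed

lemma ip_sum_left: "finite A \<Longrightarrow> ip (\<lambda>\<sigma>. \<Sum>x\<in>A. a x * f x \<sigma>) g = (\<Sum>x\<in>A. a x * ip (f x) g)"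
proof -
  have "ip (\<lambda>\<sigma>. \<Sum>x\<in>A. a x * f x \<sigma>) g = (\<Sum>\<sigma>\<in>perms n. \<Sum>x\<in>A. a x * (f x \<sigma> * g \<sigma>))"
    by (simp add: sum_distrib_right mult.assoc)
  also have "\<dots> = (\<Sum>x\<in>A. \<Sum>\<sigma>\<in>perms n. a x * (f x \<sigma> * g \<sigma>))" by (rule sum.swap)
  finally show ?thesis by (simp add: sum_distrib_left)
qed

lemma ip_commute: "ip f g = ip g f" by (simp add: mult.commute)

lemma eq_if_ip_diff_zero:
  assumes "ip f f - 2 * ip f g + ip g g = 0" "\<sigma> \<in> perms n"
  shows "f \<sigma> = g \<sigma>"
proof -
  have "(\<Sum>\<sigma>\<in>perms n. (f \<sigma> - g \<sigma>)\<^sup>2) = ip f f - 2 * ip f g + ip g g"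
    by (simp add: power2_eq_square algebra_simps sum.distrib sum_subtractf sum_distrib_left)
  then have "(\<Sum>\<sigma>\<in>perms n. (f \<sigma> - g \<sigma>)\<^sup>2) = 0" using assms by simp
  then have "(f \<sigma> - g \<sigma>)\<^sup>2 = 0"
    using assms(2) by (subst (asm) sum_nonneg_eq_0_iff) (auto simp: finite_permutations)
  then show ?thesis by simp
qed

lemma ip_cong:
  assumes "\<And>\<sigma>. \<sigma> \<in> perms n \<Longrightarrow> f \<sigma> = f' \<sigma>"
  shows "ip f g = ip f' g"
  using assms by (intro sum.cong) auto

text \<open>Inverting the Kostka matrix produces class functions \<open>z\<close> that are orthonormal by the Cauchy
  identity; triangularity and Bessel's inequality force them to be the irreducible characters.\<close>

lemma young_rule_and_orthonormality:
  shows "mu \<in> partitions n \<Longrightarrow> \<sigma> \<in> perms n \<Longrightarrow> XI (shp mu) \<sigma> = (\<Sum>la\<in>partitions n. real (kos N la (shp mu)) * chi la \<sigma>)"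
    and "la \<in> partitions n \<Longrightarrow> ka \<in> partitions n \<Longrightarrow> ip (chi la) (chi ka) = (if la = ka then fact n else 0)"
proof -
  let ?P = "partitions n"
  note fP = finite_partitions[of n]
  have "\<exists>x. \<forall>mu\<in>?P. XI (shp mu) \<sigma> = (\<Sum>la\<in>?P. real (kos N la (shp mu)) * x la)" for \<sigma>
    using kos_solvable[of "\<lambda>mu. XI (shp mu) \<sigma>"] by metis
  then obtain zz where zz: "\<And>\<sigma> mu. mu \<in> ?P \<Longrightarrow> XI (shp mu) \<sigma> = (\<Sum>la\<in>?P. real (kos N la (shp mu)) * zz \<sigma> la)" by metis
  define z where "z la \<sigma> = zz \<sigma> la" for la \<sigma>
  have z: "XI (shp mu) = (\<lambda>\<sigma>. \<Sum>la\<in>?P. real (kos N la (shp mu)) * z la \<sigma>)" if "mu \<in> ?P" for mu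
    using zz[OF that] by (auto simp: z_def)
  have ipz: "ip (XI (shp mu)) f = (\<Sum>la\<in>?P. real (kos N la (shp mu)) * ip (z la) f)" if "mu \<in> ?P" for mu f
    by (subst ip_sum_left[OF fP, symmetric], rule ip_cong) (simp add: zz[OF that] z_def)
  \<comment> \<open>By the Cauchy identity the Gram matrix of the permutation characters is
    \<open>fact n\<close> times the Kostka matrix times its transpose. Injectivity cancels one
    factor here and the other one in \<open>orth\<close>.\<close>
  have zxi: "ip (z la) (XI (shp rho)) = fact n * real (kos N la (shp rho))" if "la \<in> ?P" "rho \<in> ?P" for la rho
  proof -
    have "ip (z la) (XI (shp rho)) - fact n * real (kos N la (shp rho)) = 0"
    proof (rule kos_injective[OF _ that(1), where x = "\<lambda>la. ip (z la) (XI (shp rho)) - fact n * real (kos N la (shp rho))"])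
      fix mu assume mu: "mu \<in> ?P"
      have "(\<Sum>la\<in>?P. real (kos N la (shp mu)) * ip (z la) (XI (shp rho)))
        = fact n * (\<Sum>la\<in>?P. real (kos N la (shp mu)) * real (kos N la (shp rho)))"
        using ipz[OF mu, of "XI (shp rho)"] ip_xi[OF shp_comp[OF mu] shp_comp[OF that(2)]] by simp
      then show "(\<Sum>la\<in>?P. of_nat (kos N la (shp mu)) * (ip (z la) (XI (shp rho)) - fact n * real (kos N la (shp rho)))) = 0"
        by (simp add: right_diff_distrib sum_subtractf sum_distrib_left mult.left_commute)
    qed
    then show ?thesis by simp
  qed
  have orth: "ip (z la) (z ka) = (if la = ka then fact n else 0)" if "la \<in> ?P" "ka \<in> ?P" for la ka
  proof -
    have "ip (z ka) (z la) - (if la = ka then fact n else 0) = 0"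
    proof (rule kos_injective[OF _ that(2), where x = "\<lambda>ka. ip (z ka) (z la) - (if la = ka then fact n else 0)"])
      fix mu assume mu: "mu \<in> ?P"
      have "(\<Sum>ka\<in>?P. real (kos N ka (shp mu)) * ip (z ka) (z la)) = fact n * real (kos N la (shp mu))"
        using ipz[OF mu, of "z la"] zxi[OF that(1) mu] ip_commute by metis
      moreover have "(\<Sum>ka\<in>?P. real (kos N ka (shp mu)) * (if la = ka then fact n else 0)) = real (kos N la (shp mu)) * fact n"
        using fP that(1) by (simp add: if_distrib sum.delta cong: if_cong)
      ultimately show "(\<Sum>ka\<in>?P. of_nat (kos N ka (shp mu)) * (ip (z ka) (z la) - (if la = ka then fact n else 0))) = 0"
        by (simp add: right_diff_distrib sum_subtractf)
    qed
    then show ?thesis using ip_commute[of "z la" "z ka"] by simp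
  qed
  obtain B where B: "\<And>la. la \<in> ?P \<Longrightarrow> rank N (shp la) \<le> B" using rank_bound by blast
  have fin: "finite {i. shp la i \<noteq> 0}" for la by (rule finite_support_shp)
  \<comment> \<open>\<open>z la\<close> is the permutation character of \<open>la\<close> minus
    multiples of \<open>z ka\<close> of larger rank; these corrections keep the pairing with the
    characters triangular and do not touch its diagonal.\<close>
  have tri: "(ip (z la) (chi nu) \<noteq> 0 \<longrightarrow> nu = la \<or> rank N (shp la) < rank N (shp nu)) \<and> ip (z la) (chi la) = fact n"
    if "la \<in> ?P" "nu \<in> ?P" for la nu
    using that
  proof (induction "B - rank N (shp la)" arbitrary: la nu rule: less_induct)
    case less
    have eq: "ip (z la) f = ip (XI (shp la)) f - (\<Sum>ka\<in>?P - {la}. real (kos N ka (shp la)) * ip (z ka) f)" for f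
      using ipz[OF less.prems(1), of f] kos_split_diag[OF less.prems(1), of "\<lambda>la. ip (z la) f"] by simp
    have IH: "(ip (z ka) (chi mu) \<noteq> 0 \<longrightarrow> mu = ka \<or> rank N (shp ka) < rank N (shp mu)) \<and> rank N (shp la) < rank N (shp ka)"
      if "ka \<in> ?P - {la}" "kos N ka (shp la) \<noteq> 0" "mu \<in> ?P" for ka mu
    proof -
      have r: "rank N (shp la) < rank N (shp ka)" using kos_triangular[of ka la] that less.prems(1) by auto
      then have "B - rank N (shp ka) < B - rank N (shp la)" using B[of ka] that by auto
      then show ?thesis using less.hyps[of ka mu] that r by auto
    qed
    have "nu = la \<or> rank N (shp la) < rank N (shp nu)" if nz: "ip (z la) (chi nu) \<noteq> 0"
    proof (cases "ip (XI (shp la)) (chi nu) = 0")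
      case False
      then have "(\<Sum>\<sigma>\<in>perms n. chi nu \<sigma> * XI (shp la) \<sigma>) \<noteq> 0" using ip_commute[of "chi nu" "XI (shp la)"] by simp
      then have "\<And>i. (\<Sum>k<i. shp la k) \<le> (\<Sum>k<i. shp nu k)" by (rule chi_props(4)[OF less.prems(2) fin])
      moreover have "shape N (shp la)" "shape N (shp nu)" using shp_par[OF _ nN] less.prems by (auto simp: par_def)
      ultimately show ?thesis using rank_less[of "shp la" "shp nu" N] shp_inj[OF less.prems] by metis
    next
      case True
      then have "(\<Sum>ka\<in>?P - {la}. real (kos N ka (shp la)) * ip (z ka) (chi nu)) \<noteq> 0" using nz eq[of "chi nu"] by simp
      then obtain ka where ka: "ka \<in> ?P - {la}" "real (kos N ka (shp la)) * ip (z ka) (chi nu) \<noteq> 0" by (meson sum.neutral)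
      then have "kos N ka (shp la) \<noteq> 0" "ip (z ka) (chi nu) \<noteq> 0" by auto
      then show ?thesis using IH[OF ka(1) _ less.prems(2)] by auto
    qed
    moreover have "ip (z la) (chi la) = fact n"
    proof -
      have "(\<Sum>ka\<in>?P - {la}. real (kos N ka (shp la)) * ip (z ka) (chi la)) = 0"
      proof (rule sum.neutral, rule ballI, rule ccontr)
        fix ka assume ka: "ka \<in> ?P - {la}" "real (kos N ka (shp la)) * ip (z ka) (chi la) \<noteq> 0"
        then have "kos N ka (shp la) \<noteq> 0" "ip (z ka) (chi la) \<noteq> 0" by auto
        then show False using IH[OF ka(1) _ less.prems(1)] ka(1) by auto
      qed
      then show ?thesis using eq[of "chi la"] chi_props(3)[OF less.prems(1)] ip_commute[of "chi la" "XI (shp la)"] by simp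
    qed
    ultimately show ?case by blast
  qed
  \<comment> \<open>Equal norms, and an inner product equal to the squared norm, leave no room for a
    difference.\<close>
  have chz: "chi la \<sigma> = z la \<sigma>" if "la \<in> ?P" "\<sigma> \<in> perms n" for la \<sigma>
  proof (rule eq_if_ip_diff_zero[OF _ that(2)])
    have "ip (chi la) (z la) = fact n" using tri[OF that(1) that(1)] ip_commute[of "chi la" "z la"] by simp
    then show "ip (chi la) (chi la) - 2 * ip (chi la) (z la) + ip (z la) (z la) = 0"
      using chi_props(2)[OF that(1)] orth[OF that(1) that(1)] by simp
  qed
  show "XI (shp mu) \<sigma> = (\<Sum>la\<in>?P. real (kos N la (shp mu)) * chi la \<sigma>)" if "mu \<in> ?P" "\<sigma> \<in> perms n"
    using fun_cong[OF z[OF that(1)], of \<sigma>] chz[OF _ that(2)] by simp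
  show "ip (chi la) (chi ka) = (if la = ka then fact n else 0)" if "la \<in> ?P" "ka \<in> ?P"
  proof -
    have "ip (chi la) (chi ka) = ip (z la) (z ka)" using chz that by (intro sum.cong) auto
    then show ?thesis using orth[OF that] by simp
  qed
qed

lemmas chi_orthonormal = young_rule_and_orthonormality(2)

text \<open>For an unsorted content the multiplicities follow by pairing with the permutation
  characters of partitions and cancelling the Kostka matrix.\<close>

lemma ip_xi_chi:
  assumes c: "c \<in> comp_of" and la: "la \<in> partitions n"
  shows "ip (chi la) (XI c) = fact n * real (kos N la c)"
proof -
  have "ip (chi la) (XI c) - fact n * real (kos N la c) = 0"
  proof (rule kos_injective[OF _ la, where x = "\<lambda>la. ip (chi la) (XI c) - fact n * real (kos N la c)"])
    fix mu assume mu: "mu \<in> partitions n"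
    have "(\<Sum>la\<in>partitions n. real (kos N la (shp mu)) * ip (chi la) (XI c)) = ip (XI (shp mu)) (XI c)"
      by (subst ip_sum_left[OF finite_partitions, symmetric], rule ip_cong) (simp add: young_rule_and_orthonormality(1)[OF mu])
    also have "\<dots> = fact n * (\<Sum>la\<in>partitions n. real (kos N la (shp mu)) * real (kos N la c))"
      by (rule ip_xi[OF shp_comp[OF mu] c])
    finally show "(\<Sum>la\<in>partitions n. of_nat (kos N la (shp mu)) * (ip (chi la) (XI c) - fact n * real (kos N la c))) = 0"
      by (simp add: right_diff_distrib sum_subtractf sum_distrib_left mult.left_commute)
  qed
  then show ?thesis by simp
qed

text \<open>The projection of \<open>XI c\<close> to the span of the characters has the same norm as
  \<open>XI c\<close>, again by the Cauchy identity, so it is all of \<open>XI c\<close>.\<close>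

theorem young_rule:
  assumes c: "c \<in> comp_of" and s: "\<sigma> \<in> perms n"
  shows "XI c \<sigma> = (\<Sum>la\<in>partitions n. real (kos N la c) * chi la \<sigma>)"
proof (rule eq_if_ip_diff_zero[OF _ s])
  let ?f = "\<lambda>\<sigma>. \<Sum>la\<in>partitions n. real (kos N la c) * chi la \<sigma>"
  let ?q = "\<Sum>la\<in>partitions n. real (kos N la c) * real (kos N la c)"
  have "ip (XI c) ?f = ip ?f (XI c)" by (rule ip_commute)
  also have "\<dots> = (\<Sum>la\<in>partitions n. real (kos N la c) * (fact n * real (kos N la c)))"
    unfolding ip_sum_left[OF finite_partitions] by (rule sum.cong[OF refl]) (simp add: ip_xi_chi[OF c])
  finally have 1: "ip (XI c) ?f = fact n * ?q" by (simp add: sum_distrib_left mult.left_commute)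
  have ck: "ip (chi la) ?f = fact n * real (kos N la c)" if "la \<in> partitions n" for la
  proof -
    have "ip (chi la) ?f = (\<Sum>ka\<in>partitions n. real (kos N ka c) * ip (chi ka) (chi la))"
      by (subst ip_commute) (rule ip_sum_left[OF finite_partitions])
    also have "\<dots> = (\<Sum>ka\<in>partitions n. if la = ka then real (kos N ka c) * fact n else 0)"
      by (rule sum.cong[OF refl]) (simp add: chi_orthonormal that)
    finally show ?thesis using that finite_partitions by simp
  qed
  have "ip ?f ?f = (\<Sum>la\<in>partitions n. real (kos N la c) * (fact n * real (kos N la c)))"
    unfolding ip_sum_left[OF finite_partitions, where g = ?f] by (rule sum.cong[OF refl]) (simp only: ck)
  then have 2: "ip ?f ?f = fact n * ?q" by (simp add: sum_distrib_left mult.left_commute)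
  show "ip (XI c) (XI c) - 2 * ip (XI c) ?f + ip ?f ?f = 0"
    unfolding 1 2 ip_xi[OF c c] by simp
qed

lemma chi_independent:
  fixes x :: "nat list \<Rightarrow> complex"
  assumes z: "\<And>\<sigma>. \<sigma> \<in> perms n \<Longrightarrow> (\<Sum>la\<in>partitions n. x la * of_real (chi la \<sigma>)) = 0" and ka: "ka \<in> partitions n"
  shows "x ka = 0"
proof -
  have "0 = (\<Sum>\<sigma>\<in>perms n. (\<Sum>la\<in>partitions n. x la * of_real (chi la \<sigma>)) * of_real (chi ka \<sigma>))"
    by (simp add: z)
  also have "\<dots> = (\<Sum>\<sigma>\<in>perms n. \<Sum>la\<in>partitions n. x la * of_real (chi la \<sigma> * chi ka \<sigma>))"
    by (simp add: sum_distrib_right mult.assoc)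
  also have "\<dots> = (\<Sum>la\<in>partitions n. \<Sum>\<sigma>\<in>perms n. x la * of_real (chi la \<sigma> * chi ka \<sigma>))" by (rule sum.swap)
  also have "\<dots> = (\<Sum>la\<in>partitions n. x la * of_real (ip (chi la) (chi ka)))"
    by (simp add: sum_distrib_left)
  also have "\<dots> = (\<Sum>la\<in>partitions n. if la = ka then x la * fact n else 0)"
    by (rule sum.cong[OF refl]) (subst chi_orthonormal[OF _ ka], assumption, simp)
  also have "\<dots> = x ka * fact n" using ka finite_partitions by simp
  finally show ?thesis by simp
qed

end

section \<open>Multiplication by a two-row character\<close>

definition two_row :: "nat \<Rightarrow> nat \<Rightarrow> nat \<Rightarrow> nat" where
  "two_row n k i = (if i = 0 then n - k else if i = 1 then k else 0)"

text \<open>By the Littlewood-Richardson rule this is the coefficient of the Schur function of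
  \<open>nu\<close> in the sum, over the partitions \<open>a\<close> of \<open>k\<close>, of the
  Schur function of \<open>a\<close> times the skew one of \<open>la/a\<close>.\<close>

definition lr_count :: "nat \<Rightarrow> nat \<Rightarrow> nat list \<Rightarrow> nat list \<Rightarrow> nat" where
  "lr_count N k la nu = (\<Sum>a\<in>par N k.
    card {g \<in> gt N a (shp la). lattice N a g \<and> (\<lambda>i. a i + wt N g i) = shp nu})"

lemma sum_two:
  fixes f :: "nat \<Rightarrow> nat"
  assumes "2 \<le> N" "\<And>i. 2 \<le> i \<Longrightarrow> i < N \<Longrightarrow> f i = 0"
  shows "(\<Sum>i<N. f i) = f 0 + f 1"
proof -
  have "(\<Sum>i<N. f i) = (\<Sum>i\<in>{0, 1}. f i)"
    by (rule sum.mono_neutral_right) (use assms in auto)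
  then show ?thesis by simp
qed

lemma mats_two_row:
  assumes m: "m \<in> mats N (two_row n k) d" and N: "2 \<le> N"
  shows "2 \<le> i \<Longrightarrow> m (i, j) = 0" and "j < N \<Longrightarrow> m (0, j) + m (1, j) = d j"
    and "(\<Sum>j<N. m (1, j)) = k"
proof -
  show z: "m (i, j) = 0" if "2 \<le> i" for i j
  proof (cases "i < N \<and> j < N")
    case True
    then have "(\<Sum>j<N. m (i, j)) = 0" using m that by (simp add: mats_def two_row_def)
    then show ?thesis using True by simp
  next
    case False
    then show ?thesis using m by (auto simp: mats_def not_less)
  qed
  show "m (0, j) + m (1, j) = d j" if "j < N"
  proof -
    have "(\<Sum>i<N. m (i, j)) = d j" using m that by (simp add: mats_def)
    then show ?thesis using sum_two[OF N, of "\<lambda>i. m (i, j)"] z by simp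
  qed
  have "\<forall>i<N. (\<Sum>j<N. m (i, j)) = two_row n k i" using m unfolding mats_def by blast
  then show "(\<Sum>j<N. m (1, j)) = k" using N by (simp add: two_row_def)
qed

text \<open>Row 1 of the matrix records the content of the tableau of shape \<open>a\<close>, row 0
  that of the skew tableau of shape \<open>l/a\<close>; the column sums give the joint
  content.\<close>

lemma pairs_by_content:
  assumes N: "2 \<le> N" and a: "a \<in> par N k" and l: "l \<in> par N n" and d: "\<And>j. N \<le> j \<Longrightarrow> d j = 0"
  shows "(\<Sum>m\<in>mats N (two_row n k) d. kostka N (\<lambda>_. 0) a (\<lambda>j. m (1, j)) * kostka N a l (\<lambda>j. m (0, j)))
    = card {(g, h). g \<in> gt N (\<lambda>_. 0) a \<and> h \<in> gt N a l \<and> (\<lambda>i. wt N g i + wt N h i) = d}"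
proof -
  let ?P = "{(g, h). g \<in> gt N (\<lambda>_. 0) a \<and> h \<in> gt N a l \<and> (\<lambda>i. wt N g i + wt N h i) = d}"
  define M where "M = (\<lambda>(g, h) (i, j). if i = (1::nat) then wt N g j else if i = 0 then wt N h j else 0)"
  have sh: "shape N a" "shape N l" "vsize N a = k" "vsize N l = n" using a l by (auto simp: par_def)
  have fin: "finite ?P"
    by (rule finite_subset[of _ "gt N (\<lambda>_. 0) a \<times> gt N a l"]) (use finite_gt sh in auto)
  have "card ?P = (\<Sum>p\<in>?P. 1)" by simp
  also have "\<dots> = (\<Sum>m\<in>mats N (two_row n k) d. \<Sum>p\<in>{p \<in> ?P. M p = m}. 1)"
  proof (rule sum.group[symmetric, OF fin finite_mats], rule image_subsetI)
    fix p assume "p \<in> ?P"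
    then obtain g h where p: "p = (g, h)" "g \<in> gt N (\<lambda>_. 0) a" "h \<in> gt N a l" "(\<lambda>i. wt N g i + wt N h i) = d"
      by auto
    have gN: "g N = a" "h N = l" using p by (auto simp: gt_def)
    have s1: "(\<Sum>j<N. wt N g j) = k" using sum_wt[OF p(2), of N] gN sh by simp
    have s2: "(\<Sum>j<N. wt N h j) = n - k" using sum_wt[OF p(3), of N] gN sh by simp
    have "wt N g j + wt N h j = d j" for j using fun_cong[OF p(4), of j] .
    then have col: "(\<Sum>i<N. M p (i, j)) = d j" for j
      using sum_two[OF N, of "\<lambda>i. M p (i, j)"] by (simp add: M_def p(1) add.commute)
    show "M p \<in> mats N (two_row n k) d"
      using s1 s2 col wt_outside[OF p(2)] wt_outside[OF p(3)] N
      by (auto simp: mats_def M_def p(1) two_row_def)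
  qed
  also have "\<dots> = (\<Sum>m\<in>mats N (two_row n k) d. kostka N (\<lambda>_. 0) a (\<lambda>j. m (1, j)) * kostka N a l (\<lambda>j. m (0, j)))"
  proof (rule sum.cong[OF refl])
    fix m assume m: "m \<in> mats N (two_row n k) d"
    note mt = mats_two_row[OF m N]
    have "{p \<in> ?P. M p = m} = {g \<in> gt N (\<lambda>_. 0) a. wt N g = (\<lambda>j. m (1, j))} \<times> {h \<in> gt N a l. wt N h = (\<lambda>j. m (0, j))}"
    proof (intro equalityI subsetI)
      fix p assume "p \<in> {p \<in> ?P. M p = m}"
      then obtain g h where p: "p = (g, h)" "g \<in> gt N (\<lambda>_. 0) a" "h \<in> gt N a l" "M (g, h) = m" by auto
      have "wt N g = (\<lambda>j. m (1, j))" "wt N h = (\<lambda>j. m (0, j))"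
        unfolding p(4)[symmetric] by (simp_all add: M_def)
      then show "p \<in> {g \<in> gt N (\<lambda>_. 0) a. wt N g = (\<lambda>j. m (1, j))} \<times> {h \<in> gt N a l. wt N h = (\<lambda>j. m (0, j))}"
        using p by simp
    next
      fix p assume "p \<in> {g \<in> gt N (\<lambda>_. 0) a. wt N g = (\<lambda>j. m (1, j))} \<times> {h \<in> gt N a l. wt N h = (\<lambda>j. m (0, j))}"
      then obtain g h where p: "p = (g, h)" "g \<in> gt N (\<lambda>_. 0) a" "h \<in> gt N a l"
        and w: "wt N g = (\<lambda>j. m (1, j))" "wt N h = (\<lambda>j. m (0, j))" by auto
      have "wt N g j + wt N h j = d j" for j
      proof (cases "j < N")
        case True
        then show ?thesis using mt(2)[OF True] by (simp add: w)
      next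
        case False
        then show ?thesis using d[of j] wt_outside[OF p(2)] wt_outside[OF p(3)] by simp
      qed
      moreover have "M (g, h) = m"
      proof
        fix x :: "nat \<times> nat"
        obtain i j where x: "x = (i, j)" by (cases x)
        show "M (g, h) x = m x" using mt(1)[of i j] by (cases "2 \<le> i") (auto simp: x M_def w less_2_cases_iff not_le)
      qed
      ultimately show "p \<in> {p \<in> ?P. M p = m}" using p by (simp add: fun_eq_iff)
    qed
    then show "(\<Sum>p\<in>{p \<in> ?P. M p = m}. 1) = kostka N (\<lambda>_. 0) a (\<lambda>j. m (1, j)) * kostka N a l (\<lambda>j. m (0, j))"
      by (simp add: kostka_def card_cartesian_product)
  qed
  finally show ?thesis by simp
qed

lemma lattice_by_shape:
  assumes nN: "n \<le> N" and a: "a \<in> par N k" and la: "la \<in> partitions n"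
  shows "(\<Sum>g | g \<in> gt N a (shp la) \<and> lattice N a g. kostka N (\<lambda>_. 0) (\<lambda>i. a i + wt N g i) c)
    = (\<Sum>nu\<in>partitions n. card {g \<in> gt N a (shp la). lattice N a g \<and> (\<lambda>i. a i + wt N g i) = shp nu} * kos N nu c)"
proof -
  let ?S = "{g. g \<in> gt N a (shp la) \<and> lattice N a g}"
  have sh: "shape N a" "vsize N a = k" "shape N (shp la)" "vsize N (shp la) = n"
    using a shp_par[OF la nN] by (auto simp: par_def)
  have fin: "finite ?S" by (rule finite_subset[OF _ finite_gt[OF sh(3), of a]]) auto
  have mem: "(\<lambda>i. a i + wt N g i) \<in> par N n" if "g \<in> ?S" for g
  proof -
    have g: "g \<in> gt N a (shp la)" "lattice N a g" using that by auto
    then have "g N = shp la" by (simp add: gt_def)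
    then have "vsize N (\<lambda>i. a i + wt N g i) = n"
      using sum_wt[OF g(1), of N] sh by (simp add: vsize_def sum.distrib add.commute)
    then show ?thesis using shape_add_wt[OF g(1) sh(1) g(2)] by (simp add: par_def)
  qed
  have "(\<Sum>g\<in>?S. kostka N (\<lambda>_. 0) (\<lambda>i. a i + wt N g i) c)
    = (\<Sum>l\<in>par N n. \<Sum>g\<in>{g \<in> ?S. (\<lambda>i. a i + wt N g i) = l}. kostka N (\<lambda>_. 0) (\<lambda>i. a i + wt N g i) c)"
    by (rule sum.group[symmetric, OF fin finite_par]) (use mem in blast)
  also have "\<dots> = (\<Sum>l\<in>par N n. card {g \<in> gt N a (shp la). lattice N a g \<and> (\<lambda>i. a i + wt N g i) = l} * kostka N (\<lambda>_. 0) l c)"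
  proof (rule sum.cong[OF refl])
    fix l
    have "(\<Sum>g\<in>{g \<in> ?S. (\<lambda>i. a i + wt N g i) = l}. kostka N (\<lambda>_. 0) (\<lambda>i. a i + wt N g i) c)
      = (\<Sum>g\<in>{g \<in> ?S. (\<lambda>i. a i + wt N g i) = l}. kostka N (\<lambda>_. 0) l c)"
      by (rule sum.cong) auto
    then show "(\<Sum>g\<in>{g \<in> ?S. (\<lambda>i. a i + wt N g i) = l}. kostka N (\<lambda>_. 0) (\<lambda>i. a i + wt N g i) c)
      = card {g \<in> gt N a (shp la). lattice N a g \<and> (\<lambda>i. a i + wt N g i) = l} * kostka N (\<lambda>_. 0) l c"
      by (simp add: conj_assoc)
  qed
  finally show ?thesis by (simp add: sum_par[OF nN])
qed

context
  fixes n :: nat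
  assumes n: "0 < n"
begin

declare One_nat_def [simp del]

lemma le_twice: "n \<le> 2 * n" and twice_pos: "0 < 2 * n" and two_le_twice: "2 \<le> 2 * n" using n by auto

text \<open>The rows of \<open>m\<close> are written one after the other, row 1 first, as a content
  on \<open>2 * n\<close> letters. Cutting the tableaux of Young's rule after \<open>n\<close>
  letters produces the intermediate shape \<open>a\<close>, of size \<open>k\<close>.\<close>

lemma xi_pair:
  assumes m: "m \<in> mats (2 * n) (two_row n k) (shp mu)" and mu: "mu \<in> partitions n" and k: "k \<le> n" and s: "\<sigma> \<in> perms n"
  shows "real (xi {1..n} m \<sigma>) = (\<Sum>la\<in>partitions n. (\<Sum>a\<in>par (2 * n) k.
    real (kostka (2 * n) (\<lambda>_. 0) a (\<lambda>j. m (1, j)) * kostka (2 * n) a (shp la) (\<lambda>j. m (0, j)))) * chi la \<sigma>)"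
proof -
  note mt = mats_two_row[OF m two_le_twice]
  have mz: "m (0, j) = 0 \<and> m (1, j) = 0" if "n \<le> j" for j
  proof (cases "j < 2 * n")
    case True
    have "shp mu j = 0" using shp_zero length_partition[OF mu] that by (meson le_trans)
    then show ?thesis using mt(2)[OF True] by simp
  next
    case False
    then show ?thesis using m by (simp add: mats_def)
  qed
  define c where "c i = (if i < n then m (1, i) else m (0, i - n))" for i
  have xi_c: "xi {1..n} c \<sigma> = xi {1..n} m \<sigma>"
  proof (rule xi_relabel[of "\<lambda>(i, j). if i = 1 then j else n + j" "{0::nat, 1} \<times> {..<n}"])
    show "inj_on (\<lambda>(i, j). if i = 1 then j else n + j) ({0::nat, 1} \<times> {..<n})" by (auto simp: inj_on_def)
    show "m x = 0" if x: "x \<notin> {0::nat, 1} \<times> {..<n}" for x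
    proof -
      obtain i j where ij: "x = (i, j)" by (cases x)
      then have "2 \<le> i \<or> n \<le> j" using x by auto
      then show ?thesis using mt(1)[of i j] mz[of j]
        by (cases "2 \<le> i") (auto simp: ij less_2_cases_iff not_le One_nat_def)
    qed
    show "c ((\<lambda>(i, j). if i = 1 then j else n + j) x) = m x" if "x \<in> {0::nat, 1} \<times> {..<n}" for x
      using that by (auto simp: c_def)
    show "c j = 0" if j: "j \<notin> (\<lambda>(i, j). if i = 1 then j else n + j) ` ({0::nat, 1} \<times> {..<n})" for j
    proof -
      have "\<not> j < n" using j by (auto simp: image_iff)
      moreover have "\<not> j - n < n"
      proof
        assume "j - n < n"
        then have "j = (\<lambda>(i, j). if i = 1 then j else n + j) (0::nat, j - n)" "(0::nat, j - n) \<in> {0::nat, 1} \<times> {..<n}"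
          using calculation by auto
        then have "j \<in> (\<lambda>(i, j). if i = 1 then j else n + j) ` ({0::nat, 1} \<times> {..<n})" by (rule image_eqI)
        then show False using j by contradiction
      qed
      ultimately show ?thesis using mz[of "j - n"] by (simp add: c_def)
    qed
  qed (use s in auto)
  have sum1: "(\<Sum>j<n. m (1, j)) = k"
  proof -
    have "(\<Sum>j<2 * n. m (1, j)) = (\<Sum>j<n. m (1, j))"
      by (rule sum.mono_neutral_right) (use mz in auto)
    then show ?thesis using mt(3) by simp
  qed
  have "(\<Sum>i<2 * n. c i) = n"
  proof -
    have split: "(\<Sum>i<2 * n. c i) = (\<Sum>i<n. c i) + (\<Sum>i<n. c (n + i))"
      using sum.atLeastLessThan_concat[of 0 n "2 * n" c] sum.shift_bounds_nat_ivl[of c 0 n n]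
      by (simp add: atLeast0LessThan add.commute mult_2)
    also have "\<dots> = (\<Sum>j<n. m (0, j) + m (1, j))" by (simp add: c_def sum.distrib add.commute)
    also have "\<dots> = (\<Sum>j<n. shp mu j)" by (rule sum.cong) (simp_all add: mt(2))
    also have "\<dots> = n" using sum_shp[OF length_partition[OF mu]] mu by (simp add: partitions_def)
    finally show ?thesis .
  qed
  moreover have "c i = 0" if "2 * n \<le> i" for i using that mz[of "i - n"] n by (simp add: c_def)
  ultimately have c: "c \<in> comp_of n (2 * n)" by (simp add: comp_of_def[OF le_twice twice_pos])
  have kc: "kos (2 * n) la c = (\<Sum>a\<in>par (2 * n) k. kostka (2 * n) (\<lambda>_. 0) a (\<lambda>j. m (1, j)) * kostka (2 * n) a (shp la) (\<lambda>j. m (0, j)))"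
    if la: "la \<in> partitions n" for la
  proof -
    have sh: "shape (2 * n) (shp la)" using shp_par[OF la le_twice] by (simp add: par_def)
    show ?thesis unfolding c_def
      using kostka_split[OF sh le_twice, of "\<lambda>j. m (1, j)" "\<lambda>j. m (0, j)"] mz sum1 by simp
  qed
  have "real (xi {1..n} m \<sigma>) = (\<Sum>la\<in>partitions n. real (kos (2 * n) la c) * chi la \<sigma>)"
    using young_rule[OF le_twice twice_pos c s] xi_c by simp
  also have "\<dots> = (\<Sum>la\<in>partitions n. (\<Sum>a\<in>par (2 * n) k.
    real (kostka (2 * n) (\<lambda>_. 0) a (\<lambda>j. m (1, j)) * kostka (2 * n) a (shp la) (\<lambda>j. m (0, j)))) * chi la \<sigma>)"
    by (rule sum.cong[OF refl]) (simp only: kc of_nat_sum)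
  finally show ?thesis .
qed

text \<open>Multiplication by the Kostka matrix replaces \<open>chi nu\<close> by the permutation
  character of \<open>mu\<close>, whose product with that of \<open>two_row n k\<close> runs over
  matrices with two rows. For fixed \<open>a\<close> the pairs of tableaux are regrouped by the
  Littlewood-Richardson rule, which brings the Kostka numbers back.\<close>

lemma two_row_mult_chi:
  assumes k: "k \<le> n" and nu: "nu \<in> partitions n" and s: "\<sigma> \<in> perms n"
  shows "real (xi {1..n} (two_row n k) \<sigma>) * chi nu \<sigma> = (\<Sum>la\<in>partitions n. real (lr_count (2 * n) k la nu) * chi la \<sigma>)"
proof -
  let ?P = "partitions n" and ?N = "2 * n"
  let ?t = "real (xi {1..n} (two_row n k) \<sigma>)"
  let ?y = "\<lambda>nu. \<Sum>la\<in>?P. real (lr_count ?N k la nu) * chi la \<sigma>"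
  have "?t * chi nu \<sigma> - ?y nu = 0"
  proof (rule kos_injective[OF le_twice twice_pos _ nu, where x = "\<lambda>nu. ?t * chi nu \<sigma> - ?y nu"])
    fix mu assume mu: "mu \<in> ?P"
    have d: "shp mu j = 0" if "?N \<le> j" for j
      using that length_partition[OF mu] by (intro shp_zero) linarith
    let ?L = "\<lambda>a la nu. card {g \<in> gt ?N a (shp la). lattice ?N a g \<and> (\<lambda>i. a i + wt ?N g i) = shp nu}"
    have "?t * (\<Sum>nu\<in>?P. real (kos ?N nu (shp mu)) * chi nu \<sigma>) = ?t * real (xi {1..n} (shp mu) \<sigma>)"
      using young_rule_and_orthonormality(1)[OF le_twice twice_pos mu s] by simp
    also have "\<dots> = real (xi {1..n} (two_row n k) \<sigma> * xi {1..n} (shp mu) \<sigma>)" by simp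
    also have "\<dots> = real (\<Sum>m\<in>mats ?N (two_row n k) (shp mu). xi {1..n} m \<sigma>)"
      using xi_mult[of "{1..n}" \<sigma> ?N "two_row n k" "shp mu"] s n d by (simp add: two_row_def)
    also have "\<dots> = (\<Sum>m\<in>mats ?N (two_row n k) (shp mu). \<Sum>la\<in>?P. (\<Sum>a\<in>par ?N k.
        real (kostka ?N (\<lambda>_. 0) a (\<lambda>j. m (1, j)) * kostka ?N a (shp la) (\<lambda>j. m (0, j)))) * chi la \<sigma>)"
      unfolding of_nat_sum by (rule sum.cong[OF refl]) (rule xi_pair[OF _ mu k s])
    also have "\<dots> = (\<Sum>la\<in>?P. (\<Sum>a\<in>par ?N k. real (\<Sum>m\<in>mats ?N (two_row n k) (shp mu).
        kostka ?N (\<lambda>_. 0) a (\<lambda>j. m (1, j)) * kostka ?N a (shp la) (\<lambda>j. m (0, j)))) * chi la \<sigma>)"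
      unfolding of_nat_sum sum_distrib_right
      by (subst sum.swap, rule sum.cong[OF refl], rule sum.swap)
    also have "\<dots> = (\<Sum>la\<in>?P. (\<Sum>a\<in>par ?N k. real (\<Sum>nu\<in>?P. ?L a la nu * kos ?N nu (shp mu))) * chi la \<sigma>)"
    proof (intro sum.cong[OF refl] arg_cong2[of _ _ _ _ "(*)"] arg_cong[of _ _ real])
      fix la a assume la: "la \<in> ?P" and a: "a \<in> par ?N k"
      have sh: "shape ?N (shp la)" "shape ?N a" using shp_par[OF la le_twice] a by (auto simp: par_def)
      have "(\<Sum>m\<in>mats ?N (two_row n k) (shp mu). kostka ?N (\<lambda>_. 0) a (\<lambda>j. m (1, j)) * kostka ?N a (shp la) (\<lambda>j. m (0, j)))
        = card {(g, h). g \<in> gt ?N (\<lambda>_. 0) a \<and> h \<in> gt ?N a (shp la) \<and> (\<lambda>i. wt ?N g i + wt ?N h i) = shp mu}"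
        by (rule pairs_by_content[OF two_le_twice a shp_par[OF la le_twice] d])
      also have "\<dots> = (\<Sum>g | g \<in> gt ?N a (shp la) \<and> lattice ?N a g. kostka ?N (\<lambda>_. 0) (\<lambda>i. a i + wt ?N g i) (shp mu))"
        by (rule kostka_product[OF sh d])
      also have "\<dots> = (\<Sum>nu\<in>?P. ?L a la nu * kos ?N nu (shp mu))"
        by (rule lattice_by_shape[OF le_twice a la])
      finally show "(\<Sum>m\<in>mats ?N (two_row n k) (shp mu). kostka ?N (\<lambda>_. 0) a (\<lambda>j. m (1, j)) * kostka ?N a (shp la) (\<lambda>j. m (0, j)))
        = (\<Sum>nu\<in>?P. ?L a la nu * kos ?N nu (shp mu))" .
    qed (rule refl)
    also have "\<dots> = (\<Sum>la\<in>?P. \<Sum>nu\<in>?P. real (kos ?N nu (shp mu)) * (real (lr_count ?N k la nu) * chi la \<sigma>))"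
    proof (rule sum.cong[OF refl])
      fix la
      have "(\<Sum>a\<in>par ?N k. real (\<Sum>nu\<in>?P. ?L a la nu * kos ?N nu (shp mu)))
        = (\<Sum>nu\<in>?P. real (kos ?N nu (shp mu)) * real (lr_count ?N k la nu))"
        unfolding of_nat_sum lr_count_def sum_distrib_left
        by (subst sum.swap) (simp add: mult.commute)
      then show "(\<Sum>a\<in>par ?N k. real (\<Sum>nu\<in>?P. ?L a la nu * kos ?N nu (shp mu))) * chi la \<sigma>
        = (\<Sum>nu\<in>?P. real (kos ?N nu (shp mu)) * (real (lr_count ?N k la nu) * chi la \<sigma>))"
        by (simp add: sum_distrib_right mult.assoc)
    qed
    also have "\<dots> = (\<Sum>nu\<in>?P. real (kos ?N nu (shp mu)) * ?y nu)"
      unfolding sum_distrib_left by (rule sum.swap)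
    finally show "(\<Sum>nu\<in>?P. of_nat (kos ?N nu (shp mu)) * (?t * chi nu \<sigma> - ?y nu)) = 0"
      by (simp add: right_diff_distrib sum_subtractf sum_distrib_left mult.left_commute)
  qed
  then show ?thesis by simp
qed

lemma lr_count_inner:
  assumes k: "k \<le> n" and la: "la \<in> partitions n" and nu: "nu \<in> partitions n"
  shows "(\<Sum>\<sigma>\<in>perms n. real (xi {1..n} (two_row n k) \<sigma>) * chi nu \<sigma> * chi la \<sigma>) = fact n * real (lr_count (2 * n) k la nu)"
proof -
  have "(\<Sum>\<sigma>\<in>perms n. real (xi {1..n} (two_row n k) \<sigma>) * chi nu \<sigma> * chi la \<sigma>)
    = (\<Sum>\<sigma>\<in>perms n. (\<Sum>ka\<in>partitions n. real (lr_count (2 * n) k ka nu) * chi ka \<sigma>) * chi la \<sigma>)"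
    by (rule sum.cong[OF refl]) (simp only: two_row_mult_chi[OF k nu])
  also have "\<dots> = (\<Sum>ka\<in>partitions n. real (lr_count (2 * n) k ka nu) * (\<Sum>\<sigma>\<in>perms n. chi ka \<sigma> * chi la \<sigma>))"
    by (rule ip_sum_left[OF le_twice twice_pos finite_partitions])
  also have "\<dots> = (\<Sum>ka\<in>partitions n. if ka = la then real (lr_count (2 * n) k ka nu) * fact n else 0)"
    by (rule sum.cong[OF refl]) (subst chi_orthonormal[OF le_twice twice_pos _ la], assumption, simp)
  finally show ?thesis using la finite_partitions by simp
qed

text \<open>Multiplication by a real class function is a symmetric operator in the orthonormal
  characters. This lets \<open>la\<close>, the factor in the product, become the shape of the
  tableaux.\<close>

lemma lr_count_commute:
  assumes "k \<le> n" "la \<in> partitions n" "nu \<in> partitions n"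
  shows "lr_count (2 * n) k la nu = lr_count (2 * n) k nu la"
proof -
  have "fact n * real (lr_count (2 * n) k la nu) = fact n * real (lr_count (2 * n) k nu la)"
    unfolding lr_count_inner[OF assms(1,2,3), symmetric] lr_count_inner[OF assms(1,3,2), symmetric]
    by (rule sum.cong[OF refl]) simp
  then show ?thesis by simp
qed

section \<open>The two-row character as a difference of permutation characters\<close>

lemma kos_two_row:
  assumes k: "k \<le> n" and la: "la \<in> partitions n"
  shows "kos (2 * n) la (two_row n k) = (if interlaced (row_shape (n - k)) (shp la) then 1 else 0)"
proof -
  let ?N = "2 * n"
  have sh: "shape ?N (shp la)" "vsize ?N (shp la) = n" using shp_par[OF la le_twice] by (auto simp: par_def)
  have eq: "two_row n k = (\<lambda>i. if i < 1 then (\<lambda>i. if i = 0 then n - k else 0) i else (\<lambda>i. if i = 0 then k else 0) (i - 1))"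
    by (auto simp: two_row_def fun_eq_iff)
  have row: "interlaced (\<lambda>_. 0) a \<longleftrightarrow> a = row_shape (n - k)" if a: "a \<in> par ?N (n - k)" for a
  proof
    assume il: "interlaced (\<lambda>_. 0) a"
    have z: "a r = 0" if "0 < r" for r using il that by (cases r) (auto simp: interlaced_def)
    have "vsize ?N a = (\<Sum>r\<in>{0}. a r)" unfolding vsize_def
      by (rule sum.mono_neutral_right) (use z n in auto)
    then have "a 0 = n - k" using a by (simp add: par_def)
    then show "a = row_shape (n - k)" using z by (auto simp: fun_eq_iff row_shape_def)
  qed (simp add: interlaced_def row_shape_def)
  have mem: "row_shape (n - k) \<in> par ?N (n - k)" using vsize_row_shape[OF twice_pos] shape_row_shape[OF twice_pos] by (simp add: par_def)
  have "kos ?N la (two_row n k) = (\<Sum>a\<in>par ?N (n - k). kostka ?N (\<lambda>_. 0) a (\<lambda>i. if i = 0 then n - k else 0)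
      * kostka ?N a (shp la) (\<lambda>i. if i = 0 then k else 0))"
    unfolding eq by (subst kostka_split[OF sh(1)]) (use n in auto)
  also have "\<dots> = (\<Sum>a\<in>par ?N (n - k). if a = row_shape (n - k) then
      (if interlaced (row_shape (n - k)) (shp la) then 1 else 0) else 0)"
  proof (rule sum.cong[OF refl])
    fix a assume a: "a \<in> par ?N (n - k)"
    then have va: "shape ?N a" "vsize ?N a = n - k" by (auto simp: par_def)
    show "kostka ?N (\<lambda>_. 0) a (\<lambda>i. if i = 0 then n - k else 0) * kostka ?N a (shp la) (\<lambda>i. if i = 0 then k else 0)
      = (if a = row_shape (n - k) then (if interlaced (row_shape (n - k)) (shp la) then 1 else 0) else 0)"
      using row[OF a] va sh k by (auto simp: kostka_single[OF va(1) twice_pos] kostka_single[OF sh(1) twice_pos])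
  qed
  finally show ?thesis using mem finite_par by simp
qed

text \<open>The Kostka numbers for \<open>p\<close> and \<open>p - 1\<close> are 1 exactly on the
  partitions with at most two rows whose second row is at most \<open>p\<close>, respectively
  \<open>p - 1\<close>; they differ only at \<open>[n - p, p]\<close>.\<close>

lemma chi_two_row:
  assumes p: "0 < p" "2 * p \<le> n" and s: "\<sigma> \<in> perms n"
  shows "chi [n - p, p] \<sigma> = real (xi {1..n} (two_row n p) \<sigma>) - real (xi {1..n} (two_row n (p - 1)) \<sigma>)"
proof -
  let ?N = "2 * n"
  have P: "[n - p, p] \<in> partitions n" using p by (auto simp: partitions_def)
  have tr: "two_row n k \<in> comp_of n ?N" if "k \<le> n" for k
    using sum_two[OF two_le_twice, of "two_row n k"] that n by (auto simp: comp_of_def[OF le_twice twice_pos] two_row_def)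
  have diff: "real (kos ?N la (two_row n p)) - real (kos ?N la (two_row n (p - 1))) = (if la = [n - p, p] then 1 else 0)"
    if la: "la \<in> partitions n" for la
  proof -
    have il: "interlaced (row_shape q) (shp la) \<longleftrightarrow> q \<le> shp la 0 \<and> shp la 1 \<le> q \<and> (\<forall>r\<ge>2. shp la r = 0)" for q
    proof -
      have "interlaced (row_shape q) (shp la) \<longleftrightarrow> q \<le> shp la 0 \<and> (\<forall>k. shp la (Suc k) \<le> row_shape q k)"
        by (auto simp: interlaced_def row_shape_def)
      also have "(\<forall>k. shp la (Suc k) \<le> row_shape q k) \<longleftrightarrow> shp la 1 \<le> q \<and> (\<forall>r\<ge>2. shp la r = 0)"
      proof (intro iffI conjI allI impI)
        assume *: "\<forall>k. shp la (Suc k) \<le> row_shape q k"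
        show "shp la 1 \<le> q" using *[rule_format, of 0] by (simp add: row_shape_def One_nat_def)
        show "shp la r = 0" if "2 \<le> r" for r
          using *[rule_format, of "r - 1"] that by (simp add: row_shape_def)
      next
        fix k assume "shp la 1 \<le> q \<and> (\<forall>r\<ge>2. shp la r = 0)"
        then show "shp la (Suc k) \<le> row_shape q k" by (cases k) (auto simp: row_shape_def One_nat_def)
      qed
      finally show ?thesis .
    qed
    have anti: "shp la 1 \<le> shp la 0" using shp_antimono[OF la] by (auto simp: antimono_def)
    have tot: "shp la 0 + shp la 1 = n" if "\<forall>r\<ge>2. shp la r = 0"
    proof -
      have "(\<Sum>r<?N. shp la r) = n" using shp_par[OF la le_twice] by (simp add: par_def vsize_def)
      then show ?thesis using sum_two[OF two_le_twice, of "shp la"] that by simp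
    qed
    have iff: "la = [n - p, p] \<longleftrightarrow> shp la 1 = p \<and> (\<forall>r\<ge>2. shp la r = 0)"
    proof
      assume "la = [n - p, p]"
      then show "shp la 1 = p \<and> (\<forall>r\<ge>2. shp la r = 0)" by (auto simp: shp_def part_def)
    next
      assume *: "shp la 1 = p \<and> (\<forall>r\<ge>2. shp la r = 0)"
      then have "shp la 0 = n - p" using tot by simp
      have "shp la r = shp [n - p, p] r" for r
      proof -
        consider "r = 0" | "r = 1" | "2 \<le> r" by linarith
        then show ?thesis
          using * \<open>shp la 0 = n - p\<close> by cases (auto simp: shp_def part_def)
      qed
      then show "la = [n - p, p]" using shp_inj[OF la P] by auto
    qed
    have a1: "kos ?N la (two_row n p) = (if (\<forall>r\<ge>2. shp la r = 0) \<and> shp la 1 \<le> p then 1 else 0)"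
    proof -
      have "interlaced (row_shape (n - p)) (shp la) \<longleftrightarrow> (\<forall>r\<ge>2. shp la r = 0) \<and> shp la 1 \<le> p"
        unfolding il using tot anti p by auto
      then show ?thesis using kos_two_row[of p la] p la by simp
    qed
    have a2: "kos ?N la (two_row n (p - 1)) = (if (\<forall>r\<ge>2. shp la r = 0) \<and> shp la 1 \<le> p - 1 then 1 else 0)"
    proof -
      have "interlaced (row_shape (n - (p - 1))) (shp la) \<longleftrightarrow> (\<forall>r\<ge>2. shp la r = 0) \<and> shp la 1 \<le> p - 1"
        unfolding il using tot anti p by auto
      then show ?thesis using kos_two_row[of "p - 1" la] p la by simp
    qed
    show ?thesis unfolding a1 a2 iff using p by auto
  qed
  have "real (xi {1..n} (two_row n p) \<sigma>) - real (xi {1..n} (two_row n (p - 1)) \<sigma>)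
    = (\<Sum>la\<in>partitions n. (real (kos ?N la (two_row n p)) - real (kos ?N la (two_row n (p - 1)))) * chi la \<sigma>)"
    using young_rule[OF le_twice twice_pos tr s] p by (simp add: sum_subtractf left_diff_distrib)
  also have "\<dots> = (\<Sum>la\<in>partitions n. if la = [n - p, p] then chi la \<sigma> else 0)"
    by (rule sum.cong[OF refl]) (simp add: diff)
  finally show ?thesis using P finite_partitions by simp
qed

theorem chi_two_row_mult:
  assumes p: "0 < p" "2 * p \<le> n" and la: "la \<in> partitions n" and s: "\<sigma> \<in> perms n"
  shows "chi [n - p, p] \<sigma> * chi la \<sigma> = (\<Sum>nu\<in>partitions n.
    (real (lr_count (2 * n) p la nu) - real (lr_count (2 * n) (p - 1) la nu)) * chi nu \<sigma>)"
proof -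
  have lr: "real (xi {1..n} (two_row n k) \<sigma>) * chi la \<sigma> = (\<Sum>nu\<in>partitions n. real (lr_count (2 * n) k la nu) * chi nu \<sigma>)"
    if "k \<le> n" for k
    unfolding two_row_mult_chi[OF that la s]
    by (rule sum.cong[OF refl]) (simp add: lr_count_commute[OF that la])
  show ?thesis unfolding chi_two_row[OF p s] left_diff_distrib sum_subtractf
    using lr[of p] lr[of "p - 1"] p by simp
qed

end

section \<open>Tableaux as patterns\<close>

text \<open>The half-open form matches the rows of a skew shape, whose columns begin just after the
  inner row.\<close>

lemma initial_segment:
  fixes D :: "nat set"
  assumes "D \<subseteq> {a<..b}" "\<And>c c'. c \<in> D \<Longrightarrow> a < c' \<Longrightarrow> c' < c \<Longrightarrow> c' \<in> D"
  shows "D = {a<..a + card D}"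
proof (cases "D = {}")
  case False
  have fin: "finite D" using assms(1) finite_subset by blast
  have M: "Max D \<in> D" using Max_in[OF fin False] .
  have "D = {a<..Max D}"
  proof (intro equalityI subsetI)
    fix c assume "c \<in> D" then show "c \<in> {a<..Max D}" using assms(1) Max_ge[OF fin] by auto
  next
    fix c assume "c \<in> {a<..Max D}"
    then show "c \<in> D" using assms(2)[OF M, of c] M by (cases "c = Max D") auto
  qed
  moreover from this have "a + card D = Max D" using M assms(1) by (metis add_diff_inverse_nat card_greaterThanAtMost
        greaterThanAtMost_iff not_less_iff_gr_or_eq subsetD)
  ultimately show ?thesis by simp
qed simp

lemma mem_skew: "(Suc r, c) \<in> skew la al \<longleftrightarrow> shp al r < c \<and> c \<le> shp la r"
  by (simp add: skew_def shp_def)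

lemma skew_Suc: "b \<in> skew la al \<Longrightarrow> \<exists>r c. b = (Suc r, c)"
  by (cases b) (auto simp: skew_def dest: Suc_le_D)

text \<open>Entries of a tableau start at 1, letters of a pattern at 0: the entries at most
  \<open>i\<close> are the letters less than \<open>i\<close>, which make up level
  \<open>i\<close>.\<close>

definition to_gt :: "nat list \<Rightarrow> nat list \<Rightarrow> (nat \<times> nat \<Rightarrow> nat) \<Rightarrow> nat \<Rightarrow> nat \<Rightarrow> nat" where
  "to_gt la al T i r = shp al r + card {c. (Suc r, c) \<in> skew la al \<and> T (Suc r, c) \<le> i}"

definition of_gt :: "nat list \<Rightarrow> nat list \<Rightarrow> (nat \<Rightarrow> nat \<Rightarrow> nat) \<Rightarrow> nat \<times> nat \<Rightarrow> nat" where
  "of_gt la al g b = (if b \<in> skew la al then LEAST i. snd b \<le> g i (fst b - 1) else 0)"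

lemma count_list_map_distinct:
  "distinct xs \<Longrightarrow> count_list (map f xs) v = card {x \<in> set xs. f x = v}"
proof (induction xs)
  case (Cons x xs)
  have "{y \<in> set (x # xs). f y = v} = (if f x = v then {x} else {}) \<union> {y \<in> set xs. f y = v}" by auto
  then show ?case using Cons by (auto simp: card_insert_if)
qed simp

text \<open>A prefix of the reading word consists of complete rows and a prefix of the next one;
  \<open>Q []\<close> stands apart to cover the case without rows.\<close>

lemma prefixes_concat:
  "(\<forall>j\<le>length (concat xss). Q (take j (concat xss)))
    \<longleftrightarrow> Q [] \<and> (\<forall>r<length xss. \<forall>c\<le>length (xss ! r). Q (concat (take r xss) @ take c (xss ! r)))"
proof (induction xss arbitrary: Q)
  case (Cons x xss)
  have "(\<forall>j\<le>length (concat (x # xss)). Q (take j (concat (x # xss))))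
    \<longleftrightarrow> (\<forall>c\<le>length x. Q (take c x)) \<and> (\<forall>j\<le>length (concat xss). Q (x @ take j (concat xss)))" (is "?L \<longleftrightarrow> ?A \<and> ?B")
  proof (intro iffI conjI allI impI)
    fix c assume ?L "c \<le> length x"
    then show "Q (take c x)" by (auto dest: spec[of _ c])
  next
    fix j assume ?L "j \<le> length (concat xss)"
    then show "Q (x @ take j (concat xss))" by (auto dest: spec[of _ "length x + j"])
  next
    fix j assume *: "?A \<and> ?B" "j \<le> length (concat (x # xss))"
    show "Q (take j (concat (x # xss)))"
    proof (cases "j \<le> length x")
      case True
      then show ?thesis using * by simp
    next
      case False
      then have "j - length x \<le> length (concat xss)" using *(2) by simp
      then have "Q (x @ take (j - length x) (concat xss))" using * by blast
      then show ?thesis using False by simp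
    qed
  qed
  also have "?B \<longleftrightarrow> Q x \<and> (\<forall>r<length xss. \<forall>c\<le>length (xss ! r). Q (x @ concat (take r xss) @ take c (xss ! r)))"
    using Cons.IH[of "\<lambda>u. Q (x @ u)"] by simp
  also have "?A \<and> (Q x \<and> (\<forall>r<length xss. \<forall>c\<le>length (xss ! r). Q (x @ concat (take r xss) @ take c (xss ! r))))
    \<longleftrightarrow> Q [] \<and> (\<forall>r<length (x # xss). \<forall>c\<le>length ((x # xss) ! r). Q (concat (take r (x # xss)) @ take c ((x # xss) ! r)))"
    (is "?l \<longleftrightarrow> ?r")
  proof
    assume l: ?l
    show ?r
    proof (intro conjI allI impI)
      show "Q []" using l by (metis le0 take0)
      fix r c assume "r < length (x # xss)" "c \<le> length ((x # xss) ! r)"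
      then show "Q (concat (take r (x # xss)) @ take c ((x # xss) ! r))" using l by (cases r) auto
    qed
  next
    assume r: ?r
    have A: "Q (take c x)" if "c \<le> length x" for c using r that by (auto dest: spec[of _ 0])
    moreover have "Q x" using A[of "length x"] by simp
    moreover have "Q (x @ concat (take r' xss) @ take c (xss ! r'))" if "r' < length xss" "c \<le> length (xss ! r')" for r' c
      using conjunct2[OF r, rule_format, of "Suc r'" c] that by simp
    ultimately show ?l by blast
  qed
  finally show ?case .
qed simp

context
  fixes la al :: "nat list" and n k N :: nat
  assumes la: "la \<in> partitions n" and al: "al \<in> partitions k" and nN: "n \<le> N"
    and sub: "\<And>r. shp al r \<le> shp la r"
begin

lemma shp_le: "r \<le> r' \<Longrightarrow> shp la r' \<le> shp la r" "r \<le> r' \<Longrightarrow> shp al r' \<le> shp al r"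
  using antimonoD[OF shp_antimono[OF la]] antimonoD[OF shp_antimono[OF al]] by auto

lemma shape_la: "shape N (shp la)"
  using shp_par[OF la nN] by (simp add: par_def)

text \<open>Rows increase weakly, so the entries at most \<open>i\<close> fill an initial segment of
  the row, and its end is recovered from its cardinality.\<close>

lemma to_gt_le_iff:
  assumes T: "T \<in> ssyt la al" and b: "(Suc r, c) \<in> skew la al"
  shows "T (Suc r, c) \<le> i \<longleftrightarrow> c \<le> to_gt la al T i r"
proof -
  let ?D = "{c. (Suc r, c) \<in> skew la al \<and> T (Suc r, c) \<le> i}"
  have "?D = {shp al r<..shp al r + card ?D}"
  proof (rule initial_segment[of _ _ "shp la r"])
    show "?D \<subseteq> {shp al r<..shp la r}" by (auto simp: mem_skew)
    fix c c' assume c: "c \<in> ?D" "shp al r < c'" "c' < c"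
    then have "(Suc r, c') \<in> skew la al" "(Suc r, c) \<in> skew la al" by (auto simp: mem_skew)
    then have "T (Suc r, c') \<le> T (Suc r, c)" using T c(3) unfolding ssyt_def by blast
    then show "c' \<in> ?D" using c \<open>(Suc r, c') \<in> skew la al\<close> by simp
  qed
  then have "c \<in> ?D \<longleftrightarrow> c \<in> {shp al r<..shp al r + card ?D}" by (rule arg_cong[of _ _ "\<lambda>X. c \<in> X"])
  then show ?thesis using b by (simp add: mem_skew to_gt_def)
qed

lemma to_gt_bounds:
  "shp al r \<le> to_gt la al T i r" "to_gt la al T i r \<le> shp la r"
proof -
  show "shp al r \<le> to_gt la al T i r" by (simp add: to_gt_def)
  have "card {c. (Suc r, c) \<in> skew la al \<and> T (Suc r, c) \<le> i} \<le> card {shp al r<..shp la r}"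
    by (rule card_mono) (auto simp: mem_skew)
  then show "to_gt la al T i r \<le> shp la r" using sub[of r] by (simp add: to_gt_def)
qed

lemma to_gt_mem:
  assumes T: "T \<in> ssyt la al" and TN: "\<And>b. T b \<le> N"
  shows "to_gt la al T \<in> gt N (shp al) (shp la)"
proof -
  let ?g = "to_gt la al T"
  have pos: "0 < T b" if "b \<in> skew la al" for b using T that unfolding ssyt_def by blast
  have 0: "?g 0 = shp al"
  proof
    fix r
    have "\<not> T (Suc r, c) \<le> 0" if "(Suc r, c) \<in> skew la al" for c using pos[OF that] by simp
    then have "{c. (Suc r, c) \<in> skew la al \<and> T (Suc r, c) \<le> 0} = {}" by blast
    then show "?g 0 r = shp al r" unfolding to_gt_def by (metis add_0_right card.empty)
  qed
  have top: "?g i = shp la" if "N \<le> i" for i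
  proof
    fix r
    show "?g i r = shp la r"
    proof (cases "shp al r < shp la r")
      case True
      then have "(Suc r, shp la r) \<in> skew la al" by (simp add: mem_skew)
      then have "shp la r \<le> ?g i r" using to_gt_le_iff[OF T, of r "shp la r" i] TN[of "(Suc r, shp la r)"] that by simp
      then show ?thesis using to_gt_bounds(2)[of T i r] by simp
    next
      case False
      then show ?thesis using to_gt_bounds(1)[of r T i] to_gt_bounds(2)[of T i r] sub[of r] by simp
    qed
  qed
  have "interlaced (?g i) (?g (Suc i))" for i
    unfolding interlaced_def
  proof (intro allI conjI)
    fix r
    show "?g i r \<le> ?g (Suc i) r" unfolding to_gt_def
      by (intro add_left_mono card_mono) (auto simp: mem_skew intro: finite_subset[of _ "{..shp la r}"])
    show "?g (Suc i) (Suc r) \<le> ?g i r"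
    proof (rule ccontr)
      let ?c = "?g (Suc i) (Suc r)"
      assume less: "\<not> ?c \<le> ?g i r"
      then have c: "shp al r < ?c" "?c \<le> shp la (Suc r)"
        using to_gt_bounds(1)[of r T i] to_gt_bounds(2)[of T "Suc i" "Suc r"] by auto
      have m1: "(Suc (Suc r), ?c) \<in> skew la al" using c shp_le(2)[of r "Suc r"] by (simp add: mem_skew)
      have m0: "(Suc r, ?c) \<in> skew la al" using c shp_le(1)[of r "Suc r"] by (simp add: mem_skew)
      have "T (Suc r, ?c) < T (Suc (Suc r), ?c)" using T m0 m1 unfolding ssyt_def by blast
      moreover have "T (Suc (Suc r), ?c) \<le> Suc i" using to_gt_le_iff[OF T m1, of "Suc i"] by simp
      ultimately have "T (Suc r, ?c) \<le> i" by simp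
      then show False using to_gt_le_iff[OF T m0, of i] less by simp
    qed
  qed
  then show ?thesis using 0 top by (simp add: gt_def)
qed

lemma of_gt_le_iff:
  assumes g: "g \<in> gt N (shp al) (shp la)" and b: "(Suc r, c) \<in> skew la al"
  shows "of_gt la al g (Suc r, c) \<le> i \<longleftrightarrow> c \<le> g i r"
proof -
  have eq: "of_gt la al g (Suc r, c) = (LEAST i. c \<le> g i r)" using b by (simp add: of_gt_def)
  have "g N r = shp la r" using g by (simp add: gt_def)
  then have ex: "\<exists>i. c \<le> g i r" using b by (metis mem_skew)
  show ?thesis
  proof
    assume "of_gt la al g (Suc r, c) \<le> i"
    then have "g (LEAST i. c \<le> g i r) r \<le> g i r" using gt_mono[OF g] eq by (simp add: le_fun_def)
    then show "c \<le> g i r" using LeastI_ex[OF ex] by simp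
  next
    assume "c \<le> g i r"
    then show "of_gt la al g (Suc r, c) \<le> i" unfolding eq by (rule Least_le)
  qed
qed

lemma of_gt_mem:
  assumes g: "g \<in> gt N (shp al) (shp la)"
  shows "of_gt la al g \<in> ssyt la al" "of_gt la al g b \<le> N" "to_gt la al (of_gt la al g) = g"
proof -
  let ?T = "of_gt la al g"
  have g0: "g 0 = shp al" and gN: "g N = shp la" using g by (auto simp: gt_def)
  have "0 < ?T b" if b: "b \<in> skew la al" for b
  proof -
    obtain r c where rc: "b = (Suc r, c)" using skew_Suc[OF b] by blast
    then have "\<not> c \<le> g 0 r" using b by (simp add: g0 mem_skew)
    then show ?thesis using of_gt_le_iff[OF g, of r c 0] b rc by simp
  qed
  moreover have "?T (i, j) \<le> ?T (i, j')" if h: "(i, j) \<in> skew la al" "(i, j') \<in> skew la al" "j < j'" for i j j'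
  proof -
    obtain r where r: "i = Suc r" using skew_Suc[OF h(1)] by auto
    have "j' \<le> g (?T (i, j')) r" using of_gt_le_iff[OF g, of r j' "?T (i, j')"] h r by simp
    then show ?thesis using of_gt_le_iff[OF g, of r j "?T (i, j')"] h r by simp
  qed
  moreover have "?T (i, j) < ?T (i', j)" if h: "(i, j) \<in> skew la al" "(i', j) \<in> skew la al" "i < i'" for i i' j
  proof -
    obtain r where r: "i = Suc r" using skew_Suc[OF h(1)] by auto
    obtain r' where r': "i' = Suc r'" using skew_Suc[OF h(2)] by auto
    have "0 < ?T (i', j)" using calculation(1) h(2) by blast
    then obtain m where m: "?T (i', j) = Suc m" by (cases "?T (i', j)") auto
    have "j \<le> g (Suc m) r'" using of_gt_le_iff[OF g, of r' j "Suc m"] h r' m by simp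
    also have "\<dots> \<le> g (Suc m) (Suc r)" using gt_shape[OF g shape_la, of "Suc m"] h r r' by (auto simp: shape_def antimono_def)
    also have "\<dots> \<le> g m r" using g by (simp add: gt_def interlaced_def)
    finally have "?T (i, j) \<le> m" using of_gt_le_iff[OF g, of r j m] h r by simp
    then show ?thesis using m by simp
  qed
  moreover have "?T b = 0" if "b \<notin> skew la al" for b using that by (simp add: of_gt_def)
  ultimately show "?T \<in> ssyt la al" unfolding ssyt_def by blast
  show "?T b \<le> N"
  proof (cases "b \<in> skew la al")
    case True
    then obtain r c where rc: "b = (Suc r, c)" using skew_Suc by blast
    then show ?thesis using of_gt_le_iff[OF g, of r c N] True by (simp add: gN mem_skew)
  next
    case False
    then show ?thesis by (simp add: of_gt_def)
  qed
  show "to_gt la al ?T = g"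
  proof (intro ext)
    fix i r
    have bd: "shp al r \<le> g i r" "g i r \<le> shp la r" using gt_bounds[OF g, of i] by (auto simp: le_fun_def)
    have "{c. (Suc r, c) \<in> skew la al \<and> ?T (Suc r, c) \<le> i} = {shp al r<..g i r}"
      using of_gt_le_iff[OF g, of r _ i] bd(2) by (auto simp: mem_skew)
    then show "to_gt la al ?T i r = g i r" using bd by (simp add: to_gt_def)
  qed
qed

lemma to_gt_inj:
  assumes T: "T \<in> ssyt la al" "T' \<in> ssyt la al" and eq: "to_gt la al T = to_gt la al T'"
  shows "T = T'"
proof
  fix b
  show "T b = T' b"
  proof (cases "b \<in> skew la al")
    case True
    then obtain r c where rc: "b = (Suc r, c)" using skew_Suc by blast
    have "T b \<le> i \<longleftrightarrow> T' b \<le> i" for i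
      using to_gt_le_iff[OF T(1), of r c i] to_gt_le_iff[OF T(2), of r c i] True rc eq by simp
    then show ?thesis by (meson order_antisym order_refl)
  next
    case False
    then have "T b = 0" "T' b = 0" using T unfolding ssyt_def by blast+
    then show ?thesis by simp
  qed
qed

lemma row_count_to_gt:
  assumes T: "T \<in> ssyt la al"
  shows "row_count la al T (Suc r) (Suc i) + to_gt la al T i r = to_gt la al T (Suc i) r"
proof -
  have "{c. (Suc r, c) \<in> skew la al \<and> T (Suc r, c) \<le> Suc i}
    = {c. (Suc r, c) \<in> skew la al \<and> T (Suc r, c) = Suc i} \<union> {c. (Suc r, c) \<in> skew la al \<and> T (Suc r, c) \<le> i}" (is "?A = ?B \<union> ?C")
    by (auto simp: le_Suc_eq)
  moreover have "card (?B \<union> ?C) = card ?B + card ?C"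
    by (rule card_Un_disjoint) (auto simp: mem_skew intro: finite_subset[of _ "{..shp la r}"])
  ultimately have "card ?A = card ?B + card ?C" by (rule back_subst[of "\<lambda>x. card x = _", OF _ sym, rotated])
  then show ?thesis by (simp add: row_count_def to_gt_def)
qed

lemma content_to_gt:
  assumes T: "T \<in> ssyt la al"
  shows "ssyt_content la al T (Suc i) = wt N (to_gt la al T) i"
proof -
  have len: "length la \<le> N" using length_partition[OF la] nN by simp
  have "{b \<in> skew la al. T b = Suc i} = (\<lambda>(r, c). (Suc r, c)) ` (SIGMA r:{..<N}. {c. (Suc r, c) \<in> skew la al \<and> T (Suc r, c) = Suc i})"
  proof (intro equalityI subsetI)
    fix b assume b: "b \<in> {b \<in> skew la al. T b = Suc i}"
    then obtain r c where rc: "b = (Suc r, c)" using skew_Suc by blast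
    have "r < N"
    proof (rule ccontr)
      assume "\<not> r < N"
      then have "shp la r = 0" using len by (intro shp_zero) simp
      then show False using b by (auto simp: rc mem_skew)
    qed
    then show "b \<in> (\<lambda>(r, c). (Suc r, c)) ` (SIGMA r:{..<N}. {c. (Suc r, c) \<in> skew la al \<and> T (Suc r, c) = Suc i})"
      using b rc by (intro image_eqI[of _ _ "(r, c)"]) auto
  qed auto
  moreover have "inj_on (\<lambda>(r, c). (Suc r, c)) X" for X :: "(nat \<times> nat) set" by (auto simp: inj_on_def)
  ultimately have "ssyt_content la al T (Suc i) = card (SIGMA r:{..<N}. {c. (Suc r, c) \<in> skew la al \<and> T (Suc r, c) = Suc i})"
    unfolding ssyt_content_def by (simp add: card_image)
  also have "\<dots> = (\<Sum>r<N. row_count la al T (Suc r) (Suc i))"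
    unfolding row_count_def by (rule card_SigmaI) (auto simp: mem_skew intro: finite_subset[of _ "{.._}"])
  finally have "ssyt_content la al T (Suc i) + vsize N (to_gt la al T i) = vsize N (to_gt la al T (Suc i))"
    unfolding vsize_def by (simp add: sum.distrib[symmetric] row_count_to_gt[OF T])
  then show ?thesis by (simp add: wt_def)
qed


section \<open>Reading words and the lattice condition\<close>

lemma count_row_suffix:
  assumes T: "T \<in> ssyt la al" and e: "shp al r \<le> e" "e \<le> shp la r"
  shows "card {c \<in> {e<..shp la r}. T (Suc r, c) = Suc i} + max (to_gt la al T i r) e = max (to_gt la al T (Suc i) r) e"
proof -
  have set: "{c \<in> {e<..shp la r}. T (Suc r, c) \<le> m} = {e<..to_gt la al T m r}" for m
    using to_gt_le_iff[OF T, of r _ m] to_gt_bounds(2)[of T m r] e by (auto simp: mem_skew)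
  have "{c \<in> {e<..shp la r}. T (Suc r, c) \<le> Suc i} = {c \<in> {e<..shp la r}. T (Suc r, c) = Suc i} \<union> {c \<in> {e<..shp la r}. T (Suc r, c) \<le> i}"
    by (auto simp: le_Suc_eq)
  then have "card {e<..to_gt la al T (Suc i) r} = card ({c \<in> {e<..shp la r}. T (Suc r, c) = Suc i} \<union> {e<..to_gt la al T i r})"
    unfolding set by simp
  also have "\<dots> = card {c \<in> {e<..shp la r}. T (Suc r, c) = Suc i} + card {e<..to_gt la al T i r}"
  proof (rule card_Un_disjoint)
    show "{c \<in> {e<..shp la r}. T (Suc r, c) = Suc i} \<inter> {e<..to_gt la al T i r} = {}"
      unfolding set[of i, symmetric] by auto
  qed auto
  finally have eq: "to_gt la al T (Suc i) r - e = card {c \<in> {e<..shp la r}. T (Suc r, c) = Suc i} + (to_gt la al T i r - e)"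
    by (simp only: card_greaterThanAtMost)
  have arith: "B - e = x + (A - e) \<Longrightarrow> A \<le> B \<Longrightarrow> x + max A e = max B e" for x A B :: nat
    by (auto simp: max_def)
  have "to_gt la al T i r \<le> to_gt la al T (Suc i) r"
    using row_count_to_gt[OF T, of r i] by simp
  with eq show ?thesis by (rule arith)
qed

abbreviation row_word :: "(nat \<times> nat \<Rightarrow> nat) \<Rightarrow> nat \<Rightarrow> nat list" where
  "row_word T r \<equiv> map (\<lambda>j. T (Suc r, j)) (rev [shp al r + 1..<shp la r + 1])"

lemma reading_word_eq: "reverse_reading_word la al T = concat (map (row_word T) [0..<length la])"
proof -
  have "[1..<length la + 1] = map Suc [0..<length la]" by (simp add: map_Suc_upt)
  then show ?thesis by (simp add: reverse_reading_word_def shp_def o_def)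
qed

text \<open>The first \<open>c\<close> entries read in row \<open>r\<close> are those beyond column
  \<open>shp la r - c\<close>; taking \<open>max\<close> with this column makes the count uniform in
  the position of the cut.\<close>

lemma count_row_prefix:
  assumes T: "T \<in> ssyt la al" and c: "c \<le> shp la r - shp al r"
  shows "count_list (take c (row_word T r)) (Suc i) + max (to_gt la al T i r) (shp la r - c)
    = max (to_gt la al T (Suc i) r) (shp la r - c)"
proof -
  have "take c (rev [shp al r + 1..<shp la r + 1]) = rev [shp la r - c + 1..<shp la r + 1]"
    using c sub[of r] by (simp add: take_rev drop_upt Suc_diff_le del: upt_Suc)
  then have "count_list (take c (row_word T r)) (Suc i) = count_list (map (\<lambda>j. T (Suc r, j)) (rev [shp la r - c + 1..<shp la r + 1])) (Suc i)"
    by (simp add: take_map del: upt_Suc)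
  also have "\<dots> = card {j \<in> set (rev [shp la r - c + 1..<shp la r + 1]). T (Suc r, j) = Suc i}"
    by (rule count_list_map_distinct) simp
  also have "set (rev [shp la r - c + 1..<shp la r + 1]) = {shp la r - c<..shp la r}" by auto
  finally show ?thesis using count_row_suffix[OF T, of r "shp la r - c" i] c sub[of r] by simp
qed

lemma count_rows:
  assumes T: "T \<in> ssyt la al"
  shows "r \<le> length la \<Longrightarrow> count_list (concat (take r (map (row_word T) [0..<length la]))) (Suc i) + row_sum (to_gt la al T) i r
    = row_sum (to_gt la al T) (Suc i) r"
proof (induction r)
  case (Suc r)
  have "length (row_word T r) = shp la r - shp al r" by (simp del: upt_Suc)
  then have tk: "take (shp la r - shp al r) (row_word T r) = row_word T r" by (simp only: take_all order_refl)
  have "count_list (row_word T r) (Suc i) + to_gt la al T i r = to_gt la al T (Suc i) r"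
    using count_row_prefix[OF T, of "shp la r - shp al r" r i] sub[of r] to_gt_bounds(1)[of r T i] to_gt_bounds(1)[of r T "Suc i"]
    unfolding tk by (simp del: upt_Suc add: max_absorb1)
  moreover have "take (Suc r) (map (row_word T) [0..<length la]) = take r (map (row_word T) [0..<length la]) @ [row_word T r]"
    using Suc.prems by (simp add: take_Suc_conv_app_nth)
  ultimately show ?case using Suc by (simp add: row_sum_def)
qed (simp add: row_sum_def)

text \<open>Read from the right, a row decreases weakly. The condition between the letters
  \<open>i\<close> and \<open>Suc i\<close> is thus tightest after the last \<open>Suc i\<close> of
  the row and before its first \<open>i\<close>, and this is the prefix tested by
  \<open>lattice_iff_rows\<close>.\<close>

lemma lattice_permutation_iff:
  assumes T: "T \<in> ssyt la al" and TN: "\<And>b. T b \<le> N" and kN: "k \<le> N"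
  shows "lattice_permutation al (reverse_reading_word la al T) \<longleftrightarrow> lattice N (shp al) (to_gt la al T)"
proof -
  let ?g = "to_gt la al T" and ?xss = "map (row_word T) [0..<length la]"
  note g = to_gt_mem[OF T TN]
  have anti: "antimono (shp al)" using shp_antimono[OF al] .
  define Q where "Q w \<longleftrightarrow> (\<forall>i. count_list w (Suc i) + shp al i \<ge> count_list w (Suc (Suc i)) + shp al (Suc i))" for w
  have Q: "(\<forall>i\<ge>1. count_list w i + part al i \<ge> count_list w (i + 1) + part al (i + 1)) \<longleftrightarrow> Q w" for w
  proof -
    have "(\<forall>i\<ge>1. P i) \<longleftrightarrow> (\<forall>i. P (Suc i))" for P :: "nat \<Rightarrow> bool" by (metis Suc_le_D le_SucI One_nat_def le0 Suc_le_mono)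
    then show ?thesis by (simp add: Q_def shp_def)
  qed
  have il: "?g i r \<le> ?g (Suc i) r" for i r using row_count_to_gt[OF T, of r i] by simp
  have step: "Q (concat (take r ?xss) @ take c (row_word T r)) \<longleftrightarrow> (\<forall>i.
      shp al (Suc i) + row_sum ?g (Suc (Suc i)) r + max (?g (Suc (Suc i)) r) (shp la r - c) + row_sum ?g i r + max (?g i r) (shp la r - c)
      \<le> shp al i + 2 * row_sum ?g (Suc i) r + 2 * max (?g (Suc i) r) (shp la r - c))"
    if r: "r < length la" and c: "c \<le> shp la r - shp al r" for r c
    unfolding Q_def
  proof (intro all_cong1)
    fix i
    show "(count_list (concat (take r ?xss) @ take c (row_word T r)) (Suc (Suc i)) + shp al (Suc i)
        \<le> count_list (concat (take r ?xss) @ take c (row_word T r)) (Suc i) + shp al i)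
      \<longleftrightarrow> shp al (Suc i) + row_sum ?g (Suc (Suc i)) r + max (?g (Suc (Suc i)) r) (shp la r - c) + row_sum ?g i r + max (?g i r) (shp la r - c)
      \<le> shp al i + 2 * row_sum ?g (Suc i) r + 2 * max (?g (Suc i) r) (shp la r - c)"
      using count_rows[OF T, of r i] count_rows[OF T, of r "Suc i"] count_row_prefix[OF T c, of i] count_row_prefix[OF T c, of "Suc i"] r
      unfolding count_list_append by linarith
  qed
  have "lattice_permutation al (reverse_reading_word la al T)
    \<longleftrightarrow> (\<forall>r<length la. \<forall>c\<le>shp la r - shp al r. Q (concat (take r ?xss) @ take c (row_word T r)))"
  proof -
    have "lattice_permutation al (reverse_reading_word la al T) \<longleftrightarrow> (\<forall>j\<le>length (concat ?xss). Q (take j (concat ?xss)))"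
      unfolding lattice_permutation_def reading_word_eq Q ..
    also have "\<dots> \<longleftrightarrow> Q [] \<and> (\<forall>r<length ?xss. \<forall>c\<le>length (?xss ! r). Q (concat (take r ?xss) @ take c (?xss ! r)))"
      by (rule prefixes_concat)
    also have "\<dots> \<longleftrightarrow> (\<forall>r<length la. \<forall>c\<le>shp la r - shp al r. Q (concat (take r ?xss) @ take c (row_word T r)))"
      using anti by (auto simp: Q_def antimono_iff_le_Suc)
    finally show ?thesis .
  qed
  also have "\<dots> \<longleftrightarrow> lattice N (shp al) ?g"
    unfolding lattice_iff_rows[OF g shape_la anti]
  proof (intro iffI allI impI)
    fix i r assume *: "\<forall>r<length la. \<forall>c\<le>shp la r - shp al r. Q (concat (take r ?xss) @ take c (row_word T r))" and "Suc i < N"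
    have D: "shp al (Suc i) + row_sum ?g (Suc (Suc i)) (Suc r) + row_sum ?g i r \<le> shp al i + row_sum ?g (Suc i) r + row_sum ?g (Suc i) (Suc r)"
      if r: "r < length la" for r
    proof -
      \<comment> \<open>The prefix stops at column \<open>?g (Suc i) r\<close>: all letters
        \<open>Suc i\<close> of the row have been read and none of its letters
        \<open>i\<close>.\<close>
      let ?c = "shp la r - ?g (Suc i) r"
      have b: "shp al r \<le> ?g (Suc i) r" "?g (Suc i) r \<le> shp la r" by (rule to_gt_bounds)+
      then have c: "?c \<le> shp la r - shp al r" "shp la r - ?c = ?g (Suc i) r" by auto
      have "Q (concat (take r ?xss) @ take ?c (row_word T r))" using * r c by blast
      from step[OF r c(1), THEN iffD1, OF this, rule_format, of i] il[of i r] il[of "Suc i" r]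
      show ?thesis unfolding c(2) by (simp add: row_sum_def max_def split: if_splits)
    qed
    show "shp al (Suc i) + row_sum ?g (Suc (Suc i)) (Suc r) + row_sum ?g i r \<le> shp al i + row_sum ?g (Suc i) r + row_sum ?g (Suc i) (Suc r)"
    proof (cases "r < length la")
      case False
      have z: "?g m r' = 0" if "length la \<le> r'" for m r' using shp_zero[OF that] to_gt_bounds(2)[of T m r'] by simp
      have cut: "row_sum ?g m r' = row_sum ?g m (length la)" if "length la \<le> r'" for m r'
        unfolding row_sum_def by (rule sum.mono_neutral_right) (use that z in auto)
      \<comment> \<open>Past the last row the sums are constant, so the condition follows from the
        one for the last row, or from \<open>al\<close> being a partition if there are no
        rows.\<close>
      have cuts: "row_sum ?g m (Suc r) = row_sum ?g m (length la)" "row_sum ?g m r = row_sum ?g m (length la)" for m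
        using cut[of r m] cut[of "Suc r" m] False by auto
      show ?thesis
      proof (cases "length la")
        case 0
        then show ?thesis unfolding cuts using anti by (simp add: row_sum_def antimono_iff_le_Suc)
      next
        case (Suc r')
        then show ?thesis unfolding cuts using D[of r'] il[of i r'] by (simp add: row_sum_def)
      qed
    qed (rule D)
  next
    fix r c assume *: "\<forall>i r. Suc i < N \<longrightarrow> shp al (Suc i) + row_sum ?g (Suc (Suc i)) (Suc r) + row_sum ?g i r
        \<le> shp al i + row_sum ?g (Suc i) r + row_sum ?g (Suc i) (Suc r)"
      and r: "r < length la" and c: "c \<le> shp la r - shp al r"
    show "Q (concat (take r ?xss) @ take c (row_word T r))"
      unfolding step[OF r c]
    proof
      fix i
      have "shp al (Suc i) + row_sum ?g (Suc (Suc i)) (Suc r) + row_sum ?g i r \<le> shp al i + row_sum ?g (Suc i) r + row_sum ?g (Suc i) (Suc r)"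
      proof (cases "Suc i < N")
        case False
        \<comment> \<open>No letter from \<open>N\<close> on occurs, and \<open>al\<close> has at
          most \<open>k\<close> rows, so nothing is counted for \<open>Suc i\<close>.\<close>
        have "shp al (Suc i) = 0" using False length_partition[OF al] kN by (intro shp_zero) linarith
        moreover have "?g (Suc i) = ?g (Suc (Suc i))" using g False by (simp add: gt_def)
        moreover have "row_sum ?g i r \<le> row_sum ?g (Suc i) r" unfolding row_sum_def by (intro sum_mono il)
        ultimately show ?thesis by (simp add: row_sum_def)
      qed (use * in blast)
      then show "shp al (Suc i) + row_sum ?g (Suc (Suc i)) r + max (?g (Suc (Suc i)) r) (shp la r - c) + row_sum ?g i r + max (?g i r) (shp la r - c)
        \<le> shp al i + 2 * row_sum ?g (Suc i) r + 2 * max (?g (Suc i) r) (shp la r - c)"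
        using il[of i r] il[of "Suc i" r] by (simp add: row_sum_def max_def)
    qed
  qed
  finally show ?thesis .
qed

end

section \<open>Kronecker tableaux\<close>

definition lr_set :: "nat \<Rightarrow> (nat \<Rightarrow> nat) \<Rightarrow> nat list \<Rightarrow> nat list \<Rightarrow> (nat \<Rightarrow> nat \<Rightarrow> nat) set" where
  "lr_set N a la nu = {g \<in> gt N a (shp la). lattice N a g \<and> (\<lambda>i. a i + wt N g i) = shp nu}"

text \<open>In a pattern \<open>g 1 1 - a 1\<close> is the number of entries 1 in the second row and
  \<open>g 2 0 - g 1 0\<close> the number of entries 2 in the first row.\<close>

definition kron_set :: "nat \<Rightarrow> (nat \<Rightarrow> nat) \<Rightarrow> nat list \<Rightarrow> nat list \<Rightarrow> (nat \<Rightarrow> nat \<Rightarrow> nat) set" where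
  "kron_set N a la nu = {g \<in> lr_set N a la nu. a 0 = a 1 \<or> a 1 < a 0 \<and> (g 1 1 = a 0 \<or> g 2 0 = g 1 0 + (a 0 - a 1))}"

text \<open>An entry that occurs is the index of a nonzero part of \<open>nu\<close>, and a
  partition of \<open>m\<close> has at most \<open>m\<close> parts. Patterns have a fixed number of
  letters, so such a bound is required to pass to them.\<close>

lemma content_bound:
  assumes la: "la \<in> partitions n" and T: "T \<in> ssyt la al"
    and ty: "\<And>i. 1 \<le> i \<Longrightarrow> ssyt_content la al T i \<le> part nu i" and nu: "nu \<in> partitions m"
  shows "T b \<le> m"
proof (cases "b \<in> skew la al")
  case True
  have pos: "0 < T b" using T True unfolding ssyt_def by blast
  have "finite (skew la al)"
  proof (rule finite_subset)
    show "skew la al \<subseteq> {..length la} \<times> {..shp la 0}"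
    proof
      fix b assume b: "b \<in> skew la al"
      then obtain r c where rc: "b = (Suc r, c)" using skew_Suc by blast
      then have c: "c \<le> shp la r" "c \<noteq> 0" using b by (auto simp: mem_skew)
      have "r < length la" using c shp_zero[of la r] by (cases "r < length la") auto
      moreover have "shp la r \<le> shp la 0" using shp_antimono[OF la] by (auto simp: antimono_def)
      ultimately show "b \<in> {..length la} \<times> {..shp la 0}" using c rc by auto
    qed
  qed simp
  then have "finite {b' \<in> skew la al. T b' = T b}" by simp
  moreover have "b \<in> {b' \<in> skew la al. T b' = T b}" using True by simp
  ultimately have "0 < ssyt_content la al T (T b)" unfolding ssyt_content_def card_gt_0_iff by blast
  then have "0 < part nu (T b)" using ty[of "T b"] pos by simp
  then have "T b \<le> length nu" by (auto simp: part_def split: if_splits)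
  then show ?thesis using length_partition[OF nu] by simp
next
  case False
  then have "T b = 0" using T unfolding ssyt_def by blast
  then show ?thesis by simp
qed

lemma kronecker_tableaux_bij:
  assumes la: "la \<in> partitions n" and al: "al \<in> partitions k" and nu: "nu \<in> partitions n"
    and nN: "n \<le> N" and kN: "k \<le> N" and sub: "\<And>r. shp al r \<le> shp la r"
  shows "kronecker_tableau_count la al nu = card (kron_set N (shp al) la nu)"
  unfolding kronecker_tableau_count_def
proof (rule bij_betw_same_card[of "to_gt la al"], rule bij_betw_imageI)
  note ctx = la al nN sub
  show "inj_on (to_gt la al) (kronecker_tableaux la al nu)"
    using to_gt_inj[OF ctx] by (auto simp: inj_on_def kronecker_tableaux_def)
  have type: "has_type la al nu T \<longleftrightarrow> (\<lambda>i. shp al i + wt N (to_gt la al T) i) = shp nu" if T: "T \<in> ssyt la al" for T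
  proof -
    have "has_type la al nu T \<longleftrightarrow> (\<forall>i. ssyt_content la al T (Suc i) + part al (Suc i) = part nu (Suc i))"
      unfolding has_type_def by (metis One_nat_def Suc_le_D Suc_le_mono le0)
    also have "\<dots> \<longleftrightarrow> (\<forall>i. shp al i + wt N (to_gt la al T) i = shp nu i)"
      using content_to_gt[OF ctx T] by (simp add: shp_def add.commute)
    finally show ?thesis by (simp add: fun_eq_iff)
  qed
  have anti: "shp al 1 \<le> shp al 0" using shp_antimono[OF al] by (auto simp: antimono_def)
  have extra: "(part al 1 = part al 2 \<or> part al 1 > part al 2 \<and>
      (row_count la al T 2 1 = part al 1 - part al 2 \<or> row_count la al T 1 2 = part al 1 - part al 2))
    \<longleftrightarrow> (shp al 0 = shp al 1 \<or> shp al 1 < shp al 0 \<and>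
      (to_gt la al T 1 1 = shp al 0 \<or> to_gt la al T 2 0 = to_gt la al T 1 0 + (shp al 0 - shp al 1)))"
    if T: "T \<in> ssyt la al" and TN: "\<And>b. T b \<le> N" for T
  proof -
    have g0: "to_gt la al T 0 = shp al" using to_gt_mem[OF ctx T TN] by (simp add: gt_def)
    have p: "part al 1 = shp al 0" "part al 2 = shp al 1" by (simp_all add: shp_def numeral_2_eq_2)
    have "row_count la al T 2 1 + shp al 1 = to_gt la al T 1 1"
      using row_count_to_gt[OF ctx T, of 1 0] by (simp add: g0 numeral_2_eq_2)
    moreover have "row_count la al T 1 2 + to_gt la al T 1 0 = to_gt la al T 2 0"
      using row_count_to_gt[OF ctx T, of 0 1] by (simp add: numeral_2_eq_2)
    ultimately show ?thesis unfolding p using anti by auto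
  qed
  show "to_gt la al ` kronecker_tableaux la al nu = kron_set N (shp al) la nu"
  proof (intro equalityI subsetI)
    fix g assume "g \<in> to_gt la al ` kronecker_tableaux la al nu"
    then obtain T where g: "g = to_gt la al T" and T: "T \<in> ssyt la al" and ty: "has_type la al nu T"
      and lat: "lattice_permutation al (reverse_reading_word la al T)"
      and ex: "part al 1 = part al 2 \<or> part al 1 > part al 2 \<and>
      (row_count la al T 2 1 = part al 1 - part al 2 \<or> row_count la al T 1 2 = part al 1 - part al 2)"
      unfolding kronecker_tableaux_def by blast
    have "ssyt_content la al T i \<le> part nu i" if "1 \<le> i" for i
      using ty that unfolding has_type_def by (metis le_add1)
    then have TN: "T b \<le> N" for b using content_bound[OF la T _ nu, of b] nN by simp
    show "g \<in> kron_set N (shp al) la nu"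
      using to_gt_mem[OF ctx T TN] lattice_permutation_iff[OF ctx T TN kN] lat type[OF T] ty extra[OF T TN] ex
      unfolding kron_set_def lr_set_def g by blast
  next
    fix g assume g: "g \<in> kron_set N (shp al) la nu"
    then have gg: "g \<in> gt N (shp al) (shp la)" by (simp add: kron_set_def lr_set_def)
    let ?T = "of_gt la al g"
    note T = of_gt_mem[OF ctx gg]
    have "?T \<in> kronecker_tableaux la al nu"
      using g T(1) lattice_permutation_iff[OF ctx T(1,2) kN] type[OF T(1)] extra[OF T(1,2)]
      unfolding kron_set_def lr_set_def kronecker_tableaux_def T(3) by blast
    then show "g \<in> to_gt la al ` kronecker_tableaux la al nu" using T(3) by (metis imageI)
  qed
qed

section \<open>Trading a box of the inner shape for an entry 1\<close>

lemma row_sum_upd_other: "m \<noteq> 0 \<Longrightarrow> row_sum (g(0 := b)) m r = row_sum g m r"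
  by (simp add: row_sum_def)

lemma row_sum_0: "row_sum g m 0 = 0"
  by (simp add: row_sum_def)

text \<open>The box at the end of the first row of \<open>a\<close> is traded for an entry 1: a pattern starting at \<open>b\<close> and
  a pattern starting at \<open>b + e\<^sub>1\<close> that share all higher levels satisfy the same lattice conditions, except
  for the one on the first row.\<close>

lemma lattice_shift_iff:
  assumes g: "g \<in> gt N a l" and g': "g(0 := b) \<in> gt N b l" and l: "shape N l" and N: "2 \<le> N"
    and a: "antimono a" and b: "antimono b" and a0: "a 0 = Suc (b 0)" and ab: "\<And>i. 0 < i \<Longrightarrow> a i = b i"
    and first: "b 1 + g 2 0 \<le> b 0 + g 1 0"
  shows "lattice N a g \<longleftrightarrow> lattice N b (g(0 := b))"
proof -
  have g0: "g 0 = a" using g by (simp add: gt_def)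
  have rs: "row_sum g 0 (Suc r) = Suc (row_sum (g(0 := b)) 0 (Suc r))" for r
    by (induction r) (simp_all add: row_sum_def g0 a0 ab)
  have "(a (Suc i) + row_sum g (Suc (Suc i)) (Suc r) + row_sum g i r \<le> a i + row_sum g (Suc i) r + row_sum g (Suc i) (Suc r))
    \<longleftrightarrow> (b (Suc i) + row_sum (g(0 := b)) (Suc (Suc i)) (Suc r) + row_sum (g(0 := b)) i r
      \<le> b i + row_sum (g(0 := b)) (Suc i) r + row_sum (g(0 := b)) (Suc i) (Suc r))" for i r
  proof (cases i)
    case 0
    show ?thesis
    proof (cases r)
      case 0
      have "row_sum g (Suc (Suc 0)) (Suc 0) = g 2 0" "row_sum g (Suc 0) (Suc 0) = g 1 0"
        by (simp_all add: row_sum_def numeral_2_eq_2)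
      then show ?thesis using \<open>i = 0\<close> 0 first ab[of 1] a0 by (simp add: row_sum_upd_other row_sum_0)
    next
      case (Suc r')
      then show ?thesis using \<open>i = 0\<close> rs[of r'] a0 ab[of 1] by (simp add: row_sum_upd_other)
    qed
  next
    case (Suc i')
    then show ?thesis by (simp add: row_sum_upd_other ab)
  qed
  then show ?thesis unfolding lattice_iff_rows[OF g l a] lattice_iff_rows[OF g' l b] by simp
qed

lemma vsize_shift:
  assumes "0 < N" "a 0 = Suc (b 0)" "\<And>i. 0 < i \<Longrightarrow> a i = b i"
  shows "vsize N a = Suc (vsize N b)"
proof -
  obtain m where "N = Suc m" using assms(1) by (cases N) auto
  then show ?thesis unfolding vsize_def by (simp add: sum.lessThan_Suc_shift assms del: sum.lessThan_Suc)
qed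

lemma wt_shift:
  assumes g: "g \<in> gt N a l" and g': "g(0 := b) \<in> gt N b l" and N: "0 < N"
    and a0: "a 0 = Suc (b 0)" and ab: "\<And>i. 0 < i \<Longrightarrow> a i = b i"
  shows "(\<lambda>i. a i + wt N g i) = (\<lambda>i. b i + wt N (g(0 := b)) i)"
proof
  fix i
  show "a i + wt N g i = b i + wt N (g(0 := b)) i"
  proof (cases i)
    case 0
    have "g 0 = a" using g by (simp add: gt_def)
    then show ?thesis
      using 0 wt_eq[OF g, of 0] wt_eq[OF g', of 0] vsize_shift[of N a b, OF N a0 ab] a0 by simp
  next
    case (Suc i')
    then show ?thesis using ab by (simp add: wt_def)
  qed
qed

text \<open>Reading the first row admits at most \<open>b m - b (Suc m)\<close> letters
  \<open>Suc m\<close>. These bounds telescope: the letters other than 0 occupy at most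
  \<open>b 0\<close> boxes of the first row.\<close>

lemma first_row_bound:
  assumes g: "g \<in> gt N b l" and l: "shape N l" and b: "antimono b" and lat: "lattice N b g"
  shows "m < N \<Longrightarrow> g (Suc m) 0 + b m \<le> g 1 0 + b 0"
proof (induction m)
  case (Suc m)
  have "b (Suc m) + row_sum g (Suc (Suc m)) (Suc 0) + row_sum g m 0 \<le> b m + row_sum g (Suc m) 0 + row_sum g (Suc m) (Suc 0)"
    using lat Suc.prems unfolding lattice_iff_rows[OF g l b] by blast
  then show ?case using Suc by (simp add: row_sum_def)
qed simp

text \<open>Only level 0 of the pattern changes, its first row by one box. A pattern obtained by
  lengthening \<open>b\<close> is never a Kronecker one: the first row has become longer than the
  second, and the bounds \<open>g 1 1 \<le> b 0\<close> and
  \<open>b 1 + g 2 0 \<le> b 0 + g 1 0\<close> turn into strict inequalities for the longer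
  row.\<close>

lemma non_kronecker_bij:
  assumes n: "0 < n" and p: "0 < p" "2 * p \<le> n" and la: "la \<in> partitions n" and big: "2 * p - 1 \<le> shp la 0"
  defines "N \<equiv> 2 * n"
  shows "(\<Sum>a\<in>par N p. card (lr_set N a la nu - kron_set N a la nu)) = (\<Sum>b\<in>par N (p - 1). card (lr_set N b la nu))"
proof -
  have N: "2 \<le> N" "0 < N" using n by (auto simp: N_def)
  have l: "shape N (shp la)" using shp_par[OF la, of N] by (simp add: N_def par_def)
  have fin: "finite (lr_set N a la nu)" for a
    by (rule finite_subset[OF _ finite_gt[OF l, of a]]) (auto simp: lr_set_def)
  let ?A = "SIGMA a:par N p. lr_set N a la nu - kron_set N a la nu"
  let ?B = "SIGMA b:par N (p - 1). lr_set N b la nu"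
  define dn where "dn a = a(0 := a 0 - 1)" for a :: "nat \<Rightarrow> nat"
  define up where "up b = b(0 := Suc (b 0))" for b :: "nat \<Rightarrow> nat"
  have "bij_betw (\<lambda>(a, g). (dn a, g(0 := dn a))) ?A ?B"
  proof (rule bij_betwI[of _ _ _ "\<lambda>(b, g). (up b, g(0 := up b))"])
    show "(\<lambda>(a, g). (dn a, g(0 := dn a))) \<in> ?A \<rightarrow> ?B"
    proof
      fix x assume "x \<in> ?A"
      then obtain a g where x: "x = (a, g)" and a: "a \<in> par N p" and g: "g \<in> lr_set N a la nu" "g \<notin> kron_set N a la nu" by auto
      have gg: "g \<in> gt N a (shp la)" and lat: "lattice N a g" and wt: "(\<lambda>i. a i + wt N g i) = shp nu"
        using g(1) by (auto simp: lr_set_def)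
      have anti: "antimono a" and sa: "shape N a" using a by (auto simp: par_def shape_def)
      have g0: "g 0 = a" using gg by (simp add: gt_def)
      have "a 1 \<le> a 0" using anti by (auto simp: antimono_def)
      then have a1: "a 1 < a 0" and g11: "g 1 1 \<noteq> a 0" and g20: "g 2 0 \<noteq> g 1 0 + (a 0 - a 1)"
        using g by (auto simp: kron_set_def)
      let ?b = "dn a"
      have b0: "a 0 = Suc (?b 0)" and bi: "\<And>i. 0 < i \<Longrightarrow> a i = ?b i" using a1 by (auto simp: dn_def)
      have antib: "antimono ?b" unfolding antimono_iff_le_Suc
      proof
        fix i show "?b (Suc i) \<le> ?b i"
          using a1 anti by (cases i) (auto simp: dn_def antimono_iff_le_Suc)
      qed
      have sb: "?b \<in> par N (p - 1)"
        using a antib vsize_shift[of N a "dn a", OF N(2) b0 bi] p N by (auto simp: par_def shape_def dn_def)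
      have il: "interlaced a (g 1)" using gg g0 by (metis (no_types, lifting) One_nat_def gt_def mem_Collect_eq)
      have "interlaced ?b (g 1)" unfolding interlaced_def
      proof (intro allI conjI)
        fix r
        have "?b r \<le> a r" by (simp add: dn_def)
        also have "a r \<le> g 1 r" using il by (simp add: interlaced_def)
        finally show "?b r \<le> g 1 r" .
        have "g 1 (Suc r) \<le> a r" using il by (simp add: interlaced_def)
        \<comment> \<open>Only the first row is affected: \<open>g 1 1 \<le> a 0\<close> is strict
          by \<open>g11\<close>, so no entry 1 stands below the freed box.\<close>
        then show "g 1 (Suc r) \<le> ?b r" using g11 by (cases r) (auto simp: dn_def)
      qed
      then have g': "g(0 := ?b) \<in> gt N ?b (shp la)" using gg N by (auto simp: gt_def)
      have "a 1 + g 2 0 \<le> a 0 + g 1 0"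
      proof -
        have "Suc 0 < N" using N by simp
        then have "a (Suc 0) + row_sum g (Suc (Suc 0)) (Suc 0) + row_sum g 0 0 \<le> a 0 + row_sum g (Suc 0) 0 + row_sum g (Suc 0) (Suc 0)"
          using lat unfolding lattice_iff_rows[OF gg l anti] by blast
        then show ?thesis by (simp add: row_sum_def numeral_2_eq_2)
      qed
      \<comment> \<open>Equality is excluded by \<open>g20\<close>, and the unit of slack pays for
        the shortened first row.\<close>
      then have "?b 1 + g 2 0 \<le> ?b 0 + g 1 0" using g20 a1 by (simp add: dn_def)
      then have "lattice N ?b (g(0 := ?b))"
        using lattice_shift_iff[OF gg g' l N(1) anti antib b0 bi] lat by simp
      moreover have "(\<lambda>i. ?b i + wt N (g(0 := ?b)) i) = shp nu" using wt_shift[OF gg g' N(2) b0 bi] wt by simp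
      ultimately show "(\<lambda>(a, g). (dn a, g(0 := dn a))) x \<in> ?B" using sb g' by (simp add: x lr_set_def)
    qed
    show "(\<lambda>(b, g). (up b, g(0 := up b))) \<in> ?B \<rightarrow> ?A"
    proof
      fix x assume "x \<in> ?B"
      then obtain b g where x: "x = (b, g)" and b: "b \<in> par N (p - 1)" and g: "g \<in> lr_set N b la nu" by auto
      have gg: "g \<in> gt N b (shp la)" and lat: "lattice N b g" and wt: "(\<lambda>i. b i + wt N g i) = shp nu"
        using g by (auto simp: lr_set_def)
      have anti: "antimono b" and sb: "shape N b" "vsize N b = p - 1" using b by (auto simp: par_def shape_def)
      have g0: "g 0 = b" using gg by (simp add: gt_def)
      let ?a = "up b"
      have a0: "?a 0 = Suc (b 0)" and ai: "\<And>i. 0 < i \<Longrightarrow> ?a i = b i" by (auto simp: up_def)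
      have antia: "antimono ?a" unfolding antimono_iff_le_Suc
      proof
        fix i show "?a (Suc i) \<le> ?a i"
          using anti by (cases i) (auto simp: up_def antimono_iff_le_Suc intro: le_SucI)
      qed
      have sa: "?a \<in> par N p"
        using antia vsize_shift[of N "up b" b, OF N(2) a0 ai] p N sb by (auto simp: par_def shape_def up_def)
      have "b 0 \<le> vsize N b" unfolding vsize_def using N by (intro member_le_sum) auto
      then have b0: "b 0 \<le> p - 1" using sb by simp
      have "g (Suc (N - 1)) 0 + b (N - 1) \<le> g 1 0 + b 0" by (rule first_row_bound[OF gg l anti lat]) (use N in simp)
      moreover have "g (Suc (N - 1)) = shp la" using gg N by (simp add: gt_def)
      \<comment> \<open>Since \<open>b 0 \<le> p - 1\<close>, a first row of length at least
        \<open>2 * p - 1\<close> is longer than \<open>2 * b 0\<close> and therefore contains an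
        entry 1.\<close>
      ultimately have g10: "b 0 < g 1 0" using big b0 p by simp
      have il: "interlaced b (g 1)" using gg g0 by (metis (no_types, lifting) One_nat_def gt_def mem_Collect_eq)
      have "interlaced ?a (g 1)" unfolding interlaced_def
      proof (intro allI conjI)
        fix r
        show "?a r \<le> g 1 r" using il g10 by (cases "r = 0") (auto simp: up_def interlaced_def)
        show "g 1 (Suc r) \<le> ?a r" using il by (cases "r = 0") (auto simp: up_def interlaced_def intro: le_SucI)
      qed
      then have g': "g(0 := ?a) \<in> gt N ?a (shp la)" using gg N by (auto simp: gt_def)
      have eq: "(g(0 := ?a))(0 := b) = g" using g0 by auto
      have g'': "(g(0 := ?a))(0 := b) \<in> gt N b (shp la)" unfolding eq by (rule gg)
      have "b 1 + g 2 0 \<le> b 0 + g 1 0"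
      proof -
        have "Suc 0 < N" using N by simp
        then have "b (Suc 0) + row_sum g (Suc (Suc 0)) (Suc 0) + row_sum g 0 0 \<le> b 0 + row_sum g (Suc 0) 0 + row_sum g (Suc 0) (Suc 0)"
          using lat unfolding lattice_iff_rows[OF gg l anti] by blast
        then show ?thesis by (simp add: row_sum_def numeral_2_eq_2)
      qed
      then have first: "b 1 + (g(0 := ?a)) 2 0 \<le> b 0 + (g(0 := ?a)) 1 0" by simp
      have "lattice N ?a (g(0 := ?a))"
        using lattice_shift_iff[OF g' g'' l N(1) antia anti a0 ai first] lat unfolding eq by (simp only:)
      moreover have "(\<lambda>i. ?a i + wt N (g(0 := ?a)) i) = shp nu"
        using wt_shift[OF g' g'' N(2) a0 ai] wt unfolding eq by (simp only:)
      ultimately have mem: "g(0 := ?a) \<in> lr_set N ?a la nu" using g' by (simp add: lr_set_def)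
      have "g 1 1 \<le> b 0" using il by (metis One_nat_def interlaced_def)
      moreover have "b 1 \<le> b 0" using anti by (auto simp: antimono_def)
      ultimately have "g(0 := ?a) \<notin> kron_set N ?a la nu"
        using first by (auto simp: kron_set_def up_def)
      then show "(\<lambda>(b, g). (up b, g(0 := up b))) x \<in> ?A" using mem sa by (simp add: x)
    qed
    show "(\<lambda>(b, g). (up b, g(0 := up b))) ((\<lambda>(a, g). (dn a, g(0 := dn a))) x) = x" if "x \<in> ?A" for x
    proof -
      obtain a g where x: "x = (a, g)" and a: "a \<in> par N p" and g: "g \<in> lr_set N a la nu" "g \<notin> kron_set N a la nu"
        using \<open>x \<in> ?A\<close> by auto
      have "antimono a" using a by (simp add: par_def shape_def)
      then have "a 1 \<le> a 0" by (auto simp: antimono_def)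
      then have "0 < a 0" using g by (auto simp: kron_set_def)
      then have "up (dn a) = a" by (auto simp: up_def dn_def)
      moreover have "g 0 = a" using g(1) by (simp add: lr_set_def gt_def)
      ultimately show ?thesis by (auto simp: x)
    qed
    show "(\<lambda>(a, g). (dn a, g(0 := dn a))) ((\<lambda>(b, g). (up b, g(0 := up b))) x) = x" if "x \<in> ?B" for x
    proof -
      obtain b g where x: "x = (b, g)" and g: "g \<in> lr_set N b la nu" using \<open>x \<in> ?B\<close> by auto
      have "dn (up b) = b" by (auto simp: up_def dn_def)
      moreover have "g 0 = b" using g by (simp add: lr_set_def gt_def)
      ultimately show ?thesis by (auto simp: x)
    qed
  qed
  then have "card ?A = card ?B" by (rule bij_betw_same_card)
  then show ?thesis using fin finite_par by (simp add: card_SigmaI)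
qed

lemma diagram_subset_iff: "diagram al \<subseteq> diagram la \<longleftrightarrow> (\<forall>r. shp al r \<le> shp la r)"
proof
  assume s: "diagram al \<subseteq> diagram la"
  show "\<forall>r. shp al r \<le> shp la r"
  proof
    fix r show "shp al r \<le> shp la r"
    proof (cases "shp al r = 0")
      case False
      then have "(Suc r, shp al r) \<in> diagram al" by (simp add: mem_diagram)
      then have "(Suc r, shp al r) \<in> diagram la" using s by blast
      then show ?thesis by (simp add: mem_diagram)
    qed simp
  qed
next
  assume s: "\<forall>r. shp al r \<le> shp la r"
  show "diagram al \<subseteq> diagram la"
  proof
    fix b assume "b \<in> diagram al"
    then show "b \<in> diagram la" using s by (cases b) (auto simp: mem_diagram intro: le_trans)
  qed
qed

text \<open>The partitions of \<open>p\<close> outside the intersection of the diagrams carry no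
  patterns, because a pattern lies between \<open>a\<close> and \<open>la\<close> and its type
  \<open>nu\<close> is \<open>a\<close> plus a weight.\<close>

lemma lr_count_diff:
  assumes n: "0 < n" and p: "0 < p" "2 * p \<le> n" and la: "la \<in> partitions n" and nu: "nu \<in> partitions n"
    and big: "2 * p - 1 \<le> shp la 0"
  shows "lr_count (2 * n) p la nu = (\<Sum>al\<in>{al \<in> partitions p. diagram al \<subseteq> diagram la \<inter> diagram nu}. kronecker_tableau_count la al nu)
    + lr_count (2 * n) (p - 1) la nu"
proof -
  let ?N = "2 * n"
  have l: "shape ?N (shp la)" using shp_par[OF la, of ?N] by (simp add: par_def)
  have pN: "p \<le> ?N" using p by simp
  have fin: "finite (lr_set ?N a la nu)" for a
    by (rule finite_subset[OF _ finite_gt[OF l, of a]]) (auto simp: lr_set_def)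
  have sub: "kron_set ?N a la nu \<subseteq> lr_set ?N a la nu" for a by (auto simp: kron_set_def)
  have "lr_count ?N p la nu = (\<Sum>a\<in>par ?N p. card (kron_set ?N a la nu) + card (lr_set ?N a la nu - kron_set ?N a la nu))"
    unfolding lr_count_def lr_set_def[symmetric]
    by (rule sum.cong[OF refl]) (simp add: card_Diff_subset finite_subset[OF sub fin] sub card_mono[OF fin sub])
  also have "\<dots> = (\<Sum>a\<in>par ?N p. card (kron_set ?N a la nu)) + lr_count ?N (p - 1) la nu"
    unfolding sum.distrib non_kronecker_bij[OF n p la big] by (simp add: lr_count_def lr_set_def)
  also have "(\<Sum>a\<in>par ?N p. card (kron_set ?N a la nu)) = (\<Sum>al\<in>partitions p. card (kron_set ?N (shp al) la nu))"
    by (rule sum_par[OF pN])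
  also have "\<dots> = (\<Sum>al\<in>{al \<in> partitions p. diagram al \<subseteq> diagram la \<inter> diagram nu}. card (kron_set ?N (shp al) la nu))"
  proof (rule sum.mono_neutral_right[OF finite_partitions])
    show "\<forall>al\<in>partitions p - {al \<in> partitions p. diagram al \<subseteq> diagram la \<inter> diagram nu}. card (kron_set ?N (shp al) la nu) = 0"
    proof (rule ballI, rule ccontr)
      fix al assume al: "al \<in> partitions p - {al \<in> partitions p. diagram al \<subseteq> diagram la \<inter> diagram nu}"
        and "card (kron_set ?N (shp al) la nu) \<noteq> 0"
      then have "kron_set ?N (shp al) la nu \<noteq> {}" by auto
      then obtain g where "g \<in> lr_set ?N (shp al) la nu" using sub by blast
      then have g: "g \<in> gt ?N (shp al) (shp la)" "(\<lambda>i. shp al i + wt ?N g i) = shp nu" by (auto simp: lr_set_def)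
      have "shp al \<le> shp la" using gt_bounds[OF g(1), of 0] by (rule order_trans)
      then have "diagram al \<subseteq> diagram la" by (simp add: diagram_subset_iff le_fun_def)
      moreover have "shp al r \<le> shp nu r" for r using fun_cong[OF g(2), of r] by simp
      then have "diagram al \<subseteq> diagram nu" by (simp add: diagram_subset_iff)
      ultimately show False using al by blast
    qed
  qed auto
  also have "\<dots> = (\<Sum>al\<in>{al \<in> partitions p. diagram al \<subseteq> diagram la \<inter> diagram nu}. kronecker_tableau_count la al nu)"
  proof (rule sum.cong[OF refl])
    fix al assume "al \<in> {al \<in> partitions p. diagram al \<subseteq> diagram la \<inter> diagram nu}"
    then have al: "al \<in> partitions p" and "diagram al \<subseteq> diagram la" by auto
    then have "shp al r \<le> shp la r" for r by (simp add: diagram_subset_iff)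
    then show "card (kron_set ?N (shp al) la nu) = kronecker_tableau_count la al nu"
      using kronecker_tableaux_bij[OF la al nu _ pN] by simp
  qed
  finally show ?thesis .
qed


section \<open>Coefficients in the Schur basis and Kronecker coefficients\<close>

lemma schur_part:
  assumes la: "la \<in> partitions n" and mu: "mu \<in> partitions n" and nN: "n \<le> N"
  shows "schur la (part mu) = of_nat (kos N la (shp mu))"
proof -
  have e: "[] \<in> partitions 0" by (simp add: partitions_def)
  have s0: "shp [] = (\<lambda>_. 0)" by (simp add: shp_def part_def fun_eq_iff)
  have sub: "shp [] r \<le> shp la r" for r by (simp add: s0)
  note ctx = la e nN sub
  have "card {T \<in> ssyt la []. ssyt_content la [] T = part mu} = kos N la (shp mu)"
    unfolding kostka_def
  proof (rule bij_betw_same_card[of "to_gt la []"], rule bij_betw_imageI)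
    show "inj_on (to_gt la []) {T \<in> ssyt la []. ssyt_content la [] T = part mu}"
      using to_gt_inj[OF ctx] by (auto simp: inj_on_def)
    have content: "ssyt_content la [] T = part mu \<longleftrightarrow> wt N (to_gt la [] T) = shp mu" if T: "T \<in> ssyt la []" for T
    proof -
      have "0 < T b" if "b \<in> skew la []" for b using T that unfolding ssyt_def by blast
      then have "\<not> T b = 0" if "b \<in> skew la []" for b using that by (metis less_irrefl)
      then have "{b \<in> skew la []. T b = 0} = {}" by blast
      then have "card {b \<in> skew la []. T b = 0} = 0" by (simp only: card.empty)
      then have "ssyt_content la [] T 0 = part mu 0" unfolding ssyt_content_def part_def by (simp only:) simp
      then have "ssyt_content la [] T = part mu \<longleftrightarrow> (\<forall>i. ssyt_content la [] T (Suc i) = part mu (Suc i))"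
        unfolding fun_eq_iff by (metis not0_implies_Suc)
      also have "\<dots> \<longleftrightarrow> wt N (to_gt la [] T) = shp mu"
        unfolding content_to_gt[OF ctx T] by (simp add: fun_eq_iff shp_def)
      finally show ?thesis .
    qed
    show "to_gt la [] ` {T \<in> ssyt la []. ssyt_content la [] T = part mu} = {g \<in> gt N (\<lambda>_. 0) (shp la). wt N g = shp mu}"
    proof (intro equalityI subsetI)
      fix g assume "g \<in> to_gt la [] ` {T \<in> ssyt la []. ssyt_content la [] T = part mu}"
      then obtain T where T: "g = to_gt la [] T" "T \<in> ssyt la []" "ssyt_content la [] T = part mu" by blast
      have "T b \<le> N" for b using content_bound[OF la T(2) _ mu, of b] T(3) nN by simp
      then show "g \<in> {g \<in> gt N (\<lambda>_. 0) (shp la). wt N g = shp mu}"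
        using to_gt_mem[OF ctx T(2)] content[OF T(2)] T by (simp add: s0)
    next
      fix g assume g: "g \<in> {g \<in> gt N (\<lambda>_. 0) (shp la). wt N g = shp mu}"
      then have gg: "g \<in> gt N (shp []) (shp la)" by (simp add: s0)
      note T = of_gt_mem[OF ctx gg]
      have "ssyt_content la [] (of_gt la [] g) = part mu" using content[OF T(1)] g unfolding T(3) by simp
      then show "g \<in> to_gt la [] ` {T \<in> ssyt la []. ssyt_content la [] T = part mu}"
        using T(1,3) by (intro image_eqI[of _ _ "of_gt la [] g"]) simp_all
    qed
  qed
  then show ?thesis by (simp add: schur_def)
qed

text \<open>The monomials indexed by partitions suffice: there the Schur functions form the Kostka
  matrix, which is injective.\<close>

lemma schur_coeff_unique:
  assumes n: "0 < n" and g: "\<And>nu. nu \<notin> partitions n \<Longrightarrow> g nu = 0"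
  shows "schur_coeff n (\<lambda>m. \<Sum>nu\<in>partitions n. g nu * schur nu m) = g"
  unfolding schur_coeff_def
proof (rule the_equality)
  fix c assume c: "(\<forall>nu. nu \<notin> partitions n \<longrightarrow> c nu = 0) \<and>
    (\<lambda>m. \<Sum>nu\<in>partitions n. g nu * schur nu m) = (\<lambda>m. \<Sum>nu\<in>partitions n. c nu * schur nu m)"
  have "c nu - g nu = 0" if nu: "nu \<in> partitions n" for nu
  proof (rule kos_injective[OF order_refl n _ nu, where x = "\<lambda>nu. c nu - g nu"])
    fix mu assume mu: "mu \<in> partitions n"
    have "(\<Sum>nu\<in>partitions n. g nu * schur nu (part mu)) = (\<Sum>nu\<in>partitions n. c nu * schur nu (part mu))"
      using fun_cong[OF conjunct2[OF c], of "part mu"] .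
    then have "(\<Sum>nu\<in>partitions n. schur nu (part mu) * (c nu - g nu)) = 0"
      by (simp add: right_diff_distrib sum_subtractf mult.commute)
    moreover have "(\<Sum>nu\<in>partitions n. of_nat (kos n nu (shp mu)) * (c nu - g nu)) = (\<Sum>nu\<in>partitions n. schur nu (part mu) * (c nu - g nu))"
      by (rule sum.cong[OF refl]) (simp add: schur_part[OF _ mu order_refl])
    ultimately show "(\<Sum>nu\<in>partitions n. of_nat (kos n nu (shp mu)) * (c nu - g nu)) = 0" by simp
  qed
  then show "c = g" using c g by (metis (no_types, lifting) ext eq_iff_diff_eq_0)
qed (use g in auto)

text \<open>Independence of the characters makes the description in \<open>kronecker_coeff\<close>
  unique, so any expansion with suitable coefficients identifies it.\<close>

lemma kronecker_coeff_unique: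
  assumes n: "0 < n" and la: "la \<in> partitions n" and mu: "mu \<in> partitions n"
    and g: "\<And>nu. nu \<notin> partitions n \<Longrightarrow> g nu = 0"
    and eq: "\<And>\<sigma>. \<sigma> \<in> perms n \<Longrightarrow> chi la \<sigma> * chi mu \<sigma> = (\<Sum>nu\<in>partitions n. g nu * chi nu \<sigma>)"
  shows "kronecker_coeff n la mu = (\<lambda>nu. of_real (g nu))"
  unfolding kronecker_coeff_def
proof (rule the_equality)
  have ex: "irr_char la \<sigma> * irr_char mu \<sigma> = (\<Sum>nu\<in>partitions n. of_real (g nu) * irr_char nu \<sigma>)" if "\<sigma> \<in> perms n" for \<sigma>
  proof -
    have "irr_char la \<sigma> * irr_char mu \<sigma> = of_real (chi la \<sigma> * chi mu \<sigma>)"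
      using chi_props(1)[OF la that] chi_props(1)[OF mu that] by simp
    also have "\<dots> = (\<Sum>nu\<in>partitions n. of_real (g nu) * of_real (chi nu \<sigma>))" by (simp only: eq[OF that] of_real_sum of_real_mult)
    also have "\<dots> = (\<Sum>nu\<in>partitions n. of_real (g nu) * irr_char nu \<sigma>)"
      by (rule sum.cong[OF refl]) (simp only: chi_props(1)[OF _ that])
    finally show ?thesis .
  qed
  then show "(\<forall>nu. nu \<notin> partitions n \<longrightarrow> complex_of_real (g nu) = 0) \<and>
    (\<forall>\<sigma>. \<sigma> permutes {1..n} \<longrightarrow> irr_char la \<sigma> * irr_char mu \<sigma> = (\<Sum>nu\<in>partitions n. of_real (g nu) * irr_char nu \<sigma>))"
    using g by simp
  fix c assume c: "(\<forall>nu. nu \<notin> partitions n \<longrightarrow> c nu = 0) \<and>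
    (\<forall>\<sigma>. \<sigma> permutes {1..n} \<longrightarrow> irr_char la \<sigma> * irr_char mu \<sigma> = (\<Sum>nu\<in>partitions n. c nu * irr_char nu \<sigma>))"
  have "c nu - of_real (g nu) = 0" if nu: "nu \<in> partitions n" for nu
  proof (rule chi_independent[OF order_refl n _ nu, where x = "\<lambda>nu. c nu - of_real (g nu)"])
    fix \<sigma> assume s: "\<sigma> \<in> perms n"
    have "(\<Sum>nu\<in>partitions n. (c nu - of_real (g nu)) * of_real (chi nu \<sigma>)) = (\<Sum>nu\<in>partitions n. (c nu - of_real (g nu)) * irr_char nu \<sigma>)"
      by (rule sum.cong[OF refl]) (simp only: chi_props(1)[OF _ s])
    also have "\<dots> = 0" using c ex[OF s] s by (simp add: left_diff_distrib sum_subtractf)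
    finally show "(\<Sum>nu\<in>partitions n. (c nu - of_real (g nu)) * of_real (chi nu \<sigma>)) = 0" .
  qed
  then show "c = (\<lambda>nu. of_real (g nu))" using c g by (metis (no_types, lifting) ext eq_iff_diff_eq_0 of_real_0)
qed

section \<open>Conjugate partitions and the sign character\<close>

lemma finite_shp_gt: "finite {r. c < shp la r}"
  by (rule finite_subset[OF _ finite_support_shp[of la]]) auto

lemma less_card_iff:
  assumes la: "la \<in> partitions n"
  shows "r < card {r. c < shp la r} \<longleftrightarrow> c < shp la r"
proof -
  let ?X = "{r. c < shp la r}"
  \<comment> \<open>Rows count from 0; shifted by \<open>Suc\<close> they form a segment starting
    after 0, the form that \<open>initial_segment\<close> expects.\<close>
  have seg: "Suc ` ?X = {0<..0 + card (Suc ` ?X)}"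
  proof (rule initial_segment[of _ _ "Suc (Max ?X)"])
    show "Suc ` ?X \<subseteq> {0<..Suc (Max ?X)}" using Max_ge[OF finite_shp_gt[of c la]] by auto
    fix x x' assume "x \<in> Suc ` ?X" "0 < x'" "x' < x"
    then obtain r where r: "x = Suc r" "c < shp la r" by auto
    obtain r' where r': "x' = Suc r'" using \<open>0 < x'\<close> by (cases x') auto
    have "shp la r \<le> shp la r'" using shp_antimono[OF la] r r' \<open>x' < x\<close> by (auto simp: antimono_def)
    then show "x' \<in> Suc ` ?X" using r r' by auto
  qed
  have card: "card (Suc ` ?X) = card ?X" by (simp add: card_image)
  have "c < shp la r \<longleftrightarrow> Suc r \<in> Suc ` ?X" by auto
  also have "\<dots> \<longleftrightarrow> Suc r \<in> {0<..card ?X}" using arg_cong[OF seg[unfolded card add_0], of "\<lambda>X. Suc r \<in> X"] .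
  also have "\<dots> \<longleftrightarrow> r < card ?X" by auto
  finally show ?thesis by simp
qed

lemma shp_conj:
  assumes la: "la \<in> partitions n"
  shows "shp (conj_partition la) c = card {r. c < shp la r}"
proof -
  have col: "card {i. (i, Suc c) \<in> diagram la} = card {r. c < shp la r}" for c
  proof -
    have "{i. (i, Suc c) \<in> diagram la} = Suc ` {r. c < shp la r}"
    proof (intro equalityI subsetI)
      fix i assume i: "i \<in> {i. (i, Suc c) \<in> diagram la}"
      then obtain r where "i = Suc r" by (cases i) (auto simp: mem_diagram)
      then show "i \<in> Suc ` {r. c < shp la r}" using i by (simp add: mem_diagram less_eq_Suc_le)
    qed (auto simp: mem_diagram)
    then show ?thesis by (simp add: card_image)
  qed
  have len: "length (conj_partition la) = shp la 0" by (simp add: conj_partition_def shp_def)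
  show ?thesis
  proof (cases "c < shp la 0")
    case True
    then have "shp (conj_partition la) c = conj_partition la ! c" using len by (intro shp_nth) simp
    also have "\<dots> = card {i. (i, Suc c) \<in> diagram la}"
      using True by (simp add: conj_partition_def shp_def nth_upt del: upt_Suc)
    finally show ?thesis by (simp only: col)
  next
    case False
    have "\<not> c < shp la r" for r using antimonoD[OF shp_antimono[OF la], of 0 r] False by simp
    then have "card {r. c < shp la r} = 0" by simp
    then show ?thesis using False shp_zero[of "conj_partition la" c] len by simp
  qed
qed

lemma shp_conj_less: "la \<in> partitions n \<Longrightarrow> r < shp (conj_partition la) c \<longleftrightarrow> c < shp la r"
  by (simp add: shp_conj less_card_iff)

lemma conj_partitions:
  assumes la: "la \<in> partitions n"
  shows "conj_partition la \<in> partitions n"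
proof -
  let ?l = "shp (conj_partition la)"
  have "?l (Suc c) \<le> ?l c" for c
    unfolding shp_conj[OF la] by (rule card_mono[OF finite_shp_gt]) auto
  then have anti: "antimono ?l" by (simp add: antimono_iff_le_Suc)
  define m where "m = max n (shp la 0)"
  have z: "?l c = 0" if "m \<le> c" for c
  proof -
    have "length (conj_partition la) = shp la 0" by (simp add: conj_partition_def shp_def)
    then show ?thesis using that by (intro shp_zero) (simp add: m_def)
  qed
  have "vsize m ?l = card (SIGMA c:{..<m}. {..<?l c})" by (simp add: vsize_def card_SigmaI)
  also have "\<dots> = card (SIGMA r:{..<m}. {..<shp la r})"
  proof (rule bij_betw_same_card[of prod.swap], rule bij_betwI[of _ _ _ prod.swap])
    have lz: "c < m \<and> r < m" if "c < shp la r" for c r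
    proof -
      have "shp la r \<le> shp la 0" using shp_antimono[OF la] by (auto simp: antimono_def)
      moreover have "r < n" using that shp_zero[of la r] length_partition[OF la] by (cases "r < n") auto
      ultimately show ?thesis using that by (auto simp: m_def)
    qed
    show "prod.swap \<in> (SIGMA c:{..<m}. {..<?l c}) \<rightarrow> (SIGMA r:{..<m}. {..<shp la r})"
      using lz by (auto simp: shp_conj_less[OF la])
    show "prod.swap \<in> (SIGMA r:{..<m}. {..<shp la r}) \<rightarrow> (SIGMA c:{..<m}. {..<?l c})"
      using lz by (auto simp: shp_conj_less[OF la])
  qed auto
  also have "\<dots> = (\<Sum>r<m. shp la r)" by (simp add: card_SigmaI)
  also have "\<dots> = n" using sum_shp[of la m] length_partition[OF la] la by (simp add: m_def partitions_def)
  finally have "?l \<in> par m n" using anti z by (simp add: par_def shape_def)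
  then obtain mu where mu: "mu \<in> partitions n" "shp mu = ?l" by (rule shp_surj)
  have len: "length (conj_partition la) = shp la 0" by (simp add: conj_partition_def shp_def)
  have "0 \<notin> set (conj_partition la)"
  proof
    assume "0 \<in> set (conj_partition la)"
    then obtain c where c: "c < shp la 0" "conj_partition la ! c = 0" using len by (metis in_set_conv_nth)
    then have "?l c = 0" using shp_nth[of c "conj_partition la"] len by simp
    then show False using shp_conj_less[OF la, of 0 c] c by simp
  qed
  moreover have "sorted_wrt (\<ge>) (conj_partition la)"
    unfolding sorted_wrt_iff_nth_less using shp_nth[of _ "conj_partition la"] antimonoD[OF anti] by (metis less_imp_le order_less_trans)
  moreover have "sum_list (conj_partition la) = n"
    using sum_shp[of "conj_partition la" m] len \<open>?l \<in> par m n\<close> by (simp add: par_def vsize_def m_def)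
  ultimately show ?thesis by (simp add: partitions_def)
qed

lemma conj_conj:
  assumes la: "la \<in> partitions n"
  shows "conj_partition (conj_partition la) = la"
proof (rule shp_inj[OF conj_partitions[OF conj_partitions[OF la]] la], rule ext)
  fix r
  have "c < shp (conj_partition (conj_partition la)) r \<longleftrightarrow> c < shp la r" for c
    using shp_conj_less[OF conj_partitions[OF la]] shp_conj_less[OF la] by simp
  then show "shp (conj_partition (conj_partition la)) r = shp la r" by (meson linorder_neqE_nat less_irrefl)
qed

lemma diagram_conj: "la \<in> partitions n \<Longrightarrow> (i, j) \<in> diagram (conj_partition la) \<longleftrightarrow> (j, i) \<in> diagram la"
  using shp_conj_less[of la n "j - 1" "i - 1"] by (auto simp: mem_diagram)

text \<open>The transposed tableau has the row and column functions of the original one exchanged,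
  so the sign twist of the class functions applies.\<close>

lemma chi_conj:
  assumes la: "la \<in> partitions n" and s: "\<sigma> \<in> perms n"
  shows "chi (conj_partition la) \<sigma> = of_int (sign \<sigma>) * chi la \<sigma>"
proof -
  obtain t0 where sp: "specht la n t0" using specht_exists[OF la] .
  interpret s: specht la n t0 by (rule sp)
  let ?t = "\<lambda>(i, j). t0 (j, i)"
  have "bij_betw ?t (diagram (conj_partition la)) {1..n}"
  proof -
    have "bij_betw prod.swap (diagram (conj_partition la)) (diagram la)"
      by (rule bij_betwI[of _ _ _ prod.swap]) (auto simp: diagram_conj[OF la])
    then have "bij_betw (t0 \<circ> prod.swap) (diagram (conj_partition la)) {1..n}" using s.bij_t0 by (rule bij_betw_trans)
    moreover have "t0 \<circ> prod.swap = ?t" by (auto simp: fun_eq_iff)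
    ultimately show ?thesis by simp
  qed
  then have "specht (conj_partition la) n ?t"
    using conj_partitions[OF la] by (simp add: specht_def young_tableaux_def partitions_def)
  then interpret s': specht "conj_partition la" n ?t .
  have rc: "s'.rw x = s.cl x \<and> s'.cl x = s.rw x" for x
  proof (cases "x \<in> {1..n}")
    case True
    have "(Suc (s'.cl x), Suc (s'.rw x)) \<in> diagram la"
      using s'.box_of(1)[OF True] diagram_conj[OF la] by blast
    moreover have "t0 (Suc (s'.cl x), Suc (s'.rw x)) = x" using s'.box_of(2)[OF True] by simp
    ultimately show ?thesis using s.of_box[of "s'.cl x" "s'.rw x"] by simp
  next
    case False
    show ?thesis unfolding s.rw_def s.cl_def s'.rw_def s'.cl_def by (simp only: False if_False simp_thms)
  qed
  then have eq: "s'.rw = s.cl" "s'.cl = s.rw" by auto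
  have A: "numbering {1..n} s.rw s.cl (shp la)" by (rule s.numbering_la)
  have B: "numbering {1..n} s.cl s.rw (shp (conj_partition la))" using s'.numbering_la unfolding eq .
  have "chi (conj_partition la) \<sigma> = s'.hsum \<sigma> / s'.ynorm" using s'.irr_char_eq s by (simp add: chi_def)
  also have "\<dots> = of_int (sign \<sigma>) * s.hsum \<sigma> / s.ynorm"
    unfolding eq using hsum_transpose[OF A B] ynorm_transpose[OF A B] s by simp
  also have "\<dots> = of_int (sign \<sigma>) * chi la \<sigma>" using s.irr_char_eq s by (simp add: chi_def)
  finally show ?thesis .
qed

lemma kronecker_two_row:
  assumes n: "0 < n" and p: "0 < p" "2 * p \<le> n" and la: "la \<in> partitions n"
  shows "kronecker_coeff n [n - p, p] la = (\<lambda>nu. of_real (if nu \<in> partitions n then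
    real (lr_count (2 * n) p la nu) - real (lr_count (2 * n) (p - 1) la nu) else 0))"
proof (rule kronecker_coeff_unique[OF n _ la])
  show "[n - p, p] \<in> partitions n" using p by (auto simp: partitions_def)
qed (simp_all add: chi_two_row_mult[OF n p la])

text \<open>One sign turns \<open>la\<close> into its conjugate, the product is expanded there, and
  the second sign returns each constituent to its conjugate.\<close>

lemma kronecker_two_row_conj:
  assumes n: "0 < n" and p: "0 < p" "2 * p \<le> n" and la: "la \<in> partitions n"
  shows "kronecker_coeff n [n - p, p] la = (\<lambda>nu. of_real (if nu \<in> partitions n then
    real (lr_count (2 * n) p (conj_partition la) (conj_partition nu))
      - real (lr_count (2 * n) (p - 1) (conj_partition la) (conj_partition nu)) else 0))"
proof (rule kronecker_coeff_unique[OF n _ la])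
  show "[n - p, p] \<in> partitions n" using p by (auto simp: partitions_def)
  let ?d = "\<lambda>nu. real (lr_count (2 * n) p (conj_partition la) nu) - real (lr_count (2 * n) (p - 1) (conj_partition la) nu)"
  fix \<sigma> assume s: "\<sigma> \<in> perms n"
  have sq: "of_int (sign \<sigma>) * of_int (sign \<sigma>) = (1::real)" by (simp flip: of_int_mult)
  have "chi [n - p, p] \<sigma> * chi la \<sigma> = of_int (sign \<sigma>) * (chi [n - p, p] \<sigma> * chi (conj_partition la) \<sigma>)"
    unfolding chi_conj[OF la s] using sq by (simp add: mult.left_commute mult.assoc[symmetric])
  also have "\<dots> = (\<Sum>nu\<in>partitions n. ?d nu * (of_int (sign \<sigma>) * chi nu \<sigma>))"
    unfolding chi_two_row_mult[OF n p conj_partitions[OF la] s] sum_distrib_left by (simp add: mult.left_commute)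
  also have "\<dots> = (\<Sum>nu\<in>partitions n. ?d nu * chi (conj_partition nu) \<sigma>)"
    by (rule sum.cong[OF refl]) (simp only: chi_conj[OF _ s])
  also have "\<dots> = (\<Sum>nu\<in>partitions n. ?d (conj_partition nu) * chi nu \<sigma>)"
    by (rule sum.reindex_bij_witness[of _ conj_partition conj_partition]) (auto simp: conj_conj conj_partitions)
  finally show "chi [n - p, p] \<sigma> * chi la \<sigma> = (\<Sum>nu\<in>partitions n. (if nu \<in> partitions n then ?d (conj_partition nu) else 0) * chi nu \<sigma>)"
    by simp
qed simp

lemma schur_coeff_kronecker:
  assumes "0 < n" "0 < p" "2 * p \<le> n" "la \<in> partitions n"
  shows "schur_coeff n (schur_kronecker n [n - p, p] la) = kronecker_coeff n [n - p, p] la"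
  unfolding schur_kronecker_def
  by (rule schur_coeff_unique[OF assms(1)]) (simp add: kronecker_two_row[OF assms])

theorem theorem3p2:
  fixes n p :: nat and la nu :: "nat list"
  assumes "0 < n" and "0 < p" and "2 * p \<le> n"
    and "la \<in> partitions n" and "nu \<in> partitions n"
  shows "(part la 1 \<ge> 2 * p - 1 \<longrightarrow>
      schur_coeff n (schur_kronecker n [n - p, p] la) nu = kronecker_coeff n [n - p, p] la nu \<and>
      kronecker_coeff n [n - p, p] la nu =
        of_nat (\<Sum>al\<in>{al \<in> partitions p. diagram al \<subseteq> diagram la \<inter> diagram nu}.
                  kronecker_tableau_count la al nu)) \<and>
    (length la \<ge> 2 * p - 1 \<longrightarrow>
      schur_coeff n (schur_kronecker n [n - p, p] la) nu =
        of_nat (\<Sum>al\<in>{al \<in> partitions p.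
                        diagram al \<subseteq> diagram (conj_partition la) \<inter> diagram (conj_partition nu)}.
                  kronecker_tableau_count (conj_partition la) al (conj_partition nu)))"
proof (intro conjI impI)
  note n = assms(1) and p = assms(2,3) and la = assms(4) and nu = assms(5)
  show "schur_coeff n (schur_kronecker n [n - p, p] la) nu = kronecker_coeff n [n - p, p] la nu"
    by (simp only: schur_coeff_kronecker[OF n p la])
  show "kronecker_coeff n [n - p, p] la nu =
      of_nat (\<Sum>al\<in>{al \<in> partitions p. diagram al \<subseteq> diagram la \<inter> diagram nu}. kronecker_tableau_count la al nu)"
    if "part la 1 \<ge> 2 * p - 1"
  proof -
    have "2 * p - 1 \<le> shp la 0" using that by (simp add: shp_def)
    from lr_count_diff[OF n p la nu this] show ?thesis using nu by (simp add: kronecker_two_row[OF n p la])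
  qed
  show "schur_coeff n (schur_kronecker n [n - p, p] la) nu =
      of_nat (\<Sum>al\<in>{al \<in> partitions p. diagram al \<subseteq> diagram (conj_partition la) \<inter> diagram (conj_partition nu)}.
        kronecker_tableau_count (conj_partition la) al (conj_partition nu))"
    if "length la \<ge> 2 * p - 1"
  proof -
    \<comment> \<open>The parts of \<open>la\<close> are positive, so its conjugate has a first row
      at least as long as \<open>la\<close> has parts.\<close>
    have "r < shp (conj_partition la) 0" if "r < length la" for r
      unfolding shp_conj_less[OF la] shp_nth[OF that] using la that by (auto simp: partitions_def in_set_conv_nth)
    then have "length la \<le> shp (conj_partition la) 0" by (meson linorder_not_less less_irrefl)
    then have "2 * p - 1 \<le> shp (conj_partition la) 0" using that by simp
    from lr_count_diff[OF n p conj_partitions[OF la] conj_partitions[OF nu] this] show ?thesis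
      using nu by (simp add: schur_coeff_kronecker[OF n p la] kronecker_two_row_conj[OF n p la])
  qed
qed

end
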